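(* Let $k\ge 3$ be an integer. Let $u$ be the solution of $\varepsilon^2\Delta^2u-\Delta u=f$ in $\Omega=(0,1)^2$, $u=\partial u/\partial\mathbf n=0$ on $\partial\Omega$, satisfying the layer decomposition assumption given in the context, and let $u_N=\{u_0,u_b,\mathbf u_g\}\in V_N^0$ be the weak Galerkin finite element solution on the Shishkin mesh $\mathcal T_N$, i.e. $$\varepsilon^{2}(\Delta_{w}u_{N},\Delta_{w}v)_{\mathcal T_N}+(\nabla_{w}u_{N},\nabla_{w}v)_{\mathcal T_N}+s(u_{N},v)=(f,v_0)\qquad\text{for all } v=\{v_0,v_b,\mathbf v_g\}\in V_N^0 .$$ Assume $u\in H^{k+1}(\Omega)$ and set $e_N=\mathcal Q_Nu-u_N$. Then there exists a constant $C$, independent of $\varepsilon$ and $N$, such that $$|||e_N|||\le C\,N^{-(k-1)}\ln^{k-\frac32}N .$$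
   Context: Data. $\Omega=(0,1)^2$, $0<\varepsilon\ll1$, $f\in L^2(\Omega)$, $\mathbf n$ is the unit outward normal. $(\cdot,\cdot)_T$, $\langle\cdot,\cdot\rangle_{\partial T}$ denote $L^2$ inner products on $T$ and $\partial T$ (for vector functions too), $(\cdot,\cdot)$ that on $\Omega$. Layer decomposition assumption. $u=S+\sum_{l=1}^4E_l+E_{12}+E_{23}+E_{34}+E_{41}$, where $S$ is smooth, $E_1,E_2,E_3,E_4$ are boundary layer parts along the sides $y=0$, $x=1$, $y=1$, $x=0$ (anti-clockwise), and $E_{12},E_{23},E_{34},E_{41}$ are corner layer parts at $(1,0),(1,1),(0,1),(0,0)$. There is a constant $C$, independent of $x,y$ and $\varepsilon$, such that for all $(x,y)\in\bar\Omega$ and $0\le i+j\le k+1$: $|\partial_x^i\partial_y^jS|\le C$; $|\partial_x^i\partial_y^jE_1|\le C\varepsilon^{1-j}e^{-y/\varepsilon}$; $|\partial_x^i\partial_y^jE_4|\le C\varepsilon^{1-i}e^{-x/\varepsilon}$; $|\partial_x^i\partial_y^jE_{41}|\le C\varepsilon^{1-i-j}e^{-x/\varepsilon}e^{-y/\varepsilon}$; and the other components are bounded in the analogous manner (replacing $x$ by $1-x$ and/or $y$ by $1-y$ in the exponentials according to the side or corner). Shishkin mesh. $N\ge4$ is an integer divisible by 4, $\lambda=\min\{\alpha\varepsilon\ln N,\tfrac14\}$ with $\alpha=k+1$. Divide $[0,\lambda]$ and $[1-\lambda,1]$ into $N/4$ equal subintervals each and $[\lambda,1-\lambda]$ into $N/2$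 equal subintervals; $\mathcal T_N$ is the tensor product of two such one-dimensional meshes. The fine and coarse meshwidths are $h=4\lambda/N$ and $H=2(1-2\lambda)/N$. Weak functions. $\mathbb Q_k(T)$: polynomials of degree at most $k$ in each variable; $\mathbb P_k(e)$: polynomials of degree at most $k$ on an edge $e$. $V_N$ is the space of $v=\{v_0,v_b,\mathbf v_g\}$ such that, on every $T\in\mathcal T_N$, $v_0|_T\in\mathbb Q_k(T)$ and, for each edge $e\subset\partial T$, $v_b|_e\in\mathbb P_k(e)$, $\mathbf v_g|_e\in[\mathbb P_k(e)]^2$; $v_b$ and $\mathbf v_g$ are single-valued on each edge of the mesh. $V_N^0$ is the subspace of those $v$ with $v_b=0$ and $\mathbf v_g\cdot\mathbf n=0$ on all edges contained in $\partial\Omega$. Weak operators. For $v=\{v_0,v_b,\mathbf v_g\}$, on each $T$, $\Delta_wv\in\mathbb Q_k(T)$ and $\nabla_wv\in[\mathbb Q_k(T)]^2$ are the unique polynomials with $(\Delta_wv,\varphi)_T=(v_0,\Delta\varphi)_T-\langle v_b,\nabla\varphi\cdot\mathbf n\rangle_{\partial T}+\langle\mathbf v_g\cdot\mathbf n,\varphi\rangle_{\partial T}$ for all $\varphi\in\mathbb Q_k(T)$, and $(\nabla_wv,\mathbf q)_T=-(v_0,\nabla\cdot\mathbf q)_T+\langle v_b,\mathbf q\cdot\mathbf n\rangle_{\partial T}$ for all $\mathbf q\in[\mathbb Q_k(T)]^2$. Write $(\cdot,\cdot)_{\mathcal T_N}=\sum_{T\in\mathcal T_N}(\cdot,\cdot)_T$.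 Stabilizer: for $w=\{w_0,w_b,\mathbf w_g\}$ and $v=\{v_0,v_b,\mathbf v_g\}$, $$s(w,v)=\sum_{T\in\mathcal T_N}\Big(\varepsilon^2h^{-1}\langle\nabla w_0-\mathbf w_g,\nabla v_0-\mathbf v_g\rangle_{\partial T}+(\varepsilon^2h^{-2}H^{-1}+H^{-1})\langle w_0-w_b,v_0-v_b\rangle_{\partial T}\Big).$$ Norm: $|||v|||^2=\varepsilon^2(\Delta_wv,\Delta_wv)_{\mathcal T_N}+(\nabla_wv,\nabla_wv)_{\mathcal T_N}+s(v,v)$. Projection: $\mathcal Q_Nu=\{\mathcal Q_0u,\mathcal Q_bu,\mathbf Q_g(\nabla u)\}$, where $\mathcal Q_0$ is the $L^2$ projection onto $\mathbb Q_k(T)$ on each $T$, and $\mathcal Q_b$, $\mathbf Q_g$ are the $L^2$ projections onto $\mathbb P_k(e)$, $[\mathbb P_k(e)]^2$ on each edge $e$. *)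

theory Defs
  imports "HOL-Analysis.Analysis" "HOL-Computational_Algebra.Polynomial"
begin

type_synonym point = "real \<times> real"

abbreviation Omega :: "point set"
  where "Omega \<equiv> {0<..<1} \<times> {0<..<1}"

abbreviation Omega_bar :: "point set"
  where "Omega_bar \<equiv> {0..1} \<times> {0..1}"

text \<open>Partial derivatives relative to a set \<open>A\<close>, so that they are one-sided on the boundary
  of the closed square. For polynomials, which live on the whole plane, take \<open>A = UNIV\<close>.\<close>

definition dx :: "point set \<Rightarrow> (point \<Rightarrow> real) \<Rightarrow> point \<Rightarrow> real"
  where "dx A u p = vector_derivative (\<lambda>t. u (t, snd p)) (at (fst p) within {t. (t, snd p) \<in> A})"

definition dy :: "point set \<Rightarrow> (point \<Rightarrow> real) \<Rightarrow> point \<Rightarrow> real"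
  where "dy A u p = vector_derivative (\<lambda>t. u (fst p, t)) (at (snd p) within {t. (fst p, t) \<in> A})"

definition partial :: "point set \<Rightarrow> nat \<Rightarrow> nat \<Rightarrow> (point \<Rightarrow> real) \<Rightarrow> point \<Rightarrow> real"
  where "partial A i j u = (dx A ^^ i) ((dy A ^^ j) u)"

definition gradient :: "point set \<Rightarrow> (point \<Rightarrow> real) \<Rightarrow> point \<Rightarrow> point"
  where "gradient A u p = (dx A u p, dy A u p)"

definition divergence :: "point set \<Rightarrow> (point \<Rightarrow> point) \<Rightarrow> point \<Rightarrow> real"
  where "divergence A q p = dx A (\<lambda>z. fst (q z)) p + dy A (\<lambda>z. snd (q z)) p"

definition laplacian :: "point set \<Rightarrow> (point \<Rightarrow> real) \<Rightarrow> point \<Rightarrow> real"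
  where "laplacian A u p = dx A (dx A u) p + dy A (dy A u) p"

primrec C_on :: "nat \<Rightarrow> point set \<Rightarrow> (point \<Rightarrow> real) \<Rightarrow> bool" where
  "C_on 0 A u \<longleftrightarrow> continuous_on A u"
| "C_on (Suc m) A u \<longleftrightarrow> continuous_on A u \<and>
     (\<forall>(x, y) \<in> A. (\<lambda>t. u (t, y)) differentiable (at x within {t. (t, y) \<in> A}) \<and>
                    (\<lambda>t. u (x, t)) differentiable (at y within {t. (x, t) \<in> A})) \<and>
     C_on m A (dx A u) \<and> C_on m A (dy A u)"

definition L2 :: "point set \<Rightarrow> (point \<Rightarrow> real) \<Rightarrow> bool"
  where "L2 A f \<longleftrightarrow> set_borel_measurable lebesgue A f \<and> set_integrable lebesgue A (\<lambda>p. (f p)\<^sup>2)"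

definition inner_L2 :: "point set \<Rightarrow> (point \<Rightarrow> 'a::real_inner) \<Rightarrow> (point \<Rightarrow> 'a) \<Rightarrow> real"
  where "inner_L2 A f g = (LINT p:A|lebesgue. f p \<bullet> g p)"

definition test_functions :: "point set \<Rightarrow> (point \<Rightarrow> real) set"
  where "test_functions A =
    {\<phi>. (\<forall>m. C_on m UNIV \<phi>) \<and> (\<exists>K. compact K \<and> K \<subseteq> A \<and> (\<forall>p. p \<notin> K \<longrightarrow> \<phi> p = 0))}"

definition has_weak_partial ::
    "point set \<Rightarrow> nat \<Rightarrow> nat \<Rightarrow> (point \<Rightarrow> real) \<Rightarrow> (point \<Rightarrow> real) \<Rightarrow> bool"
  where "has_weak_partial A i j u g \<longleftrightarrow>
    (\<forall>\<phi> \<in> test_functions A. inner_L2 A u (partial UNIV i j \<phi>) = (-1) ^ (i + j) * inner_L2 A g \<phi>)"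

definition sobolev_H :: "nat \<Rightarrow> point set \<Rightarrow> (point \<Rightarrow> real) set"
  where "sobolev_H m A =
    {u. L2 A u \<and> (\<forall>i j. i + j \<le> m \<longrightarrow> (\<exists>g. L2 A g \<and> has_weak_partial A i j u g))}"

text \<open>The derivatives are pointwise ones: every \<open>u\<close> with the layer decomposition below is
  \<open>k + 1 \<ge> 4\<close> times continuously differentiable on the closed square. As \<open>f\<close> is only in
  \<open>L^2\<close>, the equation holds almost everywhere. At the corners there is no normal.\<close>

definition solves_problem :: "real \<Rightarrow> (point \<Rightarrow> real) \<Rightarrow> (point \<Rightarrow> real) \<Rightarrow> bool"
  where "solves_problem \<epsilon> f u \<longleftrightarrow>
    (AE p in lebesgue. p \<in> Omega \<longrightarrow>
        \<epsilon>\<^sup>2 * laplacian Omega_bar (laplacian Omega_bar u) p - laplacian Omega_bar u p = f p) \<and>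
    (\<forall>p \<in> frontier Omega. u p = 0) \<and>
    (\<forall>t \<in> {0<..<1}. gradient Omega_bar u (t, 0) \<bullet> (0, -1) = 0 \<and>
                     gradient Omega_bar u (1, t) \<bullet> (1, 0) = 0 \<and>
                     gradient Omega_bar u (t, 1) \<bullet> (0, 1) = 0 \<and>
                     gradient Omega_bar u (0, t) \<bullet> (-1, 0) = 0)"

definition layer_decomposition :: "nat \<Rightarrow> real \<Rightarrow> real \<Rightarrow> (point \<Rightarrow> real) \<Rightarrow> bool"
  where "layer_decomposition k C0 \<epsilon> u \<longleftrightarrow>
    (\<exists>S E1 E2 E3 E4 E12 E23 E34 E41.
      (\<forall>F \<in> {S, E1, E2, E3, E4, E12, E23, E34, E41}. C_on (k + 1) Omega_bar F) \<and>
      (\<forall>p \<in> Omega_bar. u p = S p + (E1 p + E2 p + E3 p + E4 p) + E12 p + E23 p + E34 p + E41 p) \<and>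
      (\<forall>(x, y) \<in> Omega_bar. \<forall>i j. i + j \<le> k + 1 \<longrightarrow>
        \<bar>partial Omega_bar i j S (x, y)\<bar> \<le> C0 \<and>
        \<bar>partial Omega_bar i j E1 (x, y)\<bar> \<le> C0 * \<epsilon> powi (1 - int j) * exp (- y / \<epsilon>) \<and>
        \<bar>partial Omega_bar i j E2 (x, y)\<bar> \<le> C0 * \<epsilon> powi (1 - int i) * exp (- (1 - x) / \<epsilon>) \<and>
        \<bar>partial Omega_bar i j E3 (x, y)\<bar> \<le> C0 * \<epsilon> powi (1 - int j) * exp (- (1 - y) / \<epsilon>) \<and>
        \<bar>partial Omega_bar i j E4 (x, y)\<bar> \<le> C0 * \<epsilon> powi (1 - int i) * exp (- x / \<epsilon>) \<and>
        \<bar>partial Omega_bar i j E12 (x, y)\<bar>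
          \<le> C0 * \<epsilon> powi (1 - int i - int j) * exp (- (1 - x) / \<epsilon>) * exp (- y / \<epsilon>) \<and>
        \<bar>partial Omega_bar i j E23 (x, y)\<bar>
          \<le> C0 * \<epsilon> powi (1 - int i - int j) * exp (- (1 - x) / \<epsilon>) * exp (- (1 - y) / \<epsilon>) \<and>
        \<bar>partial Omega_bar i j E34 (x, y)\<bar>
          \<le> C0 * \<epsilon> powi (1 - int i - int j) * exp (- x / \<epsilon>) * exp (- (1 - y) / \<epsilon>) \<and>
        \<bar>partial Omega_bar i j E41 (x, y)\<bar>
          \<le> C0 * \<epsilon> powi (1 - int i - int j) * exp (- x / \<epsilon>) * exp (- y / \<epsilon>)))"

definition transition :: "nat \<Rightarrow> real \<Rightarrow> nat \<Rightarrow> real"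
  where "transition k \<epsilon> N = min (real (k + 1) * \<epsilon> * ln (real N)) (1 / 4)"

definition fine_width :: "nat \<Rightarrow> real \<Rightarrow> nat \<Rightarrow> real"
  where "fine_width k \<epsilon> N = 4 * transition k \<epsilon> N / real N"

definition coarse_width :: "nat \<Rightarrow> real \<Rightarrow> nat \<Rightarrow> real"
  where "coarse_width k \<epsilon> N = 2 * (1 - 2 * transition k \<epsilon> N) / real N"

definition shishkin_node :: "nat \<Rightarrow> real \<Rightarrow> nat \<Rightarrow> nat \<Rightarrow> real"
  where "shishkin_node k \<epsilon> N i =
    (if 4 * i \<le> N then real i * fine_width k \<epsilon> N
     else if 4 * i \<le> 3 * N
       then transition k \<epsilon> N + (real i - real N / 4) * coarse_width k \<epsilon> N
     else 1 - transition k \<epsilon> N + (real i - 3 * real N / 4) * fine_width k \<epsilon> N)"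

text \<open>From here on \<open>X 0 < \<dots> < X N\<close> are the nodes of a one-dimensional mesh. The pair \<open>(i, j)\<close>
  stands for the cell \<open>[X i, X (i+1)] \<times> [X j, X (j+1)]\<close> of the tensor product mesh,
  \<open>Hor i j\<close> for the edge \<open>[X i, X (i+1)] \<times> {X j}\<close> and \<open>Ver i j\<close> for the edge
  \<open>{X i} \<times> [X j, X (j+1)]\<close>. Functions on an edge are functions of the coordinate
  that varies along it, which is its arc length up to translation.\<close>

type_synonym cell = "nat \<times> nat"

datatype edge = Hor nat nat | Ver nat nat

definition cells :: "nat \<Rightarrow> cell set"
  where "cells N = {..<N} \<times> {..<N}"

definition cell_set :: "(nat \<Rightarrow> real) \<Rightarrow> cell \<Rightarrow> point set"
  where "cell_set X T = {X (fst T)..X (Suc (fst T))} \<times> {X (snd T)..X (Suc (snd T))}"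

primrec edge_range :: "(nat \<Rightarrow> real) \<Rightarrow> edge \<Rightarrow> real set" where
  "edge_range X (Hor i j) = {X i..X (Suc i)}"
| "edge_range X (Ver i j) = {X j..X (Suc j)}"

primrec edge_point :: "(nat \<Rightarrow> real) \<Rightarrow> edge \<Rightarrow> real \<Rightarrow> point" where
  "edge_point X (Hor i j) t = (t, X j)"
| "edge_point X (Ver i j) t = (X i, t)"

definition edge_set :: "(nat \<Rightarrow> real) \<Rightarrow> edge \<Rightarrow> point set"
  where "edge_set X e = edge_point X e ` edge_range X e"

definition cell_boundary :: "cell \<Rightarrow> (edge \<times> point) set"
  where "cell_boundary T = (case T of (i, j) \<Rightarrow>
    {(Hor i j, (0, -1)), (Ver (Suc i) j, (1, 0)), (Hor i (Suc j), (0, 1)), (Ver i j, (-1, 0))})"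

definition edge_integral :: "(nat \<Rightarrow> real) \<Rightarrow> edge \<Rightarrow> (real \<Rightarrow> real) \<Rightarrow> real"
  where "edge_integral X e F = (LINT t:edge_range X e|lebesgue. F t)"

definition boundary_integral :: "(nat \<Rightarrow> real) \<Rightarrow> cell \<Rightarrow> (edge \<Rightarrow> point \<Rightarrow> real \<Rightarrow> real) \<Rightarrow> real"
  where "boundary_integral X T F = (\<Sum>(e, n) \<in> cell_boundary T. edge_integral X e (F e n))"

definition Qk :: "nat \<Rightarrow> (point \<Rightarrow> real) set"
  where "Qk k = {q. \<exists>c. \<forall>x y. q (x, y) = (\<Sum>i\<le>k. \<Sum>j\<le>k. c i j * x ^ i * y ^ j)}"

definition Qk_vec :: "nat \<Rightarrow> (point \<Rightarrow> point) set"
  where "Qk_vec k = {q. (\<lambda>p. fst (q p)) \<in> Qk k \<and> (\<lambda>p. snd (q p)) \<in> Qk k}"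

definition Pk :: "nat \<Rightarrow> (real \<Rightarrow> real) set"
  where "Pk k = {r. \<exists>p. degree p \<le> k \<and> r = poly p}"

definition Pk_vec :: "nat \<Rightarrow> (real \<Rightarrow> point) set"
  where "Pk_vec k = {r. (\<lambda>t. fst (r t)) \<in> Pk k \<and> (\<lambda>t. snd (r t)) \<in> Pk k}"

text \<open>A discontinuous piecewise polynomial is given by its polynomial on each cell, so that its
  traces on the boundary of the cell are unambiguous. The components \<open>wf_b\<close> and \<open>wf_g\<close> are
  indexed by edges, hence single-valued on each edge.\<close>

record weak_function =
  wf_0 :: "cell \<Rightarrow> point \<Rightarrow> real"
  wf_b :: "edge \<Rightarrow> real \<Rightarrow> real"
  wf_g :: "edge \<Rightarrow> real \<Rightarrow> point"

definition wf_minus :: "weak_function \<Rightarrow> weak_function \<Rightarrow> weak_function"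
  where "wf_minus v w = \<lparr>wf_0 = (\<lambda>T p. wf_0 v T p - wf_0 w T p),
                          wf_b = (\<lambda>e t. wf_b v e t - wf_b w e t),
                          wf_g = (\<lambda>e t. wf_g v e t - wf_g w e t)\<rparr>"

definition V_space :: "nat \<Rightarrow> nat \<Rightarrow> weak_function set"
  where "V_space k N = {v. \<forall>T \<in> cells N. wf_0 v T \<in> Qk k \<and>
    (\<forall>(e, n) \<in> cell_boundary T. wf_b v e \<in> Pk k \<and> wf_g v e \<in> Pk_vec k)}"

definition V0_space :: "nat \<Rightarrow> nat \<Rightarrow> (nat \<Rightarrow> real) \<Rightarrow> weak_function set"
  where "V0_space k N X = {v \<in> V_space k N. \<forall>T \<in> cells N. \<forall>(e, n) \<in> cell_boundary T.
    edge_set X e \<subseteq> frontier Omega \<longrightarrow>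
      (\<forall>t \<in> edge_range X e. wf_b v e t = 0 \<and> wf_g v e t \<bullet> n = 0)}"

definition weak_laplacian ::
    "nat \<Rightarrow> (nat \<Rightarrow> real) \<Rightarrow> weak_function \<Rightarrow> cell \<Rightarrow> point \<Rightarrow> real"
  where "weak_laplacian k X v T = (THE z. z \<in> Qk k \<and> (\<forall>\<phi> \<in> Qk k.
    inner_L2 (cell_set X T) z \<phi> =
      inner_L2 (cell_set X T) (wf_0 v T) (laplacian UNIV \<phi>)
      - boundary_integral X T (\<lambda>e n t. wf_b v e t * (gradient UNIV \<phi> (edge_point X e t) \<bullet> n))
      + boundary_integral X T (\<lambda>e n t. (wf_g v e t \<bullet> n) * \<phi> (edge_point X e t))))"

definition weak_gradient ::
    "nat \<Rightarrow> (nat \<Rightarrow> real) \<Rightarrow> weak_function \<Rightarrow> cell \<Rightarrow> point \<Rightarrow> point"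
  where "weak_gradient k X v T = (THE z. z \<in> Qk_vec k \<and> (\<forall>q \<in> Qk_vec k.
    inner_L2 (cell_set X T) z q =
      - inner_L2 (cell_set X T) (wf_0 v T) (divergence UNIV q)
      + boundary_integral X T (\<lambda>e n t. wf_b v e t * (q (edge_point X e t) \<bullet> n))))"

definition stabilizer ::
    "nat \<Rightarrow> real \<Rightarrow> nat \<Rightarrow> weak_function \<Rightarrow> weak_function \<Rightarrow> real"
  where "stabilizer k \<epsilon> N w v =
    (let X = shishkin_node k \<epsilon> N; h = fine_width k \<epsilon> N; H = coarse_width k \<epsilon> N in
     \<Sum>T \<in> cells N.
       \<epsilon>\<^sup>2 * inverse h * boundary_integral X T (\<lambda>e n t.
         (gradient UNIV (wf_0 w T) (edge_point X e t) - wf_g w e t) \<bullet>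
         (gradient UNIV (wf_0 v T) (edge_point X e t) - wf_g v e t))
       + (\<epsilon>\<^sup>2 * inverse (h\<^sup>2) * inverse H + inverse H) * boundary_integral X T (\<lambda>e n t.
         (wf_0 w T (edge_point X e t) - wf_b w e t) *
         (wf_0 v T (edge_point X e t) - wf_b v e t)))"

definition wg_form :: "nat \<Rightarrow> real \<Rightarrow> nat \<Rightarrow> weak_function \<Rightarrow> weak_function \<Rightarrow> real"
  where "wg_form k \<epsilon> N w v =
    (let X = shishkin_node k \<epsilon> N in
     \<epsilon>\<^sup>2 * (\<Sum>T \<in> cells N. inner_L2 (cell_set X T) (weak_laplacian k X w T) (weak_laplacian k X v T))
     + (\<Sum>T \<in> cells N. inner_L2 (cell_set X T) (weak_gradient k X w T) (weak_gradient k X v T))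
     + stabilizer k \<epsilon> N w v)"

definition triple_norm :: "nat \<Rightarrow> real \<Rightarrow> nat \<Rightarrow> weak_function \<Rightarrow> real"
  where "triple_norm k \<epsilon> N v = sqrt (wg_form k \<epsilon> N v v)"

definition wg_solution :: "nat \<Rightarrow> real \<Rightarrow> nat \<Rightarrow> (point \<Rightarrow> real) \<Rightarrow> weak_function \<Rightarrow> bool"
  where "wg_solution k \<epsilon> N f uN \<longleftrightarrow>
    (let X = shishkin_node k \<epsilon> N in
     uN \<in> V0_space k N X \<and>
     (\<forall>v \<in> V0_space k N X.
        wg_form k \<epsilon> N uN v = (\<Sum>T \<in> cells N. inner_L2 (cell_set X T) f (wf_0 v T))))"

definition proj_cell :: "nat \<Rightarrow> (nat \<Rightarrow> real) \<Rightarrow> (point \<Rightarrow> real) \<Rightarrow> cell \<Rightarrow> point \<Rightarrow> real"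
  where "proj_cell k X u T = (THE q. q \<in> Qk k \<and>
    (\<forall>\<phi> \<in> Qk k. inner_L2 (cell_set X T) q \<phi> = inner_L2 (cell_set X T) u \<phi>))"

definition proj_edge :: "nat \<Rightarrow> (nat \<Rightarrow> real) \<Rightarrow> (point \<Rightarrow> real) \<Rightarrow> edge \<Rightarrow> real \<Rightarrow> real"
  where "proj_edge k X u e = (THE r. r \<in> Pk k \<and>
    (\<forall>\<psi> \<in> Pk k. edge_integral X e (\<lambda>t. r t * \<psi> t)
                 = edge_integral X e (\<lambda>t. u (edge_point X e t) * \<psi> t)))"

definition proj_edge_vec :: "nat \<Rightarrow> (nat \<Rightarrow> real) \<Rightarrow> (point \<Rightarrow> point) \<Rightarrow> edge \<Rightarrow> real \<Rightarrow> point"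
  where "proj_edge_vec k X g e = (THE r. r \<in> Pk_vec k \<and>
    (\<forall>\<psi> \<in> Pk_vec k. edge_integral X e (\<lambda>t. r t \<bullet> \<psi> t)
                     = edge_integral X e (\<lambda>t. g (edge_point X e t) \<bullet> \<psi> t)))"

definition Q_proj :: "nat \<Rightarrow> (nat \<Rightarrow> real) \<Rightarrow> (point \<Rightarrow> real) \<Rightarrow> weak_function"
  where "Q_proj k X u = \<lparr>wf_0 = proj_cell k X u,
                          wf_b = proj_edge k X u,
                          wf_g = proj_edge_vec k X (gradient Omega_bar u)\<rparr>"

end

theory Submission
  imports Defs
begin

text \<open>
  The weak operators commute with the projections: the weak Laplacian of \<open>Q_proj k X u\<close> is the
  \<open>L\<^sup>2\<close> projection of \<open>\<Delta>u\<close>, and its weak gradient that of \<open>\<nabla>u\<close>. Integrating by parts cell by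
  cell, the form applied to the error and a test function \<open>v\<close> reduces to boundary integrals of
  residuals against the jumps \<open>v\<^sub>0 - v\<^sub>b\<close> and \<open>\<nabla>v\<^sub>0 - v\<^sub>g\<close>. With \<open>v\<close> the error itself, Young's
  inequality absorbs the jumps into the stabilizer, so the squared error is at most the residuals
  squared over the stabilizer weights.

  The residuals are approximation errors of the tensor product projection. Put
  \<open>\<rho> = h / \<epsilon> \<le> C ln N / N\<close>. On each cell the smooth part contributes powers of \<open>1 / N\<close>. A layer part
  is either resolved, contributing powers of \<open>\<rho>\<close> times the decay of the layer, or it is of size
  \<open>N\<close> to the power \<open>-(k + 1)\<close>, where stability of the projection is enough. Since
  \<open>\<epsilon> \<rho> N \<le> 1\<close> and the squared decay sums to \<open>O(1 / \<rho>)\<close> over a line of cells, the layers contribute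
  \<open>\<rho> ^ (2 * k - 3) / N\<close>, which is the claimed rate.
\<close>

subsection \<open>Orthonormal polynomials and one-dimensional projection\<close>

text \<open>The cells have unbounded aspect ratio as \<open>\<epsilon>\<close> tends to zero, so
  every approximation estimate is anisotropic: the cell projection is an iteration of
  one-dimensional projections, and each width is paired with derivatives in its own direction. The
  derivative of a projection is bounded by the derivative of the function, without a negative power
  of a width. The residuals contain \<open>\<nabla>\<Delta>u\<close> and the equation contains
  \<open>\<Delta>\<Delta>u\<close>; \<open>3 \<le> k\<close> supplies these four derivatives. Terms
  pairing the single-valued \<open>v_b\<close> and \<open>v_g\<close> with traces of
  \<open>\<nabla>u\<close>, \<open>\<Delta>u\<close> and \<open>\<nabla>\<Delta>u\<close> cancel
  between neighbouring cells and vanish on the boundary. A third derivative of a layer is of size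
  \<open>1 / \<epsilon>\<^sup>2\<close>, which the factor \<open>\<epsilon>\<^sup>2\<close> of the
  fourth-order operator cancels. Division by the value weight, at least
  \<open>N / (2 * \<rho>\<^sup>2)\<close>, leaves \<open>\<rho> ^ (2 * k - 2) / N\<close> times the
  squared decay. Summing that decay over the mesh costs one factor \<open>\<rho>\<close>: the odd
  exponent \<open>2 * k - 3\<close> is the origin of the half-integer power of the
  logarithm.\<close>

definition pint :: "real poly \<Rightarrow> real poly \<Rightarrow> real"
  where "pint p q = integral {0..1} (\<lambda>t. poly p t * poly q t)"

lemma poly_integrable_01 [simp]: "(\<lambda>t. poly p t * poly q t) integrable_on {0..1::real}"
  by (intro integrable_continuous_real continuous_intros)

lemma continuous_on_poly_id [continuous_intros]: "continuous_on S (poly p)" for p :: "real poly"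
  using continuous_on_poly[OF continuous_on_id, of S p] by simp

lemma pint_add_left: "pint (p + q) r = pint p r + pint q r"
  unfolding pint_def by (simp add: algebra_simps integral_add)

lemma pint_smult_left: "pint (smult c p) r = c * pint p r"
  unfolding pint_def by (simp add: mult.assoc)

lemma pint_commute: "pint p q = pint q p"
  unfolding pint_def by (simp add: mult.commute)

lemma pint_smult_right: "pint r (smult c p) = c * pint r p"
  using pint_smult_left pint_commute by metis

lemma pint_diff_left: "pint (p - q) r = pint p r - pint q r"
  using pint_add_left[of "p - q" q r] by simp

lemma pint_0_left [simp]: "pint 0 r = 0"
  unfolding pint_def by simp

lemma pint_sum_left: "pint (\<Sum>i\<in>A. p i) r = (\<Sum>i\<in>A. pint (p i) r)"
  by (induction A rule: infinite_finite_induct) (simp_all add: pint_add_left)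

text \<open>A continuous square with vanishing integral is zero on the whole interval, which gives
  infinitely many roots.\<close>

lemma pint_self_pos:
  assumes "p \<noteq> 0"
  shows "0 < pint p p"
proof -
  have "0 \<le> pint p p"
    unfolding pint_def by (intro integral_nonneg) auto
  moreover have "pint p p \<noteq> 0"
  proof
    assume "pint p p = 0"
    moreover have "continuous_on {0..1} (\<lambda>t. poly p t * poly p t)"
      by (intro continuous_intros)
    ultimately have "\<forall>t\<in>{0..1}. poly p t * poly p t = 0"
      unfolding pint_def by (subst (asm) integral_eq_0_iff) auto
    then have "{0..1} \<subseteq> {t. poly p t = 0}" by auto
    moreover have "infinite {0..1::real}" by simp
    ultimately show False
      using poly_roots_finite[OF assms] finite_subset by blast
  qed
  ultimately show ?thesis by linarith
qed

text \<open>Gram-Schmidt on the monomials, one degree at a time. The expansion property is carried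
  through the induction and takes the place of a dimension argument.\<close>

lemma orthonormal_poly_exists:
  "\<exists>b. (\<forall>i\<le>n. degree (b i) \<le> i) \<and> (\<forall>i\<le>n. \<forall>j\<le>n. pint (b i) (b j) = of_bool (i = j)) \<and>
       (\<forall>q. degree q \<le> n \<longrightarrow> q = (\<Sum>i\<le>n. smult (pint q (b i)) (b i)))"
proof (induction n)
  case 0
  have "pint 1 1 = 1" unfolding pint_def by simp
  moreover have "q = smult (pint q 1) 1" if q: "degree q = 0" for q
  proof -
    obtain c where "q = [:c:]" using q by (elim degree_eq_zeroE)
    then show ?thesis unfolding pint_def by (simp add: one_pCons)
  qed
  ultimately show ?case
    by (intro exI[of _ "\<lambda>_. 1"]) simp
next
  case (Suc n)
  then obtain b where deg: "\<And>i. i \<le> n \<Longrightarrow> degree (b i) \<le> i"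
    and orth: "\<And>i j. i \<le> n \<Longrightarrow> j \<le> n \<Longrightarrow> pint (b i) (b j) = of_bool (i = j)"
    and span: "\<And>q. degree q \<le> n \<Longrightarrow> q = (\<Sum>i\<le>n. smult (pint q (b i)) (b i))"
    by blast
  define m where "m = monom (1::real) (Suc n)"
  define s where "s = (\<Sum>i\<le>n. smult (pint m (b i)) (b i))"
  define r where "r = m - s"
  have degs: "degree s \<le> n"
    unfolding s_def by (intro degree_sum_le) (auto intro!: order.trans[OF degree_smult_le] order.trans[OF deg])
  \<comment> \<open>Subtracting \<open>s\<close>, of degree at most \<open>n\<close>, leaves the
    leading coefficient of the monomial: \<open>r\<close> is nonzero and can be normalised.\<close>
  have cr: "coeff r (Suc n) = 1"
    using degs by (simp add: r_def m_def coeff_eq_0)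
  then have r0: "r \<noteq> 0" by auto
  have degr: "degree r \<le> Suc n"
    unfolding r_def m_def using degs by (intro degree_diff_le) (auto simp: degree_monom_eq)
  have rorth: "pint r (b i) = 0" if "i \<le> n" for i
  proof -
    have "pint s (b i) = (\<Sum>j\<le>n. pint m (b j) * of_bool (j = i))"
      unfolding s_def pint_sum_left pint_smult_left using that orth by (intro sum.cong) auto
    also have "\<dots> = pint m (b i)" using that by (simp add: of_bool_def if_distrib cong: if_cong)
    finally show ?thesis by (simp add: r_def pint_diff_left)
  qed
  define c where "c = 1 / sqrt (pint r r)"
  have rr: "0 < pint r r" by (rule pint_self_pos[OF r0])
  have cc: "c * c * pint r r = 1" unfolding c_def using rr by (simp add: field_simps)
  define b' where "b' = b(Suc n := smult c r)"
  have b'_old: "b' i = b i" if "i \<le> n" for i using that by (simp add: b'_def)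
  have b'_new: "b' (Suc n) = smult c r" by (simp add: b'_def)
  have p1: "degree (b' i) \<le> i" if "i \<le> Suc n" for i
    using that deg degr by (cases "i = Suc n") (auto simp: b'_def)
  have p2: "pint (b' i) (b' j) = of_bool (i = j)" if "i \<le> Suc n" "j \<le> Suc n" for i j
  proof -
    have "pint (b l) r = 0" if "l \<le> n" for l using rorth[OF that] pint_commute by metis
    then show ?thesis
      using that orth rorth cc unfolding b'_def
      by (auto simp: pint_smult_left pint_smult_right le_Suc_eq mult.assoc)
  qed
  have p3: "q = (\<Sum>i\<le>Suc n. smult (pint q (b' i)) (b' i))" if q: "degree q \<le> Suc n" for q
  proof -
    \<comment> \<open>\<open>r\<close> has coefficient \<open>1\<close> in degree
      \<open>Suc n\<close>, so \<open>q - smult a r\<close> has degree at most \<open>n\<close> and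
      the old expansion applies to it.\<close>
    define a where "a = coeff q (Suc n)"
    define t where "t = q - smult a r"
    have "degree t \<le> Suc n" unfolding t_def using q degr
      by (intro degree_diff_le) (auto intro: order.trans[OF degree_smult_le])
    moreover have "coeff t (Suc n) = 0" by (simp add: t_def a_def cr)
    ultimately have "degree t \<le> n"
      by (metis le_SucE leading_coeff_0_iff degree_0 le0)
    then have t: "t = (\<Sum>i\<le>n. smult (pint t (b i)) (b i))" by (rule span)
    have "pint t r = (\<Sum>i\<le>n. pint t (b i) * pint (b i) r)"
      by (subst t) (simp add: pint_sum_left pint_smult_left)
    also have "\<dots> = 0" by (intro sum.neutral) (use rorth pint_commute in \<open>auto\<close>)
    finally have tr: "pint t r = 0" .
    have q_eq: "q = t + smult a r" by (simp add: t_def)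
    have "pint q (b i) = pint t (b i)" if "i \<le> n" for i
      using rorth[OF that] by (simp add: q_eq pint_add_left pint_smult_left)
    then have "t = (\<Sum>i\<le>n. smult (pint q (b' i)) (b' i))"
      by (subst t) (intro sum.cong, simp_all add: b'_old)
    moreover have "smult (pint q (b' (Suc n))) (b' (Suc n)) = smult a r"
    proof -
      have "pint q r = a * pint r r" using tr by (simp add: q_eq pint_add_left pint_smult_left)
      then have "pint q (smult c r) * c = a"
        using cc by (simp add: pint_smult_right mult_ac)
      then show ?thesis by (simp add: b'_new)
    qed
    ultimately show ?thesis using q_eq by simp
  qed
  show ?case using p1 p2 p3 by blast
qed

text \<open>Up to sign the shifted Legendre polynomials, normalised in \<open>L2\<close> of the unit
  interval.\<close>

definition onb :: "nat \<Rightarrow> nat \<Rightarrow> real poly"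
  where "onb n = (SOME b. (\<forall>i\<le>n. degree (b i) \<le> i) \<and>
     (\<forall>i\<le>n. \<forall>j\<le>n. pint (b i) (b j) = of_bool (i = j)) \<and>
     (\<forall>q. degree q \<le> n \<longrightarrow> q = (\<Sum>i\<le>n. smult (pint q (b i)) (b i))))"

lemma
  shows degree_onb: "i \<le> n \<Longrightarrow> degree (onb n i) \<le> n"
    and pint_onb: "i \<le> n \<Longrightarrow> j \<le> n \<Longrightarrow> pint (onb n i) (onb n j) = of_bool (i = j)"
    and onb_expansion: "degree q \<le> n \<Longrightarrow> q = (\<Sum>i\<le>n. smult (pint q (onb n i)) (onb n i))"
  using someI_ex[OF orthonormal_poly_exists[of n], folded onb_def] le_trans by blast+

section \<open>Orthonormal polynomials on an arbitrary interval\<close>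

text \<open>The factor \<open>1 / sqrt (b - a)\<close> preserves orthonormality under the affine map
  onto \<open>{a..b}\<close>; \<open>lgd'\<close> is the derivative in closed form.\<close>

definition lgd :: "nat \<Rightarrow> real \<Rightarrow> real \<Rightarrow> nat \<Rightarrow> real \<Rightarrow> real"
  where "lgd k a b i t = poly (onb k i) ((t - a) / (b - a)) / sqrt (b - a)"

definition lgd' :: "nat \<Rightarrow> real \<Rightarrow> real \<Rightarrow> nat \<Rightarrow> real \<Rightarrow> real"
  where "lgd' k a b i t = poly (pderiv (onb k i)) ((t - a) / (b - a)) / ((b - a) * sqrt (b - a))"

lemma lgd_deriv:
  assumes "a < b"
  shows "(lgd k a b i has_real_derivative lgd' k a b i t) (at t within S)"
proof -
  have "((\<lambda>t. (t - a) / (b - a)) has_real_derivative 1 / (b - a)) (at t within S)"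
    using assms by (auto intro!: derivative_eq_intros)
  from DERIV_chain2[OF poly_DERIV this]
  have "((\<lambda>t. poly (onb k i) ((t - a) / (b - a))) has_real_derivative
      poly (pderiv (onb k i)) ((t - a) / (b - a)) * (1 / (b - a))) (at t within S)" .
  from DERIV_cdivide[OF this, of "sqrt (b - a)"] show ?thesis
    unfolding lgd_def[abs_def] lgd'_def by simp
qed

lemma continuous_on_lgd [continuous_intros]:
  "a < b \<Longrightarrow> continuous_on S f \<Longrightarrow> continuous_on S (\<lambda>x. lgd k a b i (f x))"
  unfolding lgd_def by (intro continuous_intros) auto

lemma continuous_on_lgd' [continuous_intros]:
  "a < b \<Longrightarrow> continuous_on S f \<Longrightarrow> continuous_on S (\<lambda>x. lgd' k a b i (f x))"
  unfolding lgd'_def by (intro continuous_intros) auto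

definition lgd_poly :: "nat \<Rightarrow> real \<Rightarrow> real \<Rightarrow> nat \<Rightarrow> real poly"
  where "lgd_poly k a b i = smult (1 / sqrt (b - a)) (pcompose (onb k i) [:- a / (b - a), 1 / (b - a):])"

lemma poly_lgd_poly: "poly (lgd_poly k a b i) t = lgd k a b i t"
  by (simp add: lgd_poly_def lgd_def poly_pcompose diff_divide_distrib)

lemma degree_lgd_poly: "i \<le> k \<Longrightarrow> degree (lgd_poly k a b i) \<le> k"
proof -
  assume i: "i \<le> k"
  have "degree (lgd_poly k a b i) \<le> degree (onb k i) * degree [:- a / (b - a), 1 / (b - a):]"
    unfolding lgd_poly_def using degree_smult_le order.trans degree_pcompose_le by blast
  also have "\<dots> \<le> degree (onb k i) * 1" by (intro mult_left_mono) auto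
  finally show ?thesis using degree_onb[OF i] by linarith
qed

lemma lgd_in_Pk: "i \<le> k \<Longrightarrow> lgd k a b i \<in> Pk k"
  unfolding Pk_def using degree_lgd_poly poly_lgd_poly
  by (intro CollectI exI[of _ "lgd_poly k a b i"]) auto

lemma integral_rescale:
  fixes F :: "real \<Rightarrow> real"
  assumes "a < b" "continuous_on {0..1} F"
  shows "integral {a..b} (\<lambda>t. F ((t - a) / (b - a))) = (b - a) * integral {0..1} F"
proof -
  have "(F has_integral integral {0..1} F) (cbox 0 1)"
    using assms(2) by (simp add: integrable_integral integrable_continuous_real)
  from has_integral_affinity'[OF this, of "1 / (b - a)" "- a / (b - a)"] assms(1)
  have "((\<lambda>x. F (x / (b - a) - a / (b - a))) has_integral (b - a) * integral {0..1} F)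
     (cbox (a / (b - a) * (b - a)) ((1 + a / (b - a)) * (b - a)))"
    by (simp add: divide_simps add.commute)
  moreover have "(1 + a / (b - a)) * (b - a) = b" "a / (b - a) * (b - a) = a"
    using assms(1) by (simp_all add: field_simps)
  ultimately show ?thesis by (simp add: diff_divide_distrib integral_unique)
qed

lemma lgd_orthonormal:
  assumes "a < b" "i \<le> k" "j \<le> k"
  shows "integral {a..b} (\<lambda>t. lgd k a b i t * lgd k a b j t) = of_bool (i = j)"
proof -
  have "integral {a..b} (\<lambda>t. lgd k a b i t * lgd k a b j t)
      = integral {a..b} (\<lambda>t. (\<lambda>s. poly (onb k i) s * poly (onb k j) s / (b - a)) ((t - a) / (b - a)))"
    using assms(1) by (intro integral_cong) (simp add: lgd_def)
  also have "\<dots> = (b - a) * integral {0..1} (\<lambda>s. poly (onb k i) s * poly (onb k j) s / (b - a))"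
    using assms(1) by (intro integral_rescale continuous_intros) auto
  also have "\<dots> = pint (onb k i) (onb k j)"
    using assms(1) by (simp add: pint_def)
  finally show ?thesis using pint_onb assms by simp
qed

text \<open>Pull \<open>q\<close> back to the unit interval, expand it in \<open>onb\<close>, and
  rescale the coefficients.\<close>

lemma lgd_expansion:
  assumes "a < b" "degree q \<le> k"
  shows "poly q t = (\<Sum>i\<le>k. integral {a..b} (\<lambda>s. poly q s * lgd k a b i s) * lgd k a b i t)"
proof -
  define r where "r = pcompose q [:a, b - a:]"
  have "degree r \<le> k"
  proof -
    have "degree r \<le> degree q * degree [:a, b - a:]" unfolding r_def by (rule degree_pcompose_le)
    also have "\<dots> \<le> degree q * 1" by (intro mult_left_mono) auto
    finally show ?thesis using assms by linarith
  qed
  then have r: "r = (\<Sum>i\<le>k. smult (pint r (onb k i)) (onb k i))" by (rule onb_expansion)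
  have rq: "poly r ((s - a) / (b - a)) = poly q s" for s
    using assms(1) by (simp add: r_def poly_pcompose)
  have co: "integral {a..b} (\<lambda>s. poly q s * lgd k a b i s) = sqrt (b - a) * pint r (onb k i)" for i
  proof -
    have "integral {a..b} (\<lambda>s. poly q s * lgd k a b i s)
      = integral {a..b} (\<lambda>s. (\<lambda>v. poly r v * poly (onb k i) v / sqrt (b - a)) ((s - a) / (b - a)))"
      by (intro integral_cong) (simp add: lgd_def rq)
    also have "\<dots> = (b - a) * integral {0..1} (\<lambda>v. poly r v * poly (onb k i) v / sqrt (b - a))"
      using assms(1) by (intro integral_rescale continuous_intros) auto
    also have "\<dots> = (b - a) / sqrt (b - a) * pint r (onb k i)" by (simp add: pint_def)
    finally show ?thesis using assms(1) by (simp add: real_div_sqrt)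
  qed
  have "poly q t = poly r ((t - a) / (b - a))" by (simp add: rq)
  also have "\<dots> = (\<Sum>i\<le>k. pint r (onb k i) * poly (onb k i) ((t - a) / (b - a)))"
    by (subst r) (simp add: poly_sum)
  also have "\<dots> = (\<Sum>i\<le>k. integral {a..b} (\<lambda>s. poly q s * lgd k a b i s) * lgd k a b i t)"
    unfolding co using assms(1) by (intro sum.cong) (auto simp: lgd_def)
  finally show ?thesis .
qed

text \<open>A sum in place of a maximum: all suprema are nonnegative, so it dominates each of them.
  It depends on \<open>k\<close> only, hence so do all constants built from it.\<close>

definition onb_bound :: "nat \<Rightarrow> real"
  where "onb_bound k =
    (\<Sum>i\<le>k. (SUP t\<in>{0..1}. \<bar>poly (onb k i) t\<bar>) + (SUP t\<in>{0..1}. \<bar>poly (pderiv (onb k i)) t\<bar>))"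

lemma poly_le_SUP: "t \<in> {0..1} \<Longrightarrow> \<bar>poly p t\<bar> \<le> (SUP t\<in>{0..1}. \<bar>poly p t\<bar>)" for p :: "real poly"
proof (rule cSUP_upper)
  have "compact ((\<lambda>t. \<bar>poly p t\<bar>) ` {0..1})"
    by (intro compact_continuous_image continuous_intros) auto
  then show "bdd_above ((\<lambda>t. \<bar>poly p t\<bar>) ` {0..1})"
    by (intro bounded_imp_bdd_above compact_imp_bounded)
qed

lemma
  shows onb_bound_nonneg: "0 \<le> onb_bound k"
    and onb_le: "i \<le> k \<Longrightarrow> t \<in> {0..1} \<Longrightarrow> \<bar>poly (onb k i) t\<bar> \<le> onb_bound k"
    and onb'_le: "i \<le> k \<Longrightarrow> t \<in> {0..1} \<Longrightarrow> \<bar>poly (pderiv (onb k i)) t\<bar> \<le> onb_bound k"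
proof -
  let ?S = "\<lambda>p::real poly. SUP t\<in>{0..1}. \<bar>poly p t\<bar>"
  have S0: "0 \<le> ?S p" for p using poly_le_SUP[of 0 p] by simp
  then show "0 \<le> onb_bound k" unfolding onb_bound_def by (intro sum_nonneg add_nonneg_nonneg)
  assume i: "i \<le> k" and t: "t \<in> {0..1}"
  have "?S (onb k i) + ?S (pderiv (onb k i)) \<le> onb_bound k"
    unfolding onb_bound_def using i S0
    by (intro member_le_sum[of i "{..k}" "\<lambda>i. ?S (onb k i) + ?S (pderiv (onb k i))"])
      (simp_all add: add_nonneg_nonneg)
  then show "\<bar>poly (onb k i) t\<bar> \<le> onb_bound k" "\<bar>poly (pderiv (onb k i)) t\<bar> \<le> onb_bound k"
    using poly_le_SUP[OF t, of "onb k i"] poly_le_SUP[OF t, of "pderiv (onb k i)"]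
      S0[of "onb k i"] S0[of "pderiv (onb k i)"] by linarith+
qed

lemma
  assumes "a < b" "i \<le> k" "t \<in> {a..b}"
  shows lgd_le: "\<bar>lgd k a b i t\<bar> \<le> onb_bound k / sqrt (b - a)"
    and lgd'_le: "\<bar>lgd' k a b i t\<bar> \<le> onb_bound k / ((b - a) * sqrt (b - a))"
proof -
  have "(t - a) / (b - a) \<in> {0..1}" using assms by (auto simp: field_simps)
  then show "\<bar>lgd k a b i t\<bar> \<le> onb_bound k / sqrt (b - a)"
    "\<bar>lgd' k a b i t\<bar> \<le> onb_bound k / ((b - a) * sqrt (b - a))"
    using onb_le[OF assms(2)] onb'_le[OF assms(2)] assms(1)
    unfolding lgd_def lgd'_def abs_divide by (simp_all add: divide_right_mono)
qed

section \<open>The one-dimensional projection and its stability\<close>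

text \<open>The \<open>L2\<close> projection onto polynomials of degree at most \<open>k\<close> on
  \<open>{a..b}\<close>, spelled out by coefficients so that its maximum norm can be estimated;
  \<open>proj1'\<close> is the derivative of the projection.\<close>

definition proj1 :: "nat \<Rightarrow> real \<Rightarrow> real \<Rightarrow> (real \<Rightarrow> real) \<Rightarrow> real \<Rightarrow> real"
  where "proj1 k a b g x = (\<Sum>i\<le>k. integral {a..b} (\<lambda>s. g s * lgd k a b i s) * lgd k a b i x)"

definition proj1' :: "nat \<Rightarrow> real \<Rightarrow> real \<Rightarrow> (real \<Rightarrow> real) \<Rightarrow> real \<Rightarrow> real"
  where "proj1' k a b g x = (\<Sum>i\<le>k. integral {a..b} (\<lambda>s. g s * lgd k a b i s) * lgd' k a b i x)"

lemma proj1_deriv: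
  "a < b \<Longrightarrow> (proj1 k a b g has_real_derivative proj1' k a b g x) (at x within S)"
  unfolding proj1_def[abs_def] proj1'_def by (intro DERIV_sum DERIV_cmult lgd_deriv)

lemma proj1_poly: "a < b \<Longrightarrow> degree q \<le> k \<Longrightarrow> proj1 k a b (poly q) = poly q"
  by (rule ext) (simp add: proj1_def lgd_expansion[symmetric])

lemma proj1'_poly:
  assumes "a < b" "degree q \<le> k"
  shows "proj1' k a b (poly q) x = poly (pderiv q) x"
proof (rule DERIV_unique)
  show "(poly q has_real_derivative proj1' k a b (poly q) x) (at x)"
    using proj1_deriv[OF assms(1), of k "poly q" x UNIV] proj1_poly[OF assms] by simp
qed (rule poly_DERIV)

lemma lgd_coeff_integrable:
  "a < b \<Longrightarrow> continuous_on {a..b} g \<Longrightarrow> (\<lambda>s. g s * lgd k a b i s) integrable_on {a..b}"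
  by (intro integrable_continuous_real continuous_intros)

lemma lgd_coeff_diff:
  assumes "a < b" "continuous_on {a..b} f" "continuous_on {a..b} g"
  shows "integral {a..b} (\<lambda>s. (f s - g s) * lgd k a b i s)
    = integral {a..b} (\<lambda>s. f s * lgd k a b i s) - integral {a..b} (\<lambda>s. g s * lgd k a b i s)"
  unfolding left_diff_distrib using assms by (intro integral_diff lgd_coeff_integrable)

lemma proj1_diff:
  assumes "a < b" "continuous_on {a..b} f" "continuous_on {a..b} g"
  shows "proj1 k a b (\<lambda>s. f s - g s) x = proj1 k a b f x - proj1 k a b g x"
  unfolding proj1_def lgd_coeff_diff[OF assms] by (simp add: left_diff_distrib sum_subtractf)

lemma proj1'_diff:
  assumes "a < b" "continuous_on {a..b} f" "continuous_on {a..b} g"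
  shows "proj1' k a b (\<lambda>s. f s - g s) x = proj1' k a b f x - proj1' k a b g x"
  unfolding proj1'_def lgd_coeff_diff[OF assms] by (simp add: left_diff_distrib sum_subtractf)

lemma lgd_coeff_bound:
  assumes "a < b" "continuous_on {a..b} g" "\<And>s. s \<in> {a..b} \<Longrightarrow> \<bar>g s\<bar> \<le> B" "i \<le> k"
  shows "\<bar>integral {a..b} (\<lambda>s. g s * lgd k a b i s)\<bar> \<le> B * onb_bound k * sqrt (b - a)"
proof -
  have B: "0 \<le> B" using assms(1) assms(3)[of a] by auto
  have "norm (integral {a..b} (\<lambda>s. g s * lgd k a b i s)) \<le> (B * (onb_bound k / sqrt (b - a))) * (b - a)"
  proof (intro integral_bound)
    show "continuous_on {a..b} (\<lambda>s. g s * lgd k a b i s)"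
      using assms by (intro continuous_intros)
    show "norm (g t * lgd k a b i t) \<le> B * (onb_bound k / sqrt (b - a))" if "t \<in> {a..b}" for t
      unfolding real_norm_def abs_mult using that assms B by (intro mult_mono lgd_le) auto
  qed (use assms(1) in auto)
  also have "\<dots> = B * onb_bound k * ((b - a) / sqrt (b - a))" by simp
  finally show ?thesis using assms(1) by (simp add: real_div_sqrt)
qed

definition proj1_const :: "nat \<Rightarrow> real"
  where "proj1_const k = real (Suc k) * (onb_bound k * onb_bound k)"

lemma proj1_const_nonneg: "0 \<le> proj1_const k"
  unfolding proj1_const_def using onb_bound_nonneg[of k] by simp

text \<open>The coefficients are of size \<open>sqrt (b - a)\<close> and the basis functions of size
  \<open>1 / sqrt (b - a)\<close>, so the length cancels and the constant depends on
  \<open>k\<close> alone.\<close>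

lemma proj1_stable:
  assumes ab: "a < b" and g: "continuous_on {a..b} g" "\<And>s. s \<in> {a..b} \<Longrightarrow> \<bar>g s\<bar> \<le> B"
    and x: "x \<in> {a..b}"
  shows "\<bar>proj1 k a b g x\<bar> \<le> proj1_const k * B"
proof -
  have B: "0 \<le> B" using g(2)[of x] x by linarith
  have "\<bar>proj1 k a b g x\<bar>
    \<le> (\<Sum>i\<le>k. \<bar>integral {a..b} (\<lambda>s. g s * lgd k a b i s) * lgd k a b i x\<bar>)"
    unfolding proj1_def by (rule sum_abs)
  also have "\<dots> \<le> (\<Sum>i\<le>k. (B * onb_bound k * sqrt (b - a)) * (onb_bound k / sqrt (b - a)))"
    unfolding abs_mult using onb_bound_nonneg[of k] B ab x g
    by (intro sum_mono mult_mono lgd_coeff_bound lgd_le) auto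
  also have "\<dots> = proj1_const k * B" using ab by (simp add: proj1_const_def)
  finally show ?thesis .
qed

text \<open>Bounding \<open>lgd'\<close> directly costs a factor \<open>1 / (b - a)\<close>. The
  projection reproduces the constant \<open>g a\<close>, whose derivative is zero; the remainder
  \<open>g - g a\<close> is of size \<open>B * (b - a)\<close> and pays for that factor.\<close>

lemma proj1'_stable:
  assumes ab: "a < b"
    and g: "\<And>s. s \<in> {a..b} \<Longrightarrow> (g has_real_derivative g' s) (at s within {a..b})"
      "\<And>s. s \<in> {a..b} \<Longrightarrow> \<bar>g' s\<bar> \<le> B"
    and x: "x \<in> {a..b}"
  shows "\<bar>proj1' k a b g x\<bar> \<le> proj1_const k * B"
proof -
  have B: "0 \<le> B" using g(2)[of x] x by linarith
  have cont: "continuous_on {a..b} g" using g(1) DERIV_continuous_on by blast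
  define f where "f s = g s - poly [:g a:] s" for s
  have fb: "\<bar>f s\<bar> \<le> B * (b - a)" if s: "s \<in> {a..b}" for s
  proof -
    have "norm (g s - g a) \<le> B * norm (s - a)"
      by (rule field_differentiable_bound[of "{a..b}" g g']) (use g s in auto)
    also have "\<dots> \<le> B * (b - a)" using B s by (intro mult_left_mono) auto
    finally show ?thesis by (simp add: f_def)
  qed
  have cf: "continuous_on {a..b} f" unfolding f_def by (intro continuous_intros cont)
  have "proj1' k a b f x = proj1' k a b g x - proj1' k a b (poly [:g a:]) x"
    unfolding f_def by (rule proj1'_diff[OF ab cont]) (auto intro!: continuous_intros)
  also have "\<dots> = proj1' k a b g x" by (subst proj1'_poly[OF ab]) (auto simp: pderiv_pCons)
  finally have "\<bar>proj1' k a b g x\<bar> = \<bar>proj1' k a b f x\<bar>" by simp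
  also have "\<dots> \<le> (\<Sum>i\<le>k. \<bar>integral {a..b} (\<lambda>s. f s * lgd k a b i s) * lgd' k a b i x\<bar>)"
    unfolding proj1'_def by (rule sum_abs)
  also have "\<dots> \<le> (\<Sum>i\<le>k. (B * (b - a) * onb_bound k * sqrt (b - a)) * (onb_bound k / ((b - a) * sqrt (b - a))))"
    unfolding abs_mult using onb_bound_nonneg[of k] B ab x cf fb
    by (intro sum_mono mult_mono lgd_coeff_bound lgd'_le) auto
  also have "\<dots> = proj1_const k * B" using ab by (simp add: proj1_const_def)
  finally show ?thesis .
qed

section \<open>Polynomial approximation of Taylor type and projection errors\<close>

lemma poly_antiderivative: "\<exists>q. pderiv q = p \<and> degree q \<le> Suc (degree p)" for p :: "real poly"
proof -
  define q where "q = (\<Sum>i\<le>degree p. monom (coeff p i / real (Suc i)) (Suc i))"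
  have "pderiv q = (\<Sum>i\<le>degree p. monom (coeff p i) i)"
    unfolding q_def higher_pderiv_sum[of 1, simplified] by (intro sum.cong refl) (simp add: pderiv_monom del: of_nat_Suc)
  then have "pderiv q = p" using poly_as_sum_of_monoms by metis
  moreover have "degree q \<le> Suc (degree p)"
    unfolding q_def by (intro degree_sum_le) (auto intro: order.trans[OF degree_monom_le])
  ultimately show ?thesis by blast
qed

text \<open>The antiderivative of \<open>T\<close> is normalised to agree with \<open>g\<close> at
  \<open>a\<close>; the mean value inequality then gains one factor \<open>b - a\<close>.\<close>

lemma antiderivative_bound:
  fixes g g' :: "real \<Rightarrow> real"
  assumes "\<And>s. s \<in> {a..b} \<Longrightarrow> (g has_real_derivative g' s) (at s within {a..b})" "a \<le> b"
    and T: "\<And>s. s \<in> {a..b} \<Longrightarrow> \<bar>g' s - poly T s\<bar> \<le> B"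
  shows "\<exists>U. pderiv U = T \<and> degree U \<le> Suc (degree T) \<and> (\<forall>s\<in>{a..b}. \<bar>g s - poly U s\<bar> \<le> (b - a) * B)"
proof -
  obtain q where q: "pderiv q = T" "degree q \<le> Suc (degree T)" using poly_antiderivative by blast
  define U where "U = q + [:g a - poly q a:]"
  have B: "0 \<le> B" using T[of a] assms(2) by force
  have U: "pderiv U = T" "poly U a = g a" by (simp_all add: U_def q pderiv_add pderiv_pCons)
  have dU: "degree U \<le> Suc (degree T)" unfolding U_def using q(2) by (intro degree_add_le) auto
  have "\<bar>g s - poly U s\<bar> \<le> (b - a) * B" if s: "s \<in> {a..b}" for s
  proof -
    have "norm ((g s - poly U s) - (g a - poly U a)) \<le> B * norm (s - a)"
      by (rule field_differentiable_bound[of "{a..b}" _ "\<lambda>s. g' s - poly T s"])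
        (use assms T s U in \<open>auto intro!: derivative_eq_intros simp: poly_DERIV[THEN DERIV_subset]\<close>)
    also have "\<dots> \<le> B * (b - a)" using B s by (intro mult_left_mono) auto
    finally show ?thesis using U(2) by (simp add: mult.commute)
  qed
  then show ?thesis using U dU by blast
qed

text \<open>Here \<open>g i\<close> plays the part of the derivative of order \<open>i\<close>. The
  polynomial is obtained by integrating an approximation of \<open>g 1\<close>, so that one and the
  same \<open>T\<close> serves for the value and for the derivative, as \<open>proj1'_error\<close>
  requires.\<close>

lemma taylor_poly_exists:
  fixes g :: "nat \<Rightarrow> real \<Rightarrow> real"
  assumes "\<And>i s. i < Suc m \<Longrightarrow> s \<in> {a..b} \<Longrightarrow> (g i has_real_derivative g (Suc i) s) (at s within {a..b})"
    and "\<And>s. s \<in> {a..b} \<Longrightarrow> \<bar>g (Suc m) s\<bar> \<le> B" "a \<le> b"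
  shows "\<exists>T. degree T \<le> m \<and> (\<forall>s\<in>{a..b}. \<bar>g 0 s - poly T s\<bar> \<le> (b - a) ^ Suc m * B \<and>
     \<bar>g 1 s - poly (pderiv T) s\<bar> \<le> (b - a) ^ m * B)"
  using assms
proof (induction m arbitrary: g)
  case 0
  obtain U where U: "pderiv U = 0" "\<forall>s\<in>{a..b}. \<bar>g 0 s - poly U s\<bar> \<le> (b - a) * B"
    using antiderivative_bound[of a b "g 0" "g 1" 0 B] 0 by auto
  moreover have "degree U = 0" using U(1) by (simp add: pderiv_eq_0_iff)
  ultimately show ?case using 0 by (intro exI[of _ U]) simp
next
  case (Suc m)
  have "\<exists>T. degree T \<le> m \<and> (\<forall>s\<in>{a..b}. \<bar>g (Suc 0) s - poly T s\<bar> \<le> (b - a) ^ Suc m * B \<and>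
     \<bar>g (Suc 1) s - poly (pderiv T) s\<bar> \<le> (b - a) ^ m * B)"
    by (rule Suc.IH[of "\<lambda>i. g (Suc i)"]) (use Suc.prems in auto)
  then obtain T where T: "degree T \<le> m" "\<And>s. s \<in> {a..b} \<Longrightarrow> \<bar>g 1 s - poly T s\<bar> \<le> (b - a) ^ Suc m * B"
    by auto
  obtain U where "pderiv U = T" "degree U \<le> Suc (degree T)"
    "\<forall>s\<in>{a..b}. \<bar>g 0 s - poly U s\<bar> \<le> (b - a) * ((b - a) ^ Suc m * B)"
    using antiderivative_bound[of a b "g 0" "g 1" T "(b - a) ^ Suc m * B"] Suc.prems T by auto
  then show ?case using T by (intro exI[of _ U]) (auto simp: mult.assoc)
qed

lemma proj1_error:
  assumes ab: "a < b" and m: "m \<le> Suc k" and x: "x \<in> {a..b}"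
    and D: "\<And>i s. i < m \<Longrightarrow> s \<in> {a..b} \<Longrightarrow> (g i has_real_derivative g (Suc i) s) (at s within {a..b})"
    and c: "continuous_on {a..b} (g 0)" and B: "\<And>s. s \<in> {a..b} \<Longrightarrow> \<bar>g m s\<bar> \<le> B"
  shows "\<bar>g 0 x - proj1 k a b (g 0) x\<bar> \<le> (1 + proj1_const k) * ((b - a) ^ m * B)"
proof -
  have "\<exists>T. degree T \<le> k \<and> (\<forall>s\<in>{a..b}. \<bar>g 0 s - poly T s\<bar> \<le> (b - a) ^ m * B)"
  proof (cases m)
    case 0
    \<comment> \<open>Order zero: the approximating polynomial is \<open>0\<close>.\<close>
    then show ?thesis using B by (intro exI[of _ 0]) auto
  next
    case (Suc l)
    then have "\<exists>T. degree T \<le> l \<and> (\<forall>s\<in>{a..b}. \<bar>g 0 s - poly T s\<bar> \<le> (b - a) ^ Suc l * B \<and>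
        \<bar>g 1 s - poly (pderiv T) s\<bar> \<le> (b - a) ^ l * B)"
      using D B ab by (intro taylor_poly_exists) auto
    then obtain T where "degree T \<le> l" "\<forall>s\<in>{a..b}. \<bar>g 0 s - poly T s\<bar> \<le> (b - a) ^ m * B"
      using Suc by auto
    then show ?thesis using Suc m by (intro exI[of _ T]) auto
  qed
  then obtain T where T: "degree T \<le> k" "\<And>s. s \<in> {a..b} \<Longrightarrow> \<bar>g 0 s - poly T s\<bar> \<le> (b - a) ^ m * B"
    by blast
  have "\<bar>proj1 k a b (\<lambda>s. g 0 s - poly T s) x\<bar> \<le> proj1_const k * ((b - a) ^ m * B)"
    using T ab x by (intro proj1_stable) (auto intro!: continuous_intros c)
  moreover have "proj1 k a b (\<lambda>s. g 0 s - poly T s) x = proj1 k a b (g 0) x - poly T x"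
    using proj1_diff[OF ab c continuous_on_poly_id] proj1_poly[OF ab T(1)] by simp
  ultimately show ?thesis
    using T(2)[OF x] unfolding distrib_right by linarith
qed

text \<open>The same argument with stability of the derivative. The order \<open>m\<close> counts
  derivatives beyond the one already taken, whence the hypothesis on \<open>g (Suc m)\<close> and
  the restriction \<open>m \<le> k\<close>.\<close>

lemma proj1'_error:
  assumes ab: "a < b" and m: "m \<le> k" and x: "x \<in> {a..b}"
    and D: "\<And>i s. i < Suc m \<Longrightarrow> s \<in> {a..b} \<Longrightarrow> (g i has_real_derivative g (Suc i) s) (at s within {a..b})"
    and B: "\<And>s. s \<in> {a..b} \<Longrightarrow> \<bar>g (Suc m) s\<bar> \<le> B"
  shows "\<bar>g 1 x - proj1' k a b (g 0) x\<bar> \<le> (1 + proj1_const k) * ((b - a) ^ m * B)"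
proof -
  have D0: "(g 0 has_real_derivative g 1 s) (at s within {a..b})" if "s \<in> {a..b}" for s
    using D[of 0 s] that by simp
  then have c: "continuous_on {a..b} (g 0)" by (intro DERIV_continuous_on)
  obtain T where T: "degree T \<le> m" "\<And>s. s \<in> {a..b} \<Longrightarrow> \<bar>g 1 s - poly (pderiv T) s\<bar> \<le> (b - a) ^ m * B"
    using taylor_poly_exists[of m a b g B] D B ab by auto
  have "\<bar>proj1' k a b (\<lambda>s. g 0 s - poly T s) x\<bar> \<le> proj1_const k * ((b - a) ^ m * B)"
    using T ab x D0
    by (intro proj1'_stable[where g' = "\<lambda>s. g 1 s - poly (pderiv T) s"])
      (auto intro!: DERIV_diff poly_DERIV[THEN DERIV_subset])
  moreover have "proj1' k a b (\<lambda>s. g 0 s - poly T s) x = proj1' k a b (g 0) x - poly (pderiv T) x"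
    using proj1'_diff[OF ab c continuous_on_poly_id] proj1'_poly[OF ab, of T k] T(1) m by simp
  ultimately show ?thesis
    using T(2)[OF x] unfolding distrib_right by linarith
qed

subsection \<open>Tensor product projection on a rectangle\<close>

text \<open>Kept as an iterated integral, with \<open>x\<close> inside, so that the projection on a
  rectangle is literally a composition of two one-dimensional ones.\<close>

definition lgd_coeff2 ::
    "nat \<Rightarrow> real \<Rightarrow> real \<Rightarrow> real \<Rightarrow> real \<Rightarrow> (real \<Rightarrow> real \<Rightarrow> real) \<Rightarrow> nat \<Rightarrow> nat \<Rightarrow> real"
  where "lgd_coeff2 k a b c d g i j =
    integral {c..d} (\<lambda>s. integral {a..b} (\<lambda>t. g t s * lgd k a b i t) * lgd k c d j s)"

definition proj2 ::
    "nat \<Rightarrow> real \<Rightarrow> real \<Rightarrow> real \<Rightarrow> real \<Rightarrow> (real \<Rightarrow> real \<Rightarrow> real) \<Rightarrow> real \<Rightarrow> real \<Rightarrow> real"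
  where "proj2 k a b c d g x y =
    (\<Sum>i\<le>k. \<Sum>j\<le>k. lgd_coeff2 k a b c d g i j * (lgd k a b i x * lgd k c d j y))"

definition proj2x ::
    "nat \<Rightarrow> real \<Rightarrow> real \<Rightarrow> real \<Rightarrow> real \<Rightarrow> (real \<Rightarrow> real \<Rightarrow> real) \<Rightarrow> real \<Rightarrow> real \<Rightarrow> real"
  where "proj2x k a b c d g x y =
    (\<Sum>i\<le>k. \<Sum>j\<le>k. lgd_coeff2 k a b c d g i j * (lgd' k a b i x * lgd k c d j y))"

definition proj2y ::
    "nat \<Rightarrow> real \<Rightarrow> real \<Rightarrow> real \<Rightarrow> real \<Rightarrow> (real \<Rightarrow> real \<Rightarrow> real) \<Rightarrow> real \<Rightarrow> real \<Rightarrow> real"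
  where "proj2y k a b c d g x y =
    (\<Sum>i\<le>k. \<Sum>j\<le>k. lgd_coeff2 k a b c d g i j * (lgd k a b i x * lgd' k c d j y))"

abbreviation continuous_rect :: "real \<Rightarrow> real \<Rightarrow> real \<Rightarrow> real \<Rightarrow> (real \<Rightarrow> real \<Rightarrow> real) \<Rightarrow> bool"
  where "continuous_rect a b c d g \<equiv> continuous_on ({a..b} \<times> {c..d}) (\<lambda>(x, y). g x y)"

lemma continuous_rect_slice1:
  "continuous_rect a b c d g \<Longrightarrow> y \<in> {c..d} \<Longrightarrow> continuous_on {a..b} (\<lambda>t. g t y)"
  by (rule continuous_on_compose2[of "{a..b} \<times> {c..d}" "\<lambda>(x, y). g x y" "{a..b}" "\<lambda>t. (t, y)", simplified])
    (auto intro!: continuous_intros)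

lemma continuous_rect_flip: "continuous_rect a b c d g \<Longrightarrow> continuous_rect c d a b (\<lambda>y x. g x y)"
  by (rule continuous_on_compose2[of "{a..b} \<times> {c..d}" "\<lambda>(x, y). g x y" _ prod.swap, THEN continuous_on_eq])
    (auto intro!: continuous_on_swap)

lemma continuous_rect_slice2:
  "continuous_rect a b c d g \<Longrightarrow> x \<in> {a..b} \<Longrightarrow> continuous_on {c..d} (\<lambda>t. g x t)"
  using continuous_rect_slice1[OF continuous_rect_flip] .

lemma continuous_rect_mult:
  "continuous_rect a b c d f \<Longrightarrow> continuous_rect a b c d g \<Longrightarrow> continuous_rect a b c d (\<lambda>x y. f x y * g x y)"
  by (simp add: case_prod_unfold continuous_on_mult)

lemma continuous_rect_lgd:
  assumes "a < b" "c < d"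
  shows "continuous_rect a b c d (\<lambda>x y. lgd k a b i x)" "continuous_rect a b c d (\<lambda>x y. lgd k c d j y)"
  unfolding case_prod_unfold using assms by (auto intro!: continuous_intros)

lemma lgd_coeff_continuous:
  assumes "a < b" "c < d" "continuous_rect a b c d g"
  shows "continuous_on {c..d} (\<lambda>s. integral {a..b} (\<lambda>t. g t s * lgd k a b i t))"
proof -
  have "continuous_rect c d a b (\<lambda>s t. g t s * lgd k a b i t)"
    using continuous_rect_flip[OF continuous_rect_mult[OF assms(3) continuous_rect_lgd(1)]] assms by simp
  then show ?thesis
    using integral_continuous_on_param[of "{c..d}" a b "\<lambda>s t. g t s * lgd k a b i t"] by simp
qed

lemma integral_swap_rect:
  fixes f :: "real \<Rightarrow> real \<Rightarrow> real"
  assumes "continuous_rect a b c d f"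
  shows "integral {a..b} (\<lambda>x. integral {c..d} (\<lambda>y. f x y)) = integral {c..d} (\<lambda>y. integral {a..b} (\<lambda>x. f x y))"
  using integral_swap_continuous[of a c b d f] assms by (simp add: cbox_Pair_eq)

text \<open>Interchange of the order of integration. This symmetry reduces statements about
  \<open>proj2y\<close> to those about \<open>proj2x\<close>.\<close>

lemma lgd_coeff2_flip:
  assumes "a < b" "c < d" "continuous_rect a b c d g"
  shows "lgd_coeff2 k c d a b (\<lambda>y x. g x y) j i = lgd_coeff2 k a b c d g i j"
proof -
  have "lgd_coeff2 k c d a b (\<lambda>y x. g x y) j i
      = integral {a..b} (\<lambda>t. integral {c..d} (\<lambda>s. g t s * lgd k a b i t * lgd k c d j s))"
    unfolding lgd_coeff2_def integral_mult_left[symmetric] by (simp add: mult_ac)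
  also have "\<dots> = integral {c..d} (\<lambda>s. integral {a..b} (\<lambda>t. g t s * lgd k a b i t * lgd k c d j s))"
    by (rule integral_swap_rect) (intro continuous_rect_mult continuous_rect_lgd assms)
  finally show ?thesis unfolding lgd_coeff2_def by simp
qed

lemma proj2_flip:
  assumes "a < b" "c < d" "continuous_rect a b c d g"
  shows "proj2 k c d a b (\<lambda>y x. g x y) y x = proj2 k a b c d g x y"
    and "proj2x k c d a b (\<lambda>y x. g x y) y x = proj2y k a b c d g x y"
  unfolding proj2_def proj2x_def proj2y_def lgd_coeff2_flip[OF assms]
  by (subst sum.swap, simp add: mult.commute)+

lemma proj1_sum:
  assumes "c < d" "\<And>i. i \<le> k \<Longrightarrow> continuous_on {c..d} (f i)"
  shows "proj1 k c d (\<lambda>s. \<Sum>i\<le>k. f i s * r i) y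
    = (\<Sum>i\<le>k. \<Sum>j\<le>k. integral {c..d} (\<lambda>s. f i s * lgd k c d j s) * (r i * lgd k c d j y))"
proof -
  have "integral {c..d} (\<lambda>s. (\<Sum>i\<le>k. f i s * r i) * lgd k c d j s)
      = (\<Sum>i\<le>k. integral {c..d} (\<lambda>s. f i s * lgd k c d j s) * r i)" for j
  proof -
    have "integral {c..d} (\<lambda>s. (\<Sum>i\<le>k. f i s * r i) * lgd k c d j s)
        = integral {c..d} (\<lambda>s. \<Sum>i\<le>k. f i s * lgd k c d j s * r i)"
      by (intro integral_cong) (simp add: sum_distrib_left sum_distrib_right mult_ac)
    also have "\<dots> = (\<Sum>i\<le>k. integral {c..d} (\<lambda>s. f i s * lgd k c d j s * r i))"
      using assms by (intro integral_sum integrable_on_mult_left lgd_coeff_integrable) auto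
    finally show ?thesis by simp
  qed
  then have "proj1 k c d (\<lambda>s. \<Sum>i\<le>k. f i s * r i) y
    = (\<Sum>j\<le>k. \<Sum>i\<le>k. integral {c..d} (\<lambda>s. f i s * lgd k c d j s) * (r i * lgd k c d j y))"
    unfolding proj1_def by (simp add: sum_distrib_right mult.assoc)
  then show ?thesis by (subst sum.swap)
qed

text \<open>The slices are projected in \<open>x\<close> and the result in \<open>y\<close>. The
  continuity claims allow the outer projection to be estimated by
  \<open>proj1_stable\<close>.\<close>

lemma proj2_iterated:
  assumes "a < b" "c < d" "continuous_rect a b c d g"
  shows "proj2 k a b c d g x y = proj1 k c d (\<lambda>s. proj1 k a b (\<lambda>t. g t s) x) y"
    and "proj2x k a b c d g x y = proj1 k c d (\<lambda>s. proj1' k a b (\<lambda>t. g t s) x) y"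
    and "continuous_on {c..d} (\<lambda>s. proj1 k a b (\<lambda>t. g t s) x)"
    and "continuous_on {c..d} (\<lambda>s. proj1' k a b (\<lambda>t. g t s) x)"
proof -
  note c = lgd_coeff_continuous[OF assms]
  show "proj2 k a b c d g x y = proj1 k c d (\<lambda>s. proj1 k a b (\<lambda>t. g t s) x) y"
    unfolding proj1_def[of k a b] proj1_sum[OF assms(2) c] proj2_def lgd_coeff2_def ..
  show "proj2x k a b c d g x y = proj1 k c d (\<lambda>s. proj1' k a b (\<lambda>t. g t s) x) y"
    unfolding proj1'_def proj1_sum[OF assms(2) c] proj2x_def lgd_coeff2_def ..
  show "continuous_on {c..d} (\<lambda>s. proj1 k a b (\<lambda>t. g t s) x)"
    "continuous_on {c..d} (\<lambda>s. proj1' k a b (\<lambda>t. g t s) x)"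
    unfolding proj1_def proj1'_def by (intro continuous_intros c)+
qed

section \<open>Errors of the tensor product projection\<close>

text \<open>\<open>D i j\<close> plays the role of the derivative of order \<open>i\<close> in \<open>x\<close> and \<open>j\<close> in \<open>y\<close> of \<open>D 0 0\<close>.\<close>

definition partials ::
    "nat \<Rightarrow> real \<Rightarrow> real \<Rightarrow> real \<Rightarrow> real \<Rightarrow> (nat \<Rightarrow> nat \<Rightarrow> real \<Rightarrow> real \<Rightarrow> real) \<Rightarrow> bool"
  where "partials m a b c d D \<longleftrightarrow>
    (\<forall>i j. i + j \<le> m \<longrightarrow> continuous_rect a b c d (D i j)) \<and>
    (\<forall>i j. i + j < m \<longrightarrow> (\<forall>x\<in>{a..b}. \<forall>y\<in>{c..d}.
       ((\<lambda>t. D i j t y) has_real_derivative D (Suc i) j x y) (at x within {a..b}) \<and>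
       ((\<lambda>t. D i j x t) has_real_derivative D i (Suc j) x y) (at y within {c..d})))"

lemma
  assumes "partials m a b c d D"
  shows partials_continuous: "i + j \<le> m \<Longrightarrow> continuous_rect a b c d (D i j)"
    and partials_x: "i + j < m \<Longrightarrow> x \<in> {a..b} \<Longrightarrow> y \<in> {c..d} \<Longrightarrow>
      ((\<lambda>t. D i j t y) has_real_derivative D (Suc i) j x y) (at x within {a..b})"
    and partials_y: "i + j < m \<Longrightarrow> x \<in> {a..b} \<Longrightarrow> y \<in> {c..d} \<Longrightarrow>
      ((\<lambda>t. D i j x t) has_real_derivative D i (Suc j) x y) (at y within {c..d})"
  using assms unfolding partials_def by blast+

lemma partials_flip: "partials m a b c d D \<Longrightarrow> partials m c d a b (\<lambda>j i y x. D i j x y)"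
  unfolding partials_def using continuous_rect_flip by (simp add: add.commute[of _ "_::nat"])

lemma partials_subset:
  assumes "partials m a b c d D" "{a'..b'} \<subseteq> {a..b}" "{c'..d'} \<subseteq> {c..d}"
  shows "partials m a' b' c' d' D"
  unfolding partials_def
proof (intro conjI allI impI ballI)
  fix i j assume "i + j \<le> m"
  then show "continuous_rect a' b' c' d' (D i j)"
    by (rule continuous_on_subset[OF partials_continuous[OF assms(1)] Sigma_mono[OF assms(2,3)]])
next
  fix i j x y assume *: "i + j < m" "x \<in> {a'..b'}" "y \<in> {c'..d'}"
  then have "x \<in> {a..b}" "y \<in> {c..d}" using assms(2,3) by blast+
  with * show "((\<lambda>t. D i j t y) has_real_derivative D (Suc i) j x y) (at x within {a'..b'})"
    "((\<lambda>t. D i j x t) has_real_derivative D i (Suc j) x y) (at y within {c'..d'})"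
    by (auto intro!: DERIV_subset[OF partials_x[OF assms(1)] assms(2)]
      DERIV_subset[OF partials_y[OF assms(1)] assms(3)])
qed

definition proj2_const :: "nat \<Rightarrow> real"
  where "proj2_const k = (1 + proj1_const k) * (1 + proj1_const k)"

lemma proj2_const_nonneg: "0 \<le> proj2_const k"
  unfolding proj2_const_def using proj1_const_nonneg[of k] by simp

text \<open>\<open>e1\<close> is an error in one variable, \<open>e2\<close> the image under a
  projection with stability constant \<open>C\<close> of an error in the other;
  \<open>(1 + C) * (1 + C)\<close> dominates both coefficients.\<close>

lemma proj2_error_combine:
  fixes A B C :: real
  assumes "\<bar>e1\<bar> \<le> (1 + C) * B" "\<bar>e2\<bar> \<le> C * ((1 + C) * A)" "0 \<le> A" "0 \<le> B" "0 \<le> C"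
  shows "\<bar>e1 + e2\<bar> \<le> ((1 + C) * (1 + C)) * (A + B)"
proof -
  have "(1 + C) * (1 + C) * (A + B) - ((1 + C) * B + C * ((1 + C) * A)) = (1 + C) * A + C * (1 + C) * B"
    by (simp add: algebra_simps)
  moreover have "0 \<le> (1 + C) * A" "0 \<le> C * (1 + C) * B" using assms by simp_all
  ultimately show ?thesis using assms(1,2) by linarith
qed

text \<open>The error splits as \<open>(f - P_y f) + P_y (f - P_x f)\<close>. Each summand sees
  derivatives in one variable and the width in that variable only, so the shape of the rectangle
  does not enter.\<close>

lemma proj2_error:
  assumes ab: "a < b" and cd: "c < d" and P: "partials (i + j + m) a b c d D" and m: "m \<le> Suc k"
    and Bx: "\<And>x y. x \<in> {a..b} \<Longrightarrow> y \<in> {c..d} \<Longrightarrow> \<bar>D (i + m) j x y\<bar> \<le> Bx"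
    and By: "\<And>x y. x \<in> {a..b} \<Longrightarrow> y \<in> {c..d} \<Longrightarrow> \<bar>D i (j + m) x y\<bar> \<le> By"
    and x: "x \<in> {a..b}" and y: "y \<in> {c..d}"
  shows "\<bar>D i j x y - proj2 k a b c d (D i j) x y\<bar> \<le> proj2_const k * ((b - a) ^ m * Bx + (d - c) ^ m * By)"
proof -
  have cont: "continuous_rect a b c d (D i j)" by (rule partials_continuous[OF P]) simp
  have B0: "0 \<le> Bx" "0 \<le> By" using Bx[OF x y] By[OF x y] by linarith+
  \<comment> \<open>The index \<open>j + 0\<close> makes the claim an instance of \<open>g 0\<close>
    with \<open>g l = D i (j + l)\<close>.\<close>
  have 1: "\<bar>D i (j + 0) x y - proj1 k c d (\<lambda>s. D i (j + 0) x s) y\<bar>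
      \<le> (1 + proj1_const k) * ((d - c) ^ m * By)"
    using cd m y x By partials_y[OF P] continuous_rect_slice2[OF cont x]
    by (intro proj1_error[where g = "\<lambda>l s. D i (j + l) x s"]) auto
  have 2: "\<bar>D (i + 0) j x s - proj1 k a b (\<lambda>t. D (i + 0) j t s) x\<bar>
      \<le> (1 + proj1_const k) * ((b - a) ^ m * Bx)" if s: "s \<in> {c..d}" for s
    using ab m s x Bx partials_x[OF P] continuous_rect_slice1[OF cont s]
    by (intro proj1_error[where g = "\<lambda>l t. D (i + l) j t s"]) auto
  have "\<bar>proj1 k c d (\<lambda>s. D i j x s - proj1 k a b (\<lambda>t. D i j t s) x) y\<bar>
      \<le> proj1_const k * ((1 + proj1_const k) * ((b - a) ^ m * Bx))"
    using 2 cd y by (intro proj1_stable continuous_intros continuous_rect_slice2[OF cont x]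
      proj2_iterated(3)[OF ab cd cont]) auto
  moreover have "proj1 k c d (\<lambda>s. D i j x s - proj1 k a b (\<lambda>t. D i j t s) x) y
      = proj1 k c d (\<lambda>s. D i j x s) y - proj2 k a b c d (D i j) x y"
    unfolding proj2_iterated(1)[OF ab cd cont]
    by (rule proj1_diff[OF cd continuous_rect_slice2[OF cont x] proj2_iterated(3)[OF ab cd cont]])
  ultimately show ?thesis
    using proj2_error_combine[OF 1, where A = "(b - a) ^ m * Bx"
      and ?e2.0 = "proj1 k c d (\<lambda>s. D i j x s) y - proj2 k a b c d (D i j) x y"] ab cd B0 proj1_const_nonneg[of k]
    by (simp add: proj2_const_def)
qed

text \<open>The splitting of \<open>proj2_error\<close> for the derivative in \<open>x\<close>: the
  inner error is that of \<open>proj1'\<close> applied to \<open>D i j\<close>, the outer one that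
  of \<open>proj1\<close> applied to \<open>D (Suc i) j\<close>. The order \<open>m\<close> is
  counted from \<open>D (Suc i) j\<close>.\<close>

lemma proj2x_error:
  assumes ab: "a < b" and cd: "c < d" and P: "partials (i + j + Suc m) a b c d D" and m: "m \<le> k"
    and Bx: "\<And>x y. x \<in> {a..b} \<Longrightarrow> y \<in> {c..d} \<Longrightarrow> \<bar>D (i + Suc m) j x y\<bar> \<le> Bx"
    and By: "\<And>x y. x \<in> {a..b} \<Longrightarrow> y \<in> {c..d} \<Longrightarrow> \<bar>D (Suc i) (j + m) x y\<bar> \<le> By"
    and x: "x \<in> {a..b}" and y: "y \<in> {c..d}"
  shows "\<bar>D (Suc i) j x y - proj2x k a b c d (D i j) x y\<bar>
    \<le> proj2_const k * ((b - a) ^ m * Bx + (d - c) ^ m * By)"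
proof -
  have cont: "continuous_rect a b c d (D i j)" by (rule partials_continuous[OF P]) simp
  have cont': "continuous_rect a b c d (D (Suc i) j)" by (rule partials_continuous[OF P]) simp
  have B0: "0 \<le> Bx" "0 \<le> By" using Bx[OF x y] By[OF x y] by linarith+
  have 1: "\<bar>D (Suc i) (j + 0) x y - proj1 k c d (\<lambda>s. D (Suc i) (j + 0) x s) y\<bar>
      \<le> (1 + proj1_const k) * ((d - c) ^ m * By)"
    using cd m y x By partials_y[OF P] continuous_rect_slice2[OF cont' x]
    by (intro proj1_error[where g = "\<lambda>l s. D (Suc i) (j + l) x s"]) auto
  have 2: "\<bar>D (i + 1) j x s - proj1' k a b (\<lambda>t. D (i + 0) j t s) x\<bar>
      \<le> (1 + proj1_const k) * ((b - a) ^ m * Bx)" if s: "s \<in> {c..d}" for s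
    using ab m s x Bx partials_x[OF P] continuous_rect_slice1[OF cont s]
    by (intro proj1'_error[where g = "\<lambda>l t. D (i + l) j t s"]) auto
  have "\<bar>proj1 k c d (\<lambda>s. D (Suc i) j x s - proj1' k a b (\<lambda>t. D i j t s) x) y\<bar>
      \<le> proj1_const k * ((1 + proj1_const k) * ((b - a) ^ m * Bx))"
    using 2 cd y by (intro proj1_stable continuous_intros continuous_rect_slice2[OF cont' x]
      proj2_iterated(4)[OF ab cd cont]) auto
  moreover have "proj1 k c d (\<lambda>s. D (Suc i) j x s - proj1' k a b (\<lambda>t. D i j t s) x) y
      = proj1 k c d (\<lambda>s. D (Suc i) j x s) y - proj2x k a b c d (D i j) x y"
    unfolding proj2_iterated(2)[OF ab cd cont]
    by (rule proj1_diff[OF cd continuous_rect_slice2[OF cont' x] proj2_iterated(4)[OF ab cd cont]])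
  ultimately show ?thesis
    using proj2_error_combine[OF 1, where A = "(b - a) ^ m * Bx"
      and ?e2.0 = "proj1 k c d (\<lambda>s. D (Suc i) j x s) y - proj2x k a b c d (D i j) x y"] ab cd B0 proj1_const_nonneg[of k]
    by (simp add: proj2_const_def)
qed

lemma proj2y_error:
  assumes ab: "a < b" and cd: "c < d" and P: "partials (i + j + Suc m) a b c d D" and m: "m \<le> k"
    and Bx: "\<And>x y. x \<in> {a..b} \<Longrightarrow> y \<in> {c..d} \<Longrightarrow> \<bar>D (i + m) (Suc j) x y\<bar> \<le> Bx"
    and By: "\<And>x y. x \<in> {a..b} \<Longrightarrow> y \<in> {c..d} \<Longrightarrow> \<bar>D i (j + Suc m) x y\<bar> \<le> By"
    and x: "x \<in> {a..b}" and y: "y \<in> {c..d}"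
  shows "\<bar>D i (Suc j) x y - proj2y k a b c d (D i j) x y\<bar>
    \<le> proj2_const k * ((b - a) ^ m * Bx + (d - c) ^ m * By)"
proof -
  have "\<bar>(\<lambda>j i y x. D i j x y) (Suc j) i y x - proj2x k c d a b ((\<lambda>j i y x. D i j x y) j i) y x\<bar>
    \<le> proj2_const k * ((d - c) ^ m * By + (b - a) ^ m * Bx)"
    using partials_flip[OF P] assms
    by (intro proj2x_error) (auto simp: add.commute add.left_commute)
  moreover have "continuous_rect a b c d (D i j)" by (rule partials_continuous[OF P]) simp
  ultimately show ?thesis using proj2_flip(2)[OF ab cd] by (simp add: add.commute)
qed

subsection \<open>Partial derivatives on the closed unit square\<close>

lemma real_derivative_unique_Icc:
  fixes f :: "real \<Rightarrow> real"
  assumes "(f has_real_derivative d) (at x within {a..b})" "(f has_real_derivative d') (at x within {a..b})"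
    "a < b" "x \<in> {a..b}"
  shows "d = d'"
  using vector_derivative_within_closed_interval[OF assms(3,4), of f d]
    vector_derivative_within_closed_interval[OF assms(3,4), of f d'] assms(1,2)
  by (simp add: has_real_derivative_iff_has_vector_derivative)

lemma real_derivative_transform:
  assumes "(f has_real_derivative d) (at x within S)" "x \<in> S" "\<And>t. t \<in> S \<Longrightarrow> g t = f t"
  shows "(g has_real_derivative d) (at x within S)"
  using assms unfolding has_field_derivative_def by - (rule has_derivative_transform[where f = f])

text \<open>Schwarz's theorem up to the boundary, with one-sided derivatives. Write
  \<open>f x v - f x 0\<close> as the integral of \<open>fy x\<close> and differentiate under the
  integral sign in \<open>x\<close>: then \<open>fx x v - fx x 0\<close> is the integral of
  \<open>fyx x\<close>. Differentiation in \<open>v\<close> gives the claim.\<close>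

lemma mixed_derivatives_eq:
  fixes f fx fy fxy fyx :: "real \<Rightarrow> real \<Rightarrow> real"
  assumes dx: "\<And>x y. x \<in> {0..1} \<Longrightarrow> y \<in> {0..1} \<Longrightarrow> ((\<lambda>t. f t y) has_real_derivative fx x y) (at x within {0..1})"
    and dy: "\<And>x y. x \<in> {0..1} \<Longrightarrow> y \<in> {0..1} \<Longrightarrow> ((\<lambda>t. f x t) has_real_derivative fy x y) (at y within {0..1})"
    and dxy: "\<And>x y. x \<in> {0..1} \<Longrightarrow> y \<in> {0..1} \<Longrightarrow> ((\<lambda>t. fx x t) has_real_derivative fxy x y) (at y within {0..1})"
    and dyx: "\<And>x y. x \<in> {0..1} \<Longrightarrow> y \<in> {0..1} \<Longrightarrow> ((\<lambda>t. fy t y) has_real_derivative fyx x y) (at x within {0..1})"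
    and c: "continuous_rect 0 1 0 1 fy" "continuous_rect 0 1 0 1 fxy" "continuous_rect 0 1 0 1 fyx"
    and x: "x \<in> {0..1}" and y: "y \<in> {0..1}"
  shows "fxy x y = fyx x y"
proof -
  have ftc: "((\<lambda>t. g' t) has_integral g v - g 0) {0..v}"
    if g: "\<And>t. t \<in> {0..1} \<Longrightarrow> (g has_real_derivative g' t) (at t within {0..1})" and v: "v \<in> {0..1}"
    for g g' :: "real \<Rightarrow> real" and v
  proof (rule fundamental_theorem_of_calculus)
    fix t assume "t \<in> {0..v}"
    then have "(g has_real_derivative g' t) (at t within {0..v})"
      using v by (intro DERIV_subset[OF g]) auto
    then show "(g has_vector_derivative g' t) (at t within {0..v})"
      unfolding has_real_derivative_iff_has_vector_derivative .
  qed (use v in auto)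
  have eq: "integral {0..v} (\<lambda>t. fyx x t) = fx x v - fx x 0" if v: "v \<in> {0..1}" for v
  proof -
    have "((\<lambda>z. integral (cbox 0 v) (\<lambda>t. fy z t)) has_real_derivative integral (cbox 0 v) (\<lambda>t. fyx x t))
        (at x within {0..1})"
    proof (rule leibniz_rule_field_derivative[where fx = fyx])
      show "((\<lambda>z. fy z t) has_real_derivative fyx z t) (at z within {0..1})"
        if "z \<in> {0..1}" "t \<in> cbox 0 v" for z t using that v by (intro dyx) auto
      show "fy z integrable_on cbox 0 v" if "z \<in> {0..1}" for z
        using v unfolding cbox_interval
        by (intro integrable_continuous_real continuous_on_subset[OF continuous_rect_slice2[OF c(1) that]]) auto
      show "continuous_on ({0..1} \<times> cbox 0 v) (\<lambda>(x, t). fyx x t)"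
        using v by (intro continuous_on_subset[OF c(3)]) auto
    qed (use x in auto)
    then have "((\<lambda>z. f z v - f z 0) has_real_derivative integral (cbox 0 v) (\<lambda>t. fyx x t)) (at x within {0..1})"
    proof (rule real_derivative_transform)
      show "f z v - f z 0 = integral (cbox 0 v) (\<lambda>t. fy z t)" if "z \<in> {0..1}" for z
        using integral_unique[OF ftc[of "f z" "fy z", OF dy[OF that] v]] by simp
    qed (rule x)
    moreover have "((\<lambda>z. f z v - f z 0) has_real_derivative fx x v - fx x 0) (at x within {0..1})"
      using x v by (intro DERIV_diff dx) auto
    ultimately have "integral (cbox 0 v) (\<lambda>t. fyx x t) = fx x v - fx x 0"
      by (rule real_derivative_unique_Icc) (use x in auto)
    then show ?thesis by simp
  qed
  have "((\<lambda>v. fx x v - fx x 0) has_real_derivative fyx x y) (at y within {0..1})"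
    by (rule real_derivative_transform[OF integral_has_real_derivative[OF continuous_rect_slice2[OF c(3) x] y] y])
      (rule eq[symmetric])
  moreover have "((\<lambda>v. fx x v - fx x 0) has_real_derivative fxy x y) (at y within {0..1})"
    using DERIV_diff[OF dxy[OF x y] DERIV_const[of "fx x 0"]] by simp
  ultimately show ?thesis by (rule real_derivative_unique_Icc[symmetric]) (use y in auto)
qed

lemma slice_Omega_bar:
  assumes "(x, y) \<in> Omega_bar"
  shows "{t. (t, y) \<in> Omega_bar} = {0..1}" "{t. (x, t) \<in> Omega_bar} = {0..1}"
  using assms by auto

lemma dx_Omega_bar_eq:
  assumes "(x, y) \<in> Omega_bar" "((\<lambda>t. u (t, y)) has_real_derivative d) (at x within {0..1})"
  shows "dx Omega_bar u (x, y) = d"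
  unfolding dx_def fst_conv snd_conv slice_Omega_bar[OF assms(1)]
  by (rule vector_derivative_within_closed_interval)
    (use assms in \<open>auto simp: has_real_derivative_iff_has_vector_derivative\<close>)

lemma dy_Omega_bar_eq:
  assumes "(x, y) \<in> Omega_bar" "((\<lambda>t. u (x, t)) has_real_derivative d) (at y within {0..1})"
  shows "dy Omega_bar u (x, y) = d"
  unfolding dy_def fst_conv snd_conv slice_Omega_bar[OF assms(1)]
  by (rule vector_derivative_within_closed_interval)
    (use assms in \<open>auto simp: has_real_derivative_iff_has_vector_derivative\<close>)

lemma C_on_continuous: "C_on m A u \<Longrightarrow> continuous_on A u"
  by (cases m) auto

lemma C_on_dx: "C_on (Suc m) A u \<Longrightarrow> C_on m A (dx A u)"
  and C_on_dy: "C_on (Suc m) A u \<Longrightarrow> C_on m A (dy A u)"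
  by (simp_all only: C_on.simps(2))

lemma C_on_Suc: "C_on (Suc m) A u \<Longrightarrow> C_on m A u"
proof (induction m arbitrary: u)
  case (Suc m)
  then show ?case
    unfolding C_on.simps(2)[of "Suc m"] C_on.simps(2)[of m A u] by blast
qed simp

lemma C_on_le: "C_on n A u \<Longrightarrow> m \<le> n \<Longrightarrow> C_on m A u"
proof (induction n)
  case (Suc n)
  then show ?case using C_on_Suc by (cases "m = Suc n") (auto simp del: C_on.simps)
qed simp

lemma C_on_has_dx:
  assumes "C_on (Suc m) Omega_bar u" "x \<in> {0..1}" "y \<in> {0..1}"
  shows "((\<lambda>t. u (t, y)) has_real_derivative dx Omega_bar u (x, y)) (at x within {0..1})"
proof -
  have p: "(x, y) \<in> Omega_bar" using assms by auto
  have "(\<lambda>t. u (t, y)) differentiable (at x within {t. (t, y) \<in> Omega_bar})"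
    using assms(1) p unfolding C_on.simps by fast
  then show ?thesis
    unfolding has_real_derivative_iff_has_vector_derivative vector_derivative_works dx_def
    unfolding fst_conv snd_conv slice_Omega_bar[OF p] .
qed

lemma C_on_has_dy:
  assumes "C_on (Suc m) Omega_bar u" "x \<in> {0..1}" "y \<in> {0..1}"
  shows "((\<lambda>t. u (x, t)) has_real_derivative dy Omega_bar u (x, y)) (at y within {0..1})"
proof -
  have p: "(x, y) \<in> Omega_bar" using assms by auto
  have "(\<lambda>t. u (x, t)) differentiable (at y within {t. (x, t) \<in> Omega_bar})"
    using assms(1) p unfolding C_on.simps by fast
  then show ?thesis
    unfolding has_real_derivative_iff_has_vector_derivative vector_derivative_works dy_def
    unfolding fst_conv snd_conv slice_Omega_bar[OF p] .
qed

lemma dx_cong: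
  assumes "\<And>p. p \<in> A \<Longrightarrow> u p = v p" "p \<in> A"
  shows "dx A u p = dx A v p"
proof -
  have "((\<lambda>t. u (t, snd p)) has_vector_derivative d) (at (fst p) within {t. (t, snd p) \<in> A}) \<longleftrightarrow>
      ((\<lambda>t. v (t, snd p)) has_vector_derivative d) (at (fst p) within {t. (t, snd p) \<in> A})" for d
    using assms
    by (intro iffI; elim has_vector_derivative_transform[rotated -1]) auto
  then show ?thesis unfolding dx_def vector_derivative_def by simp
qed

lemma C_on_mixed:
  assumes "C_on (Suc (Suc m)) Omega_bar u" "p \<in> Omega_bar"
  shows "dy Omega_bar (dx Omega_bar u) p = dx Omega_bar (dy Omega_bar u) p"
proof -
  obtain x y where p: "p = (x, y)" "x \<in> {0..1}" "y \<in> {0..1}" using assms(2) by auto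
  have c: "C_on (Suc m) Omega_bar (dx Omega_bar u)" "C_on (Suc m) Omega_bar (dy Omega_bar u)"
    using C_on_dx[OF assms(1)] C_on_dy[OF assms(1)] by blast+
  have "continuous_on Omega_bar (dy Omega_bar u)" "continuous_on Omega_bar (dy Omega_bar (dx Omega_bar u))"
    "continuous_on Omega_bar (dx Omega_bar (dy Omega_bar u))"
    using C_on_continuous[OF c(2)] C_on_continuous[OF C_on_dy[OF c(1)]] C_on_continuous[OF C_on_dx[OF c(2)]]
    by blast+
  then show ?thesis
    unfolding p using p(2,3)
    by (intro mixed_derivatives_eq[where f = "\<lambda>x y. u (x, y)" and fx = "\<lambda>x y. dx Omega_bar u (x, y)"
      and fy = "\<lambda>x y. dy Omega_bar u (x, y)" and fxy = "\<lambda>x y. dy Omega_bar (dx Omega_bar u) (x, y)"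
      and fyx = "\<lambda>x y. dx Omega_bar (dy Omega_bar u) (x, y)"]
      C_on_has_dx[OF assms(1)] C_on_has_dy[OF assms(1)] C_on_has_dx[OF c(2)] C_on_has_dy[OF c(1)]) auto
qed

lemma C_on_dx_pow: "C_on (i + m) A u \<Longrightarrow> C_on m A ((dx A ^^ i) u)"
proof (induction i arbitrary: m)
  case (Suc i)
  then have "C_on (Suc m) A ((dx A ^^ i) u)" by (simp del: C_on.simps)
  then show ?case using C_on_dx by (simp del: C_on.simps)
qed simp

lemma C_on_dy_pow: "C_on (i + m) A u \<Longrightarrow> C_on m A ((dy A ^^ i) u)"
proof (induction i arbitrary: m)
  case (Suc i)
  then have "C_on (Suc m) A ((dy A ^^ i) u)" by (simp del: C_on.simps)
  then show ?case using C_on_dy by (simp del: C_on.simps)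
qed simp

text \<open>In \<open>partial\<close> every \<open>dy\<close> is applied before every
  \<open>dx\<close>, so raising the order in \<open>y\<close> means moving one \<open>dy\<close>
  past \<open>i\<close> factors \<open>dx\<close>, one application of Schwarz's theorem for
  each.\<close>

lemma dy_dx_pow:
  assumes "C_on (Suc i) Omega_bar u" "p \<in> Omega_bar"
  shows "dy Omega_bar ((dx Omega_bar ^^ i) u) p = (dx Omega_bar ^^ i) (dy Omega_bar u) p"
  using assms
proof (induction i arbitrary: p)
  case (Suc i)
  have "C_on 2 Omega_bar ((dx Omega_bar ^^ i) u)"
    using Suc.prems(1) by (intro C_on_dx_pow) (simp add: numeral_2_eq_2 del: C_on.simps)
  then have "dy Omega_bar ((dx Omega_bar ^^ Suc i) u) p = dx Omega_bar (dy Omega_bar ((dx Omega_bar ^^ i) u)) p"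
    using C_on_mixed[of 0 "(dx Omega_bar ^^ i) u" p] Suc.prems(2) by (simp add: numeral_2_eq_2 del: C_on.simps)
  also have "\<dots> = dx Omega_bar ((dx Omega_bar ^^ i) (dy Omega_bar u)) p"
    by (rule dx_cong) (use Suc.IH C_on_Suc[OF Suc.prems(1)] Suc.prems(2) in \<open>auto simp del: C_on.simps\<close>)
  finally show ?case by simp
qed simp

lemma C_on_partials:
  assumes "C_on m Omega_bar u"
  shows "partials m 0 1 0 1 (\<lambda>i j x y. partial Omega_bar i j u (x, y))"
proof -
  have c: "C_on (m - (i + j)) Omega_bar (partial Omega_bar i j u)" if "i + j \<le> m" for i j
    unfolding partial_def using that assms by (intro C_on_dx_pow C_on_dy_pow) simp
  show ?thesis
    unfolding partials_def
  proof (intro conjI allI impI ballI)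
    fix i j assume "i + j \<le> m"
    then show "continuous_rect 0 1 0 1 (\<lambda>x y. partial Omega_bar i j u (x, y))"
      using C_on_continuous[OF c] by (simp add: case_prod_unfold)
  next
    fix i j and x y :: real
    assume ij: "i + j < m" and xy: "x \<in> {0..1}" "y \<in> {0..1}"
    then have c1: "C_on (Suc (m - Suc (i + j))) Omega_bar (partial Omega_bar i j u)"
      using c[of i j] by (simp add: Suc_diff_Suc del: C_on.simps)
    show "((\<lambda>t. partial Omega_bar i j u (t, y)) has_real_derivative partial Omega_bar (Suc i) j u (x, y))
        (at x within {0..1})"
      using C_on_has_dx[OF c1 xy] by (simp add: partial_def)
    have "C_on (Suc i) Omega_bar ((dy Omega_bar ^^ j) u)"
      using ij by (intro C_on_dy_pow C_on_le[OF assms]) simp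
    then have "dy Omega_bar (partial Omega_bar i j u) (x, y) = partial Omega_bar i (Suc j) u (x, y)"
      using dy_dx_pow[of i "(dy Omega_bar ^^ j) u" "(x, y)"] xy by (simp add: partial_def del: C_on.simps)
    then show "((\<lambda>t. partial Omega_bar i j u (x, t)) has_real_derivative partial Omega_bar i (Suc j) u (x, y))
        (at y within {0..1})"
      using C_on_has_dy[OF c1 xy] by simp
  qed
qed

lemma
  assumes "partials m 0 1 0 1 D" "\<forall>x y. (x, y) \<in> Omega_bar \<longrightarrow> v (x, y) = D i j x y" "i + j < m"
    "(x, y) \<in> Omega_bar"
  shows dx_of_partials: "dx Omega_bar v (x, y) = D (Suc i) j x y"
    and dy_of_partials: "dy Omega_bar v (x, y) = D i (Suc j) x y"
proof -
  have "((\<lambda>t. v (t, y)) has_real_derivative D (Suc i) j x y) (at x within {0..1})"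
    using assms(2,4) by (intro real_derivative_transform[OF partials_x[OF assms(1,3)]]) auto
  then show "dx Omega_bar v (x, y) = D (Suc i) j x y" by (rule dx_Omega_bar_eq[OF assms(4)])
  have "((\<lambda>t. v (x, t)) has_real_derivative D i (Suc j) x y) (at y within {0..1})"
    using assms(2,4) by (intro real_derivative_transform[OF partials_y[OF assms(1,3)]]) auto
  then show "dy Omega_bar v (x, y) = D i (Suc j) x y" by (rule dy_Omega_bar_eq[OF assms(4)])
qed

subsection \<open>Integrals of continuous functions over cells and edges\<close>

lemma rect_eq_cbox: "{a..b} \<times> {c..d} = cbox (a, c) (b, d)" for a b c d :: real
  by (simp add: cbox_Pair_eq)

lemma inner_L2_eq_integral:
  fixes f g :: "point \<Rightarrow> 'a::real_inner"
  assumes "continuous_on ({a..b} \<times> {c..d}) f" "continuous_on ({a..b} \<times> {c..d}) g"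
  shows "inner_L2 ({a..b} \<times> {c..d}) f g = integral ({a..b} \<times> {c..d}) (\<lambda>p. f p \<bullet> g p)"
  unfolding inner_L2_def using assms
  by (intro set_lebesgue_integral_eq_integral(2))
    (simp only: rect_eq_cbox, intro absolutely_integrable_continuous continuous_on_inner)

lemma lebesgue_integral_eq_integral_Icc:
  fixes f :: "real \<Rightarrow> real"
  assumes "continuous_on {a..b} f"
  shows "(LINT t:{a..b}|lebesgue. f t) = integral {a..b} f"
  by (intro set_lebesgue_integral_eq_integral(2) absolutely_integrable_continuous_real assms)

lemma integrable_rect:
  fixes f :: "point \<Rightarrow> real"
  shows "continuous_on ({a..b} \<times> {c..d}) f \<Longrightarrow> f integrable_on {a..b} \<times> {c..d}"
  unfolding rect_eq_cbox by (rule integrable_continuous)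

lemma integral_rect_iterated:
  fixes f :: "point \<Rightarrow> real"
  assumes "continuous_on ({a..b} \<times> {c..d}) f"
  shows "integral ({a..b} \<times> {c..d}) f = integral {c..d} (\<lambda>y. integral {a..b} (\<lambda>x. f (x, y)))"
    and "integral ({a..b} \<times> {c..d}) f = integral {a..b} (\<lambda>x. integral {c..d} (\<lambda>y. f (x, y)))"
proof -
  show 1: "integral ({a..b} \<times> {c..d}) f = integral {a..b} (\<lambda>x. integral {c..d} (\<lambda>y. f (x, y)))"
    using integral_prod_continuous[of a c b d f] assms by (simp add: rect_eq_cbox[symmetric])
  show "integral ({a..b} \<times> {c..d}) f = integral {c..d} (\<lambda>y. integral {a..b} (\<lambda>x. f (x, y)))"
    unfolding 1 using assms by (intro integral_swap_rect) (simp add: case_prod_unfold)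
qed

subsection \<open>Polynomial spaces\<close>

lemma Qk_add: "\<phi> \<in> Qk k \<Longrightarrow> \<psi> \<in> Qk k \<Longrightarrow> (\<lambda>p. \<phi> p + \<psi> p) \<in> Qk k"
proof -
  assume "\<phi> \<in> Qk k" "\<psi> \<in> Qk k"
  then obtain c d where "\<forall>x y. \<phi> (x, y) = (\<Sum>i\<le>k. \<Sum>j\<le>k. c i j * x ^ i * y ^ j)"
    "\<forall>x y. \<psi> (x, y) = (\<Sum>i\<le>k. \<Sum>j\<le>k. d i j * x ^ i * y ^ j)"
    unfolding Qk_def by blast
  then have "\<forall>x y. \<phi> (x, y) + \<psi> (x, y) = (\<Sum>i\<le>k. \<Sum>j\<le>k. (c i j + d i j) * x ^ i * y ^ j)"
    by (simp add: sum.distrib distrib_right)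
  then show ?thesis unfolding Qk_def by (intro CollectI exI[of _ "\<lambda>i j. c i j + d i j"])
qed

lemma Qk_scale: "\<phi> \<in> Qk k \<Longrightarrow> (\<lambda>p. r * \<phi> p) \<in> Qk k"
proof -
  assume "\<phi> \<in> Qk k"
  then obtain c where "\<forall>x y. \<phi> (x, y) = (\<Sum>i\<le>k. \<Sum>j\<le>k. c i j * x ^ i * y ^ j)"
    unfolding Qk_def by blast
  then have "\<forall>x y. r * \<phi> (x, y) = (\<Sum>i\<le>k. \<Sum>j\<le>k. (r * c i j) * x ^ i * y ^ j)"
    by (simp add: sum_distrib_left mult.assoc)
  then show ?thesis unfolding Qk_def by (intro CollectI exI[of _ "\<lambda>i j. r * c i j"])
qed

lemma Qk_0: "(\<lambda>p. 0) \<in> Qk k"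
  unfolding Qk_def by (intro CollectI exI[of _ "\<lambda>i j. 0"]) simp

lemma Qk_sum: "(\<And>i. i \<in> I \<Longrightarrow> \<phi> i \<in> Qk k) \<Longrightarrow> (\<lambda>p. \<Sum>i\<in>I. \<phi> i p) \<in> Qk k"
  by (induction I rule: infinite_finite_induct) (simp_all add: Qk_0 Qk_add)

lemma Qk_poly_prod:
  assumes "degree p \<le> k" "degree q \<le> k"
  shows "(\<lambda>z. poly p (fst z) * poly q (snd z)) \<in> Qk k"
proof -
  have "poly r t = (\<Sum>i\<le>k. coeff r i * t ^ i)" if "degree r \<le> k" for r :: "real poly" and t
    unfolding poly_altdef using that by (intro sum.mono_neutral_left) (auto simp: coeff_eq_0)
  then have "poly p x * poly q y = (\<Sum>i\<le>k. \<Sum>j\<le>k. coeff p i * coeff q j * x ^ i * y ^ j)" for x y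
    using assms by (simp add: sum_product mult_ac)
  then show ?thesis unfolding Qk_def by (intro CollectI exI[of _ "\<lambda>i j. coeff p i * coeff q j"]) simp
qed

lemma Qk_slice:
  assumes "\<phi> \<in> Qk k"
  shows "(\<lambda>t. \<phi> (t, y)) \<in> Pk k" "(\<lambda>t. \<phi> (x, t)) \<in> Pk k"
proof -
  obtain c where c: "\<And>x y. \<phi> (x, y) = (\<Sum>i\<le>k. \<Sum>j\<le>k. c i j * x ^ i * y ^ j)"
    using assms unfolding Qk_def by blast
  have deg: "degree (\<Sum>i\<le>k. monom (r i) i) \<le> k" for r :: "nat \<Rightarrow> real"
    by (intro degree_sum_le) (auto intro: order.trans[OF degree_monom_le])
  have e1: "\<phi> (t, y) = poly (\<Sum>i\<le>k. monom (\<Sum>j\<le>k. c i j * y ^ j) i) t" for t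
  proof -
    have "\<phi> (t, y) = (\<Sum>i\<le>k. (\<Sum>j\<le>k. c i j * y ^ j) * t ^ i)"
      unfolding c sum_distrib_right by (intro sum.cong refl) simp
    then show ?thesis by (simp add: poly_sum poly_monom)
  qed
  show "(\<lambda>t. \<phi> (t, y)) \<in> Pk k" unfolding Pk_def by (intro CollectI exI conjI ext) (rule deg, rule e1)
  have e2: "\<phi> (x, t) = poly (\<Sum>j\<le>k. monom (\<Sum>i\<le>k. c i j * x ^ i) j) t" for t
  proof -
    have "\<phi> (x, t) = (\<Sum>j\<le>k. \<Sum>i\<le>k. c i j * x ^ i * t ^ j)"
      unfolding c by (rule sum.swap)
    then show ?thesis by (simp add: poly_sum poly_monom sum_distrib_right)
  qed
  show "(\<lambda>t. \<phi> (x, t)) \<in> Pk k" unfolding Pk_def by (intro CollectI exI conjI ext) (rule deg, rule e2)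
qed

lemma Qk_edge: "\<phi> \<in> Qk k \<Longrightarrow> (\<lambda>t. \<phi> (edge_point X e t)) \<in> Pk k"
  by (cases e) (simp_all add: Qk_slice)

lemma Qk_continuous: "\<phi> \<in> Qk k \<Longrightarrow> continuous_on S \<phi>"
proof -
  assume "\<phi> \<in> Qk k"
  then obtain c where "\<And>x y. \<phi> (x, y) = (\<Sum>i\<le>k. \<Sum>j\<le>k. c i j * x ^ i * y ^ j)"
    unfolding Qk_def by blast
  then have "\<phi> = (\<lambda>p. \<Sum>i\<le>k. \<Sum>j\<le>k. c i j * fst p ^ i * snd p ^ j)" by auto
  then show ?thesis by (simp only:) (intro continuous_intros)
qed

lemma Pk_continuous: "r \<in> Pk k \<Longrightarrow> continuous_on S r"
  unfolding Pk_def using continuous_on_poly_id by blast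

lemma Pk_minus: "r \<in> Pk k \<Longrightarrow> s \<in> Pk k \<Longrightarrow> (\<lambda>t. r t - s t) \<in> Pk k"
proof -
  assume "r \<in> Pk k" "s \<in> Pk k"
  then obtain p q where "degree p \<le> k" "degree q \<le> k" "r = poly p" "s = poly q"
    unfolding Pk_def by blast
  then show ?thesis
    unfolding Pk_def by (intro CollectI exI[of _ "p - q"]) (auto intro: degree_diff_le)
qed

lemma Qk_minus: "\<phi> \<in> Qk k \<Longrightarrow> \<psi> \<in> Qk k \<Longrightarrow> (\<lambda>p. \<phi> p - \<psi> p) \<in> Qk k"
  using Qk_add[OF _ Qk_scale[of \<psi> k "-1"], of \<phi>] by simp

section \<open>Differentiation inside \<open>Qk\<close>\<close>

lemma dx_UNIV_eq: "((\<lambda>t. u (t, y)) has_real_derivative d) (at x) \<Longrightarrow> dx UNIV u (x, y) = d"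
  unfolding dx_def has_real_derivative_iff_has_vector_derivative by (simp add: vector_derivative_at)

lemma dy_UNIV_eq: "((\<lambda>t. u (x, t)) has_real_derivative d) (at y) \<Longrightarrow> dy UNIV u (x, y) = d"
  unfolding dy_def has_real_derivative_iff_has_vector_derivative by (simp add: vector_derivative_at)

lemma Qk_monom: "i \<le> k \<Longrightarrow> j \<le> k \<Longrightarrow> (\<lambda>p. fst p ^ i * snd p ^ j) \<in> Qk k"
  using Qk_poly_prod[of "monom 1 i" k "monom 1 j"] by (simp add: poly_monom degree_monom_eq)

lemma
  assumes "\<phi> \<in> Qk k"
  shows Qk_dx: "dx UNIV \<phi> \<in> Qk k"
    and Qk_has_dx: "((\<lambda>t. \<phi> (t, y)) has_real_derivative dx UNIV \<phi> (x, y)) (at x within S)"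
proof -
  obtain c where c: "\<And>x y. \<phi> (x, y) = (\<Sum>i\<le>k. \<Sum>j\<le>k. c i j * x ^ i * y ^ j)"
    using assms unfolding Qk_def by blast
  \<comment> \<open>For \<open>i = 0\<close> the truncated exponent \<open>i - 1\<close> is again
    \<open>0\<close>, and the factor \<open>real i\<close> removes the term.\<close>
  have d: "((\<lambda>t. \<phi> (t, y)) has_real_derivative (\<Sum>i\<le>k. \<Sum>j\<le>k. (c i j * real i) * (x ^ (i - 1) * y ^ j)))
      (at x within S)" for x y S
    unfolding c by (auto intro!: derivative_eq_intros sum.cong)
  have eq: "dx UNIV \<phi> (x, y) = (\<Sum>i\<le>k. \<Sum>j\<le>k. (c i j * real i) * (x ^ (i - 1) * y ^ j))" for x y
    using dx_UNIV_eq[OF d] .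
  have "(\<lambda>p. \<Sum>i\<le>k. \<Sum>j\<le>k. (c i j * real i) * (fst p ^ (i - 1) * snd p ^ j)) \<in> Qk k"
    by (intro Qk_sum Qk_scale Qk_monom) auto
  moreover have "dx UNIV \<phi> = (\<lambda>p. \<Sum>i\<le>k. \<Sum>j\<le>k. (c i j * real i) * (fst p ^ (i - 1) * snd p ^ j))"
    using eq by auto
  ultimately show "dx UNIV \<phi> \<in> Qk k" by simp
  show "((\<lambda>t. \<phi> (t, y)) has_real_derivative dx UNIV \<phi> (x, y)) (at x within S)"
    unfolding eq by (rule d)
qed

lemma
  assumes "\<phi> \<in> Qk k"
  shows Qk_dy: "dy UNIV \<phi> \<in> Qk k"
    and Qk_has_dy: "((\<lambda>t. \<phi> (x, t)) has_real_derivative dy UNIV \<phi> (x, y)) (at y within S)"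
proof -
  obtain c where c: "\<And>x y. \<phi> (x, y) = (\<Sum>i\<le>k. \<Sum>j\<le>k. c i j * x ^ i * y ^ j)"
    using assms unfolding Qk_def by blast
  have d: "((\<lambda>t. \<phi> (x, t)) has_real_derivative (\<Sum>i\<le>k. \<Sum>j\<le>k. (c i j * real j) * (x ^ i * y ^ (j - 1))))
      (at y within S)" for x y S
    unfolding c by (auto intro!: derivative_eq_intros sum.cong)
  have eq: "dy UNIV \<phi> (x, y) = (\<Sum>i\<le>k. \<Sum>j\<le>k. (c i j * real j) * (x ^ i * y ^ (j - 1)))" for x y
    using dy_UNIV_eq[OF d] .
  have "(\<lambda>p. \<Sum>i\<le>k. \<Sum>j\<le>k. (c i j * real j) * (fst p ^ i * snd p ^ (j - 1))) \<in> Qk k"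
    by (intro Qk_sum Qk_scale Qk_monom) auto
  moreover have "dy UNIV \<phi> = (\<lambda>p. \<Sum>i\<le>k. \<Sum>j\<le>k. (c i j * real j) * (fst p ^ i * snd p ^ (j - 1)))"
    using eq by auto
  ultimately show "dy UNIV \<phi> \<in> Qk k" by simp
  show "((\<lambda>t. \<phi> (x, t)) has_real_derivative dy UNIV \<phi> (x, y)) (at y within S)"
    unfolding eq by (rule d)
qed

lemma
  assumes "\<phi> \<in> Qk k" "\<psi> \<in> Qk k"
  shows Qk_dx_linear: "dx UNIV (\<lambda>p. \<phi> p + r * \<psi> p) = (\<lambda>p. dx UNIV \<phi> p + r * dx UNIV \<psi> p)"
    and Qk_dy_linear: "dy UNIV (\<lambda>p. \<phi> p + r * \<psi> p) = (\<lambda>p. dy UNIV \<phi> p + r * dy UNIV \<psi> p)"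
proof -
  have "dx UNIV (\<lambda>p. \<phi> p + r * \<psi> p) (x, y) = dx UNIV \<phi> (x, y) + r * dx UNIV \<psi> (x, y)" for x y
    by (intro dx_UNIV_eq DERIV_add DERIV_cmult Qk_has_dx assms[THEN Qk_has_dx])
  then show "dx UNIV (\<lambda>p. \<phi> p + r * \<psi> p) = (\<lambda>p. dx UNIV \<phi> p + r * dx UNIV \<psi> p)" by auto
  have "dy UNIV (\<lambda>p. \<phi> p + r * \<psi> p) (x, y) = dy UNIV \<phi> (x, y) + r * dy UNIV \<psi> (x, y)" for x y
    by (intro dy_UNIV_eq DERIV_add DERIV_cmult assms[THEN Qk_has_dy])
  then show "dy UNIV (\<lambda>p. \<phi> p + r * \<psi> p) = (\<lambda>p. dy UNIV \<phi> p + r * dy UNIV \<psi> p)" by auto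
qed

subsection \<open>Orthonormal expansions and representation of functionals\<close>

definition lgd2 :: "nat \<Rightarrow> real \<Rightarrow> real \<Rightarrow> real \<Rightarrow> real \<Rightarrow> nat \<times> nat \<Rightarrow> point \<Rightarrow> real"
  where "lgd2 k a b c d ij p = lgd k a b (fst ij) (fst p) * lgd k c d (snd ij) (snd p)"

lemma lgd2_in_Qk: "ij \<in> {..k} \<times> {..k} \<Longrightarrow> lgd2 k a b c d ij \<in> Qk k"
  using Qk_poly_prod[of "lgd_poly k a b (fst ij)" k "lgd_poly k c d (snd ij)"]
  by (auto simp: lgd2_def[abs_def] poly_lgd_poly degree_lgd_poly)

lemma continuous_rect_case: "continuous_on ({a..b} \<times> {c..d}) f \<Longrightarrow> continuous_rect a b c d (\<lambda>x y. f (x, y))"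
  by (simp add: case_prod_unfold)

lemma lgd_coeff2_eq_integral:
  assumes "a < b" "c < d" "continuous_on ({a..b} \<times> {c..d}) f"
  shows "lgd_coeff2 k a b c d (\<lambda>x y. f (x, y)) i j
    = integral ({a..b} \<times> {c..d}) (\<lambda>p. f p * lgd2 k a b c d (i, j) p)"
proof -
  have "continuous_on ({a..b} \<times> {c..d}) (\<lambda>p. f p * lgd2 k a b c d (i, j) p)"
    unfolding lgd2_def using assms by (intro continuous_intros)
  then show ?thesis
    unfolding lgd_coeff2_def by (simp add: integral_rect_iterated(1) lgd2_def mult.assoc[symmetric])
qed

text \<open>Slices of \<open>\<phi>\<close> are polynomials of degree at most \<open>k\<close>, so
  both one-dimensional projections leave them fixed.\<close>

lemma Qk_expansion:
  assumes ab: "a < b" and cd: "c < d" and \<phi>: "\<phi> \<in> Qk k"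
  shows "\<phi> p = (\<Sum>ij\<in>{..k} \<times> {..k}. integral ({a..b} \<times> {c..d}) (\<lambda>p. \<phi> p * lgd2 k a b c d ij p) * lgd2 k a b c d ij p)"
proof -
  obtain x y where p: "p = (x, y)" by force
  have cont: "continuous_rect a b c d (\<lambda>x y. \<phi> (x, y))"
    by (intro continuous_rect_case Qk_continuous[OF \<phi>])
  have pk: "proj1 k a' b' r = r" if "a' < b'" "r \<in> Pk k" for a' b' r
    using that proj1_poly unfolding Pk_def by blast
  have "proj2 k a b c d (\<lambda>x y. \<phi> (x, y)) x y = \<phi> (x, y)"
    unfolding proj2_iterated(1)[OF ab cd cont] pk[OF ab Qk_slice(1)[OF \<phi>]] pk[OF cd Qk_slice(2)[OF \<phi>]] ..
  then show ?thesis
    unfolding proj2_def lgd_coeff2_eq_integral[OF ab cd Qk_continuous[OF \<phi>]] p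
    by (simp add: sum.cartesian_product case_prod_unfold lgd2_def)
qed

text \<open>Linearity is asked on \<open>Qk k\<close> only: \<open>dx UNIV\<close> and
  \<open>dy UNIV\<close>, which occur in the functionals below, are not additive on arbitrary
  functions.\<close>

definition Qk_functional :: "nat \<Rightarrow> ((point \<Rightarrow> real) \<Rightarrow> real) \<Rightarrow> bool"
  where "Qk_functional k l \<longleftrightarrow>
    (\<forall>\<phi>\<in>Qk k. \<forall>\<psi>\<in>Qk k. \<forall>r. l (\<lambda>p. \<phi> p + r * \<psi> p) = l \<phi> + r * l \<psi>)"

definition Qk_vec_functional :: "nat \<Rightarrow> ((point \<Rightarrow> point) \<Rightarrow> real) \<Rightarrow> bool"
  where "Qk_vec_functional k l \<longleftrightarrow>
    (\<forall>\<phi>\<in>Qk_vec k. \<forall>\<psi>\<in>Qk_vec k. \<forall>r. l (\<lambda>p. \<phi> p + r *\<^sub>R \<psi> p) = l \<phi> + r * l \<psi>)"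

lemma linear_functional_sum:
  assumes lin: "Qk_functional k l"
    and "finite I" "\<And>i. i \<in> I \<Longrightarrow> \<phi> i \<in> Qk k"
  shows "l (\<lambda>p. \<Sum>i\<in>I. r i * \<phi> i p) = (\<Sum>i\<in>I. r i * l (\<phi> i))"
  using assms(2,3)
proof (induction I)
  case empty
  show ?case using lin[unfolded Qk_functional_def, rule_format, OF Qk_0 Qk_0, of 1] by simp
next
  case (insert i I)
  then have "l (\<lambda>p. (\<Sum>i\<in>I. r i * \<phi> i p) + r i * \<phi> i p) = l (\<lambda>p. \<Sum>i\<in>I. r i * \<phi> i p) + r i * l (\<phi> i)"
    by (intro lin[unfolded Qk_functional_def, rule_format] Qk_sum Qk_scale) auto
  with insert show ?case by (simp add: add.commute)
qed

lemma inner_L2_Qk_left_linear: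
  fixes f :: "point \<Rightarrow> real"
  assumes "continuous_on ({a..b} \<times> {c..d}) f" "\<phi> \<in> Qk k" "\<psi> \<in> Qk k"
  shows "inner_L2 ({a..b} \<times> {c..d}) f (\<lambda>p. \<phi> p + r * \<psi> p)
    = inner_L2 ({a..b} \<times> {c..d}) f \<phi> + r * inner_L2 ({a..b} \<times> {c..d}) f \<psi>"
proof -
  note c = assms(1) Qk_continuous[OF assms(2)] Qk_continuous[OF assms(3)]
  have "inner_L2 ({a..b} \<times> {c..d}) f (\<lambda>p. \<phi> p + r * \<psi> p)
      = integral ({a..b} \<times> {c..d}) (\<lambda>p. f p * \<phi> p + r * (f p * \<psi> p))"
    by (subst inner_L2_eq_integral) (auto intro!: continuous_intros c simp: algebra_simps)
  also have "\<dots> = integral ({a..b} \<times> {c..d}) (\<lambda>p. f p * \<phi> p) + r * integral ({a..b} \<times> {c..d}) (\<lambda>p. f p * \<psi> p)"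
    by (subst integral_add) (auto intro!: integrable_rect continuous_intros c)
  finally show ?thesis by (simp add: inner_L2_eq_integral c)
qed

lemma inner_L2_functional:
  "continuous_on ({a..b} \<times> {c..d}) f \<Longrightarrow> Qk_functional k (inner_L2 ({a..b} \<times> {c..d}) f)"
  unfolding Qk_functional_def by (simp add: inner_L2_Qk_left_linear)

lemma inner_L2_commute: "inner_L2 S f g = inner_L2 S g f"
  unfolding inner_L2_def by (simp add: inner_commute)

text \<open>Riesz representation with an explicit representer: its coefficients in the orthonormal
  basis are the values of \<open>l\<close> on that basis. Existence and uniqueness together give
  meaning to the definite descriptions in the cell projection and the weak Laplacian.\<close>

lemma Qk_riesz:
  assumes ab: "a < b" and cd: "c < d"
    and lin: "Qk_functional k l"
  defines "z \<equiv> \<lambda>p. \<Sum>ij\<in>{..k} \<times> {..k}. l (lgd2 k a b c d ij) * lgd2 k a b c d ij p"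
  shows "z \<in> Qk k" "\<And>\<phi>. \<phi> \<in> Qk k \<Longrightarrow> inner_L2 ({a..b} \<times> {c..d}) z \<phi> = l \<phi>"
    and "\<And>w. w \<in> Qk k \<Longrightarrow> (\<And>\<phi>. \<phi> \<in> Qk k \<Longrightarrow> inner_L2 ({a..b} \<times> {c..d}) w \<phi> = l \<phi>) \<Longrightarrow> w = z"
proof -
  let ?R = "{a..b} \<times> {c..d}" and ?L = "lgd2 k a b c d"
  note L = lgd2_in_Qk[of _ k a b c d]
  show z: "z \<in> Qk k" unfolding z_def by (intro Qk_sum Qk_scale L)
  show "inner_L2 ?R z \<phi> = l \<phi>" if \<phi>: "\<phi> \<in> Qk k" for \<phi>
  proof -
    have c: "integral ?R (\<lambda>p. \<phi> p * ?L ij p) = inner_L2 ?R \<phi> (?L ij)" if "ij \<in> {..k} \<times> {..k}" for ij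
      using inner_L2_eq_integral[OF Qk_continuous[OF \<phi>] Qk_continuous[OF L[OF that]]] by simp
    have "\<phi> = (\<lambda>p. \<Sum>ij\<in>{..k} \<times> {..k}. inner_L2 ?R \<phi> (?L ij) * ?L ij p)"
      using Qk_expansion[OF ab cd \<phi>] by (auto simp: c)
    then have "l \<phi> = l (\<lambda>p. \<Sum>ij\<in>{..k} \<times> {..k}. inner_L2 ?R \<phi> (?L ij) * ?L ij p)" by simp
    also have "\<dots> = (\<Sum>ij\<in>{..k} \<times> {..k}. inner_L2 ?R \<phi> (?L ij) * l (?L ij))"
      by (intro linear_functional_sum[of k] lin L) auto
    also have "\<dots> = inner_L2 ?R \<phi> z"
      unfolding z_def
      by (subst linear_functional_sum[of k "inner_L2 ?R \<phi>"])
        (auto intro!: inner_L2_functional Qk_continuous[OF \<phi>] L simp: mult.commute)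
    finally show ?thesis by (simp add: inner_L2_commute)
  qed
  show "w = z" if w: "w \<in> Qk k" and wl: "\<And>\<phi>. \<phi> \<in> Qk k \<Longrightarrow> inner_L2 ?R w \<phi> = l \<phi>" for w
  proof
    fix p
    have "integral ?R (\<lambda>p. w p * ?L ij p) = l (?L ij)" if "ij \<in> {..k} \<times> {..k}" for ij
      using inner_L2_eq_integral[OF Qk_continuous[OF w] Qk_continuous[OF L[OF that]]] wl[OF L[OF that]] by simp
    then show "w p = z p" unfolding z_def using Qk_expansion[OF ab cd w, of p] by simp
  qed
qed

lemma Qk_riesz_THE:
  assumes "a < b" "c < d"
    and lin: "Qk_functional k l"
  shows "(THE z. z \<in> Qk k \<and> (\<forall>\<phi>\<in>Qk k. inner_L2 ({a..b} \<times> {c..d}) z \<phi> = l \<phi>))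
    = (\<lambda>p. \<Sum>ij\<in>{..k} \<times> {..k}. l (lgd2 k a b c d ij) * lgd2 k a b c d ij p)"
proof (rule the_equality)
  note R = Qk_riesz[of a b c d k l, OF assms(1,2) lin]
  let ?z = "\<lambda>p. \<Sum>ij\<in>{..k} \<times> {..k}. l (lgd2 k a b c d ij) * lgd2 k a b c d ij p"
  show "?z \<in> Qk k \<and> (\<forall>\<phi>\<in>Qk k. inner_L2 ({a..b} \<times> {c..d}) ?z \<phi> = l \<phi>)"
    by (intro conjI ballI R)
  show "w = ?z" if "w \<in> Qk k \<and> (\<forall>\<phi>\<in>Qk k. inner_L2 ({a..b} \<times> {c..d}) w \<phi> = l \<phi>)" for w
    by (rule R(3)) (use that in blast)+
qed

text \<open>By linearity \<open>l\<close> is the sum of a functional of the first and one of the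
  second component; each is represented separately.\<close>

lemma Qk_vec_riesz:
  assumes "a < b" "c < d"
    and lin: "Qk_vec_functional k l"
  shows "\<exists>!z. z \<in> Qk_vec k \<and> (\<forall>\<phi>\<in>Qk_vec k. inner_L2 ({a..b} \<times> {c..d}) z \<phi> = l \<phi>)"
proof -
  let ?R = "{a..b} \<times> {c..d}"
  have vec: "(\<lambda>p. (\<phi> p, \<psi> p)) \<in> Qk_vec k \<longleftrightarrow> \<phi> \<in> Qk k \<and> \<psi> \<in> Qk k" for \<phi> \<psi>
    by (simp add: Qk_vec_def)
  note vlin = lin[unfolded Qk_vec_functional_def, rule_format]
  have l1: "Qk_functional k (\<lambda>\<phi>. l (\<lambda>p. (\<phi> p, 0)))"
    unfolding Qk_functional_def
  proof (intro ballI allI)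
    fix \<phi> \<psi> r assume "\<phi> \<in> Qk k" "\<psi> \<in> Qk k"
    then show "l (\<lambda>p. (\<phi> p + r * \<psi> p, 0)) = l (\<lambda>p. (\<phi> p, 0)) + r * l (\<lambda>p. (\<psi> p, 0))"
      using vlin[of "\<lambda>p. (\<phi> p, 0)" "\<lambda>p. (\<psi> p, 0)" r] by (simp add: vec Qk_0)
  qed
  have l2: "Qk_functional k (\<lambda>\<phi>. l (\<lambda>p. (0, \<phi> p)))"
    unfolding Qk_functional_def
  proof (intro ballI allI)
    fix \<phi> \<psi> r assume "\<phi> \<in> Qk k" "\<psi> \<in> Qk k"
    then show "l (\<lambda>p. (0, \<phi> p + r * \<psi> p)) = l (\<lambda>p. (0, \<phi> p)) + r * l (\<lambda>p. (0, \<psi> p))"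
      using vlin[of "\<lambda>p. (0, \<phi> p)" "\<lambda>p. (0, \<psi> p)" r] by (simp add: vec Qk_0)
  qed
  define z1 where "z1 = (\<lambda>p. \<Sum>ij\<in>{..k} \<times> {..k}. l (\<lambda>p. (lgd2 k a b c d ij p, 0)) * lgd2 k a b c d ij p)"
  define z2 where "z2 = (\<lambda>p. \<Sum>ij\<in>{..k} \<times> {..k}. l (\<lambda>p. (0, lgd2 k a b c d ij p)) * lgd2 k a b c d ij p)"
  note z1 = Qk_riesz[of a b c d k "\<lambda>\<phi>. l (\<lambda>p. (\<phi> p, 0))", OF assms(1,2) l1, folded z1_def]
  note z2 = Qk_riesz[of a b c d k "\<lambda>\<phi>. l (\<lambda>p. (0, \<phi> p))", OF assms(1,2) l2, folded z2_def]
  have Z: "(\<lambda>p. (z1 p, z2 p)) \<in> Qk_vec k" by (simp add: vec z1 z2)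
  have fl: "(\<lambda>p. fst (\<phi> p)) \<in> Qk k" "(\<lambda>p. snd (\<phi> p)) \<in> Qk k" if "\<phi> \<in> Qk_vec k" for \<phi>
    using that by (simp_all add: Qk_vec_def)
  have ip: "inner_L2 ?R w \<phi> = inner_L2 ?R (\<lambda>p. fst (w p)) (\<lambda>p. fst (\<phi> p)) + inner_L2 ?R (\<lambda>p. snd (w p)) (\<lambda>p. snd (\<phi> p))"
    if w: "w \<in> Qk_vec k" and \<phi>: "\<phi> \<in> Qk_vec k" for w \<phi>
  proof -
    note c = fl(1)[OF w, THEN Qk_continuous] fl(2)[OF w, THEN Qk_continuous]
      fl(1)[OF \<phi>, THEN Qk_continuous] fl(2)[OF \<phi>, THEN Qk_continuous]
    have "continuous_on ?R (\<lambda>p. (fst (w p), snd (w p)))" "continuous_on ?R (\<lambda>p. (fst (\<phi> p), snd (\<phi> p)))"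
      by (rule continuous_on_Pair[OF c(1,2)], rule continuous_on_Pair[OF c(3,4)])
    then have "inner_L2 ?R w \<phi> = integral ?R (\<lambda>p. fst (w p) * fst (\<phi> p) + snd (w p) * snd (\<phi> p))"
      by (subst inner_L2_eq_integral) (simp_all add: inner_prod_def)
    also have "\<dots> = integral ?R (\<lambda>p. fst (w p) * fst (\<phi> p)) + integral ?R (\<lambda>p. snd (w p) * snd (\<phi> p))"
      by (intro integral_add integrable_rect continuous_on_mult c)
    finally show ?thesis by (simp add: inner_L2_eq_integral c)
  qed
  have "inner_L2 ?R (\<lambda>p. (z1 p, z2 p)) \<phi> = l \<phi>" if \<phi>: "\<phi> \<in> Qk_vec k" for \<phi>
  proof -
    have "l (\<lambda>p. (fst (\<phi> p), 0) + 1 *\<^sub>R (0, snd (\<phi> p)))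
        = l (\<lambda>p. (fst (\<phi> p), 0)) + 1 * l (\<lambda>p. (0, snd (\<phi> p)))"
      by (rule vlin) (simp_all add: vec Qk_0 fl[OF \<phi>])
    then show ?thesis using ip[OF Z \<phi>] z1(2)[OF fl(1)[OF \<phi>]] z2(2)[OF fl(2)[OF \<phi>]] by simp
  qed
  moreover have "w = (\<lambda>p. (z1 p, z2 p))"
    if w: "w \<in> Qk_vec k" and wl: "\<And>\<phi>. \<phi> \<in> Qk_vec k \<Longrightarrow> inner_L2 ?R w \<phi> = l \<phi>" for w
  proof -
    have n0: "inner_L2 ?R f (\<lambda>p. 0::real) = 0" for f by (simp add: inner_L2_def)
    have "(\<lambda>p. fst (w p)) = z1"
    proof (intro z1(3) fl[OF w])
      fix \<phi> assume "\<phi> \<in> Qk k"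
      then have "(\<lambda>p. (\<phi> p, 0)) \<in> Qk_vec k" by (simp add: vec Qk_0)
      from wl[OF this] ip[OF w this] show "inner_L2 ?R (\<lambda>p. fst (w p)) \<phi> = l (\<lambda>p. (\<phi> p, 0))"
        by (simp add: n0)
    qed
    moreover have "(\<lambda>p. snd (w p)) = z2"
    proof (intro z2(3) fl[OF w])
      fix \<phi> assume "\<phi> \<in> Qk k"
      then have "(\<lambda>p. (0, \<phi> p)) \<in> Qk_vec k" by (simp add: vec Qk_0)
      from wl[OF this] ip[OF w this] show "inner_L2 ?R (\<lambda>p. snd (w p)) \<phi> = l (\<lambda>p. (0, \<phi> p))"
        by (simp add: n0)
    qed
    ultimately show ?thesis by (metis prod.collapse)
  qed
  ultimately show ?thesis using Z by blast
qed

subsection \<open>Boundary integrals and integration by parts on a cell\<close>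

definition mesh :: "nat \<Rightarrow> (nat \<Rightarrow> real) \<Rightarrow> bool"
  where "mesh N X \<longleftrightarrow> X 0 = 0 \<and> X N = 1 \<and> (\<forall>i<N. X i < X (Suc i))"

lemma mesh_less: "mesh N X \<Longrightarrow> T \<in> cells N \<Longrightarrow> X (fst T) < X (Suc (fst T))"
  and mesh_less': "mesh N X \<Longrightarrow> T \<in> cells N \<Longrightarrow> X (snd T) < X (Suc (snd T))"
  by (auto simp: mesh_def cells_def)

lemma mesh_mono: "mesh N X \<Longrightarrow> i \<le> j \<Longrightarrow> j \<le> N \<Longrightarrow> X i \<le> X j"
proof (induction j)
  case (Suc j)
  then have "X j < X (Suc j)" by (simp add: mesh_def)
  with Suc show ?case by (cases "i = Suc j") auto
qed simp

lemma mesh_range: "mesh N X \<Longrightarrow> i \<le> N \<Longrightarrow> X i \<in> {0..1}"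
  using mesh_mono[of N X 0 i] mesh_mono[of N X i N] by (simp add: mesh_def)

lemma cell_intervals:
  assumes "mesh N X" "T \<in> cells N"
  shows "{X (fst T)..X (Suc (fst T))} \<subseteq> {0..1}" "{X (snd T)..X (Suc (snd T))} \<subseteq> {0..1}"
  using assms mesh_range[OF assms(1)]
  by (auto simp: cells_def dest: mesh_range intro: order.trans)

lemma cell_subset_Omega_bar: "mesh N X \<Longrightarrow> T \<in> cells N \<Longrightarrow> cell_set X T \<subseteq> Omega_bar"
  unfolding cell_set_def using cell_intervals by blast

text \<open>The gauge integral, which has the calculus for integration by parts and agrees with the
  Lebesgue form \<open>inner_L2\<close> for continuous integrands.\<close>

definition cint :: "(nat \<Rightarrow> real) \<Rightarrow> cell \<Rightarrow> (point \<Rightarrow> real) \<Rightarrow> real"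
  where "cint X T f = integral (cell_set X T) f"

lemma integrable_cell: "continuous_on (cell_set X T) f \<Longrightarrow> f integrable_on cell_set X T"
  for f :: "point \<Rightarrow> real"
  unfolding cell_set_def by (rule integrable_rect)

lemma
  assumes "continuous_on (cell_set X T) f" "continuous_on (cell_set X T) g"
  shows cint_add: "cint X T (\<lambda>p. f p + g p) = cint X T f + cint X T g"
    and cint_diff: "cint X T (\<lambda>p. f p - g p) = cint X T f - cint X T g"
  unfolding cint_def by (intro integral_add integral_diff integrable_cell assms)+

lemma inner_L2_cell:
  fixes f g :: "point \<Rightarrow> real"
  assumes "continuous_on (cell_set X T) f" "continuous_on (cell_set X T) g"
  shows "inner_L2 (cell_set X T) f g = cint X T (\<lambda>p. f p * g p)"
  using inner_L2_eq_integral assms unfolding cell_set_def cint_def by (simp add: inner_L2_eq_integral)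

lemma edge_integral_eq:
  "continuous_on (edge_range X e) f \<Longrightarrow> edge_integral X e f = integral (edge_range X e) f"
  unfolding edge_integral_def by (cases e) (simp_all add: lebesgue_integral_eq_integral_Icc)

lemma edge_integrable: "continuous_on (edge_range X e) f \<Longrightarrow> f integrable_on edge_range X e"
  for f :: "real \<Rightarrow> real"
  by (cases e) (simp_all add: integrable_continuous_real)

lemma
  assumes "continuous_on (edge_range X e) f" "continuous_on (edge_range X e) g"
  shows edge_integral_add: "edge_integral X e (\<lambda>t. f t + g t) = edge_integral X e f + edge_integral X e g"
    and edge_integral_diff: "edge_integral X e (\<lambda>t. f t - g t) = edge_integral X e f - edge_integral X e g"
    and edge_integral_mono: "(\<And>t. t \<in> edge_range X e \<Longrightarrow> f t \<le> g t) \<Longrightarrow> edge_integral X e f \<le> edge_integral X e g"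
  using assms
  by (simp_all add: edge_integral_eq continuous_on_add continuous_on_diff continuous_on_mult
      integral_add integral_diff edge_integrable integral_le)

lemma edge_integral_cmult:
  "continuous_on (edge_range X e) f \<Longrightarrow> edge_integral X e (\<lambda>t. r * f t) = r * edge_integral X e f"
  by (simp add: edge_integral_eq continuous_on_mult)

lemma boundary_integral_expand:
  "boundary_integral X T F =
    edge_integral X (Hor (fst T) (snd T)) (F (Hor (fst T) (snd T)) (0, -1)) +
    edge_integral X (Ver (Suc (fst T)) (snd T)) (F (Ver (Suc (fst T)) (snd T)) (1, 0)) +
    edge_integral X (Hor (fst T) (Suc (snd T))) (F (Hor (fst T) (Suc (snd T))) (0, 1)) +
    edge_integral X (Ver (fst T) (snd T)) (F (Ver (fst T) (snd T)) (-1, 0))"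
  unfolding boundary_integral_def cell_boundary_def case_prod_unfold by simp

text \<open>Continuity on each edge separately: normals and edge polynomials jump at the corners of
  a cell.\<close>

definition bcont :: "(nat \<Rightarrow> real) \<Rightarrow> cell \<Rightarrow> (edge \<Rightarrow> point \<Rightarrow> real \<Rightarrow> real) \<Rightarrow> bool"
  where "bcont X T F \<longleftrightarrow> (\<forall>e n. (e, n) \<in> cell_boundary T \<longrightarrow> continuous_on (edge_range X e) (F e n))"

lemma
  assumes "bcont X T F" "bcont X T G"
  shows bcont_add: "bcont X T (\<lambda>e n t. F e n t + G e n t)"
    and bcont_diff: "bcont X T (\<lambda>e n t. F e n t - G e n t)"
    and bcont_mult: "bcont X T (\<lambda>e n t. F e n t * G e n t)"
  using assms unfolding bcont_def
  by (auto intro!: continuous_on_add continuous_on_diff continuous_on_mult)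

lemma bcont_const: "bcont X T (\<lambda>e n t. c n)"
  unfolding bcont_def by auto

lemma edge_point_in_cell:
  assumes "mesh N X" "T \<in> cells N" "(e, n) \<in> cell_boundary T" "t \<in> edge_range X e"
  shows "edge_point X e t \<in> cell_set X T"
  using assms(3,4) mesh_less[OF assms(1,2)] mesh_less'[OF assms(1,2)]
  unfolding cell_boundary_def case_prod_unfold cell_set_def by auto

lemma edge_point_continuous: "continuous_on S (edge_point X e)"
  by (cases e) (auto intro!: continuous_intros)

lemma bcont_cell:
  assumes "mesh N X" "T \<in> cells N" "continuous_on (cell_set X T) g"
  shows "bcont X T (\<lambda>e n t. g (edge_point X e t))"
  unfolding bcont_def
  using continuous_on_compose2[OF assms(3) edge_point_continuous] edge_point_in_cell[OF assms(1,2)]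
  by blast

lemma boundary_integral_add:
  "bcont X T F \<Longrightarrow> bcont X T G \<Longrightarrow>
    boundary_integral X T (\<lambda>e n t. F e n t + G e n t) = boundary_integral X T F + boundary_integral X T G"
  unfolding boundary_integral_def sum.distrib[symmetric] bcont_def
  by (intro sum.cong) (auto intro!: edge_integral_add)

lemma boundary_integral_diff:
  "bcont X T F \<Longrightarrow> bcont X T G \<Longrightarrow>
    boundary_integral X T (\<lambda>e n t. F e n t - G e n t) = boundary_integral X T F - boundary_integral X T G"
  unfolding boundary_integral_def sum_subtractf[symmetric] bcont_def
  by (intro sum.cong) (auto intro!: edge_integral_diff)

lemma boundary_integral_cmult:
  "bcont X T F \<Longrightarrow> boundary_integral X T (\<lambda>e n t. r * F e n t) = r * boundary_integral X T F"
  unfolding boundary_integral_def sum_distrib_left bcont_def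
  by (intro sum.cong) (auto intro!: edge_integral_cmult)

lemma boundary_integral_mono:
  assumes "bcont X T F" "bcont X T G"
    "\<And>e n t. (e, n) \<in> cell_boundary T \<Longrightarrow> t \<in> edge_range X e \<Longrightarrow> F e n t \<le> G e n t"
  shows "boundary_integral X T F \<le> boundary_integral X T G"
  unfolding boundary_integral_def
  using assms unfolding bcont_def by (intro sum_mono) (auto intro!: edge_integral_mono)

lemma edge_integral_0: "edge_integral X e (\<lambda>t. 0) = 0"
  by (simp add: edge_integral_def)

text \<open>Derivatives are one-sided and continuous up to the cell boundary, which is what the
  fundamental theorem on closed slices takes. The form covers polynomials and the exact solution
  alike.\<close>

definition has_dx_cell :: "(nat \<Rightarrow> real) \<Rightarrow> cell \<Rightarrow> (point \<Rightarrow> real) \<Rightarrow> (point \<Rightarrow> real) \<Rightarrow> bool"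
  where "has_dx_cell X T f f' \<longleftrightarrow> continuous_on (cell_set X T) f \<and> continuous_on (cell_set X T) f' \<and>
    (\<forall>(x, y) \<in> cell_set X T. ((\<lambda>t. f (t, y)) has_real_derivative f' (x, y))
      (at x within {X (fst T)..X (Suc (fst T))}))"

definition has_dy_cell :: "(nat \<Rightarrow> real) \<Rightarrow> cell \<Rightarrow> (point \<Rightarrow> real) \<Rightarrow> (point \<Rightarrow> real) \<Rightarrow> bool"
  where "has_dy_cell X T f f' \<longleftrightarrow> continuous_on (cell_set X T) f \<and> continuous_on (cell_set X T) f' \<and>
    (\<forall>(x, y) \<in> cell_set X T. ((\<lambda>t. f (x, t)) has_real_derivative f' (x, y))
      (at y within {X (snd T)..X (Suc (snd T))}))"

lemma has_dx_cell_mult: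
  "has_dx_cell X T f f' \<Longrightarrow> has_dx_cell X T g g' \<Longrightarrow> has_dx_cell X T (\<lambda>p. f p * g p) (\<lambda>p. f' p * g p + f p * g' p)"
  unfolding has_dx_cell_def
  by (auto intro!: continuous_on_mult continuous_on_add DERIV_mult'[THEN DERIV_cong])

lemma has_dy_cell_mult:
  "has_dy_cell X T f f' \<Longrightarrow> has_dy_cell X T g g' \<Longrightarrow> has_dy_cell X T (\<lambda>p. f p * g p) (\<lambda>p. f' p * g p + f p * g' p)"
  unfolding has_dy_cell_def
  by (auto intro!: continuous_on_mult continuous_on_add DERIV_mult'[THEN DERIV_cong])

lemma Qk_has_dx_cell: "\<phi> \<in> Qk k \<Longrightarrow> has_dx_cell X T \<phi> (dx UNIV \<phi>)"
  unfolding has_dx_cell_def by (auto intro: Qk_continuous Qk_dx Qk_has_dx)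

lemma Qk_has_dy_cell: "\<phi> \<in> Qk k \<Longrightarrow> has_dy_cell X T \<phi> (dy UNIV \<phi>)"
  unfolding has_dy_cell_def by (auto intro: Qk_continuous Qk_dy Qk_has_dy)

lemma continuous_on_slice:
  fixes f :: "point \<Rightarrow> real"
  assumes "continuous_on ({a..b} \<times> {c..d}) f"
  shows "y \<in> {c..d} \<Longrightarrow> continuous_on {a..b} (\<lambda>t. f (t, y))"
    and "x \<in> {a..b} \<Longrightarrow> continuous_on {c..d} (\<lambda>t. f (x, t))"
  using continuous_rect_slice1 continuous_rect_slice2 continuous_rect_case[OF assms] by blast+

text \<open>The fundamental theorem of calculus on every horizontal slice, integrated in
  \<open>y\<close>. The horizontal edges drop out because \<open>fst n = 0\<close> there.\<close>

lemma divergence_cell_x: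
  assumes "mesh N X" "T \<in> cells N" "has_dx_cell X T f f'"
  shows "cint X T f' = boundary_integral X T (\<lambda>e n t. f (edge_point X e t) * fst n)"
proof -
  obtain i j where T: "T = (i, j)" by force
  define a b c d where "a = X i" "b = X (Suc i)" "c = X j" "d = X (Suc j)"
  note abcd = this
  have ab: "a < b" "c < d" using mesh_less[OF assms(1,2)] mesh_less'[OF assms(1,2)] by (auto simp: abcd T)
  have R: "cell_set X T = {a..b} \<times> {c..d}" by (simp add: cell_set_def abcd T)
  have cf: "continuous_on ({a..b} \<times> {c..d}) f" "continuous_on ({a..b} \<times> {c..d}) f'"
    using assms(3) unfolding has_dx_cell_def R by auto
  have D: "((\<lambda>t. f (t, y)) has_real_derivative f' (x, y)) (at x within {a..b})"
    if "x \<in> {a..b}" "y \<in> {c..d}" for x y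
    using assms(3) that unfolding has_dx_cell_def R by (auto simp: T abcd)
  have "integral {a..b} (\<lambda>x. f' (x, y)) = f (b, y) - f (a, y)" if "y \<in> {c..d}" for y
    using that ab D by (intro integral_unique fundamental_theorem_of_calculus)
      (auto simp: has_real_derivative_iff_has_vector_derivative[symmetric])
  then have "cint X T f' = integral {c..d} (\<lambda>y. f (b, y) - f (a, y))"
    unfolding cint_def R integral_rect_iterated(1)[OF cf(2)] by (intro integral_cong) auto
  also have "\<dots> = integral {c..d} (\<lambda>y. f (b, y)) - integral {c..d} (\<lambda>y. f (a, y))"
    using ab by (intro integral_diff integrable_continuous_real continuous_on_slice(2)[OF cf(1)]) auto
  also have "\<dots> = boundary_integral X T (\<lambda>e n t. f (edge_point X e t) * fst n)"
    unfolding boundary_integral_expand using ab continuous_on_slice(2)[OF cf(1)]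
    by (simp add: T edge_integral_0 edge_integral_eq abcd[symmetric] continuous_on_minus)
  finally show ?thesis .
qed

lemma divergence_cell_y:
  assumes "mesh N X" "T \<in> cells N" "has_dy_cell X T f f'"
  shows "cint X T f' = boundary_integral X T (\<lambda>e n t. f (edge_point X e t) * snd n)"
proof -
  obtain i j where T: "T = (i, j)" by force
  define a b c d where "a = X i" "b = X (Suc i)" "c = X j" "d = X (Suc j)"
  note abcd = this
  have ab: "a < b" "c < d" using mesh_less[OF assms(1,2)] mesh_less'[OF assms(1,2)] by (auto simp: abcd T)
  have R: "cell_set X T = {a..b} \<times> {c..d}" by (simp add: cell_set_def abcd T)
  have cf: "continuous_on ({a..b} \<times> {c..d}) f" "continuous_on ({a..b} \<times> {c..d}) f'"
    using assms(3) unfolding has_dy_cell_def R by auto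
  have D: "((\<lambda>t. f (x, t)) has_real_derivative f' (x, y)) (at y within {c..d})"
    if "x \<in> {a..b}" "y \<in> {c..d}" for x y
    using assms(3) that unfolding has_dy_cell_def R by (auto simp: T abcd)
  have "integral {c..d} (\<lambda>y. f' (x, y)) = f (x, d) - f (x, c)" if "x \<in> {a..b}" for x
    using that ab D by (intro integral_unique fundamental_theorem_of_calculus)
      (auto simp: has_real_derivative_iff_has_vector_derivative[symmetric])
  then have "cint X T f' = integral {a..b} (\<lambda>x. f (x, d) - f (x, c))"
    unfolding cint_def R integral_rect_iterated(2)[OF cf(2)] by (intro integral_cong) auto
  also have "\<dots> = integral {a..b} (\<lambda>x. f (x, d)) - integral {a..b} (\<lambda>x. f (x, c))"
    using ab by (intro integral_diff integrable_continuous_real continuous_on_slice(1)[OF cf(1)]) auto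
  also have "\<dots> = boundary_integral X T (\<lambda>e n t. f (edge_point X e t) * snd n)"
    unfolding boundary_integral_expand using ab continuous_on_slice(1)[OF cf(1)]
    by (simp add: T edge_integral_0 edge_integral_eq abcd[symmetric] continuous_on_minus)
  finally show ?thesis .
qed

lemma integration_by_parts_x:
  assumes "mesh N X" "T \<in> cells N" "has_dx_cell X T f f'" "has_dx_cell X T g g'"
  shows "cint X T (\<lambda>p. f' p * g p) + cint X T (\<lambda>p. f p * g' p)
    = boundary_integral X T (\<lambda>e n t. f (edge_point X e t) * g (edge_point X e t) * fst n)"
  using divergence_cell_x[OF assms(1,2) has_dx_cell_mult[OF assms(3,4)]] assms(3,4)
  unfolding has_dx_cell_def by (simp add: cint_add continuous_on_mult)

lemma integration_by_parts_y:
  assumes "mesh N X" "T \<in> cells N" "has_dy_cell X T f f'" "has_dy_cell X T g g'"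
  shows "cint X T (\<lambda>p. f' p * g p) + cint X T (\<lambda>p. f p * g' p)
    = boundary_integral X T (\<lambda>e n t. f (edge_point X e t) * g (edge_point X e t) * snd n)"
  using divergence_cell_y[OF assms(1,2) has_dy_cell_mult[OF assms(3,4)]] assms(3,4)
  unfolding has_dy_cell_def by (simp add: cint_add continuous_on_mult)

abbreviation normal_flux ::
    "(nat \<Rightarrow> real) \<Rightarrow> (point \<Rightarrow> real) \<Rightarrow> (point \<Rightarrow> real) \<Rightarrow> edge \<Rightarrow> point \<Rightarrow> real \<Rightarrow> real"
  where "normal_flux X gx gy e n t \<equiv> gx (edge_point X e t) * fst n + gy (edge_point X e t) * snd n"

abbreviation normal_g :: "weak_function \<Rightarrow> edge \<Rightarrow> point \<Rightarrow> real \<Rightarrow> real"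
  where "normal_g v e n t \<equiv> fst (wf_g v e t) * fst n + snd (wf_g v e t) * snd n"

text \<open>Both derivatives are moved across in each variable, four integrations by parts in
  all.\<close>

lemma green_second_identity:
  assumes M: "mesh N X" "T \<in> cells N"
    and f: "has_dx_cell X T f fx" "has_dx_cell X T fx fxx" "has_dy_cell X T f fy" "has_dy_cell X T fy fyy"
    and g: "has_dx_cell X T g gx" "has_dx_cell X T gx gxx" "has_dy_cell X T g gy" "has_dy_cell X T gy gyy"
  shows "cint X T (\<lambda>p. f p * (gxx p + gyy p)) = cint X T (\<lambda>p. (fxx p + fyy p) * g p)
     + boundary_integral X T (\<lambda>e n t. f (edge_point X e t) *
         (normal_flux X gx gy e n t))
     - boundary_integral X T (\<lambda>e n t. (normal_flux X fx fy e n t) *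
         g (edge_point X e t))"
proof -
  have c: "continuous_on (cell_set X T) f" "continuous_on (cell_set X T) fx" "continuous_on (cell_set X T) fxx"
    "continuous_on (cell_set X T) fy" "continuous_on (cell_set X T) fyy" "continuous_on (cell_set X T) g"
    "continuous_on (cell_set X T) gx" "continuous_on (cell_set X T) gxx" "continuous_on (cell_set X T) gy"
    "continuous_on (cell_set X T) gyy"
    using f g unfolding has_dx_cell_def has_dy_cell_def by simp_all
  note bc = bcont_mult bcont_const c[THEN bcont_cell[OF M]]
  have "cint X T (\<lambda>p. f p * (gxx p + gyy p)) = cint X T (\<lambda>p. f p * gxx p) + cint X T (\<lambda>p. f p * gyy p)"
    unfolding distrib_left by (intro cint_add continuous_on_mult c)
  moreover have "cint X T (\<lambda>p. (fxx p + fyy p) * g p) = cint X T (\<lambda>p. fxx p * g p) + cint X T (\<lambda>p. fyy p * g p)"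
    unfolding distrib_right by (intro cint_add continuous_on_mult c)
  moreover have "boundary_integral X T (\<lambda>e n t. f (edge_point X e t) *
         (normal_flux X gx gy e n t))
      = boundary_integral X T (\<lambda>e n t. f (edge_point X e t) * gx (edge_point X e t) * fst n)
      + boundary_integral X T (\<lambda>e n t. f (edge_point X e t) * gy (edge_point X e t) * snd n)"
    by (subst boundary_integral_add[symmetric]) (auto intro!: bc simp: algebra_simps)
  moreover have "boundary_integral X T (\<lambda>e n t. (normal_flux X fx fy e n t) *
         g (edge_point X e t))
      = boundary_integral X T (\<lambda>e n t. fx (edge_point X e t) * g (edge_point X e t) * fst n)
      + boundary_integral X T (\<lambda>e n t. fy (edge_point X e t) * g (edge_point X e t) * snd n)"
    by (subst boundary_integral_add[symmetric]) (auto intro!: bc simp: algebra_simps)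
  ultimately show ?thesis
    using integration_by_parts_x[OF M f(1) g(2)] integration_by_parts_x[OF M f(2) g(1)]
      integration_by_parts_y[OF M f(3) g(4)] integration_by_parts_y[OF M f(4) g(3)] by linarith
qed

subsection \<open>Characterisation of the projections and of the weak operators\<close>

text \<open>The projection represents the functional \<open>inner_L2\<close> against
  \<open>u\<close>, and its basis coefficients are those of \<open>proj2\<close>. This transfers the
  error estimates on rectangles to the projection in the method.\<close>

lemma proj_cell_eq_proj2:
  assumes M: "mesh N X" "T \<in> cells N" and u: "continuous_on (cell_set X T) u"
  shows "proj_cell k X u T (x, y)
    = proj2 k (X (fst T)) (X (Suc (fst T))) (X (snd T)) (X (Suc (snd T))) (\<lambda>x y. u (x, y)) x y"
    and "proj_cell k X u T \<in> Qk k"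
    and "\<phi> \<in> Qk k \<Longrightarrow> cint X T (\<lambda>p. proj_cell k X u T p * \<phi> p) = cint X T (\<lambda>p. u p * \<phi> p)"
proof -
  let ?a = "X (fst T)" and ?b = "X (Suc (fst T))" and ?c = "X (snd T)" and ?d = "X (Suc (snd T))"
  note ab = mesh_less[OF M] and cd = mesh_less'[OF M]
  note R = cell_set_def[of X T]
  note u' = u[unfolded R]
  note lin = inner_L2_functional[OF u', of k]
  have eq: "proj_cell k X u T = (\<lambda>p. \<Sum>ij\<in>{..k} \<times> {..k}.
      inner_L2 (cell_set X T) u (lgd2 k ?a ?b ?c ?d ij) * lgd2 k ?a ?b ?c ?d ij p)"
    unfolding proj_cell_def R by (rule Qk_riesz_THE[OF ab cd lin])
  have "inner_L2 (cell_set X T) u (lgd2 k ?a ?b ?c ?d (i, j)) = lgd_coeff2 k ?a ?b ?c ?d (\<lambda>x y. u (x, y)) i j"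
    if "i \<le> k" "j \<le> k" for i j
    unfolding lgd_coeff2_eq_integral[OF ab cd u'] R
    using that by (subst inner_L2_eq_integral[OF u' Qk_continuous[OF lgd2_in_Qk]]) auto
  then show "proj_cell k X u T (x, y) = proj2 k ?a ?b ?c ?d (\<lambda>x y. u (x, y)) x y"
    unfolding eq proj2_def sum.cartesian_product by (intro sum.cong) (auto simp: lgd2_def)
  show in_Qk: "proj_cell k X u T \<in> Qk k"
    unfolding eq R by (rule Qk_riesz(1)[OF ab cd lin])
  show "cint X T (\<lambda>p. proj_cell k X u T p * \<phi> p) = cint X T (\<lambda>p. u p * \<phi> p)" if \<phi>: "\<phi> \<in> Qk k"
  proof -
    have "inner_L2 (cell_set X T) (proj_cell k X u T) \<phi> = inner_L2 (cell_set X T) u \<phi>"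
      unfolding eq R by (rule Qk_riesz(2)[OF ab cd lin \<phi>])
    then show ?thesis
      unfolding inner_L2_cell[OF Qk_continuous[OF in_Qk] Qk_continuous[OF \<phi>]]
        inner_L2_cell[OF u Qk_continuous[OF \<phi>]] .
  qed
qed

lemma proj_cell_derivatives:
  assumes M: "mesh N X" "T \<in> cells N" and u: "continuous_on (cell_set X T) u"
  shows "dx UNIV (proj_cell k X u T) (x, y)
    = proj2x k (X (fst T)) (X (Suc (fst T))) (X (snd T)) (X (Suc (snd T))) (\<lambda>x y. u (x, y)) x y"
    and "dy UNIV (proj_cell k X u T) (x, y)
    = proj2y k (X (fst T)) (X (Suc (fst T))) (X (snd T)) (X (Suc (snd T))) (\<lambda>x y. u (x, y)) x y"
  unfolding proj2x_def proj2y_def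
  by (intro dx_UNIV_eq dy_UNIV_eq,
    unfold proj_cell_eq_proj2(1)[OF M u] proj2_def,
    intro DERIV_sum DERIV_cmult DERIV_cmult_right lgd_deriv mesh_less[OF M] mesh_less'[OF M])+

lemma Pk_sum_lgd: "(\<lambda>t. \<Sum>i\<le>k. r i * lgd k a b i t) \<in> Pk k"
proof -
  have "degree (\<Sum>i\<le>k. smult (r i) (lgd_poly k a b i)) \<le> k"
    by (intro degree_sum_le) (auto intro: order.trans[OF degree_smult_le] degree_lgd_poly)
  moreover have "(\<lambda>t. \<Sum>i\<le>k. r i * lgd k a b i t) = poly (\<Sum>i\<le>k. smult (r i) (lgd_poly k a b i))"
    by (simp add: fun_eq_iff poly_sum poly_lgd_poly)
  ultimately show ?thesis unfolding Pk_def by blast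
qed

lemma Pk_expansion:
  assumes "a < b" "r \<in> Pk k"
  shows "r t = (\<Sum>i\<le>k. integral {a..b} (\<lambda>s. r s * lgd k a b i s) * lgd k a b i t)"
  using assms lgd_expansion unfolding Pk_def by blast

lemma Pk_orthogonal:
  assumes ab: "a < b" and f: "continuous_on {a..b} f" "\<And>i. i \<le> k \<Longrightarrow> integral {a..b} (\<lambda>s. f s * lgd k a b i s) = 0"
    and r: "r \<in> Pk k"
  shows "integral {a..b} (\<lambda>s. f s * r s) = 0"
proof -
  let ?c = "\<lambda>i. integral {a..b} (\<lambda>s. r s * lgd k a b i s)"
  have "integral {a..b} (\<lambda>s. f s * r s) = integral {a..b} (\<lambda>s. \<Sum>i\<le>k. ?c i * (f s * lgd k a b i s))"
    by (intro integral_cong, subst Pk_expansion[OF ab r]) (simp add: sum_distrib_left mult.left_commute)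
  also have "\<dots> = (\<Sum>i\<le>k. integral {a..b} (\<lambda>s. ?c i * (f s * lgd k a b i s)))"
    by (intro integral_sum integrable_on_mult_right lgd_coeff_integrable[OF ab f(1)]) simp
  also have "\<dots> = 0" using f(2) by simp
  finally show ?thesis .
qed

lemma proj1_coeff:
  assumes ab: "a < b" and j: "j \<le> k"
  shows "integral {a..b} (\<lambda>s. proj1 k a b g s * lgd k a b j s) = integral {a..b} (\<lambda>s. g s * lgd k a b j s)"
proof -
  let ?c = "\<lambda>i. integral {a..b} (\<lambda>s. g s * lgd k a b i s)"
  have "integral {a..b} (\<lambda>s. proj1 k a b g s * lgd k a b j s)
      = integral {a..b} (\<lambda>s. \<Sum>i\<le>k. ?c i * (lgd k a b i s * lgd k a b j s))"
    unfolding proj1_def by (simp add: sum_distrib_right mult.assoc)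
  also have "\<dots> = (\<Sum>i\<le>k. integral {a..b} (\<lambda>s. ?c i * (lgd k a b i s * lgd k a b j s)))"
    by (intro integral_sum integrable_continuous_real continuous_intros ab) auto
  also have "\<dots> = (\<Sum>i\<le>k. ?c i * of_bool (i = j))"
    using lgd_orthonormal[OF ab _ j] by (intro sum.cong) auto
  also have "\<dots> = ?c j" using j by (simp add: of_bool_def if_distrib cong: if_cong)
  finally show ?thesis .
qed

text \<open>\<open>proj1\<close> of the trace solves the defining problem, and expansion in the
  basis shows that nothing else does. The uniqueness claim later identifies projections of zero
  traces and the components of vector projections.\<close>

lemma proj_edge_char:
  assumes e: "edge_range X e = {a..b}" "a < b" and u: "continuous_on {a..b} (\<lambda>t. u (edge_point X e t))"
  shows "proj_edge k X u e \<in> Pk k"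
    and "\<psi> \<in> Pk k \<Longrightarrow> edge_integral X e (\<lambda>t. proj_edge k X u e t * \<psi> t)
      = edge_integral X e (\<lambda>t. u (edge_point X e t) * \<psi> t)"
    and "r \<in> Pk k \<Longrightarrow> (\<And>\<psi>. \<psi> \<in> Pk k \<Longrightarrow> edge_integral X e (\<lambda>t. r t * \<psi> t)
      = edge_integral X e (\<lambda>t. u (edge_point X e t) * \<psi> t)) \<Longrightarrow> r = proj_edge k X u e"
proof -
  let ?g = "\<lambda>t. u (edge_point X e t)"
  let ?r = "proj1 k a b ?g"
  have r: "?r \<in> Pk k" unfolding proj1_def[abs_def] by (rule Pk_sum_lgd)
  have cr: "continuous_on {a..b} ?r" by (rule Pk_continuous[OF r])
  have ei: "edge_integral X e (\<lambda>t. f t * \<psi> t) = integral {a..b} (\<lambda>t. f t * \<psi> t)"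
    if "continuous_on {a..b} f" "\<psi> \<in> Pk k" for f \<psi>
    using edge_integral_eq[of X e "\<lambda>t. f t * \<psi> t"] that Pk_continuous unfolding e
    by (simp add: continuous_on_mult)
  have rep: "edge_integral X e (\<lambda>t. ?r t * \<psi> t) = edge_integral X e (\<lambda>t. ?g t * \<psi> t)" if \<psi>: "\<psi> \<in> Pk k" for \<psi>
  proof -
    have "integral {a..b} (\<lambda>t. (?r t - ?g t) * \<psi> t) = 0"
    proof (rule Pk_orthogonal[OF e(2) _ _ \<psi>])
      show "integral {a..b} (\<lambda>s. (?r s - ?g s) * lgd k a b i s) = 0" if "i \<le> k" for i
        unfolding lgd_coeff_diff[OF e(2) cr u] proj1_coeff[OF e(2) that] by simp
    qed (intro continuous_on_diff cr u)
    moreover have "integral {a..b} (\<lambda>t. (?r t - ?g t) * \<psi> t)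
        = integral {a..b} (\<lambda>t. ?r t * \<psi> t) - integral {a..b} (\<lambda>t. ?g t * \<psi> t)"
      unfolding left_diff_distrib
      by (intro integral_diff integrable_continuous_real continuous_on_mult cr u Pk_continuous[OF \<psi>])
    ultimately show ?thesis by (simp add: ei cr u \<psi>)
  qed
  have uniq: "r = ?r" if r': "r \<in> Pk k"
    "\<And>\<psi>. \<psi> \<in> Pk k \<Longrightarrow> edge_integral X e (\<lambda>t. r t * \<psi> t) = edge_integral X e (\<lambda>t. ?g t * \<psi> t)" for r
  proof
    fix t
    have "integral {a..b} (\<lambda>s. r s * lgd k a b i s) = integral {a..b} (\<lambda>s. ?g s * lgd k a b i s)" if "i \<le> k" for i
      using r'(2)[OF lgd_in_Pk[OF that]] ei[OF Pk_continuous[OF r'(1)] lgd_in_Pk[OF that]]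
        ei[OF u lgd_in_Pk[OF that]] by simp
    then show "r t = ?r t" unfolding Pk_expansion[OF e(2) r'(1), of t] proj1_def by simp
  qed
  have eq: "proj_edge k X u e = ?r"
    unfolding proj_edge_def
  proof (rule the_equality)
    show "?r \<in> Pk k \<and> (\<forall>\<psi>\<in>Pk k. edge_integral X e (\<lambda>t. ?r t * \<psi> t) = edge_integral X e (\<lambda>t. ?g t * \<psi> t))"
      using r rep by blast
    show "r = ?r" if "r \<in> Pk k \<and> (\<forall>\<psi>\<in>Pk k. edge_integral X e (\<lambda>t. r t * \<psi> t) = edge_integral X e (\<lambda>t. ?g t * \<psi> t))" for r
      by (rule uniq) (use that in blast)+
  qed
  show "proj_edge k X u e \<in> Pk k" unfolding eq by (rule r)
  show "edge_integral X e (\<lambda>t. proj_edge k X u e t * \<psi> t) = edge_integral X e (\<lambda>t. ?g t * \<psi> t)" if "\<psi> \<in> Pk k"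
    unfolding eq by (rule rep[OF that])
  show "r = proj_edge k X u e" if "r \<in> Pk k"
    "\<And>\<psi>. \<psi> \<in> Pk k \<Longrightarrow> edge_integral X e (\<lambda>t. r t * \<psi> t) = edge_integral X e (\<lambda>t. ?g t * \<psi> t)"
    unfolding eq using that by (rule uniq)
qed

lemma Pk_0: "(\<lambda>t. 0) \<in> Pk k"
  unfolding Pk_def by (intro CollectI exI[of _ 0]) auto

text \<open>Vector test functions with one zero component decouple the two components.\<close>

lemma proj_edge_vec_eq:
  assumes e: "edge_range X e = {a..b}" "a < b"
    and g: "continuous_on {a..b} (\<lambda>t. fst (g (edge_point X e t)))" "continuous_on {a..b} (\<lambda>t. snd (g (edge_point X e t)))"
  shows "proj_edge_vec k X g e = (\<lambda>t. (proj_edge k X (\<lambda>p. fst (g p)) e t, proj_edge k X (\<lambda>p. snd (g p)) e t))"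
    (is "_ = (\<lambda>t. (?r1 t, ?r2 t))")
proof -
  note p1 = proj_edge_char[OF e, of "\<lambda>p. fst (g p)", OF g(1)]
  note p2 = proj_edge_char[OF e, of "\<lambda>p. snd (g p)", OF g(2)]
  have split: "edge_integral X e (\<lambda>t. r t \<bullet> \<psi> t)
      = edge_integral X e (\<lambda>t. fst (r t) * fst (\<psi> t)) + edge_integral X e (\<lambda>t. snd (r t) * snd (\<psi> t))"
    if "continuous_on {a..b} (\<lambda>t. fst (r t))" "continuous_on {a..b} (\<lambda>t. snd (r t))" "\<psi> \<in> Pk_vec k" for r \<psi>
  proof -
    have "continuous_on {a..b} (\<lambda>t. fst (\<psi> t))" "continuous_on {a..b} (\<lambda>t. snd (\<psi> t))"
      using that(3) Pk_continuous unfolding Pk_vec_def by blast+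
    then show ?thesis
      unfolding inner_prod_def inner_real_def using that
      by (intro edge_integral_add continuous_on_mult) (simp_all add: e)
  qed
  have vc: "continuous_on {a..b} (\<lambda>t. fst (r t))" "continuous_on {a..b} (\<lambda>t. snd (r t))" if "r \<in> Pk_vec k" for r
    using that Pk_continuous unfolding Pk_vec_def by blast+
  show ?thesis
    unfolding proj_edge_vec_def
  proof (rule the_equality)
    have in1: "(\<lambda>t. (?r1 t, ?r2 t)) \<in> Pk_vec k" using p1(1) p2(1) by (simp add: Pk_vec_def)
    moreover have "edge_integral X e (\<lambda>t. (?r1 t, ?r2 t) \<bullet> \<psi> t) = edge_integral X e (\<lambda>t. g (edge_point X e t) \<bullet> \<psi> t)"
      if \<psi>: "\<psi> \<in> Pk_vec k" for \<psi>
      using split[OF vc[OF in1] \<psi>] split[OF g \<psi>] p1(2)[of "\<lambda>t. fst (\<psi> t)"] p2(2)[of "\<lambda>t. snd (\<psi> t)"] \<psi>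
      by (simp add: Pk_vec_def)
    ultimately show "(\<lambda>t. (?r1 t, ?r2 t)) \<in> Pk_vec k \<and> (\<forall>\<psi>\<in>Pk_vec k.
        edge_integral X e (\<lambda>t. (?r1 t, ?r2 t) \<bullet> \<psi> t) = edge_integral X e (\<lambda>t. g (edge_point X e t) \<bullet> \<psi> t))"
      by blast
  next
    fix r assume "r \<in> Pk_vec k \<and> (\<forall>\<psi>\<in>Pk_vec k.
        edge_integral X e (\<lambda>t. r t \<bullet> \<psi> t) = edge_integral X e (\<lambda>t. g (edge_point X e t) \<bullet> \<psi> t))"
    then have r: "r \<in> Pk_vec k"
      and rp: "\<And>\<psi>. \<psi> \<in> Pk_vec k \<Longrightarrow> edge_integral X e (\<lambda>t. r t \<bullet> \<psi> t) = edge_integral X e (\<lambda>t. g (edge_point X e t) \<bullet> \<psi> t)"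
      by blast+
    have "(\<lambda>t. fst (r t)) = ?r1"
    proof (rule p1(3))
      show "(\<lambda>t. fst (r t)) \<in> Pk k" using r by (simp add: Pk_vec_def)
      fix \<psi> assume "\<psi> \<in> Pk k"
      then have "(\<lambda>t. (\<psi> t, 0)) \<in> Pk_vec k" by (simp add: Pk_vec_def Pk_0)
      from rp[OF this] split[OF vc[OF r] this] split[OF g this]
      show "edge_integral X e (\<lambda>t. fst (r t) * \<psi> t) = edge_integral X e (\<lambda>t. fst (g (edge_point X e t)) * \<psi> t)"
        by (simp add: edge_integral_0)
    qed
    moreover have "(\<lambda>t. snd (r t)) = ?r2"
    proof (rule p2(3))
      show "(\<lambda>t. snd (r t)) \<in> Pk k" using r by (simp add: Pk_vec_def)
      fix \<psi> assume "\<psi> \<in> Pk k"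
      then have "(\<lambda>t. (0, \<psi> t)) \<in> Pk_vec k" by (simp add: Pk_vec_def Pk_0)
      from rp[OF this] split[OF vc[OF r] this] split[OF g this]
      show "edge_integral X e (\<lambda>t. snd (r t) * \<psi> t) = edge_integral X e (\<lambda>t. snd (g (edge_point X e t)) * \<psi> t)"
        by (simp add: edge_integral_0)
    qed
    ultimately show "r = (\<lambda>t. (?r1 t, ?r2 t))" by (metis prod.collapse)
  qed
qed

lemma
  assumes v: "v \<in> V_space k N" and T: "T \<in> cells N"
  shows V_space_0: "wf_0 v T \<in> Qk k"
    and bcont_b: "bcont X T (\<lambda>e n. wf_b v e)"
    and bcont_g1: "bcont X T (\<lambda>e n t. fst (wf_g v e t))"
    and bcont_g2: "bcont X T (\<lambda>e n t. snd (wf_g v e t))"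
proof -
  show "wf_0 v T \<in> Qk k" using v T by (auto simp: V_space_def)
  have b: "wf_b v e \<in> Pk k" if "(e, n) \<in> cell_boundary T" for e n
    using v T that by (auto simp: V_space_def)
  have g: "wf_g v e \<in> Pk_vec k" if "(e, n) \<in> cell_boundary T" for e n
    using v T that by (auto simp: V_space_def)
  show "bcont X T (\<lambda>e n. wf_b v e)" unfolding bcont_def using b Pk_continuous by blast
  show "bcont X T (\<lambda>e n t. fst (wf_g v e t))" "bcont X T (\<lambda>e n t. snd (wf_g v e t))"
    unfolding bcont_def using g Pk_continuous unfolding Pk_vec_def by blast+
qed

text \<open>The right-hand side of the definition is a linear functional on \<open>Qk k\<close>, so
  the Riesz lemma makes the definite description meaningful.\<close>

lemma weak_laplacian_char:
  assumes M: "mesh N X" "T \<in> cells N" and v: "v \<in> V_space k N"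
  shows "weak_laplacian k X v T \<in> Qk k"
    and "\<phi> \<in> Qk k \<Longrightarrow> cint X T (\<lambda>p. weak_laplacian k X v T p * \<phi> p) =
      cint X T (\<lambda>p. wf_0 v T p * (dx UNIV (dx UNIV \<phi>) p + dy UNIV (dy UNIV \<phi>) p))
      - boundary_integral X T (\<lambda>e n t. wf_b v e t *
          (normal_flux X (dx UNIV \<phi>) (dy UNIV \<phi>) e n t))
      + boundary_integral X T (\<lambda>e n t. normal_g v e n t * \<phi> (edge_point X e t))"
proof -
  define l where "l = (\<lambda>\<phi>. inner_L2 (cell_set X T) (wf_0 v T) (laplacian UNIV \<phi>)
      - boundary_integral X T (\<lambda>e n t. wf_b v e t * (gradient UNIV \<phi> (edge_point X e t) \<bullet> n))
      + boundary_integral X T (\<lambda>e n t. (wf_g v e t \<bullet> n) * \<phi> (edge_point X e t)))"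
  note q = bcont_cell[OF M Qk_continuous]
  note bc = bcont_add bcont_mult bcont_const bcont_b[OF v M(2)] bcont_g1[OF v M(2)] bcont_g2[OF v M(2)]
  note c0 = Qk_continuous[OF V_space_0[OF v M(2)]]
  have lap: "laplacian UNIV \<phi> \<in> Qk k" if "\<phi> \<in> Qk k" for \<phi>
    unfolding laplacian_def[abs_def] using that by (intro Qk_add Qk_dx Qk_dy)
  have l: "l \<phi> = cint X T (\<lambda>p. wf_0 v T p * (dx UNIV (dx UNIV \<phi>) p + dy UNIV (dy UNIV \<phi>) p))
      - boundary_integral X T (\<lambda>e n t. wf_b v e t *
          (normal_flux X (dx UNIV \<phi>) (dy UNIV \<phi>) e n t))
      + boundary_integral X T (\<lambda>e n t. normal_g v e n t * \<phi> (edge_point X e t))"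
    if "\<phi> \<in> Qk k" for \<phi>
    unfolding l_def inner_L2_cell[OF c0 Qk_continuous[OF lap[OF that]]]
    by (simp add: laplacian_def gradient_def inner_prod_def)
  have lin: "Qk_functional k l"
    unfolding Qk_functional_def
  proof (intro ballI allI)
    fix \<phi> \<psi> r assume \<phi>: "\<phi> \<in> Qk k" and \<psi>: "\<psi> \<in> Qk k"
    have s: "(\<lambda>p. \<phi> p + r * \<psi> p) \<in> Qk k" by (intro Qk_add Qk_scale \<phi> \<psi>)
    have 1: "inner_L2 (cell_set X T) (wf_0 v T) (laplacian UNIV (\<lambda>p. \<phi> p + r * \<psi> p))
      = inner_L2 (cell_set X T) (wf_0 v T) (laplacian UNIV \<phi>) + r * inner_L2 (cell_set X T) (wf_0 v T) (laplacian UNIV \<psi>)"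
    proof -
      have "laplacian UNIV (\<lambda>p. \<phi> p + r * \<psi> p) = (\<lambda>p. laplacian UNIV \<phi> p + r * laplacian UNIV \<psi> p)"
        unfolding laplacian_def[abs_def] Qk_dx_linear[OF \<phi> \<psi>] Qk_dy_linear[OF \<phi> \<psi>]
          Qk_dx_linear[OF Qk_dx[OF \<phi>] Qk_dx[OF \<psi>]] Qk_dy_linear[OF Qk_dy[OF \<phi>] Qk_dy[OF \<psi>]]
        by (simp add: algebra_simps)
      then show ?thesis unfolding cell_set_def
        using inner_L2_Qk_left_linear[OF c0[where S = "cell_set X T", unfolded cell_set_def] lap[OF \<phi>] lap[OF \<psi>]] by simp
    qed
    let ?A = "\<lambda>\<phi> e (n::point) t. wf_b v e t * (gradient UNIV \<phi> (edge_point X e t) \<bullet> n)"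
    let ?B = "\<lambda>\<phi> e (n::point) t. (wf_g v e t \<bullet> n) * \<phi> (edge_point X e t)"
    have A: "bcont X T (?A \<phi>)" and B: "bcont X T (?B \<phi>)" if "\<phi> \<in> Qk k" for \<phi>
      unfolding gradient_def inner_prod_def inner_real_def fst_conv snd_conv
      using that by (intro bc q Qk_dx Qk_dy; simp)+
    have scal: "bcont X T (\<lambda>e n t. r * F e n t)" if "bcont X T F" for F
      by (intro bcont_mult bcont_const that)
    have 2: "boundary_integral X T (?A (\<lambda>p. \<phi> p + r * \<psi> p)) = boundary_integral X T (?A \<phi>) + r * boundary_integral X T (?A \<psi>)"
      unfolding boundary_integral_cmult[OF A[OF \<psi>], symmetric] boundary_integral_add[OF A[OF \<phi>] scal[OF A[OF \<psi>]], symmetric]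
      unfolding gradient_def Qk_dx_linear[OF \<phi> \<psi>] Qk_dy_linear[OF \<phi> \<psi>] by (simp add: inner_prod_def algebra_simps)
    have 3: "boundary_integral X T (?B (\<lambda>p. \<phi> p + r * \<psi> p)) = boundary_integral X T (?B \<phi>) + r * boundary_integral X T (?B \<psi>)"
      unfolding boundary_integral_cmult[OF B[OF \<psi>], symmetric] boundary_integral_add[OF B[OF \<phi>] scal[OF B[OF \<psi>]], symmetric]
      by (simp add: algebra_simps)
    show "l (\<lambda>p. \<phi> p + r * \<psi> p) = l \<phi> + r * l \<psi>"
      unfolding l_def 1 2 3 by (simp add: algebra_simps)
  qed
  note ab = mesh_less[OF M] and cd = mesh_less'[OF M]
  note R = cell_set_def[of X T]
  have eq: "weak_laplacian k X v T = (\<lambda>p. \<Sum>ij\<in>{..k} \<times> {..k}.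
      l (lgd2 k (X (fst T)) (X (Suc (fst T))) (X (snd T)) (X (Suc (snd T))) ij) *
      lgd2 k (X (fst T)) (X (Suc (fst T))) (X (snd T)) (X (Suc (snd T))) ij p)"
    using Qk_riesz_THE[OF ab cd lin] unfolding weak_laplacian_def l_def R .
  show in_Qk: "weak_laplacian k X v T \<in> Qk k"
    unfolding eq by (rule Qk_riesz(1)[OF ab cd lin])
  assume \<phi>: "\<phi> \<in> Qk k"
  have "inner_L2 (cell_set X T) (weak_laplacian k X v T) \<phi> = l \<phi>"
    unfolding eq R by (rule Qk_riesz(2)[OF ab cd lin \<phi>])
  then show "cint X T (\<lambda>p. weak_laplacian k X v T p * \<phi> p) =
      cint X T (\<lambda>p. wf_0 v T p * (dx UNIV (dx UNIV \<phi>) p + dy UNIV (dy UNIV \<phi>) p))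
      - boundary_integral X T (\<lambda>e n t. wf_b v e t *
          (normal_flux X (dx UNIV \<phi>) (dy UNIV \<phi>) e n t))
      + boundary_integral X T (\<lambda>e n t. normal_g v e n t * \<phi> (edge_point X e t))"
    unfolding l[OF \<phi>] inner_L2_cell[OF Qk_continuous[OF in_Qk] Qk_continuous[OF \<phi>]] .
qed

lemma Qk_vec_iff: "q \<in> Qk_vec k \<longleftrightarrow> (\<lambda>p. fst (q p)) \<in> Qk k \<and> (\<lambda>p. snd (q p)) \<in> Qk k"
  by (simp add: Qk_vec_def)

lemma inner_L2_Qk_vec:
  assumes "w \<in> Qk_vec k" "q \<in> Qk_vec k"
  shows "inner_L2 (cell_set X T) w q = cint X T (\<lambda>p. fst (w p) * fst (q p) + snd (w p) * snd (q p))"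
proof -
  have "continuous_on (cell_set X T) (\<lambda>p. (fst (q p), snd (q p)))" if "q \<in> Qk_vec k" for q
    using that Qk_continuous unfolding Qk_vec_iff by (intro continuous_on_Pair) blast+
  then have "continuous_on (cell_set X T) w" "continuous_on (cell_set X T) q" using assms by simp_all
  then show ?thesis
    unfolding cint_def cell_set_def by (subst inner_L2_eq_integral) (simp_all add: inner_prod_def)
qed

lemma weak_gradient_char:
  assumes M: "mesh N X" "T \<in> cells N" and v: "v \<in> V_space k N"
  shows "weak_gradient k X v T \<in> Qk_vec k"
    and "q1 \<in> Qk k \<Longrightarrow> q2 \<in> Qk k \<Longrightarrow>
      cint X T (\<lambda>p. fst (weak_gradient k X v T p) * q1 p + snd (weak_gradient k X v T p) * q2 p) =
      - cint X T (\<lambda>p. wf_0 v T p * (dx UNIV q1 p + dy UNIV q2 p))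
      + boundary_integral X T (\<lambda>e n t. wf_b v e t * (normal_flux X q1 q2 e n t))"
proof -
  define l where "l = (\<lambda>q. - inner_L2 (cell_set X T) (wf_0 v T) (divergence UNIV q)
      + boundary_integral X T (\<lambda>e n t. wf_b v e t * (q (edge_point X e t) \<bullet> n)))"
  note q = bcont_cell[OF M Qk_continuous]
  note bc = bcont_add bcont_mult bcont_const bcont_b[OF v M(2)]
  note c0 = Qk_continuous[OF V_space_0[OF v M(2)]]
  have div: "divergence UNIV q \<in> Qk k" if "q \<in> Qk_vec k" for q
    unfolding divergence_def[abs_def] using that unfolding Qk_vec_iff by (intro Qk_add Qk_dx Qk_dy) auto
  have lin: "Qk_vec_functional k l"
    unfolding Qk_vec_functional_def
  proof (intro ballI allI)
    fix \<phi> \<psi> r assume \<phi>: "\<phi> \<in> Qk_vec k" and \<psi>: "\<psi> \<in> Qk_vec k"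
    note \<phi>' = \<phi>[unfolded Qk_vec_iff, THEN conjunct1] \<phi>[unfolded Qk_vec_iff, THEN conjunct2]
    note \<psi>' = \<psi>[unfolded Qk_vec_iff, THEN conjunct1] \<psi>[unfolded Qk_vec_iff, THEN conjunct2]
    have "divergence UNIV (\<lambda>p. \<phi> p + r *\<^sub>R \<psi> p) = (\<lambda>p. divergence UNIV \<phi> p + r * divergence UNIV \<psi> p)"
      unfolding divergence_def[abs_def] fst_add snd_add fst_scaleR snd_scaleR real_scaleR_def
        Qk_dx_linear[OF \<phi>'(1) \<psi>'(1)] Qk_dy_linear[OF \<phi>'(2) \<psi>'(2)]
      by (simp add: algebra_simps)
    then have 1: "inner_L2 (cell_set X T) (wf_0 v T) (divergence UNIV (\<lambda>p. \<phi> p + r *\<^sub>R \<psi> p))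
      = inner_L2 (cell_set X T) (wf_0 v T) (divergence UNIV \<phi>) + r * inner_L2 (cell_set X T) (wf_0 v T) (divergence UNIV \<psi>)"
      unfolding cell_set_def
      using inner_L2_Qk_left_linear[OF c0[where S = "cell_set X T", unfolded cell_set_def] div[OF \<phi>] div[OF \<psi>]] by simp
    let ?A = "\<lambda>q e (n::point) t. wf_b v e t * (q (edge_point X e t) \<bullet> n)"
    have A: "bcont X T (?A q)" if "q \<in> Qk_vec k" for q
    proof -
      have "bcont X T (\<lambda>e n t. fst (q (edge_point X e t)))" "bcont X T (\<lambda>e n t. snd (q (edge_point X e t)))"
        using that unfolding Qk_vec_iff by (auto intro: bcont_cell[OF M] Qk_continuous)
      then show ?thesis unfolding inner_prod_def inner_real_def by (intro bc)
    qed
    have 2: "boundary_integral X T (?A (\<lambda>p. \<phi> p + r *\<^sub>R \<psi> p)) = boundary_integral X T (?A \<phi>) + r * boundary_integral X T (?A \<psi>)"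
      unfolding boundary_integral_cmult[OF A[OF \<psi>], symmetric]
        boundary_integral_add[OF A[OF \<phi>] bcont_mult[OF bcont_const A[OF \<psi>]], symmetric]
      by (simp add: inner_add_left algebra_simps)
    show "l (\<lambda>p. \<phi> p + r *\<^sub>R \<psi> p) = l \<phi> + r * l \<psi>"
      unfolding l_def 1 2 by (simp add: algebra_simps)
  qed
  note ab = mesh_less[OF M] and cd = mesh_less'[OF M]
  note R = cell_set_def[of X T]
  have "weak_gradient k X v T \<in> Qk_vec k \<and>
      (\<forall>\<phi>\<in>Qk_vec k. inner_L2 (cell_set X T) (weak_gradient k X v T) \<phi> = l \<phi>)"
    using theI'[OF Qk_vec_riesz[OF ab cd lin]] unfolding weak_gradient_def l_def R .
  then have in_Qk: "weak_gradient k X v T \<in> Qk_vec k"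
    and rep: "\<And>\<phi>. \<phi> \<in> Qk_vec k \<Longrightarrow> inner_L2 (cell_set X T) (weak_gradient k X v T) \<phi> = l \<phi>" by blast+
  show "weak_gradient k X v T \<in> Qk_vec k" by (rule in_Qk)
  assume q12: "q1 \<in> Qk k" "q2 \<in> Qk k"
  then have Q: "(\<lambda>p. (q1 p, q2 p)) \<in> Qk_vec k" by (simp add: Qk_vec_iff)
  show "cint X T (\<lambda>p. fst (weak_gradient k X v T p) * q1 p + snd (weak_gradient k X v T p) * q2 p) =
      - cint X T (\<lambda>p. wf_0 v T p * (dx UNIV q1 p + dy UNIV q2 p))
      + boundary_integral X T (\<lambda>e n t. wf_b v e t * (normal_flux X q1 q2 e n t))"
    using rep[OF Q] unfolding inner_L2_Qk_vec[OF in_Qk Q] l_def inner_L2_cell[OF c0 Qk_continuous[OF div[OF Q]]]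
    by (simp add: divergence_def inner_prod_def)
qed

subsection \<open>Algebra of weak functions\<close>

lemma wf_minus_simps [simp]:
  "wf_0 (wf_minus v w) T p = wf_0 v T p - wf_0 w T p"
  "wf_b (wf_minus v w) e t = wf_b v e t - wf_b w e t"
  "wf_g (wf_minus v w) e t = wf_g v e t - wf_g w e t"
  by (simp_all add: wf_minus_def)

lemma wf_minus_fun:
  "wf_0 (wf_minus v w) T = (\<lambda>p. wf_0 v T p - wf_0 w T p)"
  "wf_b (wf_minus v w) e = (\<lambda>t. wf_b v e t - wf_b w e t)"
  "wf_g (wf_minus v w) e = (\<lambda>t. wf_g v e t - wf_g w e t)"
  by (simp_all add: wf_minus_def)

lemma Pk_vec_minus: "r \<in> Pk_vec k \<Longrightarrow> s \<in> Pk_vec k \<Longrightarrow> (\<lambda>t. r t - s t) \<in> Pk_vec k"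
  unfolding Pk_vec_def by (simp add: Pk_minus)

lemma V_space_minus: "v \<in> V_space k N \<Longrightarrow> w \<in> V_space k N \<Longrightarrow> wf_minus v w \<in> V_space k N"
  unfolding V_space_def wf_minus_fun mem_Collect_eq
  by (blast intro: Qk_minus Pk_minus Pk_vec_minus)

lemma V0_space_minus:
  assumes "v \<in> V0_space k N X" "w \<in> V0_space k N X"
  shows "wf_minus v w \<in> V0_space k N X"
proof -
  have "wf_minus v w \<in> V_space k N"
    using assms V_space_minus unfolding V0_space_def by blast
  moreover have "wf_b (wf_minus v w) e t = 0 \<and> wf_g (wf_minus v w) e t \<bullet> n = 0"
    if "T \<in> cells N" "(e, n) \<in> cell_boundary T" "edge_set X e \<subseteq> frontier Omega" "t \<in> edge_range X e" for T e n t
  proof -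
    have "wf_b v e t = 0" "wf_g v e t \<bullet> n = 0" "wf_b w e t = 0" "wf_g w e t \<bullet> n = 0"
      using assms that unfolding V0_space_def by fast+
    then show ?thesis by (simp add: inner_diff_left)
  qed
  ultimately show ?thesis unfolding V0_space_def by fast
qed

lemma Qk_dx_minus: "\<phi> \<in> Qk k \<Longrightarrow> \<psi> \<in> Qk k \<Longrightarrow> dx UNIV (\<lambda>p. \<phi> p - \<psi> p) p = dx UNIV \<phi> p - dx UNIV \<psi> p"
  and Qk_dy_minus: "\<phi> \<in> Qk k \<Longrightarrow> \<psi> \<in> Qk k \<Longrightarrow> dy UNIV (\<lambda>p. \<phi> p - \<psi> p) p = dy UNIV \<phi> p - dy UNIV \<psi> p"
  using Qk_dx_linear[of \<phi> k \<psi> "-1"] Qk_dy_linear[of \<phi> k \<psi> "-1"] by simp_all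

text \<open>Linearity is stated only after testing with \<open>Qk k\<close>; in
  \<open>cell_form\<close> the other factor is always of that kind.\<close>

lemma weak_laplacian_minus:
  assumes M: "mesh N X" "T \<in> cells N" and v: "v \<in> V_space k N" and w: "w \<in> V_space k N" and \<phi>: "\<phi> \<in> Qk k"
  shows "cint X T (\<lambda>p. weak_laplacian k X (wf_minus v w) T p * \<phi> p)
    = cint X T (\<lambda>p. weak_laplacian k X v T p * \<phi> p) - cint X T (\<lambda>p. weak_laplacian k X w T p * \<phi> p)"
proof -
  note bv = bcont_b[OF v M(2)] bcont_g1[OF v M(2)] bcont_g2[OF v M(2)]
  note bw = bcont_b[OF w M(2)] bcont_g1[OF w M(2)] bcont_g2[OF w M(2)]
  have ders: "dx UNIV (dx UNIV \<phi>) \<in> Qk k" "dy UNIV (dy UNIV \<phi>) \<in> Qk k" "dx UNIV \<phi> \<in> Qk k" "dy UNIV \<phi> \<in> Qk k"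
    by (intro Qk_dx Qk_dy \<phi>)+
  note be = bcont_cell[OF M Qk_continuous[OF \<phi>]] ders[THEN Qk_continuous, THEN bcont_cell[OF M]]
  note bc = bcont_add bcont_mult bcont_const bv bw be
  have 1: "cint X T (\<lambda>p. (wf_0 v T p - wf_0 w T p) * (dx UNIV (dx UNIV \<phi>) p + dy UNIV (dy UNIV \<phi>) p))
    = cint X T (\<lambda>p. wf_0 v T p * (dx UNIV (dx UNIV \<phi>) p + dy UNIV (dy UNIV \<phi>) p))
    - cint X T (\<lambda>p. wf_0 w T p * (dx UNIV (dx UNIV \<phi>) p + dy UNIV (dy UNIV \<phi>) p))"
    unfolding left_diff_distrib
    by (intro cint_diff continuous_on_mult continuous_on_add Qk_continuous[OF V_space_0[OF v M(2)]]
        Qk_continuous[OF V_space_0[OF w M(2)]] ders[THEN Qk_continuous])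
  have 2: "boundary_integral X T (\<lambda>e n t. (wf_b v e t - wf_b w e t) *
          (normal_flux X (dx UNIV \<phi>) (dy UNIV \<phi>) e n t))
    = boundary_integral X T (\<lambda>e n t. wf_b v e t *
          (normal_flux X (dx UNIV \<phi>) (dy UNIV \<phi>) e n t))
    - boundary_integral X T (\<lambda>e n t. wf_b w e t *
          (normal_flux X (dx UNIV \<phi>) (dy UNIV \<phi>) e n t))"
    unfolding left_diff_distrib by (intro boundary_integral_diff bc)
  have 3: "boundary_integral X T (\<lambda>e n t. ((fst (wf_g v e t) - fst (wf_g w e t)) * fst n + (snd (wf_g v e t) - snd (wf_g w e t)) * snd n) * \<phi> (edge_point X e t))
    = boundary_integral X T (\<lambda>e n t. normal_g v e n t * \<phi> (edge_point X e t))
    - boundary_integral X T (\<lambda>e n t. normal_g w e n t * \<phi> (edge_point X e t))"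
    by (subst boundary_integral_diff[symmetric], intro bc, intro bc) (simp add: algebra_simps)
  show ?thesis
    unfolding weak_laplacian_char(2)[OF M V_space_minus[OF v w] \<phi>] weak_laplacian_char(2)[OF M v \<phi>]
      weak_laplacian_char(2)[OF M w \<phi>] wf_minus_simps fst_diff snd_diff 1 2 3 by simp
qed

lemma weak_gradient_minus:
  assumes M: "mesh N X" "T \<in> cells N" and v: "v \<in> V_space k N" and w: "w \<in> V_space k N"
    and q1: "q1 \<in> Qk k" and q2: "q2 \<in> Qk k"
  shows "cint X T (\<lambda>p. fst (weak_gradient k X (wf_minus v w) T p) * q1 p + snd (weak_gradient k X (wf_minus v w) T p) * q2 p)
    = cint X T (\<lambda>p. fst (weak_gradient k X v T p) * q1 p + snd (weak_gradient k X v T p) * q2 p)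
    - cint X T (\<lambda>p. fst (weak_gradient k X w T p) * q1 p + snd (weak_gradient k X w T p) * q2 p)"
proof -
  have ders: "dx UNIV q1 \<in> Qk k" "dy UNIV q2 \<in> Qk k" by (intro Qk_dx Qk_dy q1 q2)+
  note bc = bcont_add bcont_mult bcont_const bcont_b[OF v M(2)] bcont_b[OF w M(2)]
    bcont_cell[OF M Qk_continuous[OF q1]] bcont_cell[OF M Qk_continuous[OF q2]]
  have 1: "cint X T (\<lambda>p. (wf_0 v T p - wf_0 w T p) * (dx UNIV q1 p + dy UNIV q2 p))
    = cint X T (\<lambda>p. wf_0 v T p * (dx UNIV q1 p + dy UNIV q2 p))
    - cint X T (\<lambda>p. wf_0 w T p * (dx UNIV q1 p + dy UNIV q2 p))"
    unfolding left_diff_distrib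
    by (intro cint_diff continuous_on_mult continuous_on_add Qk_continuous[OF V_space_0[OF v M(2)]]
        Qk_continuous[OF V_space_0[OF w M(2)]] ders[THEN Qk_continuous])
  have 2: "boundary_integral X T (\<lambda>e n t. (wf_b v e t - wf_b w e t) *
          (normal_flux X q1 q2 e n t))
    = boundary_integral X T (\<lambda>e n t. wf_b v e t * (normal_flux X q1 q2 e n t))
    - boundary_integral X T (\<lambda>e n t. wf_b w e t * (normal_flux X q1 q2 e n t))"
    unfolding left_diff_distrib by (intro boundary_integral_diff bc)
  show ?thesis
    unfolding weak_gradient_char(2)[OF M V_space_minus[OF v w] q1 q2] weak_gradient_char(2)[OF M v q1 q2]
      weak_gradient_char(2)[OF M w q1 q2] wf_minus_simps 1 2 by simp
qed

section \<open>Jumps, stabilizer weights and the form cell by cell\<close>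

definition jump_b :: "(nat \<Rightarrow> real) \<Rightarrow> weak_function \<Rightarrow> cell \<Rightarrow> edge \<Rightarrow> real \<Rightarrow> real"
  where "jump_b X v T e t = wf_0 v T (edge_point X e t) - wf_b v e t"

definition jump_x :: "(nat \<Rightarrow> real) \<Rightarrow> weak_function \<Rightarrow> cell \<Rightarrow> edge \<Rightarrow> real \<Rightarrow> real"
  where "jump_x X v T e t = dx UNIV (wf_0 v T) (edge_point X e t) - fst (wf_g v e t)"

definition jump_y :: "(nat \<Rightarrow> real) \<Rightarrow> weak_function \<Rightarrow> cell \<Rightarrow> edge \<Rightarrow> real \<Rightarrow> real"
  where "jump_y X v T e t = dy UNIV (wf_0 v T) (edge_point X e t) - snd (wf_g v e t)"

definition weight_b :: "nat \<Rightarrow> real \<Rightarrow> nat \<Rightarrow> real"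
  where "weight_b k \<epsilon> N = \<epsilon>\<^sup>2 * inverse ((fine_width k \<epsilon> N)\<^sup>2) * inverse (coarse_width k \<epsilon> N) + inverse (coarse_width k \<epsilon> N)"

definition weight_g :: "nat \<Rightarrow> real \<Rightarrow> nat \<Rightarrow> real"
  where "weight_g k \<epsilon> N = \<epsilon>\<^sup>2 * inverse (fine_width k \<epsilon> N)"

lemma bcont_jumps:
  assumes M: "mesh N X" "T \<in> cells N" and v: "v \<in> V_space k N"
  shows "bcont X T (\<lambda>e n. jump_b X v T e)" "bcont X T (\<lambda>e n. jump_x X v T e)" "bcont X T (\<lambda>e n. jump_y X v T e)"
proof -
  note v0 = V_space_0[OF v M(2)]
  note c = Qk_continuous[OF v0] Qk_continuous[OF Qk_dx[OF v0]] Qk_continuous[OF Qk_dy[OF v0]]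
  show "bcont X T (\<lambda>e n. jump_b X v T e)" "bcont X T (\<lambda>e n. jump_x X v T e)" "bcont X T (\<lambda>e n. jump_y X v T e)"
    unfolding jump_b_def[abs_def] jump_x_def[abs_def] jump_y_def[abs_def]
    by (intro bcont_diff c[THEN bcont_cell[OF M]] bcont_b[OF v M(2)] bcont_g1[OF v M(2)] bcont_g2[OF v M(2)])+
qed

lemma jump_minus:
  assumes "T \<in> cells N" "v \<in> V_space k N" "w \<in> V_space k N"
  shows "jump_b X (wf_minus v w) T e t = jump_b X v T e t - jump_b X w T e t"
    "jump_x X (wf_minus v w) T e t = jump_x X v T e t - jump_x X w T e t"
    "jump_y X (wf_minus v w) T e t = jump_y X v T e t - jump_y X w T e t"
  unfolding jump_b_def jump_x_def jump_y_def wf_minus_fun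
  using Qk_dx_minus[OF V_space_0[OF assms(2,1)] V_space_0[OF assms(3,1)]]
    Qk_dy_minus[OF V_space_0[OF assms(2,1)] V_space_0[OF assms(3,1)]] by simp_all

definition cell_form :: "nat \<Rightarrow> real \<Rightarrow> nat \<Rightarrow> weak_function \<Rightarrow> weak_function \<Rightarrow> cell \<Rightarrow> real"
  where "cell_form k \<epsilon> N w v T = (let X = shishkin_node k \<epsilon> N in
     \<epsilon>\<^sup>2 * cint X T (\<lambda>p. weak_laplacian k X w T p * weak_laplacian k X v T p)
     + cint X T (\<lambda>p. fst (weak_gradient k X w T p) * fst (weak_gradient k X v T p)
         + snd (weak_gradient k X w T p) * snd (weak_gradient k X v T p))
     + weight_g k \<epsilon> N * boundary_integral X T (\<lambda>e n t. jump_x X w T e t * jump_x X v T e t + jump_y X w T e t * jump_y X v T e t)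
     + weight_b k \<epsilon> N * boundary_integral X T (\<lambda>e n t. jump_b X w T e t * jump_b X v T e t))"

lemma wg_form_cells:
  assumes M: "mesh N (shishkin_node k \<epsilon> N)" and w: "w \<in> V_space k N" and v: "v \<in> V_space k N"
  shows "wg_form k \<epsilon> N w v = (\<Sum>T\<in>cells N. cell_form k \<epsilon> N w v T)"
proof -
  have "inner_L2 (cell_set X T) (weak_laplacian k X w T) (weak_laplacian k X v T)
      = cint X T (\<lambda>p. weak_laplacian k X w T p * weak_laplacian k X v T p)"
    "inner_L2 (cell_set X T) (weak_gradient k X w T) (weak_gradient k X v T)
      = cint X T (\<lambda>p. fst (weak_gradient k X w T p) * fst (weak_gradient k X v T p)
         + snd (weak_gradient k X w T p) * snd (weak_gradient k X v T p))"
    if "T \<in> cells N" "X = shishkin_node k \<epsilon> N" for T X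
    using weak_laplacian_char(1)[OF M that(1) w] weak_laplacian_char(1)[OF M that(1) v]
      weak_gradient_char(1)[OF M that(1) w] weak_gradient_char(1)[OF M that(1) v]
    unfolding that(2) by (simp_all add: inner_L2_cell Qk_continuous inner_L2_Qk_vec)
  then show ?thesis
    unfolding wg_form_def stabilizer_def Let_def cell_form_def sum.distrib sum_distrib_left
    by (simp add: weight_b_def weight_g_def gradient_def inner_prod_def jump_b_def jump_x_def jump_y_def)
qed

lemma cell_form_minus:
  assumes M: "mesh N (shishkin_node k \<epsilon> N)" "T \<in> cells N"
    and w: "w \<in> V_space k N" "w' \<in> V_space k N" and v: "v \<in> V_space k N"
  shows "cell_form k \<epsilon> N (wf_minus w w') v T = cell_form k \<epsilon> N w v T - cell_form k \<epsilon> N w' v T"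
proof -
  let ?X = "shishkin_node k \<epsilon> N"
  note g = weak_gradient_char(1)[OF M v, unfolded Qk_vec_iff]
  note bj = bcont_jumps[OF M w(1)] bcont_jumps[OF M w(2)] bcont_jumps[OF M v]
  have 1: "boundary_integral ?X T (\<lambda>e n t. (jump_x ?X w T e t - jump_x ?X w' T e t) * jump_x ?X v T e t +
        (jump_y ?X w T e t - jump_y ?X w' T e t) * jump_y ?X v T e t)
    = boundary_integral ?X T (\<lambda>e n t. jump_x ?X w T e t * jump_x ?X v T e t + jump_y ?X w T e t * jump_y ?X v T e t)
    - boundary_integral ?X T (\<lambda>e n t. jump_x ?X w' T e t * jump_x ?X v T e t + jump_y ?X w' T e t * jump_y ?X v T e t)"
    by (subst boundary_integral_diff[symmetric], intro bcont_add bcont_mult bj, intro bcont_add bcont_mult bj)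
      (simp add: algebra_simps)
  have 2: "boundary_integral ?X T (\<lambda>e n t. (jump_b ?X w T e t - jump_b ?X w' T e t) * jump_b ?X v T e t)
    = boundary_integral ?X T (\<lambda>e n t. jump_b ?X w T e t * jump_b ?X v T e t)
    - boundary_integral ?X T (\<lambda>e n t. jump_b ?X w' T e t * jump_b ?X v T e t)"
    unfolding left_diff_distrib by (intro boundary_integral_diff bcont_mult bj)
  show ?thesis
    unfolding cell_form_def Let_def jump_minus[OF M(2) w] 1 2
      weak_laplacian_minus[OF M w weak_laplacian_char(1)[OF M v]]
      weak_gradient_minus[OF M w g[THEN conjunct1] g[THEN conjunct2]]
    by (simp add: algebra_simps)
qed

text \<open>The squares of the weak Laplacian and the weak gradient are dropped: the stabilizer
  alone can absorb the jumps in the energy estimate.\<close>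

lemma cell_form_ge:
  assumes M: "mesh N (shishkin_node k \<epsilon> N)" "T \<in> cells N" and v: "v \<in> V_space k N"
  defines "X \<equiv> shishkin_node k \<epsilon> N"
  shows "weight_g k \<epsilon> N * boundary_integral X T (\<lambda>e n t. jump_x X v T e t * jump_x X v T e t + jump_y X v T e t * jump_y X v T e t)
     + weight_b k \<epsilon> N * boundary_integral X T (\<lambda>e n t. jump_b X v T e t * jump_b X v T e t) \<le> cell_form k \<epsilon> N v v T"
proof -
  have "0 \<le> cint X T f" if "continuous_on (cell_set X T) f" "\<And>p. 0 \<le> f p" for f
    unfolding cint_def using that by (intro integral_nonneg integrable_cell) auto
  moreover have "continuous_on (cell_set X T) (\<lambda>p. weak_laplacian k X v T p * weak_laplacian k X v T p)"
    unfolding X_def by (intro continuous_on_mult Qk_continuous[OF weak_laplacian_char(1)[OF M v]])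
  moreover have "continuous_on (cell_set X T) (\<lambda>p. fst (weak_gradient k X v T p) * fst (weak_gradient k X v T p)
         + snd (weak_gradient k X v T p) * snd (weak_gradient k X v T p))"
    using weak_gradient_char(1)[OF M v, unfolded Qk_vec_iff] Qk_continuous
    unfolding X_def by (intro continuous_on_add continuous_on_mult) blast+
  ultimately show ?thesis unfolding cell_form_def Let_def X_def[symmetric] by simp
qed

subsection \<open>Consistency\<close>

lemma edge_integral_cong:
  "(\<And>t. t \<in> edge_range X e \<Longrightarrow> f t = g t) \<Longrightarrow> edge_integral X e f = edge_integral X e g"
  unfolding edge_integral_def set_lebesgue_integral_def
  by (intro Bochner_Integration.integral_cong refl) (auto simp: indicator_def)

lemma boundary_integral_cong:
  "(\<And>e n t. (e, n) \<in> cell_boundary T \<Longrightarrow> t \<in> edge_range X e \<Longrightarrow> F e n t = G e n t) \<Longrightarrow>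
    boundary_integral X T F = boundary_integral X T G"
  unfolding boundary_integral_def by (intro sum.cong refl) (auto intro!: edge_integral_cong)

lemma edge_integral_uminus: "edge_integral X e (\<lambda>t. - f t) = - edge_integral X e f"
  unfolding edge_integral_def set_lebesgue_integral_def by simp

lemma edge_range_cell:
  assumes "mesh N X" "T \<in> cells N" "(e, n) \<in> cell_boundary T"
  obtains a b where "edge_range X e = {a..b}" "a < b"
  using assms(3) mesh_less[OF assms(1,2)] mesh_less'[OF assms(1,2)]
  unfolding cell_boundary_def case_prod_unfold by auto

text \<open>An interior edge belongs to two cells with opposite normals. Once the boundary integral
  of a cell is a difference of edge quantities in each index, rows and columns telescope, and only
  edges on the boundary of the square remain.\<close>

lemma boundary_integral_telescope:
  assumes F: "\<And>i j. i < N \<Longrightarrow> j < N \<Longrightarrow>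
      boundary_integral X (i, j) (F (i, j)) = (B (Suc i) j - B i j) + (A i (Suc j) - A i j)"
    and A: "\<And>i. i < N \<Longrightarrow> A i 0 = 0 \<and> A i N = (0::real)"
    and B: "\<And>j. j < N \<Longrightarrow> B 0 j = 0 \<and> B N j = 0"
  shows "(\<Sum>T\<in>cells N. boundary_integral X T (F T)) = 0"
proof -
  have "(\<Sum>T\<in>cells N. boundary_integral X T (F T)) = (\<Sum>i<N. \<Sum>j<N. boundary_integral X (i, j) (F (i, j)))"
    unfolding cells_def by (simp add: sum.cartesian_product case_prod_unfold)
  also have "\<dots> = (\<Sum>i<N. \<Sum>j<N. B (Suc i) j - B i j) + (\<Sum>i<N. \<Sum>j<N. A i (Suc j) - A i j)"
    using F by (simp add: sum.distrib)
  also have "(\<Sum>i<N. \<Sum>j<N. B (Suc i) j - B i j) = (\<Sum>j<N. \<Sum>i<N. B (Suc i) j - B i j)"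
    by (rule sum.swap)
  also have "\<dots> = 0"
  proof (rule sum.neutral, rule ballI)
    show "(\<Sum>i<N. B (Suc i) j - B i j) = 0" if "j \<in> {..<N}" for j
      using sum_lessThan_telescope[of "\<lambda>i. B i j" N] B[of j] that by simp
  qed
  also have "(\<Sum>i<N. \<Sum>j<N. A i (Suc j) - A i j) = 0"
  proof (rule sum.neutral, rule ballI)
    show "(\<Sum>j<N. A i (Suc j) - A i j) = 0" if "i \<in> {..<N}" for i
      using sum_lessThan_telescope[of "A i" N] A[of i] that by simp
  qed
  finally show ?thesis by simp
qed

lemma frontier_Omega: "frontier Omega = Omega_bar - Omega"
proof -
  have "open Omega" by (intro open_Times) auto
  moreover have "closure Omega = Omega_bar" by (simp add: closure_Times)
  ultimately show ?thesis by (simp add: frontier_def interior_open)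
qed

lemma boundary_edges_in_frontier:
  assumes M: "mesh N X"
  shows "i < N \<Longrightarrow> j \<in> {0, N} \<Longrightarrow> edge_set X (Hor i j) \<subseteq> frontier Omega"
    and "j < N \<Longrightarrow> i \<in> {0, N} \<Longrightarrow> edge_set X (Ver i j) \<subseteq> frontier Omega"
proof -
  have I: "t \<in> {0..1}" if "i < N" "t \<in> {X i..X (Suc i)}" for i t
    using mesh_range[OF M, of i] mesh_range[OF M, of "Suc i"] that by auto
  have "X 0 = 0" "X N = 1" using M by (auto simp: mesh_def)
  then have E: "X j \<in> {0, 1}" if "j \<in> {0, N}" for j using that by auto
  have fr: "(s, r) \<in> frontier Omega" "(r, s) \<in> frontier Omega" if "s \<in> {0..1}" "r \<in> {0, 1}" for s r
    unfolding frontier_Omega using that by auto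
  show "edge_set X (Hor i j) \<subseteq> frontier Omega" if "i < N" "j \<in> {0, N}"
    using fr(1)[OF I[OF that(1)] E[OF that(2)]] unfolding edge_set_def by (simp add: image_subset_iff)
  show "edge_set X (Ver i j) \<subseteq> frontier Omega" if "j < N" "i \<in> {0, N}"
    using fr(2)[OF I[OF that(1)] E[OF that(2)]] unfolding edge_set_def by (simp add: image_subset_iff)
qed

text \<open>Only pure second derivatives are listed, since Green's identity for the Laplacian
  contains no mixed ones. They are taken relative to the whole closed square and agree with
  derivatives relative to the cell.\<close>

definition C2_cell :: "(nat \<Rightarrow> real) \<Rightarrow> cell \<Rightarrow> (point \<Rightarrow> real) \<Rightarrow> bool"
  where "C2_cell X T f \<longleftrightarrow>
    has_dx_cell X T f (dx Omega_bar f) \<and> has_dx_cell X T (dx Omega_bar f) (dx Omega_bar (dx Omega_bar f)) \<and>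
    has_dy_cell X T f (dy Omega_bar f) \<and> has_dy_cell X T (dy Omega_bar f) (dy Omega_bar (dy Omega_bar f))"

lemma
  assumes "C2_cell X T f"
  shows C2_cell_dx: "has_dx_cell X T f (dx Omega_bar f)"
    and C2_cell_dxx: "has_dx_cell X T (dx Omega_bar f) (dx Omega_bar (dx Omega_bar f))"
    and C2_cell_dy: "has_dy_cell X T f (dy Omega_bar f)"
    and C2_cell_dyy: "has_dy_cell X T (dy Omega_bar f) (dy Omega_bar (dy Omega_bar f))"
    and C2_cell_cont: "continuous_on (cell_set X T) f" "continuous_on (cell_set X T) (dx Omega_bar f)"
      "continuous_on (cell_set X T) (dy Omega_bar f)" "continuous_on (cell_set X T) (laplacian Omega_bar f)"
  using assms unfolding C2_cell_def has_dx_cell_def has_dy_cell_def laplacian_def[abs_def]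
  by (simp_all add: continuous_on_add)

lemma edge_continuous:
  fixes g :: "point \<Rightarrow> real"
  assumes "mesh N X" "T \<in> cells N" "continuous_on (cell_set X T) g" "(e, n) \<in> cell_boundary T"
  shows "continuous_on (edge_range X e) (\<lambda>t. g (edge_point X e t))"
  using bcont_cell[OF assms(1-3)] assms(4) unfolding bcont_def by blast

lemma proj_edge_in_Pk:
  assumes "mesh N X" "T \<in> cells N" "continuous_on (cell_set X T) g" "(e, n) \<in> cell_boundary T"
  shows "proj_edge k X g e \<in> Pk k"
proof -
  obtain a b where e: "edge_range X e = {a..b}" "a < b" by (rule edge_range_cell[OF assms(1,2,4)])
  show ?thesis by (rule proj_edge_char(1)[OF e edge_continuous[OF assms, unfolded e(1)]])
qed

lemma boundary_integral_proj_edge: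
  assumes M: "mesh N X" "T \<in> cells N" and u: "continuous_on (cell_set X T) u"
    and \<psi>: "\<And>e n. (e, n) \<in> cell_boundary T \<Longrightarrow> \<psi> e n \<in> Pk k"
  shows "boundary_integral X T (\<lambda>e n t. proj_edge k X u e t * \<psi> e n t)
    = boundary_integral X T (\<lambda>e n t. u (edge_point X e t) * \<psi> e n t)"
  unfolding boundary_integral_def
proof (rule sum.cong[OF refl], clarify)
  fix e and n1 n2 :: real assume en: "(e, n1, n2) \<in> cell_boundary T"
  obtain a b where e: "edge_range X e = {a..b}" "a < b" by (rule edge_range_cell[OF M en])
  show "edge_integral X e (\<lambda>t. proj_edge k X u e t * \<psi> e (n1, n2) t)
      = edge_integral X e (\<lambda>t. u (edge_point X e t) * \<psi> e (n1, n2) t)"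
    by (rule proj_edge_char(2)[OF e edge_continuous[OF M u en, unfolded e(1)] \<psi>[OF en]])
qed

lemma gradient_components: "(\<lambda>p. fst (gradient A u p)) = dx A u" "(\<lambda>p. snd (gradient A u p)) = dy A u"
  by (simp_all add: gradient_def fun_eq_iff)

lemma Q_proj_g:
  assumes M: "mesh N X" "T \<in> cells N" and u: "C2_cell X T u" and en: "(e, n) \<in> cell_boundary T"
  shows "wf_g (Q_proj k X u) e = (\<lambda>t. (proj_edge k X (dx Omega_bar u) e t, proj_edge k X (dy Omega_bar u) e t))"
proof -
  obtain a b where e: "edge_range X e = {a..b}" "a < b" by (rule edge_range_cell[OF M en])
  show ?thesis
    using proj_edge_vec_eq[OF e, of "gradient Omega_bar u" k]
      edge_continuous[OF M C2_cell_cont(2)[OF u] en] edge_continuous[OF M C2_cell_cont(3)[OF u] en]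
    unfolding gradient_components e(1) by (simp add: Q_proj_def gradient_def)
qed

lemma Q_proj_0: "wf_0 (Q_proj k X u) = proj_cell k X u"
  and Q_proj_b: "wf_b (Q_proj k X u) = proj_edge k X u"
  by (simp_all add: Q_proj_def)

lemma Q_proj_in_V_space:
  assumes M: "mesh N X" and u: "\<forall>T\<in>cells N. C2_cell X T u"
  shows "Q_proj k X u \<in> V_space k N"
proof -
  have "wf_0 (Q_proj k X u) T \<in> Qk k" if "T \<in> cells N" for T
    unfolding Q_proj_0 by (rule proj_cell_eq_proj2(2)[OF M that C2_cell_cont(1)[OF u[rule_format, OF that]]])
  moreover have "wf_b (Q_proj k X u) e \<in> Pk k \<and> wf_g (Q_proj k X u) e \<in> Pk_vec k"
    if T: "T \<in> cells N" and en: "(e, n) \<in> cell_boundary T" for T e n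
    using proj_edge_in_Pk[OF M T _ en] C2_cell_cont[OF u[rule_format, OF T]]
    unfolding Q_proj_b Q_proj_g[OF M T u[rule_format, OF T] en] Pk_vec_def by simp
  ultimately show ?thesis unfolding V_space_def by fast
qed

text \<open>Every projection in \<open>Q_proj\<close> meets a test function against which it is
  exact: \<open>\<Delta>\<phi>\<close> lies in \<open>Qk k\<close>, and the edge traces of
  \<open>\<phi>\<close> and of its normal derivative lie in \<open>Pk k\<close>. With the
  projections removed, Green's identity leaves \<open>\<Delta>u\<close>.\<close>

lemma weak_laplacian_Q_proj:
  assumes M: "mesh N X" "T \<in> cells N" and u: "\<forall>T\<in>cells N. C2_cell X T u" and \<phi>: "\<phi> \<in> Qk k"
  shows "cint X T (\<lambda>p. weak_laplacian k X (Q_proj k X u) T p * \<phi> p) = cint X T (\<lambda>p. laplacian Omega_bar u p * \<phi> p)"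
proof -
  note uT = u[rule_format, OF M(2)]
  note cu = C2_cell_cont[OF uT]
  have D: "dx UNIV \<phi> \<in> Qk k" "dy UNIV \<phi> \<in> Qk k" "(\<lambda>p. dx UNIV (dx UNIV \<phi>) p + dy UNIV (dy UNIV \<phi>) p) \<in> Qk k"
    by (intro Qk_add Qk_dx Qk_dy \<phi>)+
  have 1: "boundary_integral X T (\<lambda>e n t. proj_edge k X u e t *
          (normal_flux X (dx UNIV \<phi>) (dy UNIV \<phi>) e n t))
    = boundary_integral X T (\<lambda>e n t. u (edge_point X e t) *
          (normal_flux X (dx UNIV \<phi>) (dy UNIV \<phi>) e n t))"
  proof (rule boundary_integral_proj_edge[OF M cu(1)])
    fix e and n :: point
    have "(\<lambda>p. fst n * dx UNIV \<phi> p + snd n * dy UNIV \<phi> p) \<in> Qk k" by (intro Qk_add Qk_scale D)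
    from Qk_edge[OF this, of X e]
    show "(\<lambda>t. normal_flux X (dx UNIV \<phi>) (dy UNIV \<phi>) e n t) \<in> Pk k"
      by (simp add: mult.commute)
  qed
  have s: "(\<lambda>t. c * \<phi> (edge_point X e t)) \<in> Pk k" for c e
    using Qk_edge[OF Qk_scale[OF \<phi>]] .
  note b = C2_cell_cont(2,3)[OF uT, THEN bcont_cell[OF M]] bcont_cell[OF M Qk_continuous[OF \<phi>]]
  have pb: "bcont X T (\<lambda>e n. proj_edge k X g e)" if "continuous_on (cell_set X T) g" for g
    unfolding bcont_def using Pk_continuous[OF proj_edge_in_Pk[OF M that]] by blast
  have "boundary_integral X T (\<lambda>e n t. normal_g (Q_proj k X u) e n t * \<phi> (edge_point X e t))
      = boundary_integral X T (\<lambda>e n t. proj_edge k X (dx Omega_bar u) e t * (fst n * \<phi> (edge_point X e t))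
          + proj_edge k X (dy Omega_bar u) e t * (snd n * \<phi> (edge_point X e t)))"
    by (rule boundary_integral_cong) (simp add: Q_proj_g[OF M uT] algebra_simps)
  also have "\<dots> = boundary_integral X T (\<lambda>e n t. proj_edge k X (dx Omega_bar u) e t * (fst n * \<phi> (edge_point X e t)))
      + boundary_integral X T (\<lambda>e n t. proj_edge k X (dy Omega_bar u) e t * (snd n * \<phi> (edge_point X e t)))"
    by (intro boundary_integral_add bcont_mult bcont_const pb b cu)
  also have "\<dots> = boundary_integral X T (\<lambda>e n t. dx Omega_bar u (edge_point X e t) * (fst n * \<phi> (edge_point X e t)))
      + boundary_integral X T (\<lambda>e n t. dy Omega_bar u (edge_point X e t) * (snd n * \<phi> (edge_point X e t)))"
    unfolding boundary_integral_proj_edge[OF M cu(2), where \<psi> = "\<lambda>e n t. fst n * \<phi> (edge_point X e t)", OF s]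
      boundary_integral_proj_edge[OF M cu(3), where \<psi> = "\<lambda>e n t. snd n * \<phi> (edge_point X e t)", OF s] ..
  also have "\<dots> = boundary_integral X T (\<lambda>e n t. dx Omega_bar u (edge_point X e t) * (fst n * \<phi> (edge_point X e t))
      + dy Omega_bar u (edge_point X e t) * (snd n * \<phi> (edge_point X e t)))"
    by (intro boundary_integral_add[symmetric] bcont_mult bcont_const b)
  also have "\<dots> = boundary_integral X T (\<lambda>e n t. (normal_flux X (dx Omega_bar u) (dy Omega_bar u) e n t) * \<phi> (edge_point X e t))"
    by (simp add: algebra_simps)
  finally have 2: "boundary_integral X T (\<lambda>e n t. normal_g (Q_proj k X u) e n t * \<phi> (edge_point X e t))
    = boundary_integral X T (\<lambda>e n t. (normal_flux X (dx Omega_bar u) (dy Omega_bar u) e n t) * \<phi> (edge_point X e t))" .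
  show ?thesis
    unfolding weak_laplacian_char(2)[OF M Q_proj_in_V_space[OF M(1) u] \<phi>] Q_proj_0 Q_proj_b
      proj_cell_eq_proj2(3)[OF M cu(1) D(3)] 1 2
      green_second_identity[OF M C2_cell_dx[OF uT] C2_cell_dxx[OF uT] C2_cell_dy[OF uT] C2_cell_dyy[OF uT]
        Qk_has_dx_cell[OF \<phi>] Qk_has_dx_cell[OF D(1)] Qk_has_dy_cell[OF \<phi>] Qk_has_dy_cell[OF D(2)]]
    by (simp add: laplacian_def)
qed

text \<open>The same exactness, for the divergence of the test field and its normal trace, followed
  by one integration by parts.\<close>

lemma weak_gradient_Q_proj:
  assumes M: "mesh N X" "T \<in> cells N" and u: "\<forall>T\<in>cells N. C2_cell X T u"
    and q1: "q1 \<in> Qk k" and q2: "q2 \<in> Qk k"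
  shows "cint X T (\<lambda>p. fst (weak_gradient k X (Q_proj k X u) T p) * q1 p + snd (weak_gradient k X (Q_proj k X u) T p) * q2 p)
    = cint X T (\<lambda>p. dx Omega_bar u p * q1 p) + cint X T (\<lambda>p. dy Omega_bar u p * q2 p)"
proof -
  note uT = u[rule_format, OF M(2)]
  note cu = C2_cell_cont[OF uT]
  note D = Qk_add[OF Qk_dx[OF q1] Qk_dy[OF q2]]
  note b = bcont_cell[OF M cu(1)] bcont_cell[OF M Qk_continuous[OF q1]] bcont_cell[OF M Qk_continuous[OF q2]]
  have 1: "boundary_integral X T (\<lambda>e n t. proj_edge k X u e t *
          (normal_flux X q1 q2 e n t))
    = boundary_integral X T (\<lambda>e n t. u (edge_point X e t) *
          (normal_flux X q1 q2 e n t))"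
  proof (rule boundary_integral_proj_edge[OF M cu(1)])
    fix e and n :: point
    have "(\<lambda>p. fst n * q1 p + snd n * q2 p) \<in> Qk k" by (intro Qk_add Qk_scale q1 q2)
    from Qk_edge[OF this, of X e]
    show "(\<lambda>t. normal_flux X q1 q2 e n t) \<in> Pk k"
      by (simp add: mult.commute)
  qed
  also have "\<dots> = boundary_integral X T (\<lambda>e n t. u (edge_point X e t) * q1 (edge_point X e t) * fst n
      + u (edge_point X e t) * q2 (edge_point X e t) * snd n)"
    by (simp add: algebra_simps)
  also have "\<dots> = boundary_integral X T (\<lambda>e n t. u (edge_point X e t) * q1 (edge_point X e t) * fst n)
      + boundary_integral X T (\<lambda>e n t. u (edge_point X e t) * q2 (edge_point X e t) * snd n)"
    by (intro boundary_integral_add bcont_mult bcont_const b)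
  finally have 1: "boundary_integral X T (\<lambda>e n t. proj_edge k X u e t *
          (normal_flux X q1 q2 e n t)) = \<dots>" .
  have 2: "cint X T (\<lambda>p. u p * (dx UNIV q1 p + dy UNIV q2 p))
      = cint X T (\<lambda>p. u p * dx UNIV q1 p) + cint X T (\<lambda>p. u p * dy UNIV q2 p)"
    unfolding distrib_left
    by (intro cint_add continuous_on_mult cu Qk_continuous[OF Qk_dx[OF q1]] Qk_continuous[OF Qk_dy[OF q2]])
  show ?thesis
    unfolding weak_gradient_char(2)[OF M Q_proj_in_V_space[OF M(1) u] q1 q2] Q_proj_0 Q_proj_b
      proj_cell_eq_proj2(3)[OF M cu(1) D] 1 2
    using integration_by_parts_x[OF M C2_cell_dx[OF uT] Qk_has_dx_cell[OF q1]]
      integration_by_parts_y[OF M C2_cell_dy[OF uT] Qk_has_dy_cell[OF q2]] by linarith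
qed

section \<open>Consistency identities on a cell\<close>

text \<open>The weak Laplacian of \<open>Q_proj\<close> may be replaced by the projection
  \<open>z\<close> of \<open>w\<close>, and \<open>z\<close> is then admissible as test function in
  the definition of the weak Laplacian of \<open>v\<close>. Green's identity for \<open>z\<close>
  and for \<open>w\<close> leaves products of jumps with projection errors, plus two terms with
  \<open>wf_b\<close> and \<open>wf_g\<close> alone, which survive on the cell and cancel only in
  the sum over cells.\<close>

lemma laplacian_consistency:
  fixes u :: "point \<Rightarrow> real"
  assumes M: "mesh N X" "T \<in> cells N" and u: "\<forall>T\<in>cells N. C2_cell X T u"
    and w: "C2_cell X T w" and w_def: "w = laplacian Omega_bar u" and v: "v \<in> V_space k N"
  defines "z \<equiv> proj_cell k X w T"
  shows "cint X T (\<lambda>p. weak_laplacian k X (Q_proj k X u) T p * weak_laplacian k X v T p)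
    = cint X T (\<lambda>p. wf_0 v T p * laplacian Omega_bar w p)
    + boundary_integral X T (\<lambda>e n t. jump_b X v T e t *
        ((dx UNIV z (edge_point X e t) - dx Omega_bar w (edge_point X e t)) * fst n
       + (dy UNIV z (edge_point X e t) - dy Omega_bar w (edge_point X e t)) * snd n))
    - boundary_integral X T (\<lambda>e n t. (jump_x X v T e t * fst n + jump_y X v T e t * snd n) *
        (z (edge_point X e t) - w (edge_point X e t)))
    - boundary_integral X T (\<lambda>e n t. wf_b v e t * (normal_flux X (dx Omega_bar w) (dy Omega_bar w) e n t))
    + boundary_integral X T (\<lambda>e n t. normal_g v e n t * w (edge_point X e t))"
proof -
  note cw = C2_cell_cont[OF w]
  note v0 = V_space_0[OF v M(2)]
  note wl = weak_laplacian_char(1)[OF M v]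
  have z: "z \<in> Qk k" unfolding z_def by (rule proj_cell_eq_proj2(2)[OF M cw(1)])
  have Dv: "dx UNIV (wf_0 v T) \<in> Qk k" "dy UNIV (wf_0 v T) \<in> Qk k"
    "(\<lambda>p. dx UNIV (dx UNIV (wf_0 v T)) p + dy UNIV (dy UNIV (wf_0 v T)) p) \<in> Qk k"
    by (intro Qk_add Qk_dx Qk_dy v0)+
  have Dz: "dx UNIV z \<in> Qk k" "dy UNIV z \<in> Qk k" by (intro Qk_dx Qk_dy z)+
  note zt = proj_cell_eq_proj2(3)[OF M cw(1), where k = k, folded z_def]
  have 1: "cint X T (\<lambda>p. weak_laplacian k X (Q_proj k X u) T p * weak_laplacian k X v T p)
      = cint X T (\<lambda>p. weak_laplacian k X v T p * z p)"
    using weak_laplacian_Q_proj[OF M u wl] zt[OF wl] unfolding w_def[symmetric] by (simp add: mult.commute)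
  \<comment> \<open>The Laplacian of \<open>wf_0 v T\<close> lies in \<open>Qk k\<close>, and
    \<open>z - w\<close> is orthogonal to it; this links the two applications of Green's
    identity.\<close>
  have 2: "cint X T (\<lambda>p. (dx UNIV (dx UNIV (wf_0 v T)) p + dy UNIV (dy UNIV (wf_0 v T)) p) * z p)
      = cint X T (\<lambda>p. (dx UNIV (dx UNIV (wf_0 v T)) p + dy UNIV (dy UNIV (wf_0 v T)) p) * w p)"
    using zt[OF Dv(3)] by (simp add: mult.commute)
  note g1 = green_second_identity[OF M Qk_has_dx_cell[OF v0] Qk_has_dx_cell[OF Dv(1)] Qk_has_dy_cell[OF v0] Qk_has_dy_cell[OF Dv(2)]
      Qk_has_dx_cell[OF z] Qk_has_dx_cell[OF Dz(1)] Qk_has_dy_cell[OF z] Qk_has_dy_cell[OF Dz(2)]]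
  note g2 = green_second_identity[OF M Qk_has_dx_cell[OF v0] Qk_has_dx_cell[OF Dv(1)] Qk_has_dy_cell[OF v0] Qk_has_dy_cell[OF Dv(2)]
      C2_cell_dx[OF w] C2_cell_dxx[OF w] C2_cell_dy[OF w] C2_cell_dyy[OF w]]
  note bs = bcont_b[OF v M(2)] bcont_g1[OF v M(2)] bcont_g2[OF v M(2)]
    cw(1-3)[THEN bcont_cell[OF M]] v0[THEN Qk_continuous, THEN bcont_cell[OF M]] z[THEN Qk_continuous, THEN bcont_cell[OF M]]
    Dv(1,2)[THEN Qk_continuous, THEN bcont_cell[OF M]] Dz[THEN Qk_continuous, THEN bcont_cell[OF M]]
  let ?gz = "\<lambda>e (n::point) t. normal_flux X (dx UNIV z) (dy UNIV z) e n t"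
  let ?gw = "\<lambda>e (n::point) t. normal_flux X (dx Omega_bar w) (dy Omega_bar w) e n t"
  let ?gv = "\<lambda>e (n::point) t. normal_flux X (dx UNIV (wf_0 v T)) (dy UNIV (wf_0 v T)) e n t"
  let ?vg = "\<lambda>e (n::point) t. fst (wf_g v e t) * fst n + snd (wf_g v e t) * snd n"
  let ?v0 = "\<lambda>e (n::point) t. wf_0 v T (edge_point X e t)" and ?vb = "\<lambda>e (n::point) t. wf_b v e t"
  let ?z = "\<lambda>e (n::point) t. z (edge_point X e t)" and ?w = "\<lambda>e (n::point) t. w (edge_point X e t)"
  have bn: "bcont X T ?gz" "bcont X T ?gw" "bcont X T ?gv" "bcont X T ?vg"
    by (intro bcont_add bcont_mult bcont_const bs)+
  have b0: "bcont X T ?v0" "bcont X T ?vb" "bcont X T ?z" "bcont X T ?w" by (intro bs)+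
  have 3: "boundary_integral X T (\<lambda>e n t. jump_b X v T e t *
        ((dx UNIV z (edge_point X e t) - dx Omega_bar w (edge_point X e t)) * fst n
       + (dy UNIV z (edge_point X e t) - dy Omega_bar w (edge_point X e t)) * snd n))
     = (boundary_integral X T (\<lambda>e n t. ?v0 e n t * ?gz e n t) - boundary_integral X T (\<lambda>e n t. ?v0 e n t * ?gw e n t))
     - (boundary_integral X T (\<lambda>e n t. ?vb e n t * ?gz e n t) - boundary_integral X T (\<lambda>e n t. ?vb e n t * ?gw e n t))"
    (is "?L = _")
  proof -
    have "?L = boundary_integral X T (\<lambda>e n t. (?v0 e n t * ?gz e n t - ?v0 e n t * ?gw e n t) - (?vb e n t * ?gz e n t - ?vb e n t * ?gw e n t))"
      unfolding jump_b_def by (simp add: algebra_simps)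
    also have "\<dots> = (boundary_integral X T (\<lambda>e n t. ?v0 e n t * ?gz e n t) - boundary_integral X T (\<lambda>e n t. ?v0 e n t * ?gw e n t))
     - (boundary_integral X T (\<lambda>e n t. ?vb e n t * ?gz e n t) - boundary_integral X T (\<lambda>e n t. ?vb e n t * ?gw e n t))"
      by (subst boundary_integral_diff, (intro bcont_diff bcont_mult bn b0)+)+ (rule refl)
    finally show ?thesis .
  qed
  have 4: "boundary_integral X T (\<lambda>e n t. (jump_x X v T e t * fst n + jump_y X v T e t * snd n) *
        (z (edge_point X e t) - w (edge_point X e t)))
     = (boundary_integral X T (\<lambda>e n t. ?gv e n t * ?z e n t) - boundary_integral X T (\<lambda>e n t. ?gv e n t * ?w e n t))
     - (boundary_integral X T (\<lambda>e n t. ?vg e n t * ?z e n t) - boundary_integral X T (\<lambda>e n t. ?vg e n t * ?w e n t))"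
    (is "?L = _")
  proof -
    have "?L = boundary_integral X T (\<lambda>e n t. (?gv e n t * ?z e n t - ?gv e n t * ?w e n t) - (?vg e n t * ?z e n t - ?vg e n t * ?w e n t))"
      unfolding jump_x_def jump_y_def by (simp add: algebra_simps)
    also have "\<dots> = (boundary_integral X T (\<lambda>e n t. ?gv e n t * ?z e n t) - boundary_integral X T (\<lambda>e n t. ?gv e n t * ?w e n t))
     - (boundary_integral X T (\<lambda>e n t. ?vg e n t * ?z e n t) - boundary_integral X T (\<lambda>e n t. ?vg e n t * ?w e n t))"
      by (subst boundary_integral_diff, (intro bcont_diff bcont_mult bn b0)+)+ (rule refl)
    finally show ?thesis .
  qed
  show ?thesis
    unfolding 1 3 4 weak_laplacian_char(2)[OF M v z] using g1 g2 2 by (simp add: laplacian_def)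
qed

text \<open>The scheme of \<open>laplacian_consistency\<close> for first derivatives, with the
  projections \<open>q1\<close>, \<open>q2\<close> of the components of \<open>\<nabla>u\<close> as
  test field.\<close>

lemma gradient_consistency:
  fixes u :: "point \<Rightarrow> real"
  assumes M: "mesh N X" "T \<in> cells N" and u: "\<forall>T\<in>cells N. C2_cell X T u" and v: "v \<in> V_space k N"
  defines "q1 \<equiv> proj_cell k X (dx Omega_bar u) T" and "q2 \<equiv> proj_cell k X (dy Omega_bar u) T"
  shows "cint X T (\<lambda>p. fst (weak_gradient k X (Q_proj k X u) T p) * fst (weak_gradient k X v T p)
      + snd (weak_gradient k X (Q_proj k X u) T p) * snd (weak_gradient k X v T p))
    = - cint X T (\<lambda>p. wf_0 v T p * laplacian Omega_bar u p)
    + boundary_integral X T (\<lambda>e n t. jump_b X v T e t *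
        ((dx Omega_bar u (edge_point X e t) - q1 (edge_point X e t)) * fst n
       + (dy Omega_bar u (edge_point X e t) - q2 (edge_point X e t)) * snd n))
    + boundary_integral X T (\<lambda>e n t. wf_b v e t * (normal_flux X (dx Omega_bar u) (dy Omega_bar u) e n t))"
proof -
  note uT = u[rule_format, OF M(2)]
  note cu = C2_cell_cont[OF uT]
  note v0 = V_space_0[OF v M(2)]
  have wg: "(\<lambda>p. fst (weak_gradient k X v T p)) \<in> Qk k" "(\<lambda>p. snd (weak_gradient k X v T p)) \<in> Qk k"
    using weak_gradient_char(1)[OF M v] unfolding Qk_vec_iff by auto
  have q: "q1 \<in> Qk k" "q2 \<in> Qk k"
    unfolding q1_def q2_def by (rule proj_cell_eq_proj2(2)[OF M cu(2)], rule proj_cell_eq_proj2(2)[OF M cu(3)])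
  note t1 = proj_cell_eq_proj2(3)[OF M cu(2), where k = k, folded q1_def]
  note t2 = proj_cell_eq_proj2(3)[OF M cu(3), where k = k, folded q2_def]
  have Dv: "dx UNIV (wf_0 v T) \<in> Qk k" "dy UNIV (wf_0 v T) \<in> Qk k" by (intro Qk_dx Qk_dy v0)+
  note c = cu(1-3) v0[THEN Qk_continuous] q[THEN Qk_continuous] Dv[THEN Qk_continuous] wg[THEN Qk_continuous]
    Qk_continuous[OF Qk_dx[OF q(1)]] Qk_continuous[OF Qk_dy[OF q(2)]]
    uT[unfolded C2_cell_def has_dx_cell_def has_dy_cell_def, THEN conjunct2, THEN conjunct1, THEN conjunct2, THEN conjunct1]
    uT[unfolded C2_cell_def has_dx_cell_def has_dy_cell_def, THEN conjunct2, THEN conjunct2, THEN conjunct2, THEN conjunct2, THEN conjunct1]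
  have 1: "cint X T (\<lambda>p. dx Omega_bar u p * fst (weak_gradient k X v T p)) + cint X T (\<lambda>p. dy Omega_bar u p * snd (weak_gradient k X v T p))
      = cint X T (\<lambda>p. fst (weak_gradient k X v T p) * q1 p + snd (weak_gradient k X v T p) * q2 p)"
    using t1[OF wg(1)] t2[OF wg(2)] by (subst cint_add) (auto intro!: continuous_on_mult c simp: mult.commute)
  have 2: "cint X T (\<lambda>p. wf_0 v T p * (dx UNIV q1 p + dy UNIV q2 p))
      = cint X T (\<lambda>p. wf_0 v T p * dx UNIV q1 p) + cint X T (\<lambda>p. wf_0 v T p * dy UNIV q2 p)"
    unfolding distrib_left by (intro cint_add continuous_on_mult c)
  have 3: "cint X T (\<lambda>p. dx UNIV (wf_0 v T) p * q1 p) = cint X T (\<lambda>p. dx UNIV (wf_0 v T) p * dx Omega_bar u p)"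
    "cint X T (\<lambda>p. dy UNIV (wf_0 v T) p * q2 p) = cint X T (\<lambda>p. dy UNIV (wf_0 v T) p * dy Omega_bar u p)"
    using t1[OF Dv(1)] t2[OF Dv(2)] by (simp_all add: mult.commute)
  have 4: "cint X T (\<lambda>p. wf_0 v T p * laplacian Omega_bar u p)
      = cint X T (\<lambda>p. wf_0 v T p * dx Omega_bar (dx Omega_bar u) p) + cint X T (\<lambda>p. wf_0 v T p * dy Omega_bar (dy Omega_bar u) p)"
    unfolding laplacian_def distrib_left by (intro cint_add continuous_on_mult c)
  note bs = bcont_b[OF v M(2)] cu(2,3)[THEN bcont_cell[OF M]] v0[THEN Qk_continuous, THEN bcont_cell[OF M]]
    q[THEN Qk_continuous, THEN bcont_cell[OF M]]
  let ?v0 = "\<lambda>e (n::point) t. wf_0 v T (edge_point X e t)" and ?vb = "\<lambda>e (n::point) t. wf_b v e t"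
  let ?ux = "\<lambda>e (n::point) t. dx Omega_bar u (edge_point X e t)" and ?uy = "\<lambda>e (n::point) t. dy Omega_bar u (edge_point X e t)"
  let ?q1 = "\<lambda>e (n::point) t. q1 (edge_point X e t)" and ?q2 = "\<lambda>e (n::point) t. q2 (edge_point X e t)"
  have 5: "boundary_integral X T (\<lambda>e n t. jump_b X v T e t *
        ((?ux e n t - ?q1 e n t) * fst n + (?uy e n t - ?q2 e n t) * snd n))
    = (boundary_integral X T (\<lambda>e n t. ?v0 e n t * ?ux e n t * fst n) + boundary_integral X T (\<lambda>e n t. ?v0 e n t * ?uy e n t * snd n)
      - (boundary_integral X T (\<lambda>e n t. ?v0 e n t * ?q1 e n t * fst n) + boundary_integral X T (\<lambda>e n t. ?v0 e n t * ?q2 e n t * snd n)))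
      - (boundary_integral X T (\<lambda>e n t. ?vb e n t * (?ux e n t * fst n + ?uy e n t * snd n))
       - boundary_integral X T (\<lambda>e n t. ?vb e n t * (?q1 e n t * fst n + ?q2 e n t * snd n)))" (is "?L = _")
  proof -
    have "?L = boundary_integral X T (\<lambda>e n t. (?v0 e n t * ?ux e n t * fst n + ?v0 e n t * ?uy e n t * snd n
      - (?v0 e n t * ?q1 e n t * fst n + ?v0 e n t * ?q2 e n t * snd n))
      - (?vb e n t * (?ux e n t * fst n + ?uy e n t * snd n) - ?vb e n t * (?q1 e n t * fst n + ?q2 e n t * snd n)))"
      unfolding jump_b_def by (simp add: algebra_simps)
    also have "\<dots> = (boundary_integral X T (\<lambda>e n t. ?v0 e n t * ?ux e n t * fst n) + boundary_integral X T (\<lambda>e n t. ?v0 e n t * ?uy e n t * snd n)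
      - (boundary_integral X T (\<lambda>e n t. ?v0 e n t * ?q1 e n t * fst n) + boundary_integral X T (\<lambda>e n t. ?v0 e n t * ?q2 e n t * snd n)))
      - (boundary_integral X T (\<lambda>e n t. ?vb e n t * (?ux e n t * fst n + ?uy e n t * snd n))
       - boundary_integral X T (\<lambda>e n t. ?vb e n t * (?q1 e n t * fst n + ?q2 e n t * snd n)))"
      by ((subst boundary_integral_diff | subst boundary_integral_add), (intro bcont_diff bcont_add bcont_mult bcont_const bs)+)+ (rule refl)
    finally show ?thesis .
  qed
  show ?thesis
    unfolding weak_gradient_Q_proj[OF M u wg] 1 weak_gradient_char(2)[OF M v q] 2 4 5
    using integration_by_parts_x[OF M Qk_has_dx_cell[OF v0] Qk_has_dx_cell[OF q(1)]]
      integration_by_parts_y[OF M Qk_has_dy_cell[OF v0] Qk_has_dy_cell[OF q(2)]]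
      integration_by_parts_x[OF M Qk_has_dx_cell[OF v0] C2_cell_dxx[OF uT]]
      integration_by_parts_y[OF M Qk_has_dy_cell[OF v0] C2_cell_dyy[OF uT]] 3 by linarith
qed

section \<open>Boundary conditions and cancellation over the mesh\<close>

lemma zero_edge_proj:
  assumes M: "mesh N X" "T \<in> cells N" "(e, n) \<in> cell_boundary T"
    and g: "\<forall>t\<in>edge_range X e. g (edge_point X e t) = 0"
  shows "proj_edge k X g e = (\<lambda>t. 0)"
proof -
  obtain a b where e: "edge_range X e = {a..b}" "a < b" by (rule edge_range_cell[OF M])
  have "continuous_on {a..b} (\<lambda>t. g (edge_point X e t)) \<longleftrightarrow> continuous_on {a..b} (\<lambda>t. 0::real)"
    using g e(1) by (intro continuous_on_cong) auto
  then have c: "continuous_on {a..b} (\<lambda>t. g (edge_point X e t))" by simp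
  have "(\<lambda>t. 0) = proj_edge k X g e"
  proof (rule proj_edge_char(3)[OF e c Pk_0])
    show "edge_integral X e (\<lambda>t. 0 * \<psi> t) = edge_integral X e (\<lambda>t. g (edge_point X e t) * \<psi> t)" for \<psi>
      using g by (intro edge_integral_cong) simp
  qed
  then show ?thesis by simp
qed

text \<open>At the midpoint of an edge the varying coordinate lies strictly between \<open>0\<close>
  and \<open>1\<close>, so a frontier point there forces the fixed coordinate to be \<open>0\<close>
  or \<open>1\<close>.\<close>

lemma frontier_edge:
  assumes M: "mesh N X" "T \<in> cells N" and en: "(e, n) \<in> cell_boundary T" and fr: "edge_set X e \<subseteq> frontier Omega"
  shows "(fst n = 0 \<and> (\<forall>t\<in>edge_range X e. \<exists>r\<in>{0,1}. edge_point X e t = (t, r) \<and> t \<in> {0..1})) \<or>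
         (snd n = 0 \<and> (\<forall>t\<in>edge_range X e. \<exists>r\<in>{0,1}. edge_point X e t = (r, t) \<and> t \<in> {0..1}))"
proof (cases e)
  case (Hor i j)
  then have n: "fst n = 0" and i: "i = fst T" using en unfolding cell_boundary_def case_prod_unfold by auto
  have less: "X i < X (Suc i)" using mesh_less[OF M] i by simp
  have I: "{X i..X (Suc i)} \<subseteq> {0..1}" using cell_intervals(1)[OF M] i by simp
  define s where "s = (X i + X (Suc i)) / 2"
  have s: "s \<in> {X i..X (Suc i)}" "0 < s" "s < 1" using less I unfolding s_def by auto
  have "edge_point X e s \<in> edge_set X e" using s(1) unfolding edge_set_def Hor by simp
  then have "(s, X j) \<in> frontier Omega" using fr unfolding Hor by auto
  then have "X j \<in> {0, 1}" unfolding frontier_Omega using s(2,3) by auto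
  then show ?thesis using n I unfolding Hor by auto
next
  case (Ver i j)
  then have n: "snd n = 0" and j: "j = snd T" using en unfolding cell_boundary_def case_prod_unfold by auto
  have less: "X j < X (Suc j)" using mesh_less'[OF M] j by simp
  have I: "{X j..X (Suc j)} \<subseteq> {0..1}" using cell_intervals(2)[OF M] j by simp
  define s where "s = (X j + X (Suc j)) / 2"
  have s: "s \<in> {X j..X (Suc j)}" "0 < s" "s < 1" using less I unfolding s_def by auto
  have "edge_point X e s \<in> edge_set X e" using s(1) unfolding edge_set_def Ver by simp
  then have "(X i, s) \<in> frontier Omega" using fr unfolding Ver by auto
  then have "X i \<in> {0, 1}" unfolding frontier_Omega using s(2,3) by auto
  then show ?thesis using n I unfolding Ver by auto
qed

text \<open>On a boundary edge the normal is a coordinate vector, so the condition on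
  \<open>wf_g\<close> concerns the projection of the normal derivative of \<open>u\<close> alone,
  and a zero trace has zero projection.\<close>

lemma Q_proj_in_V0_space:
  assumes M: "mesh N X" and u: "\<forall>T\<in>cells N. C2_cell X T u"
    and u0: "\<forall>p\<in>frontier Omega. u p = 0"
    and ux: "\<And>r s. r \<in> {0,1} \<Longrightarrow> s \<in> {0..1} \<Longrightarrow> dx Omega_bar u (r, s) = 0"
    and uy: "\<And>r s. r \<in> {0,1} \<Longrightarrow> s \<in> {0..1} \<Longrightarrow> dy Omega_bar u (s, r) = 0"
  shows "Q_proj k X u \<in> V0_space k N X"
proof -
  have "wf_b (Q_proj k X u) e t = 0 \<and> wf_g (Q_proj k X u) e t \<bullet> n = 0"
    if T: "T \<in> cells N" and en: "(e, n) \<in> cell_boundary T" and fr: "edge_set X e \<subseteq> frontier Omega"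
      and t: "t \<in> edge_range X e" for T e n t
  proof
    have "\<forall>t\<in>edge_range X e. u (edge_point X e t) = 0"
      using fr u0 unfolding edge_set_def by blast
    from zero_edge_proj[OF M T en, of u k, OF this] show "wf_b (Q_proj k X u) e t = 0" by (simp add: Q_proj_b)
    note g = Q_proj_g[OF M T u[rule_format, OF T] en]
    from frontier_edge[OF M T en fr] show "wf_g (Q_proj k X u) e t \<bullet> n = 0"
    proof (elim disjE conjE)
      assume n: "fst n = 0" and *: "\<forall>t\<in>edge_range X e. \<exists>r\<in>{0,1}. edge_point X e t = (t, r) \<and> t \<in> {0..1}"
      have "\<forall>t\<in>edge_range X e. dy Omega_bar u (edge_point X e t) = 0"
        using * uy by fastforce
      from zero_edge_proj[OF M T en, of "dy Omega_bar u" k, OF this] show ?thesis using n by (simp add: g inner_prod_def)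
    next
      assume n: "snd n = 0" and *: "\<forall>t\<in>edge_range X e. \<exists>r\<in>{0,1}. edge_point X e t = (r, t) \<and> t \<in> {0..1}"
      have "\<forall>t\<in>edge_range X e. dx Omega_bar u (edge_point X e t) = 0"
        using * ux by fastforce
      from zero_edge_proj[OF M T en, of "dx Omega_bar u" k, OF this] show ?thesis using n by (simp add: g inner_prod_def)
    qed
  qed
  then show ?thesis using Q_proj_in_V_space[OF M u] unfolding V0_space_def by fast
qed

lemma V0_space_boundary:
  assumes M: "mesh N X" and v: "v \<in> V0_space k N X"
  shows "i < N \<Longrightarrow> j \<in> {0, N} \<Longrightarrow> t \<in> {X i..X (Suc i)} \<Longrightarrow> wf_b v (Hor i j) t = 0 \<and> snd (wf_g v (Hor i j) t) = 0"
    and "j < N \<Longrightarrow> i \<in> {0, N} \<Longrightarrow> t \<in> {X j..X (Suc j)} \<Longrightarrow> wf_b v (Ver i j) t = 0 \<and> fst (wf_g v (Ver i j) t) = 0"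
proof -
  have V: "wf_b v e t = 0 \<and> wf_g v e t \<bullet> n = 0"
    if "T \<in> cells N" "(e, n) \<in> cell_boundary T" "edge_set X e \<subseteq> frontier Omega" "t \<in> edge_range X e" for T e n t
    using v that unfolding V0_space_def by fast
  show "wf_b v (Hor i j) t = 0 \<and> snd (wf_g v (Hor i j) t) = 0"
    if i: "i < N" and j: "j \<in> {0, N}" and t: "t \<in> {X i..X (Suc i)}"
  proof -
    obtain T n where "T \<in> cells N" "(Hor i j, n) \<in> cell_boundary T" "n = (0, -1) \<or> n = (0, 1)"
    proof (cases "j = 0")
      case True
      then show ?thesis using i by (intro that[of "(i, 0)" "(0, -1)"]) (auto simp: cells_def cell_boundary_def)
    next
      case False
      \<comment> \<open>The membership condition is phrased through cells; the edge at index
        \<open>N\<close> is the upper side of the cell in row \<open>N - 1\<close>.\<close>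
      then show ?thesis using i j by (intro that[of "(i, N - 1)" "(0, 1)"]) (auto simp: cells_def cell_boundary_def)
    qed
    then show ?thesis
      using V[of T "Hor i j" n t] boundary_edges_in_frontier(1)[OF M i j] t by (auto simp: inner_prod_def)
  qed
  show "wf_b v (Ver i j) t = 0 \<and> fst (wf_g v (Ver i j) t) = 0"
    if j: "j < N" and i: "i \<in> {0, N}" and t: "t \<in> {X j..X (Suc j)}"
  proof -
    obtain T n where "T \<in> cells N" "(Ver i j, n) \<in> cell_boundary T" "n = (-1, 0) \<or> n = (1, 0)"
    proof (cases "i = 0")
      case True
      then show ?thesis using j by (intro that[of "(0, j)" "(-1, 0)"]) (auto simp: cells_def cell_boundary_def)
    next
      case False
      then show ?thesis using i j by (intro that[of "(N - 1, j)" "(1, 0)"]) (auto simp: cells_def cell_boundary_def)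
    qed
    then show ?thesis
      using V[of T "Ver i j" n t] boundary_edges_in_frontier(2)[OF M j i] t by (auto simp: inner_prod_def)
  qed
qed

lemma edge_integral_eq_0: "(\<And>t. t \<in> edge_range X e \<Longrightarrow> f t = 0) \<Longrightarrow> edge_integral X e f = 0"
  using edge_integral_cong[of X e f "\<lambda>t. 0"] by (simp add: edge_integral_0)

text \<open>Both \<open>wf_b v\<close> and the flux are single-valued on edges, so neighbouring
  cells contribute opposite terms; on the boundary \<open>wf_b v\<close> is zero.\<close>

lemma sum_boundary_b:
  assumes M: "mesh N X" and v: "v \<in> V0_space k N X"
  shows "(\<Sum>T\<in>cells N. boundary_integral X T (\<lambda>e n t. wf_b v e t *
      (normal_flux X gx gy e n t))) = 0"
proof (rule boundary_integral_telescope[where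
    A = "\<lambda>i j. edge_integral X (Hor i j) (\<lambda>t. wf_b v (Hor i j) t * gy (t, X j))" and
    B = "\<lambda>i j. edge_integral X (Ver i j) (\<lambda>t. wf_b v (Ver i j) t * gx (X i, t))"])
  fix i assume "i < N"
  then show "edge_integral X (Hor i 0) (\<lambda>t. wf_b v (Hor i 0) t * gy (t, X 0)) = 0 \<and>
      edge_integral X (Hor i N) (\<lambda>t. wf_b v (Hor i N) t * gy (t, X N)) = 0"
    using V0_space_boundary(1)[OF M v] by (auto intro!: edge_integral_eq_0)
next
  fix j assume "j < N"
  then show "edge_integral X (Ver 0 j) (\<lambda>t. wf_b v (Ver 0 j) t * gx (X 0, t)) = 0 \<and>
      edge_integral X (Ver N j) (\<lambda>t. wf_b v (Ver N j) t * gx (X N, t)) = 0"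
    using V0_space_boundary(2)[OF M v] by (auto intro!: edge_integral_eq_0)
qed (simp add: boundary_integral_expand edge_integral_uminus)

text \<open>As for \<open>sum_boundary_b\<close>. On the boundary only the normal component of
  \<open>wf_g v\<close> is zero, and it is the component that occurs here.\<close>

lemma sum_boundary_g:
  assumes M: "mesh N X" and v: "v \<in> V0_space k N X"
  shows "(\<Sum>T\<in>cells N. boundary_integral X T (\<lambda>e n t.
      normal_g v e n t * w (edge_point X e t))) = 0"
proof (rule boundary_integral_telescope[where
    A = "\<lambda>i j. edge_integral X (Hor i j) (\<lambda>t. snd (wf_g v (Hor i j) t) * w (t, X j))" and
    B = "\<lambda>i j. edge_integral X (Ver i j) (\<lambda>t. fst (wf_g v (Ver i j) t) * w (X i, t))"])
  fix i assume "i < N"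
  then show "edge_integral X (Hor i 0) (\<lambda>t. snd (wf_g v (Hor i 0) t) * w (t, X 0)) = 0 \<and>
      edge_integral X (Hor i N) (\<lambda>t. snd (wf_g v (Hor i N) t) * w (t, X N)) = 0"
    using V0_space_boundary(1)[OF M v] by (auto intro!: edge_integral_eq_0)
next
  fix j assume "j < N"
  then show "edge_integral X (Ver 0 j) (\<lambda>t. fst (wf_g v (Ver 0 j) t) * w (X 0, t)) = 0 \<and>
      edge_integral X (Ver N j) (\<lambda>t. fst (wf_g v (Ver N j) t) * w (X N, t)) = 0"
    using V0_space_boundary(2)[OF M v] by (auto intro!: edge_integral_eq_0)
qed (simp add: boundary_integral_expand edge_integral_uminus)

text \<open>The equation holds almost everywhere in the open square, while a closed cell may touch
  its frontier; the frontier is a null set.\<close>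

lemma load_cell:
  assumes M: "mesh N X" "T \<in> cells N"
    and f: "AE p in lebesgue. p \<in> Omega \<longrightarrow> g p = f p"
    and c: "continuous_on (cell_set X T) g" "continuous_on (cell_set X T) \<phi>"
  shows "inner_L2 (cell_set X T) f \<phi> = cint X T (\<lambda>p. g p * \<phi> p)"
proof -
  let ?S = "cell_set X T"
  have "negligible (frontier Omega)"
    by (intro negligible_convex_frontier convex_Times) auto
  then have "AE p in lebesgue. p \<notin> frontier Omega"
    using AE_not_in negligible_iff_null_sets by blast
  with f have ae: "AE p in lebesgue. indicator ?S p *\<^sub>R (g p * \<phi> p) = indicator ?S p *\<^sub>R (f p * \<phi> p)"
  proof eventually_elim
    case (elim p)
    then show ?case
      using cell_subset_Omega_bar[OF M] unfolding frontier_Omega by (auto simp: indicator_def)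
  qed
  have "set_integrable lebesgue ?S (\<lambda>p. g p * \<phi> p)"
    using c unfolding cell_set_def rect_eq_cbox
    by (intro absolutely_integrable_continuous continuous_on_mult)
  then have m: "(\<lambda>p. indicator ?S p *\<^sub>R (g p * \<phi> p)) \<in> borel_measurable lebesgue"
    unfolding set_integrable_def by (rule borel_measurable_integrable)
  \<comment> \<open>Measurability of the integrand containing \<open>f\<close> is inherited from the
    continuous one by equality almost everywhere.\<close>
  have "(LINT p:?S|lebesgue. g p * \<phi> p) = (LINT p:?S|lebesgue. f p * \<phi> p)"
    unfolding set_lebesgue_integral_def by (rule integral_cong_AE[OF m borel_measurable_AE[OF m ae] ae])
  then have "inner_L2 ?S f \<phi> = inner_L2 ?S g \<phi>" unfolding inner_L2_def by simp
  then show ?thesis using inner_L2_cell[OF c] by simp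
qed

subsection \<open>Energy estimate\<close>

text \<open>The total coefficient of the value jump of a test function. The three lines come from
  the weak Laplacian, the weak gradient and the stabilizer; the last is present because the
  projection of \<open>u\<close> itself has jumps. \<open>res_x\<close> and \<open>res_y\<close> do
  the same for the gradient jumps.\<close>

definition res_b :: "nat \<Rightarrow> real \<Rightarrow> nat \<Rightarrow> (point \<Rightarrow> real) \<Rightarrow> cell \<Rightarrow> edge \<Rightarrow> point \<Rightarrow> real \<Rightarrow> real"
  where "res_b k \<epsilon> N u T e n t = (let X = shishkin_node k \<epsilon> N; w = laplacian Omega_bar u; z = proj_cell k X w T;
      q1 = proj_cell k X (dx Omega_bar u) T; q2 = proj_cell k X (dy Omega_bar u) T; p = edge_point X e t in
    \<epsilon>\<^sup>2 * ((dx UNIV z p - dx Omega_bar w p) * fst n + (dy UNIV z p - dy Omega_bar w p) * snd n)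
    + ((dx Omega_bar u p - q1 p) * fst n + (dy Omega_bar u p - q2 p) * snd n)
    + weight_b k \<epsilon> N * jump_b X (Q_proj k X u) T e t)"

definition res_x :: "nat \<Rightarrow> real \<Rightarrow> nat \<Rightarrow> (point \<Rightarrow> real) \<Rightarrow> cell \<Rightarrow> edge \<Rightarrow> point \<Rightarrow> real \<Rightarrow> real"
  where "res_x k \<epsilon> N u T e n t = (let X = shishkin_node k \<epsilon> N; w = laplacian Omega_bar u; p = edge_point X e t in
    weight_g k \<epsilon> N * jump_x X (Q_proj k X u) T e t - \<epsilon>\<^sup>2 * (proj_cell k X w T p - w p) * fst n)"

definition res_y :: "nat \<Rightarrow> real \<Rightarrow> nat \<Rightarrow> (point \<Rightarrow> real) \<Rightarrow> cell \<Rightarrow> edge \<Rightarrow> point \<Rightarrow> real \<Rightarrow> real"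
  where "res_y k \<epsilon> N u T e n t = (let X = shishkin_node k \<epsilon> N; w = laplacian Omega_bar u; p = edge_point X e t in
    weight_g k \<epsilon> N * jump_y X (Q_proj k X u) T e t - \<epsilon>\<^sup>2 * (proj_cell k X w T p - w p) * snd n)"

text \<open>The volume term in \<open>cell_form_Q_proj\<close> is the differential operator tested
  with \<open>wf_0 v\<close>. The last three boundary integrals contain only single-valued
  quantities and disappear after summation.\<close>

lemma
  fixes k \<epsilon> N defines "X \<equiv> shishkin_node k \<epsilon> N"
  assumes M: "mesh N X" "T \<in> cells N" and u: "\<forall>T\<in>cells N. C2_cell X T u"
    and w: "C2_cell X T (laplacian Omega_bar u)"
  shows bcont_res: "bcont X T (res_b k \<epsilon> N u T)" "bcont X T (res_x k \<epsilon> N u T)" "bcont X T (res_y k \<epsilon> N u T)"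
    and cell_form_Q_proj: "v \<in> V_space k N \<Longrightarrow> cell_form k \<epsilon> N (Q_proj k X u) v T =
      cint X T (\<lambda>p. (\<epsilon>\<^sup>2 * laplacian Omega_bar (laplacian Omega_bar u) p - laplacian Omega_bar u p) * wf_0 v T p)
      + boundary_integral X T (\<lambda>e n t. jump_b X v T e t * res_b k \<epsilon> N u T e n t
          + (jump_x X v T e t * res_x k \<epsilon> N u T e n t + jump_y X v T e t * res_y k \<epsilon> N u T e n t))
      + (boundary_integral X T (\<lambda>e n t. wf_b v e t * (normal_flux X (dx Omega_bar u) (dy Omega_bar u) e n t))
      - \<epsilon>\<^sup>2 * boundary_integral X T (\<lambda>e n t. wf_b v e t * (normal_flux X (dx Omega_bar (laplacian Omega_bar u)) (dy Omega_bar (laplacian Omega_bar u)) e n t))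
      + \<epsilon>\<^sup>2 * boundary_integral X T (\<lambda>e n t. normal_g v e n t * laplacian Omega_bar u (edge_point X e t)))"
proof -
  define w where "w = laplacian Omega_bar u"
  note w = w[folded w_def]
  note cu = C2_cell_cont[OF u[rule_format, OF M(2)]]
  note cw = C2_cell_cont[OF w]
  define z where "z = proj_cell k X w T"
  define q1 where "q1 = proj_cell k X (dx Omega_bar u) T"
  define q2 where "q2 = proj_cell k X (dy Omega_bar u) T"
  have Q: "z \<in> Qk k" "q1 \<in> Qk k" "q2 \<in> Qk k"
    unfolding z_def q1_def q2_def using proj_cell_eq_proj2(2)[OF M] cw(1) cu(2,3) by blast+
  have QV: "Q_proj k X u \<in> V_space k N" by (rule Q_proj_in_V_space[OF M(1) u])
  note bs = cu(2,3)[THEN bcont_cell[OF M]] cw(1-3)[THEN bcont_cell[OF M]]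
    Q[THEN Qk_continuous, THEN bcont_cell[OF M]] Qk_continuous[OF Qk_dx[OF Q(1)], THEN bcont_cell[OF M]]
    Qk_continuous[OF Qk_dy[OF Q(1)], THEN bcont_cell[OF M]] bcont_jumps[OF M QV]
  note bi = bcont_add bcont_diff bcont_mult bcont_const
  let ?G = "\<lambda>e (n::point) t. (dx UNIV z (edge_point X e t) - dx Omega_bar w (edge_point X e t)) * fst n
       + (dy UNIV z (edge_point X e t) - dy Omega_bar w (edge_point X e t)) * snd n"
  let ?H = "\<lambda>e (n::point) t. (dx Omega_bar u (edge_point X e t) - q1 (edge_point X e t)) * fst n
       + (dy Omega_bar u (edge_point X e t) - q2 (edge_point X e t)) * snd n"
  let ?D = "\<lambda>e (n::point) t. z (edge_point X e t) - w (edge_point X e t)"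
  let ?jb = "jump_b X (Q_proj k X u) T" and ?jx = "jump_x X (Q_proj k X u) T" and ?jy = "jump_y X (Q_proj k X u) T"
  have rb: "res_b k \<epsilon> N u T = (\<lambda>e n t. \<epsilon>\<^sup>2 * ?G e n t + ?H e n t + weight_b k \<epsilon> N * ?jb e t)"
    and rx: "res_x k \<epsilon> N u T = (\<lambda>e n t. weight_g k \<epsilon> N * ?jx e t - \<epsilon>\<^sup>2 * ?D e n t * fst n)"
    and ry: "res_y k \<epsilon> N u T = (\<lambda>e n t. weight_g k \<epsilon> N * ?jy e t - \<epsilon>\<^sup>2 * ?D e n t * snd n)"
    unfolding res_b_def[abs_def] res_x_def[abs_def] res_y_def[abs_def] Let_def X_def[symmetric] w_def[symmetric]
      z_def q1_def q2_def by blast+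
  have bG: "bcont X T ?G" and bH: "bcont X T ?H" and bD: "bcont X T ?D" by (intro bi bs)+
  show "bcont X T (res_b k \<epsilon> N u T)" "bcont X T (res_x k \<epsilon> N u T)" "bcont X T (res_y k \<epsilon> N u T)"
    unfolding rb rx ry by (intro bi bs bG bH bD)+
  assume v: "v \<in> V_space k N"
  note bj = bcont_jumps[OF M v]
  note lc = laplacian_consistency[OF M u w w_def v, folded z_def]
  note gc = gradient_consistency[OF M u v, folded q1_def q2_def]
  have cv: "continuous_on (cell_set X T) (wf_0 v T)" by (rule Qk_continuous[OF V_space_0[OF v M(2)]])
  have 1: "cint X T (\<lambda>p. (\<epsilon>\<^sup>2 * laplacian Omega_bar w p - w p) * wf_0 v T p)
      = \<epsilon>\<^sup>2 * cint X T (\<lambda>p. wf_0 v T p * laplacian Omega_bar w p) - cint X T (\<lambda>p. wf_0 v T p * w p)"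
  proof -
    have "cint X T (\<lambda>p. (\<epsilon>\<^sup>2 * laplacian Omega_bar w p - w p) * wf_0 v T p)
        = cint X T (\<lambda>p. \<epsilon>\<^sup>2 * (wf_0 v T p * laplacian Omega_bar w p) - wf_0 v T p * w p)"
      by (simp add: algebra_simps)
    also have "\<dots> = cint X T (\<lambda>p. \<epsilon>\<^sup>2 * (wf_0 v T p * laplacian Omega_bar w p)) - cint X T (\<lambda>p. wf_0 v T p * w p)"
      by (intro cint_diff continuous_on_mult continuous_on_const cv cw)
    finally show ?thesis by (simp add: cint_def)
  qed
  have 2: "boundary_integral X T (\<lambda>e n t. jump_b X v T e t * res_b k \<epsilon> N u T e n t
          + (jump_x X v T e t * res_x k \<epsilon> N u T e n t + jump_y X v T e t * res_y k \<epsilon> N u T e n t))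
      = \<epsilon>\<^sup>2 * boundary_integral X T (\<lambda>e n t. jump_b X v T e t * ?G e n t)
      + boundary_integral X T (\<lambda>e n t. jump_b X v T e t * ?H e n t)
      + weight_b k \<epsilon> N * boundary_integral X T (\<lambda>e n t. ?jb e t * jump_b X v T e t)
      + (weight_g k \<epsilon> N * boundary_integral X T (\<lambda>e n t. ?jx e t * jump_x X v T e t + ?jy e t * jump_y X v T e t)
      - \<epsilon>\<^sup>2 * boundary_integral X T (\<lambda>e n t. (jump_x X v T e t * fst n + jump_y X v T e t * snd n) * ?D e n t))" (is "?L = _")
  proof -
    have "?L = boundary_integral X T (\<lambda>e n t. \<epsilon>\<^sup>2 * (jump_b X v T e t * ?G e n t) + jump_b X v T e t * ?H e n t
        + weight_b k \<epsilon> N * (?jb e t * jump_b X v T e t)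
        + (weight_g k \<epsilon> N * (?jx e t * jump_x X v T e t + ?jy e t * jump_y X v T e t)
        - \<epsilon>\<^sup>2 * ((jump_x X v T e t * fst n + jump_y X v T e t * snd n) * ?D e n t)))"
      unfolding rb rx ry by (simp add: algebra_simps)
    also have "\<dots> = boundary_integral X T (\<lambda>e n t. \<epsilon>\<^sup>2 * (jump_b X v T e t * ?G e n t))
      + boundary_integral X T (\<lambda>e n t. jump_b X v T e t * ?H e n t)
      + boundary_integral X T (\<lambda>e n t. weight_b k \<epsilon> N * (?jb e t * jump_b X v T e t))
      + (boundary_integral X T (\<lambda>e n t. weight_g k \<epsilon> N * (?jx e t * jump_x X v T e t + ?jy e t * jump_y X v T e t))
      - boundary_integral X T (\<lambda>e n t. \<epsilon>\<^sup>2 * ((jump_x X v T e t * fst n + jump_y X v T e t * snd n) * ?D e n t)))"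
    proof -
      let ?A = "\<lambda>e n t. \<epsilon>\<^sup>2 * (jump_b X v T e t * ?G e n t)" and ?B = "\<lambda>e n t. jump_b X v T e t * ?H e n t"
      let ?C = "\<lambda>e (n::point) t. weight_b k \<epsilon> N * (?jb e t * jump_b X v T e t)"
      let ?E = "\<lambda>e (n::point) t. weight_g k \<epsilon> N * (?jx e t * jump_x X v T e t + ?jy e t * jump_y X v T e t)"
      let ?F = "\<lambda>e n t. \<epsilon>\<^sup>2 * ((jump_x X v T e t * fst n + jump_y X v T e t * snd n) * ?D e n t)"
      have b: "bcont X T ?A" "bcont X T ?B" "bcont X T ?C" "bcont X T ?E" "bcont X T ?F"
        by (intro bi bj bG bH bD bs)+
      show ?thesis
        unfolding boundary_integral_add[OF bcont_add[OF bcont_add[OF b(1,2)] b(3)] bcont_diff[OF b(4,5)]]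
          boundary_integral_add[OF bcont_add[OF b(1,2)] b(3)] boundary_integral_add[OF b(1,2)]
          boundary_integral_diff[OF b(4,5)] ..
    qed
    also have "\<dots> = \<epsilon>\<^sup>2 * boundary_integral X T (\<lambda>e n t. jump_b X v T e t * ?G e n t)
      + boundary_integral X T (\<lambda>e n t. jump_b X v T e t * ?H e n t)
      + weight_b k \<epsilon> N * boundary_integral X T (\<lambda>e n t. ?jb e t * jump_b X v T e t)
      + (weight_g k \<epsilon> N * boundary_integral X T (\<lambda>e n t. ?jx e t * jump_x X v T e t + ?jy e t * jump_y X v T e t)
      - \<epsilon>\<^sup>2 * boundary_integral X T (\<lambda>e n t. (jump_x X v T e t * fst n + jump_y X v T e t * snd n) * ?D e n t))"
      by (intro arg_cong2[where f = "(+)"] arg_cong2[where f = "(-)"] refl boundary_integral_cmult; intro bi bj bG bH bD bs)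
    finally show ?thesis .
  qed
  show "cell_form k \<epsilon> N (Q_proj k X u) v T =
      cint X T (\<lambda>p. (\<epsilon>\<^sup>2 * laplacian Omega_bar (laplacian Omega_bar u) p - laplacian Omega_bar u p) * wf_0 v T p)
      + boundary_integral X T (\<lambda>e n t. jump_b X v T e t * res_b k \<epsilon> N u T e n t
          + (jump_x X v T e t * res_x k \<epsilon> N u T e n t + jump_y X v T e t * res_y k \<epsilon> N u T e n t))
      + (boundary_integral X T (\<lambda>e n t. wf_b v e t * (normal_flux X (dx Omega_bar u) (dy Omega_bar u) e n t))
      - \<epsilon>\<^sup>2 * boundary_integral X T (\<lambda>e n t. wf_b v e t * (normal_flux X (dx Omega_bar (laplacian Omega_bar u)) (dy Omega_bar (laplacian Omega_bar u)) e n t))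
      + \<epsilon>\<^sup>2 * boundary_integral X T (\<lambda>e n t. normal_g v e n t * laplacian Omega_bar u (edge_point X e t)))"
    unfolding cell_form_def Let_def X_def[symmetric] w_def[symmetric] 1 2 lc gc
    by (simp add: algebra_simps)
qed

text \<open>Galerkin orthogonality up to consistency: with \<open>v = e\<close> the load cancels the
  volume terms, and what remains is the pairing of jumps of \<open>e\<close> with the
  residuals.\<close>

lemma energy_estimate:
  fixes k \<epsilon> N defines "X \<equiv> shishkin_node k \<epsilon> N"
  assumes M: "mesh N X" and u: "\<forall>T\<in>cells N. C2_cell X T u"
    and w: "\<forall>T\<in>cells N. C2_cell X T (laplacian Omega_bar u)"
    and QV: "Q_proj k X u \<in> V0_space k N X"
    and f: "AE p in lebesgue. p \<in> Omega \<longrightarrow>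
        \<epsilon>\<^sup>2 * laplacian Omega_bar (laplacian Omega_bar u) p - laplacian Omega_bar u p = f p"
    and uN: "wg_solution k \<epsilon> N f uN"
    and pos: "0 < weight_b k \<epsilon> N" "0 < weight_g k \<epsilon> N"
  defines "e \<equiv> wf_minus (Q_proj k X u) uN"
  shows "wg_form k \<epsilon> N e e \<le> (\<Sum>T\<in>cells N.
      boundary_integral X T (\<lambda>e n t. (res_b k \<epsilon> N u T e n t)\<^sup>2 / weight_b k \<epsilon> N
        + ((res_x k \<epsilon> N u T e n t)\<^sup>2 + (res_y k \<epsilon> N u T e n t)\<^sup>2) / weight_g k \<epsilon> N))"
proof -
  let ?wb = "weight_b k \<epsilon> N" and ?wg = "weight_g k \<epsilon> N"
  have uN0: "uN \<in> V0_space k N X"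
    and sol: "\<And>v. v \<in> V0_space k N X \<Longrightarrow> wg_form k \<epsilon> N uN v = (\<Sum>T\<in>cells N. inner_L2 (cell_set X T) f (wf_0 v T))"
    using uN unfolding wg_solution_def Let_def X_def by auto
  have e0: "e \<in> V0_space k N X" unfolding e_def by (rule V0_space_minus[OF QV uN0])
  have V: "Q_proj k X u \<in> V_space k N" "uN \<in> V_space k N" "e \<in> V_space k N"
    using QV uN0 e0 unfolding V0_space_def by auto
  note M' = M[unfolded X_def]
  define R where "R = (\<lambda>T e' n t. jump_b X e T e' t * res_b k \<epsilon> N u T e' n t
          + (jump_x X e T e' t * res_x k \<epsilon> N u T e' n t + jump_y X e T e' t * res_y k \<epsilon> N u T e' n t))"
  define S where "S = (\<lambda>T e' (n::point) t. jump_x X e T e' t * jump_x X e T e' t + jump_y X e T e' t * jump_y X e T e' t)"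
  define B where "B = (\<lambda>T e' (n::point) t. jump_b X e T e' t * jump_b X e T e' t)"
  define P where "P = (\<lambda>T e' n t. (res_b k \<epsilon> N u T e' n t)\<^sup>2 / ?wb
        + ((res_x k \<epsilon> N u T e' n t)\<^sup>2 + (res_y k \<epsilon> N u T e' n t)\<^sup>2) / ?wg)"
  have "wg_form k \<epsilon> N e e = (\<Sum>T\<in>cells N. cell_form k \<epsilon> N (Q_proj k X u) e T) - (\<Sum>T\<in>cells N. cell_form k \<epsilon> N uN e T)"
    unfolding wg_form_cells[OF M' V(3,3)] sum_subtractf[symmetric]
    by (intro sum.cong refl) (simp only: e_def cell_form_minus[OF M' _ V(1,2) V(3)[unfolded e_def]])
  \<comment> \<open>The discrete equation turns this sum into the load, and the differential
    equation turns the load into the volume integral that also occurs for the projection.\<close>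
  also have "(\<Sum>T\<in>cells N. cell_form k \<epsilon> N uN e T)
      = (\<Sum>T\<in>cells N. cint X T (\<lambda>p. (\<epsilon>\<^sup>2 * laplacian Omega_bar (laplacian Omega_bar u) p - laplacian Omega_bar u p) * wf_0 e T p))"
    unfolding wg_form_cells[OF M' V(2,3), symmetric] sol[OF e0]
  proof (intro sum.cong refl load_cell[OF M _ f] continuous_on_diff continuous_on_mult continuous_on_const)
    fix T assume T: "T \<in> cells N"
    show "continuous_on (cell_set X T) (laplacian Omega_bar u)"
      "continuous_on (cell_set X T) (laplacian Omega_bar (laplacian Omega_bar u))"
      using C2_cell_cont u w T by blast+
    show "continuous_on (cell_set X T) (wf_0 e T)" by (rule Qk_continuous[OF V_space_0[OF V(3) T]])
  qed
  also have "(\<Sum>T\<in>cells N. cell_form k \<epsilon> N (Q_proj k X u) e T) = (\<Sum>T\<in>cells N.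
      cint X T (\<lambda>p. (\<epsilon>\<^sup>2 * laplacian Omega_bar (laplacian Omega_bar u) p - laplacian Omega_bar u p) * wf_0 e T p)
      + boundary_integral X T (R T))"
  proof -
    let ?b = "\<lambda>g T. boundary_integral X T (\<lambda>e' n t. wf_b e e' t * (normal_flux X (dx Omega_bar g) (dy Omega_bar g) e' n t))"
    let ?g = "\<lambda>T. boundary_integral X T (\<lambda>e' n t. normal_g e e' n t * laplacian Omega_bar u (edge_point X e' t))"
    have "(\<Sum>T\<in>cells N. cell_form k \<epsilon> N (Q_proj k X u) e T) = (\<Sum>T\<in>cells N.
      (cint X T (\<lambda>p. (\<epsilon>\<^sup>2 * laplacian Omega_bar (laplacian Omega_bar u) p - laplacian Omega_bar u p) * wf_0 e T p)
      + boundary_integral X T (R T)) + (?b u T - \<epsilon>\<^sup>2 * ?b (laplacian Omega_bar u) T + \<epsilon>\<^sup>2 * ?g T))"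
      unfolding R_def X_def
      by (intro sum.cong refl cell_form_Q_proj[OF M' _ u[unfolded X_def] _ V(3)]) (use w in \<open>auto simp: X_def\<close>)
    also have "\<dots> = (\<Sum>T\<in>cells N.
      cint X T (\<lambda>p. (\<epsilon>\<^sup>2 * laplacian Omega_bar (laplacian Omega_bar u) p - laplacian Omega_bar u p) * wf_0 e T p)
      + boundary_integral X T (R T))
      + ((\<Sum>T\<in>cells N. ?b u T) - \<epsilon>\<^sup>2 * (\<Sum>T\<in>cells N. ?b (laplacian Omega_bar u) T) + \<epsilon>\<^sup>2 * (\<Sum>T\<in>cells N. ?g T))"
      by (simp only: sum.distrib sum_subtractf sum_distrib_left)
    finally show ?thesis unfolding sum_boundary_b[OF M e0] sum_boundary_g[OF M e0] by simp
  qed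
  finally have id: "wg_form k \<epsilon> N e e = (\<Sum>T\<in>cells N. boundary_integral X T (R T))"
    by (simp add: sum.distrib)
  have "boundary_integral X T (R T) \<le> (1/2) * cell_form k \<epsilon> N e e T + (1/2) * boundary_integral X T (P T)"
    if T: "T \<in> cells N" for T
  proof -
    note bj = bcont_jumps[OF M T V(3)]
    note br = bcont_res[OF M' T u[unfolded X_def] w[rule_format, OF T, unfolded X_def], folded X_def]
    note bi = bcont_add bcont_diff bcont_mult bcont_const
    have bR: "bcont X T (R T)" and bS: "bcont X T (S T)" and bB: "bcont X T (B T)" and bP: "bcont X T (P T)"
      unfolding R_def S_def B_def P_def divide_inverse power2_eq_square by (intro bi bj br)+
    \<comment> \<open>Young's inequality, scaled by the stabilizer weight: the jumps return with
      exactly half of the stabilizer, so half of the form remains on the left.\<close>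
    have y: "a * r \<le> c / 2 * (a * a) + r\<^sup>2 / (2 * c)" if "0 < c" for a r c :: real
    proof -
      have "0 \<le> (c * a - r)\<^sup>2 / (2 * c)" using that by simp
      also have "\<dots> = c / 2 * (a * a) + r\<^sup>2 / (2 * c) - a * r"
        using that by (simp add: field_simps power2_eq_square)
      finally show ?thesis by simp
    qed
    have "boundary_integral X T (R T)
        \<le> boundary_integral X T (\<lambda>e' n t. (?wb / 2) * B T e' n t + (?wg / 2) * S T e' n t + (1/2) * P T e' n t)"
    proof (rule boundary_integral_mono[OF bR])
      show "bcont X T (\<lambda>e' n t. (?wb / 2) * B T e' n t + (?wg / 2) * S T e' n t + (1/2) * P T e' n t)"
        by (intro bi bB bS bP)
      fix e' n t
      show "R T e' n t \<le> (?wb / 2) * B T e' n t + (?wg / 2) * S T e' n t + (1/2) * P T e' n t"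
        using y[OF pos(1), of "jump_b X e T e' t" "res_b k \<epsilon> N u T e' n t"]
          y[OF pos(2), of "jump_x X e T e' t" "res_x k \<epsilon> N u T e' n t"]
          y[OF pos(2), of "jump_y X e T e' t" "res_y k \<epsilon> N u T e' n t"]
        unfolding R_def B_def S_def P_def by (simp add: algebra_simps add_divide_distrib)
    qed
    also have "\<dots> = (?wb / 2) * boundary_integral X T (B T) + (?wg / 2) * boundary_integral X T (S T) + (1/2) * boundary_integral X T (P T)"
    proof -
      have s: "bcont X T (\<lambda>e' n t. c * F e' n t)" if "bcont X T F" for c F
        by (intro bcont_mult bcont_const that)
      show ?thesis
        unfolding boundary_integral_add[OF bcont_add[OF s[OF bB] s[OF bS]] s[OF bP]] boundary_integral_add[OF s[OF bB] s[OF bS]]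
          boundary_integral_cmult[OF bB] boundary_integral_cmult[OF bS] boundary_integral_cmult[OF bP] ..
    qed
    finally show ?thesis
      using cell_form_ge[OF M' T V(3)] unfolding S_def B_def X_def by linarith
  qed
  then have "wg_form k \<epsilon> N e e \<le> (\<Sum>T\<in>cells N. (1/2) * cell_form k \<epsilon> N e e T + (1/2) * boundary_integral X T (P T))"
    unfolding id by (rule sum_mono)
  also have "\<dots> = (1/2) * wg_form k \<epsilon> N e e + (1/2) * (\<Sum>T\<in>cells N. boundary_integral X T (P T))"
    unfolding wg_form_cells[OF M' V(3,3)] sum.distrib sum_distrib_left ..
  finally show ?thesis unfolding P_def by linarith
qed

subsection \<open>The Shishkin mesh\<close>

locale shishkin =
  fixes k :: nat and \<epsilon> :: real and N :: nat
  assumes eps: "0 < \<epsilon>" "\<epsilon> < 1" and N4: "4 \<le> N" "4 dvd N"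
begin

abbreviation "X \<equiv> shishkin_node k \<epsilon> N"
abbreviation "\<tau> \<equiv> transition k \<epsilon> N"
abbreviation "h \<equiv> fine_width k \<epsilon> N"
abbreviation "H \<equiv> coarse_width k \<epsilon> N"

definition \<rho> :: real where "\<rho> = h / \<epsilon>"

text \<open>Because \<open>4\<close> exceeds \<open>e\<close>. Powers of \<open>ln N\<close> may
  therefore be inserted as factors in upper bounds.\<close>

lemma ln_N: "1 < ln (real N)"
proof -
  have "exp (1::real) < 4" using e_less_272 by simp
  also have "4 \<le> real N" using N4(1) by simp
  finally have "ln (exp 1) < ln (real N)" using N4(1) by (subst ln_less_cancel_iff) auto
  then show ?thesis by simp
qed

lemma \<tau>_bounds: "0 < \<tau>" "\<tau> \<le> 1 / 4"
  using eps ln_N unfolding transition_def by auto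

lemma h_pos: "0 < h"
  using \<tau>_bounds N4 unfolding fine_width_def by simp

lemma h_le: "h \<le> 1 / real N"
  unfolding fine_width_def by (rule divide_right_mono) (use \<tau>_bounds in auto)

lemma H_bounds: "1 / real N \<le> H" "H \<le> 2 / real N"
proof -
  show "1 / real N \<le> H"
    unfolding coarse_width_def by (rule divide_right_mono) (use \<tau>_bounds in auto)
  show "H \<le> 2 / real N"
    unfolding coarse_width_def by (rule divide_right_mono) (use \<tau>_bounds in auto)
qed

lemma H_pos: "0 < H"
proof -
  have "0 < 1 / real N" using N4 by simp
  then show ?thesis using H_bounds(1) by linarith
qed

lemma h_eq: "h = \<epsilon> * \<rho>"
  using eps by (simp add: \<rho>_def)

lemma \<rho>_pos: "0 < \<rho>"
  using h_pos eps by (simp add: \<rho>_def)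

text \<open>Both arguments of the minimum in \<open>transition\<close> are at least
  \<open>\<epsilon> / 4\<close>, by \<open>\<epsilon> < 1\<close> and
  \<open>(k + 1) * ln N \<ge> 1\<close>.\<close>

lemma \<rho>_ge: "1 / real N \<le> \<rho>"
proof -
  have "\<epsilon> / 4 \<le> \<tau>"
  proof -
    have "\<epsilon> * (1 / 4) \<le> \<epsilon> * (real (k + 1) * ln (real N))"
    proof (rule mult_left_mono)
      have "1 * 1 \<le> real (k + 1) * ln (real N)" using ln_N by (intro mult_mono) auto
      then show "1 / 4 \<le> real (k + 1) * ln (real N)" by simp
    qed (use eps in simp)
    then show ?thesis using eps unfolding transition_def by (simp add: mult_ac)
  qed
  then have "\<epsilon> / real N \<le> h" using N4 unfolding fine_width_def by (simp add: divide_right_mono)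
  then show ?thesis using eps unfolding \<rho>_def by (simp add: pos_le_divide_eq mult.commute)
qed

lemma \<rho>_le: "\<rho> \<le> 4 * real (k + 1) * ln (real N) / real N"
proof -
  have "h \<le> 4 * (real (k + 1) * \<epsilon> * ln (real N)) / real N"
    using N4 unfolding fine_width_def transition_def by (intro divide_right_mono) auto
  then show ?thesis using eps unfolding \<rho>_def by (simp add: pos_divide_le_eq mult_ac)
qed

lemma \<rho>_le_const: "\<rho> \<le> 4 * real (k + 1)"
proof -
  have "ln (real N) \<le> real N" using ln_le_minus_one[of "real N"] N4 by simp
  then have "4 * real (k + 1) * ln (real N) / real N \<le> 4 * real (k + 1)"
    using N4 by (simp add: pos_divide_le_eq mult_left_mono)
  then show ?thesis using \<rho>_le by linarith
qed

text \<open>Both widths are compared with \<open>1 / N\<close>. Consequently a component with a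
  layer in one variable can be measured in powers of \<open>\<rho>\<close> in the other variable
  too.\<close>

lemma H_le_\<rho>: "H \<le> 2 * \<rho>"
  using H_bounds(2) \<rho>_ge by simp

lemma h_le_H: "h \<le> H"
  using h_le H_bounds(1) by simp

text \<open>If the minimum equals \<open>1 / 4\<close> the mesh is uniform, and every interval
  counts as fine.\<close>

lemma h_eq_H: "\<tau> = 1 / 4 \<Longrightarrow> H = h"
  by (simp add: fine_width_def coarse_width_def)

section \<open>Widths of the mesh intervals\<close>

definition width :: "nat \<Rightarrow> real" where "width i = X (Suc i) - X i"

lemma N_quarter: obtains M where "N = 4 * M" "0 < M"
  using N4 by (auto elim!: dvdE)

lemma width_cases:
  "4 * Suc i \<le> N \<Longrightarrow> width i = h"
  "N \<le> 4 * i \<Longrightarrow> 4 * Suc i \<le> 3 * N \<Longrightarrow> width i = H"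
  "3 * N \<le> 4 * i \<Longrightarrow> width i = h"
proof -
  obtain M where M: "N = 4 * M" "0 < M" by (rule N_quarter)
  have hM: "real M * h = \<tau>" and HM: "real M * 2 * H = 1 - 2 * \<tau>"
    using M by (simp_all add: fine_width_def coarse_width_def)
  show "width i = h" if "4 * Suc i \<le> N"
    using that unfolding width_def shishkin_node_def by (simp add: algebra_simps)
  show "width i = H" if "N \<le> 4 * i" "4 * Suc i \<le> 3 * N"
  proof -
    have "X i = \<tau> + (real i - real M) * H"
    \<comment> \<open>The node at the transition point is defined by the preceding branch; the two
      formulas agree there.\<close>
    proof (cases "i = M")
      case True
      then show ?thesis using hM M unfolding shishkin_node_def by simp
    next
      case False
      then show ?thesis using that M unfolding shishkin_node_def by auto
    qed
    moreover have "X (Suc i) = \<tau> + (real (Suc i) - real M) * H"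
      using that M unfolding shishkin_node_def by auto
    ultimately show ?thesis unfolding width_def by (simp add: algebra_simps)
  qed
  show "width i = h" if "3 * N \<le> 4 * i"
  proof -
    have "X i = 1 - \<tau> + (real i - 3 * real M) * h"
    \<comment> \<open>Again the transition node falls into the preceding branch, and
      \<open>HM\<close> shows that both formulas give \<open>1 - \<tau>\<close>.\<close>
    proof (cases "i = 3 * M")
      case True
      have "X i = \<tau> + real M * 2 * H" using True M unfolding shishkin_node_def by simp
      then show ?thesis using True HM by simp
    next
      case False
      then show ?thesis using that M unfolding shishkin_node_def by auto
    qed
    moreover have "X (Suc i) = 1 - \<tau> + (real (Suc i) - 3 * real M) * h"
      using that M unfolding shishkin_node_def by auto
    ultimately show ?thesis unfolding width_def by (simp add: algebra_simps)
  qed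
qed

lemma width_h_or_H: "width i = h \<or> width i = H"
proof -
  obtain M where M: "N = 4 * M" "0 < M" by (rule N_quarter)
  consider "i < M" | "M \<le> i" "i < 3 * M" | "3 * M \<le> i" by linarith
  then show ?thesis using width_cases[of i] M by cases auto
qed

lemma width_bounds: "h \<le> width i" "width i \<le> 2 / real N" "width i \<le> 2 * \<rho>" "0 < width i"
  using width_h_or_H[of i] h_le_H h_pos H_bounds(2) H_le_\<rho> by auto

lemma mesh_X: "mesh N X"
proof -
  obtain M where M: "N = 4 * M" "0 < M" by (rule N_quarter)
  have "X N = 1 - \<tau> + real M * h" using M unfolding shishkin_node_def by simp
  also have "\<dots> = 1" using M by (simp add: fine_width_def)
  finally have "X N = 1" .
  moreover have "X 0 = 0" by (simp add: shishkin_node_def)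
  moreover have "X i < X (Suc i)" for i using width_bounds(4)[of i] by (simp add: width_def)
  ultimately show ?thesis unfolding mesh_def by blast
qed

lemma sum_width: "(\<Sum>i<N. width i) = 1"
  using sum_lessThan_telescope[of X N] mesh_X unfolding width_def mesh_def by simp

lemma X_diff_ge: "X i + real m * h \<le> X (i + m)"
proof (induction m)
  case (Suc m)
  then show ?case using width_bounds(1)[of "i + m"] by (simp add: width_def distrib_right)
qed simp

text \<open>The choice of the transition point makes a layer function at most \<open>(1 / N) ^ (k + 1)\<close> on every cell
  that is not of fine width.\<close>

definition decay :: "nat \<Rightarrow> real"
  where "decay j = exp (- X j / \<epsilon>) + exp (- (1 - X (Suc j)) / \<epsilon>) + 1 / real N"

text \<open>One exponential factor seen from the mesh: on every interval it is either resolved, with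
  fine width and bounded by \<open>decay\<close>, or negligible. Stated for both ends of the
  interval at once, so that sides and corners are treated uniformly.\<close>

definition layer_fun :: "(real \<Rightarrow> real) \<Rightarrow> bool"
  where "layer_fun g \<longleftrightarrow> (\<forall>y\<in>{0..1}. 0 \<le> g y \<and> g y \<le> 1) \<and>
    (\<forall>j<N. (width j = h \<and> (\<forall>y\<in>{X j..X (Suc j)}. g y \<le> decay j)) \<or>
           (\<forall>y\<in>{X j..X (Suc j)}. g y \<le> (1 / real N) ^ (k + 1)))"

lemma exp_transition:
  assumes "\<tau> \<noteq> 1 / 4" "\<tau> \<le> y"
  shows "exp (- y / \<epsilon>) \<le> (1 / real N) ^ (k + 1)"
proof -
  have \<tau>: "\<tau> = real (k + 1) * \<epsilon> * ln (real N)" using assms(1) min_def[of _ "1 / 4 :: real"] unfolding transition_def by metis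
  have "exp (- y / \<epsilon>) \<le> exp (- \<tau> / \<epsilon>)" using assms(2) eps by (simp add: divide_right_mono)
  also have "- \<tau> / \<epsilon> = - (real (k + 1) * ln (real N))" using eps unfolding \<tau> by simp
  also have "exp (- (real (k + 1) * ln (real N))) = (1 / real N) ^ (k + 1)"
    using N4 by (simp add: exp_minus exp_of_nat_mult power_one_over inverse_eq_divide del: of_nat_add of_nat_Suc power_Suc)
  finally show ?thesis .
qed

lemma decay_ge: "exp (- X j / \<epsilon>) \<le> decay j" "exp (- (1 - X (Suc j)) / \<epsilon>) \<le> decay j" "1 / real N \<le> decay j"
  unfolding decay_def by (simp_all add: add_nonneg_nonneg)

text \<open>For a nonuniform mesh only the left transition node matters: from there on the
  exponential is negligible, also in the fine region at the far end.\<close>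

lemma layer_fun_lower: "layer_fun (\<lambda>y. exp (- y / \<epsilon>))"
  unfolding layer_fun_def
proof (intro conjI allI impI ballI)
  fix j assume j: "j < N"
  show "(width j = h \<and> (\<forall>y\<in>{X j..X (Suc j)}. exp (- y / \<epsilon>) \<le> decay j)) \<or>
           (\<forall>y\<in>{X j..X (Suc j)}. exp (- y / \<epsilon>) \<le> (1 / real N) ^ (k + 1))"
  proof (cases "\<tau> \<noteq> 1 / 4 \<and> N \<le> 4 * j")
    case True
    obtain M where M: "N = 4 * M" "0 < M" by (rule N_quarter)
    have "X M \<le> X j" by (rule mesh_mono[OF mesh_X]) (use True j M in auto)
    moreover have "X M = \<tau>" using M unfolding shishkin_node_def by (simp add: fine_width_def)
    ultimately have "\<tau> \<le> X j" by simp
    then have "exp (- y / \<epsilon>) \<le> (1 / real N) ^ (k + 1)" if "y \<in> {X j..X (Suc j)}" for y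
      using True that by (intro exp_transition) auto
    then show ?thesis by blast
  next
    case False
    have "width j = h"
    proof (cases "\<tau> = 1 / 4")
      case True
      then show ?thesis using width_h_or_H[of j] h_eq_H by auto
    next
      case f: False
      obtain M where M: "N = 4 * M" "0 < M" by (rule N_quarter)
      have "j < M" using False f M by auto
      then show ?thesis using M by (intro width_cases(1)) simp
    qed
    moreover have "exp (- y / \<epsilon>) \<le> decay j" if "y \<in> {X j..X (Suc j)}" for y
    proof -
      have "exp (- y / \<epsilon>) \<le> exp (- X j / \<epsilon>)" using that eps by (simp add: divide_right_mono)
      then show ?thesis using decay_ge(1)[of j] by linarith
    qed
    ultimately show ?thesis by blast
  qed
qed (use eps in auto)

lemma layer_fun_upper: "layer_fun (\<lambda>y. exp (- (1 - y) / \<epsilon>))"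
  unfolding layer_fun_def
proof (intro conjI allI impI ballI)
  fix j assume j: "j < N"
  show "(width j = h \<and> (\<forall>y\<in>{X j..X (Suc j)}. exp (- (1 - y) / \<epsilon>) \<le> decay j)) \<or>
           (\<forall>y\<in>{X j..X (Suc j)}. exp (- (1 - y) / \<epsilon>) \<le> (1 / real N) ^ (k + 1))"
  proof (cases "\<tau> \<noteq> 1 / 4 \<and> 4 * Suc j \<le> 3 * N")
    case True
    obtain M where M: "N = 4 * M" "0 < M" by (rule N_quarter)
    have "X (Suc j) \<le> X (3 * M)" by (rule mesh_mono[OF mesh_X]) (use True j M in auto)
    moreover have "X (3 * M) = \<tau> + real M * 2 * H"
      using M unfolding shishkin_node_def by simp
    moreover have "real M * 2 * H = 1 - 2 * \<tau>" using M by (simp add: coarse_width_def)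
    ultimately have "\<tau> \<le> 1 - X (Suc j)" by simp
    then have "exp (- (1 - y) / \<epsilon>) \<le> (1 / real N) ^ (k + 1)" if "y \<in> {X j..X (Suc j)}" for y
      using True that by (intro exp_transition) auto
    then show ?thesis by blast
  next
    case False
    have "width j = h"
    proof (cases "\<tau> = 1 / 4")
      case True
      then show ?thesis using width_h_or_H[of j] h_eq_H by auto
    next
      case f: False
      obtain M where M: "N = 4 * M" "0 < M" by (rule N_quarter)
      have "3 * M \<le> j" using False f M by auto
      then show ?thesis using M by (intro width_cases(3)) simp
    qed
    moreover have "exp (- (1 - y) / \<epsilon>) \<le> decay j" if "y \<in> {X j..X (Suc j)}" for y
    proof -
      have "exp (- (1 - y) / \<epsilon>) \<le> exp (- (1 - X (Suc j)) / \<epsilon>)" using that eps by (simp add: divide_right_mono)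
      then show ?thesis using decay_ge(2)[of j] by linarith
    qed
    ultimately show ?thesis by blast
  qed
qed (use eps in \<open>auto simp: divide_nonpos_pos\<close>)

section \<open>Summation of the squared decay\<close>

text \<open>By \<open>1 + x \<le> exp x\<close> the ratio is at most
  \<open>1 / (1 + 2 * \<rho>)\<close>, and the corresponding infinite geometric series equals the
  bound.\<close>

lemma geometric_exp_sum: "(\<Sum>j<N. exp (- 2 * \<rho>) ^ j) \<le> 1 + 1 / (2 * \<rho>)"
proof -
  have "1 + 2 * \<rho> \<le> exp (2 * \<rho>)" by (rule exp_ge_add_one_self)
  then have q: "exp (- 2 * \<rho>) \<le> 1 / (1 + 2 * \<rho>)"
    using \<rho>_pos by (simp add: exp_minus divide_simps)
  then have q1: "2 * \<rho> / (1 + 2 * \<rho>) \<le> 1 - exp (- 2 * \<rho>)"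
    using \<rho>_pos by (simp add: field_simps)
  have pos: "0 < 2 * \<rho> / (1 + 2 * \<rho>)" using \<rho>_pos by simp
  have "(\<Sum>j<N. exp (- 2 * \<rho>) ^ j) = (1 - exp (- 2 * \<rho>) ^ N) / (1 - exp (- 2 * \<rho>))"
    using q1 pos \<rho>_pos by (subst sum_gp_strict) auto
  also have "\<dots> \<le> 1 / (1 - exp (- 2 * \<rho>))"
    using q1 pos \<rho>_pos by (intro divide_right_mono) auto
  also have "\<dots> \<le> 1 / (2 * \<rho> / (1 + 2 * \<rho>))"
    using q1 pos \<rho>_pos by (intro divide_left_mono mult_pos_pos) auto
  also have "\<dots> = 1 + 1 / (2 * \<rho>)" using \<rho>_pos by (simp add: field_simps)
  finally show ?thesis .
qed

text \<open>\<open>\<pi>\<close> ranks the intervals by distance from the layer: the identity for a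
  layer at \<open>0\<close>, the reversal for one at \<open>1\<close>. Every interval has width at
  least \<open>h\<close>, so an interval of rank \<open>\<pi> j\<close> is at distance at least
  \<open>\<pi> j * h\<close>.\<close>

lemma exp_layer_sum:
  assumes "\<And>j. j < N \<Longrightarrow> real (\<pi> j) * h \<le> y j" "inj_on \<pi> {..<N}" "\<pi> ` {..<N} = {..<N}"
  shows "(\<Sum>j<N. (exp (- y j / \<epsilon>))\<^sup>2) \<le> 1 + 1 / (2 * \<rho>)"
proof -
  have "(\<Sum>j<N. (exp (- y j / \<epsilon>))\<^sup>2) \<le> (\<Sum>j<N. exp (- 2 * \<rho>) ^ (\<pi> j))"
  proof (rule sum_mono)
    fix j assume "j \<in> {..<N}"
    then have "real (\<pi> j) * \<rho> \<le> y j / \<epsilon>"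
      using assms(1)[of j] eps unfolding h_eq by (simp add: pos_le_divide_eq mult_ac)
    then have "exp (2 * (- y j / \<epsilon>)) \<le> exp (real (\<pi> j) * (- 2 * \<rho>))" by simp
    then show "(exp (- y j / \<epsilon>))\<^sup>2 \<le> exp (- 2 * \<rho>) ^ (\<pi> j)"
      by (simp add: exp_of_nat_mult[symmetric] exp_double[symmetric])
  qed
  also have "\<dots> = (\<Sum>j<N. exp (- 2 * \<rho>) ^ j)"
    using sum.reindex[OF assms(2), of "\<lambda>j. exp (- 2 * \<rho>) ^ j"] assms(3) by simp
  finally show ?thesis using geometric_exp_sum by simp
qed

text \<open>The sum is bounded by \<open>9 + 3 / \<rho>\<close>, and
  \<open>\<rho> \<le> 4 * (k + 1)\<close> turns \<open>9\<close> into at most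
  \<open>36 * (k + 1) / \<rho>\<close>.\<close>

definition decay_const :: real where "decay_const = 36 * real (k + 1) + 3"

lemma sum_decay: "(\<Sum>j<N. (decay j)\<^sup>2) \<le> decay_const / \<rho>"
proof -
  have X0: "X 0 = 0" "X N = 1" using mesh_X by (auto simp: mesh_def)
  have 1: "(\<Sum>j<N. (exp (- X j / \<epsilon>))\<^sup>2) \<le> 1 + 1 / (2 * \<rho>)"
    using X_diff_ge[of 0] X0 by (intro exp_layer_sum[of id]) auto
  have 2: "(\<Sum>j<N. (exp (- (1 - X (Suc j)) / \<epsilon>))\<^sup>2) \<le> 1 + 1 / (2 * \<rho>)"
  proof (rule exp_layer_sum[of "\<lambda>j. N - Suc j"])
    show "real (N - Suc j) * h \<le> 1 - X (Suc j)" if "j < N" for j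
      using X_diff_ge[of "Suc j" "N - Suc j"] that X0 by simp
    show "inj_on (\<lambda>j. N - Suc j) {..<N}" by (auto simp: inj_on_def)
    show "(\<lambda>j. N - Suc j) ` {..<N} = {..<N}"
    proof
      show "{..<N} \<subseteq> (\<lambda>j. N - Suc j) ` {..<N}"
      proof
        fix j assume "j \<in> {..<N}"
        then show "j \<in> (\<lambda>j. N - Suc j) ` {..<N}" by (intro image_eqI[of _ _ "N - Suc j"]) auto
      qed
    qed (use N4 in auto)
  qed
  have 3: "(\<Sum>j<N. (1 / real N)\<^sup>2) \<le> 1"
    using N4 by (simp add: power2_eq_square)
  have sq: "(a + b + c)\<^sup>2 \<le> 3 * (a\<^sup>2 + b\<^sup>2 + c\<^sup>2)" for a b c :: real
    using sum_squares_ge_zero[of "a - b" "b - c"] zero_le_power2[of "a - c"]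
    by (simp add: power2_eq_square algebra_simps)
  have "(\<Sum>j<N. (decay j)\<^sup>2) \<le> (\<Sum>j<N. 3 * ((exp (- X j / \<epsilon>))\<^sup>2 + (exp (- (1 - X (Suc j)) / \<epsilon>))\<^sup>2 + (1 / real N)\<^sup>2))"
    unfolding decay_def by (intro sum_mono sq)
  also have "\<dots> = 3 * ((\<Sum>j<N. (exp (- X j / \<epsilon>))\<^sup>2) + (\<Sum>j<N. (exp (- (1 - X (Suc j)) / \<epsilon>))\<^sup>2) + (\<Sum>j<N. (1 / real N)\<^sup>2))"
    by (simp only: sum_distrib_left[symmetric] sum.distrib)
  also have "\<dots> \<le> 3 * ((1 + 1 / (2 * \<rho>)) + (1 + 1 / (2 * \<rho>)) + 1)"
    using 1 2 3 by (intro mult_left_mono add_mono) auto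
  also have "\<dots> = 9 + 3 / \<rho>" by (simp add: algebra_simps add_divide_distrib[symmetric])
  also have "9 \<le> 36 * real (k + 1) / \<rho>"
    using \<rho>_le_const \<rho>_pos by (simp add: pos_le_divide_eq)
  finally show ?thesis by (simp add: decay_const_def add_divide_distrib)
qed

definition perimeter :: "cell \<Rightarrow> real" where "perimeter T = 2 * (width (fst T) + width (snd T))"

definition cell_decay :: "cell \<Rightarrow> real" where "cell_decay T = decay (fst T) + decay (snd T)"

lemma sum_cells: "(\<Sum>T\<in>cells N. f T) = (\<Sum>i<N. \<Sum>j<N. f (i, j))"
  unfolding cells_def by (simp add: sum.cartesian_product case_prod_unfold)

lemma sum_perimeter: "(\<Sum>T\<in>cells N. perimeter T) = 4 * real N"
  unfolding sum_cells perimeter_def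
  by (simp add: sum.distrib sum_distrib_left[symmetric] sum_width)

text \<open>A width multiplied by the decay of its own index is bounded by \<open>2 / N\<close>, and
  the free index yields a factor \<open>N\<close>; a width multiplied by the decay of the other
  index uses that the widths sum to \<open>1\<close>. The constant is
  \<open>24 = 4 * (2 + 1 + 1 + 2)\<close>.\<close>

lemma sum_perimeter_decay: "(\<Sum>T\<in>cells N. perimeter T * (cell_decay T)\<^sup>2) \<le> 24 * decay_const / \<rho>"
proof -
  let ?S = "\<Sum>j<N. (decay j)\<^sup>2"
  have le: "perimeter (i, j) * (cell_decay (i, j))\<^sup>2
      \<le> 4 * (2 / real N * (decay i)\<^sup>2 + width i * (decay j)\<^sup>2 + width j * (decay i)\<^sup>2 + 2 / real N * (decay j)\<^sup>2)" for i j
  proof -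
    have "(decay i + decay j)\<^sup>2 \<le> 2 * ((decay i)\<^sup>2 + (decay j)\<^sup>2)"
      using zero_le_power2[of "decay i - decay j"] by (simp add: power2_eq_square algebra_simps)
    then have "perimeter (i, j) * (cell_decay (i, j))\<^sup>2 \<le> 2 * (width i + width j) * (2 * ((decay i)\<^sup>2 + (decay j)\<^sup>2))"
      using width_bounds(4)[of i] width_bounds(4)[of j]
      unfolding perimeter_def cell_decay_def by (simp add: mult_left_mono)
    also have "\<dots> = 4 * (width i * (decay i)\<^sup>2 + width i * (decay j)\<^sup>2 + width j * (decay i)\<^sup>2 + width j * (decay j)\<^sup>2)"
      by (simp add: algebra_simps)
    also have "\<dots> \<le> 4 * (2 / real N * (decay i)\<^sup>2 + width i * (decay j)\<^sup>2 + width j * (decay i)\<^sup>2 + 2 / real N * (decay j)\<^sup>2)"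
      using width_bounds(2) by (intro mult_left_mono add_mono mult_right_mono order_refl) auto
    finally show ?thesis .
  qed
  have "(\<Sum>T\<in>cells N. perimeter T * (cell_decay T)\<^sup>2) \<le> (\<Sum>i<N. \<Sum>j<N.
      4 * (2 / real N * (decay i)\<^sup>2 + width i * (decay j)\<^sup>2 + width j * (decay i)\<^sup>2 + 2 / real N * (decay j)\<^sup>2))"
    unfolding sum_cells by (intro sum_mono le)
  also have "\<dots> = 4 * (2 * ?S + ?S + ?S + 2 * ?S)"
  proof -
    have "(\<Sum>i<N. \<Sum>j<N. 2 / real N * (decay i)\<^sup>2) = 2 * ?S"
      using N4 by (simp add: sum_distrib_left[symmetric] sum_divide_distrib[symmetric])
    moreover have "(\<Sum>i<N. \<Sum>j<N. 2 / real N * (decay j)\<^sup>2) = 2 * ?S"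
      using N4 by (simp add: sum_distrib_left[symmetric] sum_divide_distrib[symmetric])
    moreover have "(\<Sum>i<N. \<Sum>j<N. width i * (decay j)\<^sup>2) = ?S"
      by (simp add: sum_product[symmetric] sum_width)
    moreover have "(\<Sum>i<N. \<Sum>j<N. width j * (decay i)\<^sup>2) = ?S"
      by (subst sum.swap) (simp add: sum_product[symmetric] sum_width)
    ultimately show ?thesis by (simp only: sum_distrib_left[symmetric] sum.distrib)
  qed
  also have "\<dots> = 24 * ?S" by simp
  also have "\<dots> \<le> 24 * (decay_const / \<rho>)" using sum_decay by simp
  finally show ?thesis by simp
qed

lemma boundary_integral_le:
  assumes "bcont X T F" "T \<in> cells N"
    "\<And>e n t. (e, n) \<in> cell_boundary T \<Longrightarrow> t \<in> edge_range X e \<Longrightarrow> F e n t \<le> c"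
  shows "boundary_integral X T F \<le> perimeter T * c"
proof -
  have "boundary_integral X T F \<le> boundary_integral X T (\<lambda>e n t. c)"
    by (rule boundary_integral_mono[OF assms(1) bcont_const assms(3)])
  also have "\<dots> = perimeter T * c"
    using width_bounds(4)[of "fst T"] width_bounds(4)[of "snd T"]
    unfolding boundary_integral_expand perimeter_def width_def
    by (simp add: edge_integral_eq algebra_simps)
  finally show ?thesis .
qed

end

subsection \<open>Approximation of the components of the solution\<close>

lemma lgd_coeff2_add:
  assumes ab: "a < b" and cd: "c < d" and f: "continuous_rect a b c d f" and g: "continuous_rect a b c d g"
  shows "lgd_coeff2 k a b c d (\<lambda>x y. f x y + g x y) i j = lgd_coeff2 k a b c d f i j + lgd_coeff2 k a b c d g i j"
proof -
  have "lgd_coeff2 k a b c d (\<lambda>x y. f x y + g x y) i j = integral {c..d} (\<lambda>s.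
      integral {a..b} (\<lambda>t. f t s * lgd k a b i t) * lgd k c d j s + integral {a..b} (\<lambda>t. g t s * lgd k a b i t) * lgd k c d j s)"
    unfolding lgd_coeff2_def distrib_right[symmetric]
  proof (rule integral_cong)
    fix s assume s: "s \<in> {c..d}"
    show "integral {a..b} (\<lambda>t. (f t s + g t s) * lgd k a b i t) * lgd k c d j s
        = (integral {a..b} (\<lambda>t. f t s * lgd k a b i t) + integral {a..b} (\<lambda>t. g t s * lgd k a b i t)) * lgd k c d j s"
      unfolding distrib_right
      by (subst integral_add) (simp_all add: lgd_coeff_integrable[OF ab] continuous_rect_slice1[OF f s]
          continuous_rect_slice1[OF g s] distrib_right)
  qed
  also have "\<dots> = lgd_coeff2 k a b c d f i j + lgd_coeff2 k a b c d g i j"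
    unfolding lgd_coeff2_def
    by (intro integral_add lgd_coeff_integrable[OF cd] lgd_coeff_continuous[OF ab cd] f g)
  finally show ?thesis .
qed

lemma
  assumes "a < b" "c < d" "continuous_rect a b c d f" "continuous_rect a b c d g"
  shows proj2_add: "proj2 k a b c d (\<lambda>x y. f x y + g x y) x y = proj2 k a b c d f x y + proj2 k a b c d g x y"
    and proj2x_add: "proj2x k a b c d (\<lambda>x y. f x y + g x y) x y = proj2x k a b c d f x y + proj2x k a b c d g x y"
    and proj2y_add: "proj2y k a b c d (\<lambda>x y. f x y + g x y) x y = proj2y k a b c d f x y + proj2y k a b c d g x y"
  unfolding proj2_def proj2x_def proj2y_def lgd_coeff2_add[OF assms] distrib_right sum.distrib by simp_all

lemma
  assumes "\<forall>x\<in>{a..b}. \<forall>y\<in>{c..d}. f x y = g x y"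
  shows proj2_cong: "proj2 k a b c d f x y = proj2 k a b c d g x y"
    and proj2x_cong: "proj2x k a b c d f x y = proj2x k a b c d g x y"
    and proj2y_cong: "proj2y k a b c d f x y = proj2y k a b c d g x y"
proof -
  have "lgd_coeff2 k a b c d f i j = lgd_coeff2 k a b c d g i j" for i j
    unfolding lgd_coeff2_def
    by (intro integral_cong arg_cong2[where f = "(*)"] refl) (simp add: assms)
  then show "proj2 k a b c d f x y = proj2 k a b c d g x y"
    "proj2x k a b c d f x y = proj2x k a b c d g x y" "proj2y k a b c d f x y = proj2y k a b c d g x y"
    unfolding proj2_def proj2x_def proj2y_def by simp_all
qed

lemma partials_le: "partials m a b c d D \<Longrightarrow> n \<le> m \<Longrightarrow> partials n a b c d D"
  unfolding partials_def by simp

lemma partials_shift: "partials (l + m) a b c d D \<Longrightarrow> i + j \<le> l \<Longrightarrow> partials m a b c d (\<lambda>i' j'. D (i' + i) (j' + j))"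
  unfolding partials_def by simp

lemma partials_add:
  assumes "partials m a b c d D" "partials m a b c d E"
  shows "partials m a b c d (\<lambda>i j x y. D i j x y + E i j x y)"
  unfolding partials_def
proof (intro conjI allI impI ballI)
  fix i j assume "i + j \<le> m"
  then show "continuous_rect a b c d (\<lambda>x y. D i j x y + E i j x y)"
    using partials_continuous[OF assms(1)] partials_continuous[OF assms(2)]
    by (simp add: case_prod_unfold continuous_on_add)
next
  fix i j x y assume "i + j < m" "x \<in> {a..b}" "y \<in> {c..d}"
  then show "((\<lambda>t. D i j t y + E i j t y) has_real_derivative D (Suc i) j x y + E (Suc i) j x y) (at x within {a..b})"
    "((\<lambda>t. D i j x t + E i j x t) has_real_derivative D i (Suc j) x y + E i (Suc j) x y) (at y within {c..d})"
    by (intro DERIV_add partials_x[OF assms(1)] partials_x[OF assms(2)] partials_y[OF assms(1)] partials_y[OF assms(2)]; simp)+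
qed

context shishkin
begin

section \<open>The error scale and the approximation property\<close>

text \<open>Scale of the projection error of a derivative of order \<open>l\<close>. The smooth part
  gives the first summand, the layers the second: \<open>\<epsilon> powi (1 - int l)\<close> is the
  size of such a layer derivative, and the \<open>k + 1 - l\<close> further derivatives combine with
  the widths into powers of \<open>\<rho>\<close>.\<close>

definition eta :: "nat \<Rightarrow> cell \<Rightarrow> real"
  where "eta l T = (1 / real N) ^ (k + 1 - l) + \<epsilon> powi (1 - int l) * \<rho> ^ (k + 1 - l) * cell_decay T"

text \<open>The Taylor order \<open>m\<close> is existential since it varies with the cell: the full
  order where a layer is resolved, zero where it is negligible. Orders up to \<open>3\<close> are
  covered because of \<open>\<nabla>\<Delta>u\<close>.\<close>

definition resolved :: "real \<Rightarrow> (nat \<Rightarrow> nat \<Rightarrow> real \<Rightarrow> real \<Rightarrow> real) \<Rightarrow> bool"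
  where "resolved K D \<longleftrightarrow> (\<forall>T\<in>cells N. \<forall>i j. i + j \<le> 3 \<longrightarrow> (\<exists>m Mx My. i + j + m \<le> k + 1 \<and>
    (\<forall>x y. (x, y) \<in> cell_set X T \<longrightarrow> \<bar>D (i + m) j x y\<bar> \<le> Mx \<and> \<bar>D i (j + m) x y\<bar> \<le> My) \<and>
    width (fst T) ^ m * Mx + width (snd T) ^ m * My \<le> K * eta (i + j) T))"

abbreviation "on_cell P T \<equiv> P k (X (fst T)) (X (Suc (fst T))) (X (snd T)) (X (Suc (snd T)))"

text \<open>Unlike \<open>resolved\<close>, this property is additive: different components may use
  different orders \<open>m\<close> on the same cell. The components are therefore estimated one by
  one and added only here.\<close>

definition approx :: "real \<Rightarrow> (nat \<Rightarrow> nat \<Rightarrow> real \<Rightarrow> real \<Rightarrow> real) \<Rightarrow> bool"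
  where "approx K D \<longleftrightarrow> partials (k + 1) 0 1 0 1 D \<and> (\<forall>T\<in>cells N. \<forall>x y i j. (x, y) \<in> cell_set X T \<longrightarrow>
    (i + j \<le> 3 \<longrightarrow> \<bar>D i j x y - on_cell proj2 T (D i j) x y\<bar> \<le> K * eta (i + j) T) \<and>
    (i + j \<le> 2 \<longrightarrow> \<bar>D (Suc i) j x y - on_cell proj2x T (D i j) x y\<bar> \<le> K * eta (Suc (i + j)) T \<and>
                   \<bar>D i (Suc j) x y - on_cell proj2y T (D i j) x y\<bar> \<le> K * eta (Suc (i + j)) T))"

lemma cell_ab: "T \<in> cells N \<Longrightarrow> X (fst T) < X (Suc (fst T))" "T \<in> cells N \<Longrightarrow> X (snd T) < X (Suc (snd T))"
  using mesh_less[OF mesh_X] mesh_less'[OF mesh_X] by auto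

lemma mem_cell: "(x, y) \<in> cell_set X T \<longleftrightarrow> x \<in> {X (fst T)..X (Suc (fst T))} \<and> y \<in> {X (snd T)..X (Suc (snd T))}"
  by (simp add: cell_set_def)

lemma partials_cell:
  "T \<in> cells N \<Longrightarrow> partials m 0 1 0 1 D \<Longrightarrow>
    partials m (X (fst T)) (X (Suc (fst T))) (X (snd T)) (X (Suc (snd T))) D"
  by (rule partials_subset[OF _ cell_intervals[OF mesh_X]])

lemma resolved_imp_approx:
  assumes P: "partials (k + 1) 0 1 0 1 D" and R: "resolved K D"
  shows "approx (proj2_const k * K) D"
  unfolding approx_def
proof (intro conjI ballI allI impI P)
  fix T x y i j
  assume T: "T \<in> cells N" and xy: "(x, y) \<in> cell_set X T"
  note ab = cell_ab[OF T]
  have PT: "partials n (X (fst T)) (X (Suc (fst T))) (X (snd T)) (X (Suc (snd T))) D" if "n \<le> k + 1" for n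
    using partials_le[OF partials_cell[OF T P] that] .
  have res: "\<exists>m Mx My. i + j + m \<le> k + 1 \<and>
    (\<forall>x y. (x, y) \<in> cell_set X T \<longrightarrow> \<bar>D (i + m) j x y\<bar> \<le> Mx \<and> \<bar>D i (j + m) x y\<bar> \<le> My) \<and>
    width (fst T) ^ m * Mx + width (snd T) ^ m * My \<le> K * eta (i + j) T" if "i + j \<le> 3" for i j
    using R T that unfolding resolved_def by blast
  have fin: "e \<le> proj2_const k * K * r" if "e \<le> proj2_const k * s" "s \<le> K * r" for e s r
  proof -
    have "proj2_const k * s \<le> proj2_const k * (K * r)" by (rule mult_left_mono[OF that(2) proj2_const_nonneg])
    then show ?thesis using that(1) by simp
  qed
  show "\<bar>D i j x y - on_cell proj2 T (D i j) x y\<bar> \<le> proj2_const k * K * eta (i + j) T" if ij: "i + j \<le> 3"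
  proof -
    obtain m Mx My where m: "i + j + m \<le> k + 1"
      and M: "\<And>x y. (x, y) \<in> cell_set X T \<Longrightarrow> \<bar>D (i + m) j x y\<bar> \<le> Mx"
        "\<And>x y. (x, y) \<in> cell_set X T \<Longrightarrow> \<bar>D i (j + m) x y\<bar> \<le> My"
      and s: "width (fst T) ^ m * Mx + width (snd T) ^ m * My \<le> K * eta (i + j) T"
      using res[OF ij] by blast
    show ?thesis
      by (rule fin[OF proj2_error[OF ab PT[OF m]] s[unfolded width_def]])
        (use m M xy in \<open>auto simp: mem_cell\<close>)
  qed
  assume "i + j \<le> 2"
  \<comment> \<open>The derivative of the projection of \<open>D i j\<close> is controlled by the
    data of \<open>resolved\<close> one order higher, hence \<open>Suc m\<close> derivatives of
    \<open>D i j\<close> in all.\<close>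
  then have ijx: "Suc i + j \<le> 3" and ijy: "i + Suc j \<le> 3" by simp_all
  show "\<bar>D (Suc i) j x y - on_cell proj2x T (D i j) x y\<bar> \<le> proj2_const k * K * eta (Suc (i + j)) T"
  proof -
    obtain m Mx My where m: "Suc i + j + m \<le> k + 1"
      and M: "\<And>x y. (x, y) \<in> cell_set X T \<Longrightarrow> \<bar>D (Suc i + m) j x y\<bar> \<le> Mx"
        "\<And>x y. (x, y) \<in> cell_set X T \<Longrightarrow> \<bar>D (Suc i) (j + m) x y\<bar> \<le> My"
      and s: "width (fst T) ^ m * Mx + width (snd T) ^ m * My \<le> K * eta (Suc i + j) T"
      using res[OF ijx] by blast
    have m': "i + j + Suc m \<le> k + 1" using m by simp
    show ?thesis
      by (rule fin[OF proj2x_error[OF ab PT[OF m']] s[unfolded width_def add_Suc]])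
        (use m M xy in \<open>auto simp: mem_cell\<close>)
  qed
  show "\<bar>D i (Suc j) x y - on_cell proj2y T (D i j) x y\<bar> \<le> proj2_const k * K * eta (Suc (i + j)) T"
  proof -
    obtain m Mx My where m: "i + Suc j + m \<le> k + 1"
      and M: "\<And>x y. (x, y) \<in> cell_set X T \<Longrightarrow> \<bar>D (i + m) (Suc j) x y\<bar> \<le> Mx"
        "\<And>x y. (x, y) \<in> cell_set X T \<Longrightarrow> \<bar>D i (Suc j + m) x y\<bar> \<le> My"
      and s: "width (fst T) ^ m * Mx + width (snd T) ^ m * My \<le> K * eta (i + Suc j) T"
      using res[OF ijy] by blast
    have m': "i + j + Suc m \<le> k + 1" using m by simp
    show ?thesis
      by (rule fin[OF proj2y_error[OF ab PT[OF m']] s[unfolded width_def add_Suc_right]])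
        (use m M xy in \<open>auto simp: mem_cell\<close>)
  qed
qed

lemma approx_partials: "approx K D \<Longrightarrow> partials (k + 1) 0 1 0 1 D"
  by (simp add: approx_def)

lemma
  assumes "approx K D" "T \<in> cells N" "(x, y) \<in> cell_set X T"
  shows approx_0: "i + j \<le> 3 \<Longrightarrow> \<bar>D i j x y - on_cell proj2 T (D i j) x y\<bar> \<le> K * eta (i + j) T"
    and approx_x: "i + j \<le> 2 \<Longrightarrow> \<bar>D (Suc i) j x y - on_cell proj2x T (D i j) x y\<bar> \<le> K * eta (Suc (i + j)) T"
    and approx_y: "i + j \<le> 2 \<Longrightarrow> \<bar>D i (Suc j) x y - on_cell proj2y T (D i j) x y\<bar> \<le> K * eta (Suc (i + j)) T"
  using assms unfolding approx_def by blast+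

lemma approx_add:
  assumes D: "approx K D" and E: "approx L E" and k3: "3 \<le> k"
  shows "approx (K + L) (\<lambda>i j x y. D i j x y + E i j x y)"
  unfolding approx_def
proof (intro conjI ballI allI impI partials_add approx_partials[OF D] approx_partials[OF E])
  fix T x y i j
  assume T: "T \<in> cells N" and xy: "(x, y) \<in> cell_set X T"
  note ab = cell_ab[OF T]
  have c: "continuous_rect (X (fst T)) (X (Suc (fst T))) (X (snd T)) (X (Suc (snd T))) (D i j)"
    "continuous_rect (X (fst T)) (X (Suc (fst T))) (X (snd T)) (X (Suc (snd T))) (E i j)" if "i + j \<le> 3"
    using partials_continuous[OF partials_cell[OF T approx_partials[OF D]]]
      partials_continuous[OF partials_cell[OF T approx_partials[OF E]]] that k3 by auto
  have tri: "\<bar>(a + b) - (a' + b')\<bar> \<le> (K + L) * r" if "\<bar>a - a'\<bar> \<le> K * r" "\<bar>b - b'\<bar> \<le> L * r" for a b a' b' r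
    using that unfolding distrib_right by linarith
  show "\<bar>D i j x y + E i j x y - on_cell proj2 T (\<lambda>x y. D i j x y + E i j x y) x y\<bar> \<le> (K + L) * eta (i + j) T"
    if ij: "i + j \<le> 3"
    unfolding proj2_add[OF ab c[OF ij]] by (intro tri approx_0[OF D T xy ij] approx_0[OF E T xy ij])
  assume ij: "i + j \<le> 2"
  then have ij3: "i + j \<le> 3" by simp
  show "\<bar>D (Suc i) j x y + E (Suc i) j x y - on_cell proj2x T (\<lambda>x y. D i j x y + E i j x y) x y\<bar> \<le> (K + L) * eta (Suc (i + j)) T"
    unfolding proj2x_add[OF ab c[OF ij3]] by (intro tri approx_x[OF D T xy ij] approx_x[OF E T xy ij])
  show "\<bar>D i (Suc j) x y + E i (Suc j) x y - on_cell proj2y T (\<lambda>x y. D i j x y + E i j x y) x y\<bar> \<le> (K + L) * eta (Suc (i + j)) T"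
    unfolding proj2y_add[OF ab c[OF ij3]] by (intro tri approx_y[OF D T xy ij] approx_y[OF E T xy ij])
qed

lemma cell_decay_ge: "1 / real N \<le> cell_decay T"
proof -
  have "0 < 1 / real N" using N4 by simp
  then show ?thesis using decay_ge(3)[of "fst T"] decay_ge(3)[of "snd T"] unfolding cell_decay_def by linarith
qed

lemma cell_decay_pos: "0 < cell_decay T"
proof -
  have "0 < 1 / real N" using N4 by simp
  then show ?thesis using cell_decay_ge[of T] by linarith
qed

text \<open>The third claim fits negligible layers into the same scale. For \<open>l = 0\<close> the
  first summand suffices as \<open>\<epsilon> < 1\<close>. For \<open>l > 0\<close> the power
  \<open>(1 / N) ^ (k + 1)\<close> is split: one factor \<open>1 / N\<close> is covered by the floor
  in \<open>cell_decay\<close>, and \<open>k + 1 - l\<close> factors by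
  \<open>\<rho>\<close>.\<close>

lemma eta_ge:
  shows "(1 / real N) ^ (k + 1 - l) \<le> eta l T"
    and "\<epsilon> powi (1 - int l) * \<rho> ^ (k + 1 - l) * cell_decay T \<le> eta l T"
    and "l \<le> k + 1 \<Longrightarrow> \<epsilon> powi (1 - int l) * (1 / real N) ^ (k + 1) \<le> eta l T"
proof -
  have pos: "0 \<le> \<epsilon> powi (1 - int l) * \<rho> ^ (k + 1 - l) * cell_decay T" "0 \<le> (1 / real N) ^ (k + 1 - l)"
    using eps \<rho>_pos cell_decay_pos[of T] by (auto intro!: mult_nonneg_nonneg)
  then show "(1 / real N) ^ (k + 1 - l) \<le> eta l T"
    and 2: "\<epsilon> powi (1 - int l) * \<rho> ^ (k + 1 - l) * cell_decay T \<le> eta l T"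
    unfolding eta_def by linarith+
  assume l: "l \<le> k + 1"
  show "\<epsilon> powi (1 - int l) * (1 / real N) ^ (k + 1) \<le> eta l T"
  proof (cases l)
    case 0
    then have "\<epsilon> powi (1 - int l) * (1 / real N) ^ (k + 1) \<le> 1 * (1 / real N) ^ (k + 1 - l)"
      using eps by (intro mult_mono) auto
    then show ?thesis using pos unfolding eta_def by linarith
  next
    case (Suc l')
    have "(1 / real N) ^ (k + 1) \<le> (1 / real N) ^ (k + 1 - l) * (1 / real N)"
    proof -
      have "(1 / real N) ^ (k + 1) = (1 / real N) ^ (k + 1 - l) * (1 / real N) ^ l"
        using l by (simp only: power_add[symmetric]) simp
      also have "(1 / real N) ^ l \<le> (1 / real N) ^ 1"
        using N4 Suc by (intro power_decreasing) auto
      finally show ?thesis by (simp add: mult_left_mono)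
    qed
    also have "\<dots> \<le> \<rho> ^ (k + 1 - l) * cell_decay T"
      using \<rho>_ge cell_decay_ge[of T] \<rho>_pos by (intro mult_mono power_mono) auto
    finally have "\<epsilon> powi (1 - int l) * (1 / real N) ^ (k + 1) \<le> \<epsilon> powi (1 - int l) * (\<rho> ^ (k + 1 - l) * cell_decay T)"
      using eps by (intro mult_left_mono) auto
    then show ?thesis using 2 by (simp add: mult.assoc)
  qed
qed

text \<open>Widths are at most \<open>2 / N\<close>, which costs at most \<open>2 ^ (k + 1)\<close>;
  the two directions account for one more factor \<open>2\<close>.\<close>

lemma smooth_resolved:
  assumes k3: "3 \<le> k" and "\<And>i j x y. i + j \<le> k + 1 \<Longrightarrow> (x, y) \<in> Omega_bar \<Longrightarrow> \<bar>D i j x y\<bar> \<le> C" and C: "0 \<le> C"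
  shows "resolved (2 ^ (k + 2) * C) D"
  unfolding resolved_def
proof (intro ballI allI impI)
  fix T i j assume T: "T \<in> cells N" and ij: "i + j \<le> (3::nat)"
  define m where "m = k + 1 - (i + j)"
  have m: "i + j + m = k + 1" using ij k3 by (simp add: m_def)
  have w: "width i ^ m * C \<le> (2 ^ (k + 1) * C) * (1 / real N) ^ m" for i
  proof -
    have "width i ^ m \<le> (2 / real N) ^ m" using width_bounds(2,4)[of i] by (intro power_mono) auto
    also have "\<dots> = 2 ^ m * (1 / real N) ^ m" by (simp add: power_divide)
    also have "\<dots> \<le> 2 ^ (k + 1) * (1 / real N) ^ m"
      by (intro mult_right_mono power_increasing) (auto simp: m_def)
    finally have "width i ^ m * C \<le> 2 ^ (k + 1) * (1 / real N) ^ m * C" using C by (rule mult_right_mono)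
    then show ?thesis by (simp only: mult_ac)
  qed
  have "width (fst T) ^ m * C + width (snd T) ^ m * C \<le> 2 ^ (k + 2) * C * (1 / real N) ^ m"
    using w[of "fst T"] w[of "snd T"] by simp
  also have "\<dots> \<le> 2 ^ (k + 2) * C * eta (i + j) T"
    using C eta_ge(1)[of "i + j" T] unfolding m_def by (intro mult_left_mono) auto
  finally have "width (fst T) ^ m * C + width (snd T) ^ m * C \<le> 2 ^ (k + 2) * C * eta (i + j) T" .
  moreover have "\<bar>D (i + m) j x y\<bar> \<le> C \<and> \<bar>D i (j + m) x y\<bar> \<le> C" if "(x, y) \<in> cell_set X T" for x y
    using that cell_subset_Omega_bar[OF mesh_X T] m by (intro conjI assms(2)) auto
  ultimately show "\<exists>m Mx My. i + j + m \<le> k + 1 \<and>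
    (\<forall>x y. (x, y) \<in> cell_set X T \<longrightarrow> \<bar>D (i + m) j x y\<bar> \<le> Mx \<and> \<bar>D i (j + m) x y\<bar> \<le> My) \<and>
    width (fst T) ^ m * Mx + width (snd T) ^ m * My \<le> 2 ^ (k + 2) * C * eta (i + j) T"
    using m by (intro exI[of _ m] exI[of _ C]) auto
qed

text \<open>In a layer direction each width \<open>\<epsilon> * \<rho>\<close> cancels the power of
  \<open>1 / \<epsilon>\<close> caused by one derivative. In the other direction a derivative costs
  nothing, and the width is at most \<open>2 * \<rho>\<close>. The number \<open>c\<close> counts
  the layer derivatives already taken.\<close>

lemma width_power_layer:
  assumes "s = 0 \<or> (s = 1 \<and> width i = h)"
  shows "width i ^ m * \<epsilon> powi (1 - int (s * m) - int c) \<le> (2 * \<rho>) ^ m * \<epsilon> powi (1 - int c)"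
proof (cases "s = 0")
  case True
  have "width i ^ m * \<epsilon> powi (1 - int c) \<le> (2 * \<rho>) ^ m * \<epsilon> powi (1 - int c)"
    using width_bounds(3,4)[of i] eps by (intro mult_right_mono power_mono) auto
  then show ?thesis using True by simp
next
  case False
  then have s: "s = 1" "width i = \<epsilon> * \<rho>" using assms h_eq by auto
  have "width i ^ m * \<epsilon> powi (1 - int (s * m) - int c) = \<rho> ^ m * (\<epsilon> powi int m * \<epsilon> powi (1 - int (s * m) - int c))"
    by (simp add: s power_mult_distrib)
  also have "\<epsilon> powi int m * \<epsilon> powi (1 - int (s * m) - int c) = \<epsilon> powi (1 - int c)"
    using eps by (subst power_int_add[symmetric]) (auto simp: s)
  also have "\<rho> ^ m * \<epsilon> powi (1 - int c) \<le> (2 * \<rho>) ^ m * \<epsilon> powi (1 - int c)"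
    using \<rho>_pos eps by (intro mult_right_mono power_mono) auto
  finally show ?thesis .
qed

text \<open>The flags \<open>sx\<close> and \<open>sy\<close> tell in which variables a component has a layer.\<close>

lemma layer_resolved:
  fixes sx sy :: nat and E :: "real \<Rightarrow> real \<Rightarrow> real"
  assumes k3: "3 \<le> k" and C: "0 \<le> C" and s: "sx \<in> {0, 1}" "sy \<in> {0, 1}"
    and D: "\<And>i j x y. i + j \<le> k + 1 \<Longrightarrow> (x, y) \<in> Omega_bar \<Longrightarrow>
      \<bar>D i j x y\<bar> \<le> C * \<epsilon> powi (1 - int (sx * i) - int (sy * j)) * E x y"
    and E: "\<And>T. T \<in> cells N \<Longrightarrow>
      ((sx = 0 \<or> width (fst T) = h) \<and> (sy = 0 \<or> width (snd T) = h) \<and> (\<forall>x y. (x, y) \<in> cell_set X T \<longrightarrow> E x y \<le> cell_decay T)) \<or>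
      (\<forall>x y. (x, y) \<in> cell_set X T \<longrightarrow> E x y \<le> (1 / real N) ^ (k + 1))"
  shows "resolved (2 ^ (k + 2) * C) D"
  unfolding resolved_def
proof (intro ballI allI impI)
  fix T i j assume T: "T \<in> cells N" and ij: "i + j \<le> (3::nat)"
  let ?l = "i + j"
  note Om = cell_subset_Omega_bar[OF mesh_X T]
  have c: "sx * i + sy * j \<le> ?l" using s by auto
  \<comment> \<open>Since \<open>\<epsilon> < 1\<close>, counting every derivative as a layer
    derivative only enlarges the bound.\<close>
  have pw: "\<epsilon> powi (1 - int (sx * i + sy * j)) \<le> \<epsilon> powi (1 - int ?l)"
    by (rule power_int_decreasing[OF diff_left_mono[OF of_nat_mono[OF c]]]) (use eps in auto)
  have pnn: "0 \<le> \<epsilon> powi r" for r using eps by simp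
  from E[OF T] show "\<exists>m Mx My. i + j + m \<le> k + 1 \<and>
    (\<forall>x y. (x, y) \<in> cell_set X T \<longrightarrow> \<bar>D (i + m) j x y\<bar> \<le> Mx \<and> \<bar>D i (j + m) x y\<bar> \<le> My) \<and>
    width (fst T) ^ m * Mx + width (snd T) ^ m * My \<le> 2 ^ (k + 2) * C * eta (i + j) T"
  proof
    assume res: "(sx = 0 \<or> width (fst T) = h) \<and> (sy = 0 \<or> width (snd T) = h) \<and>
      (\<forall>x y. (x, y) \<in> cell_set X T \<longrightarrow> E x y \<le> cell_decay T)"
    \<comment> \<open>On resolved cells all available derivatives are used.\<close>
    define m where "m = k + 1 - (i + j)"
    have m: "i + j + m = k + 1" using ij k3 by (simp add: m_def)
    define Mx where "Mx = C * \<epsilon> powi (1 - int (sx * (i + m)) - int (sy * j)) * cell_decay T"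
    define My where "My = C * \<epsilon> powi (1 - int (sx * i) - int (sy * (j + m))) * cell_decay T"
    have 1: "\<bar>D (i + m) j x y\<bar> \<le> Mx \<and> \<bar>D i (j + m) x y\<bar> \<le> My" if xy: "(x, y) \<in> cell_set X T" for x y
    proof -
      have "E x y \<le> cell_decay T" using res xy by blast
      then have d: "C * \<epsilon> powi r * E x y \<le> C * \<epsilon> powi r * cell_decay T" for r
        using C pnn by (intro mult_left_mono) auto
      have O: "(x, y) \<in> Omega_bar" using xy Om by blast
      have m1: "i + m + j \<le> k + 1" and m2: "i + (j + m) \<le> k + 1" using m by simp_all
      show ?thesis
        unfolding Mx_def My_def using order.trans[OF D[OF m1 O] d] order.trans[OF D[OF m2 O] d] by blast
    qed
    let ?B = "(2 * \<rho>) ^ m * \<epsilon> powi (1 - int (sx * i + sy * j))"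
    have bx: "width (fst T) ^ m * \<epsilon> powi (1 - int (sx * (i + m)) - int (sy * j)) \<le> ?B"
      using width_power_layer[of sx "fst T" m "sx * i + sy * j"] s(1) res by (auto simp: algebra_simps)
    have by': "width (snd T) ^ m * \<epsilon> powi (1 - int (sx * i) - int (sy * (j + m))) \<le> ?B"
      using width_power_layer[of sy "snd T" m "sx * i + sy * j"] s(2) res by (auto simp: algebra_simps)
    have "?B \<le> (2 * \<rho>) ^ m * \<epsilon> powi (1 - int ?l)"
      using \<rho>_pos pw by (intro mult_left_mono) auto
    also have "\<dots> = 2 ^ m * (\<epsilon> powi (1 - int ?l) * \<rho> ^ m)" by (simp add: power_mult_distrib)
    also have "\<dots> \<le> 2 ^ (k + 1) * (\<epsilon> powi (1 - int ?l) * \<rho> ^ m)"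
      using \<rho>_pos pnn by (intro mult_right_mono power_increasing) (auto simp: m_def)
    finally have B: "?B \<le> 2 ^ (k + 1) * (\<epsilon> powi (1 - int ?l) * \<rho> ^ m)" .
    have "width (fst T) ^ m * Mx + width (snd T) ^ m * My
        = (C * cell_decay T) * (width (fst T) ^ m * \<epsilon> powi (1 - int (sx * (i + m)) - int (sy * j))
          + width (snd T) ^ m * \<epsilon> powi (1 - int (sx * i) - int (sy * (j + m))))"
      unfolding Mx_def My_def by (simp add: algebra_simps)
    also have "\<dots> \<le> (C * cell_decay T) * (2 * (2 ^ (k + 1) * (\<epsilon> powi (1 - int ?l) * \<rho> ^ m)))"
      using bx by' B C cell_decay_pos[of T] by (intro mult_left_mono) auto
    also have "\<dots> = 2 ^ (k + 2) * C * (\<epsilon> powi (1 - int ?l) * \<rho> ^ m * cell_decay T)" by (simp add: mult_ac)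
    also have "\<dots> \<le> 2 ^ (k + 2) * C * eta ?l T"
      using C eta_ge(2)[of ?l T] unfolding m_def by (intro mult_left_mono) auto
    finally show ?thesis using m 1 by (intro exI[of _ m] exI[of _ Mx] exI[of _ My]) auto
  next
    assume off: "\<forall>x y. (x, y) \<in> cell_set X T \<longrightarrow> E x y \<le> (1 / real N) ^ (k + 1)"
    \<comment> \<open>Here the order is \<open>m = 0\<close>: on a wide cell further derivatives
      would cost powers of \<open>1 / \<epsilon>\<close> with no small width to compensate, whereas
      the function itself is already small enough.\<close>
    define B where "B = C * (\<epsilon> powi (1 - int ?l) * (1 / real N) ^ (k + 1))"
    have "\<bar>D i j x y\<bar> \<le> B" if xy: "(x, y) \<in> cell_set X T" for x y
    proof -
      have "\<bar>D i j x y\<bar> \<le> C * \<epsilon> powi (1 - int (sx * i) - int (sy * j)) * E x y"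
        using xy Om ij k3 by (intro D) auto
      also have "\<dots> \<le> C * \<epsilon> powi (1 - int (sx * i) - int (sy * j)) * (1 / real N) ^ (k + 1)"
        using off xy C pnn by (intro mult_left_mono) auto
      also have "\<dots> \<le> C * \<epsilon> powi (1 - int ?l) * (1 / real N) ^ (k + 1)"
        using pw C by (intro mult_right_mono mult_left_mono) (auto simp: algebra_simps)
      finally show ?thesis unfolding B_def by (simp add: mult.assoc)
    qed
    moreover have "B \<le> C * eta ?l T"
      unfolding B_def using eta_ge(3)[of ?l T] ij k3 C by (intro mult_left_mono) auto
    moreover have "2 * (C * eta ?l T) \<le> 2 ^ (k + 2) * C * eta ?l T"
    proof -
      have "0 \<le> eta ?l T" by (rule order.trans[OF _ eta_ge(1)]) simp
      moreover have "(2::real) ^ 1 \<le> 2 ^ (k + 2)" by (intro power_increasing) auto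
      ultimately show ?thesis using C mult_right_mono[of 2 "2 ^ (k + 2)" "C * eta ?l T"] by (simp add: mult.assoc)
    qed
    ultimately show ?thesis using ij k3 by (intro exI[of _ 0] exI[of _ B]) auto
  qed
qed

lemma layer_fun_cases:
  assumes "layer_fun g" "j < N"
  shows "(width j = h \<and> (\<forall>y\<in>{X j..X (Suc j)}. g y \<le> decay j)) \<or> (\<forall>y\<in>{X j..X (Suc j)}. g y \<le> (1 / real N) ^ (k + 1))"
  using assms unfolding layer_fun_def by blast

lemma decay_le_cell_decay: "decay (fst T) \<le> cell_decay T" "decay (snd T) \<le> cell_decay T"
proof -
  have "0 < 1 / real N" using N4 by simp
  then show "decay (fst T) \<le> cell_decay T" "decay (snd T) \<le> cell_decay T"
    using decay_ge(3)[of "fst T"] decay_ge(3)[of "snd T"] unfolding cell_decay_def by linarith+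
qed

lemma layer_resolved_x:
  assumes "3 \<le> k" "0 \<le> C" and g: "layer_fun g"
    and "\<And>i j x y. i + j \<le> k + 1 \<Longrightarrow> (x, y) \<in> Omega_bar \<Longrightarrow> \<bar>D i j x y\<bar> \<le> C * \<epsilon> powi (1 - int i) * g x"
  shows "resolved (2 ^ (k + 2) * C) D"
proof (rule layer_resolved[of C 1 0 D "\<lambda>x y. g x"])
  fix T assume "T \<in> cells N"
  then have "fst T < N" by (auto simp: cells_def)
  from layer_fun_cases[OF g this] decay_le_cell_decay[of T]
  show "((1 = (0::nat) \<or> width (fst T) = h) \<and> (0 = (0::nat) \<or> width (snd T) = h) \<and> (\<forall>x y. (x, y) \<in> cell_set X T \<longrightarrow> g x \<le> cell_decay T)) \<or>
      (\<forall>x y. (x, y) \<in> cell_set X T \<longrightarrow> g x \<le> (1 / real N) ^ (k + 1))"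
    unfolding mem_cell by (auto intro: order.trans)
qed (use assms in auto)

lemma layer_resolved_y:
  assumes "3 \<le> k" "0 \<le> C" and g: "layer_fun g"
    and "\<And>i j x y. i + j \<le> k + 1 \<Longrightarrow> (x, y) \<in> Omega_bar \<Longrightarrow> \<bar>D i j x y\<bar> \<le> C * \<epsilon> powi (1 - int j) * g y"
  shows "resolved (2 ^ (k + 2) * C) D"
proof (rule layer_resolved[of C 0 1 D "\<lambda>x y. g y"])
  fix T assume "T \<in> cells N"
  then have "snd T < N" by (auto simp: cells_def)
  from layer_fun_cases[OF g this] decay_le_cell_decay[of T]
  show "((0 = (0::nat) \<or> width (fst T) = h) \<and> (1 = (0::nat) \<or> width (snd T) = h) \<and> (\<forall>x y. (x, y) \<in> cell_set X T \<longrightarrow> g y \<le> cell_decay T)) \<or>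
      (\<forall>x y. (x, y) \<in> cell_set X T \<longrightarrow> g y \<le> (1 / real N) ^ (k + 1))"
    unfolding mem_cell by (auto intro: order.trans)
qed (use assms in auto)

text \<open>The product is at most each of its factors, so it is negligible as soon as one factor
  is. Otherwise both widths are fine, and the decay of the factor in \<open>x\<close> bounds the
  product.\<close>

lemma layer_resolved_xy:
  assumes "3 \<le> k" "0 \<le> C" and f: "layer_fun f" and g: "layer_fun g"
    and "\<And>i j x y. i + j \<le> k + 1 \<Longrightarrow> (x, y) \<in> Omega_bar \<Longrightarrow> \<bar>D i j x y\<bar> \<le> C * \<epsilon> powi (1 - int i - int j) * f x * g y"
  shows "resolved (2 ^ (k + 2) * C) D"
proof (rule layer_resolved[of C 1 1 D "\<lambda>x y. f x * g y"])
  fix T assume T: "T \<in> cells N"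
  then have "fst T < N" "snd T < N" by (auto simp: cells_def)
  note cs = layer_fun_cases[OF f this(1)] layer_fun_cases[OF g this(2)]
  have fg: "f x * g y \<le> f x" "f x * g y \<le> g y" if "(x, y) \<in> cell_set X T" for x y
  proof -
    have "0 \<le> f x" "f x \<le> 1" "0 \<le> g y" "g y \<le> 1"
      using f g that cell_subset_Omega_bar[OF mesh_X T] unfolding layer_fun_def by auto
    then show "f x * g y \<le> f x" "f x * g y \<le> g y" by (simp_all add: mult_left_le mult_left_le_one_le)
  qed
  have mem: "x \<in> {X (fst T)..X (Suc (fst T))}" "y \<in> {X (snd T)..X (Suc (snd T))}" if "(x, y) \<in> cell_set X T" for x y
    using that unfolding mem_cell by auto
  show "((1 = (0::nat) \<or> width (fst T) = h) \<and> (1 = (0::nat) \<or> width (snd T) = h) \<and> (\<forall>x y. (x, y) \<in> cell_set X T \<longrightarrow> f x * g y \<le> cell_decay T)) \<or>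
      (\<forall>x y. (x, y) \<in> cell_set X T \<longrightarrow> f x * g y \<le> (1 / real N) ^ (k + 1))"
  proof (cases "width (fst T) = h \<and> (\<forall>x\<in>{X (fst T)..X (Suc (fst T))}. f x \<le> decay (fst T)) \<and> width (snd T) = h")
    case True
    have "f x * g y \<le> cell_decay T" if "(x, y) \<in> cell_set X T" for x y
      using fg(1)[OF that] True mem(1)[OF that] decay_le_cell_decay(1)[of T] by (meson order.trans)
    then show ?thesis using True by blast
  next
    case False
    then have "(\<forall>x\<in>{X (fst T)..X (Suc (fst T))}. f x \<le> (1 / real N) ^ (k + 1)) \<or>
        (\<forall>y\<in>{X (snd T)..X (Suc (snd T))}. g y \<le> (1 / real N) ^ (k + 1))"
      using cs by blast
    then have "f x * g y \<le> (1 / real N) ^ (k + 1)" if "(x, y) \<in> cell_set X T" for x y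
      using fg[OF that] mem[OF that] by (meson order.trans)
    then show ?thesis by blast
  qed
qed (use assms in \<open>auto simp: mult.assoc\<close>)

text \<open>The factor \<open>9\<close> counts the components: one smooth part, four sides and four
  corners.\<close>

lemma layer_decomposition_approx:
  assumes k3: "3 \<le> k" and u: "layer_decomposition k C0 \<epsilon> u"
  obtains U where "approx (9 * (proj2_const k * (2 ^ (k + 2) * C0))) U"
    "\<And>x y. (x, y) \<in> Omega_bar \<Longrightarrow> u (x, y) = U 0 0 x y" "0 \<le> C0"
proof -
  obtain S E1 E2 E3 E4 E12 E23 E34 E41 where
    C: "\<forall>F \<in> {S, E1, E2, E3, E4, E12, E23, E34, E41}. C_on (k + 1) Omega_bar F" and
    sum: "\<forall>p \<in> Omega_bar. u p = S p + (E1 p + E2 p + E3 p + E4 p) + E12 p + E23 p + E34 p + E41 p" and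
    bd: "\<forall>(x, y) \<in> Omega_bar. \<forall>i j. i + j \<le> k + 1 \<longrightarrow>
        \<bar>partial Omega_bar i j S (x, y)\<bar> \<le> C0 \<and>
        \<bar>partial Omega_bar i j E1 (x, y)\<bar> \<le> C0 * \<epsilon> powi (1 - int j) * exp (- y / \<epsilon>) \<and>
        \<bar>partial Omega_bar i j E2 (x, y)\<bar> \<le> C0 * \<epsilon> powi (1 - int i) * exp (- (1 - x) / \<epsilon>) \<and>
        \<bar>partial Omega_bar i j E3 (x, y)\<bar> \<le> C0 * \<epsilon> powi (1 - int j) * exp (- (1 - y) / \<epsilon>) \<and>
        \<bar>partial Omega_bar i j E4 (x, y)\<bar> \<le> C0 * \<epsilon> powi (1 - int i) * exp (- x / \<epsilon>) \<and>
        \<bar>partial Omega_bar i j E12 (x, y)\<bar>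
          \<le> C0 * \<epsilon> powi (1 - int i - int j) * exp (- (1 - x) / \<epsilon>) * exp (- y / \<epsilon>) \<and>
        \<bar>partial Omega_bar i j E23 (x, y)\<bar>
          \<le> C0 * \<epsilon> powi (1 - int i - int j) * exp (- (1 - x) / \<epsilon>) * exp (- (1 - y) / \<epsilon>) \<and>
        \<bar>partial Omega_bar i j E34 (x, y)\<bar>
          \<le> C0 * \<epsilon> powi (1 - int i - int j) * exp (- x / \<epsilon>) * exp (- (1 - y) / \<epsilon>) \<and>
        \<bar>partial Omega_bar i j E41 (x, y)\<bar>
          \<le> C0 * \<epsilon> powi (1 - int i - int j) * exp (- x / \<epsilon>) * exp (- y / \<epsilon>)"
    using u unfolding layer_decomposition_def by (elim exE conjE) (rule that; assumption)
  \<comment> \<open>The sign of \<open>C0\<close> is read off from the bound on \<open>S\<close> at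
    a single point.\<close>
  have "\<bar>partial Omega_bar 0 0 S (0, 0)\<bar> \<le> C0" using bd by auto
  then have C0: "0 \<le> C0" by linarith
  define P where "P = (\<lambda>F i j x y. partial Omega_bar i j F (x, y))"
  let ?K = "proj2_const k * (2 ^ (k + 2) * C0)"
  have A: "approx ?K (P F)" if "F \<in> {S, E1, E2, E3, E4, E12, E23, E34, E41}" "resolved (2 ^ (k + 2) * C0) (P F)" for F
    using resolved_imp_approx[OF C_on_partials[OF C[rule_format, OF that(1)]]] that(2) unfolding P_def by blast
  note lo = layer_fun_lower and up = layer_fun_upper
  have bb: "\<bar>P S i j x y\<bar> \<le> C0"
    "\<bar>P E1 i j x y\<bar> \<le> C0 * \<epsilon> powi (1 - int j) * exp (- y / \<epsilon>)"
    "\<bar>P E2 i j x y\<bar> \<le> C0 * \<epsilon> powi (1 - int i) * exp (- (1 - x) / \<epsilon>)"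
    "\<bar>P E3 i j x y\<bar> \<le> C0 * \<epsilon> powi (1 - int j) * exp (- (1 - y) / \<epsilon>)"
    "\<bar>P E4 i j x y\<bar> \<le> C0 * \<epsilon> powi (1 - int i) * exp (- x / \<epsilon>)"
    "\<bar>P E12 i j x y\<bar> \<le> C0 * \<epsilon> powi (1 - int i - int j) * exp (- (1 - x) / \<epsilon>) * exp (- y / \<epsilon>)"
    "\<bar>P E23 i j x y\<bar> \<le> C0 * \<epsilon> powi (1 - int i - int j) * exp (- (1 - x) / \<epsilon>) * exp (- (1 - y) / \<epsilon>)"
    "\<bar>P E34 i j x y\<bar> \<le> C0 * \<epsilon> powi (1 - int i - int j) * exp (- x / \<epsilon>) * exp (- (1 - y) / \<epsilon>)"
    "\<bar>P E41 i j x y\<bar> \<le> C0 * \<epsilon> powi (1 - int i - int j) * exp (- x / \<epsilon>) * exp (- y / \<epsilon>)"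
    if "i + j \<le> k + 1" "(x, y) \<in> Omega_bar" for i j x y
    using bd that unfolding P_def by blast+
  have aS: "approx ?K (P S)" by (rule A) (simp, rule smooth_resolved[OF k3 bb(1) C0])
  have a1: "approx ?K (P E1)" by (rule A) (simp, rule layer_resolved_y[OF k3 C0 lo bb(2)])
  have a2: "approx ?K (P E2)" by (rule A) (simp, rule layer_resolved_x[OF k3 C0 up bb(3)])
  have a3: "approx ?K (P E3)" by (rule A) (simp, rule layer_resolved_y[OF k3 C0 up bb(4)])
  have a4: "approx ?K (P E4)" by (rule A) (simp, rule layer_resolved_x[OF k3 C0 lo bb(5)])
  have a12: "approx ?K (P E12)" by (rule A) (simp, rule layer_resolved_xy[OF k3 C0 up lo bb(6)])
  have a23: "approx ?K (P E23)" by (rule A) (simp, rule layer_resolved_xy[OF k3 C0 up up bb(7)])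
  have a34: "approx ?K (P E34)" by (rule A) (simp, rule layer_resolved_xy[OF k3 C0 lo up bb(8)])
  have a41: "approx ?K (P E41)" by (rule A) (simp, rule layer_resolved_xy[OF k3 C0 lo lo bb(9)])
  note ad = approx_add[OF _ _ k3]
  define U where "U = (\<lambda>i j x y. P S i j x y + (P E1 i j x y + P E2 i j x y + P E3 i j x y + P E4 i j x y)
      + P E12 i j x y + P E23 i j x y + P E34 i j x y + P E41 i j x y)"
  have "approx (?K + (?K + ?K + ?K + ?K) + ?K + ?K + ?K + ?K) U"
    unfolding U_def by (intro ad aS a1 a2 a3 a4 a12 a23 a34 a41)
  moreover have "?K + (?K + ?K + ?K + ?K) + ?K + ?K + ?K + ?K = 9 * ?K" by simp
  ultimately have "approx (9 * ?K) U" by (simp only:)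
  moreover have "u (x, y) = U 0 0 x y" if "(x, y) \<in> Omega_bar" for x y
    using sum that by (simp add: U_def P_def partial_def)
  ultimately show thesis using C0 by (rule that)
qed

end

subsection \<open>Bounds for the residuals\<close>

lemma
  assumes M: "mesh N X" "T \<in> cells N" and P: "partials m 0 1 0 1 D" and ij: "i + j < m"
    and f: "\<forall>x y. (x, y) \<in> Omega_bar \<longrightarrow> f (x, y) = D i j x y"
  shows has_dx_cell_partials: "has_dx_cell X T f (dx Omega_bar f)"
    and has_dy_cell_partials: "has_dy_cell X T f (dy Omega_bar f)"
proof -
  note sub = cell_subset_Omega_bar[OF M]
  have c: "continuous_on (cell_set X T) g" if "\<forall>x y. (x, y) \<in> Omega_bar \<longrightarrow> g (x, y) = D i' j' x y" "i' + j' \<le> m"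
    for g :: "point \<Rightarrow> real" and i' j'
  proof -
    have "continuous_on Omega_bar (\<lambda>(x, y). D i' j' x y)" using partials_continuous[OF P that(2)] .
    then have "continuous_on Omega_bar g" by (rule continuous_on_eq) (use that(1) in auto)
    then show ?thesis using sub continuous_on_subset by blast
  qed
  note dx' = dx_of_partials[OF P f ij] and dy' = dy_of_partials[OF P f ij]
  have dx: "\<forall>x y. (x, y) \<in> Omega_bar \<longrightarrow> dx Omega_bar f (x, y) = D (Suc i) j x y"
    and dy: "\<forall>x y. (x, y) \<in> Omega_bar \<longrightarrow> dy Omega_bar f (x, y) = D i (Suc j) x y"
    using dx' dy' by blast+
  have "continuous_on (cell_set X T) f" using c[OF f] ij by simp
  moreover have "continuous_on (cell_set X T) (dx Omega_bar f)" using c[OF dx] ij by simp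
  moreover have "continuous_on (cell_set X T) (dy Omega_bar f)" using c[OF dy] ij by simp
  moreover have "((\<lambda>t. f (t, y)) has_real_derivative dx Omega_bar f (x, y)) (at x within {X (fst T)..X (Suc (fst T))})"
    "((\<lambda>t. f (x, t)) has_real_derivative dy Omega_bar f (x, y)) (at y within {X (snd T)..X (Suc (snd T))})"
    if xy: "(x, y) \<in> cell_set X T" for x y
  proof -
    have O: "(x, y) \<in> Omega_bar" using xy sub by blast
    then have xy': "x \<in> {0..1}" "y \<in> {0..1}" by auto
    have "((\<lambda>t. f (t, y)) has_real_derivative D (Suc i) j x y) (at x within {0..1})"
      by (rule real_derivative_transform[OF partials_x[OF P ij xy']]) (use xy' f in auto)
    then show "((\<lambda>t. f (t, y)) has_real_derivative dx Omega_bar f (x, y)) (at x within {X (fst T)..X (Suc (fst T))})"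
      unfolding dx'[OF O] by (rule DERIV_subset[OF _ cell_intervals(1)[OF M]])
    have "((\<lambda>t. f (x, t)) has_real_derivative D i (Suc j) x y) (at y within {0..1})"
      by (rule real_derivative_transform[OF partials_y[OF P ij xy']]) (use xy' f in auto)
    then show "((\<lambda>t. f (x, t)) has_real_derivative dy Omega_bar f (x, y)) (at y within {X (snd T)..X (Suc (snd T))})"
      unfolding dy'[OF O] by (rule DERIV_subset[OF _ cell_intervals(2)[OF M]])
  qed
  ultimately show "has_dx_cell X T f (dx Omega_bar f)" "has_dy_cell X T f (dy Omega_bar f)"
    unfolding has_dx_cell_def has_dy_cell_def by blast+
qed

lemma C2_cell_partials:
  assumes M: "mesh N X" "T \<in> cells N" and P: "partials m 0 1 0 1 D" and m: "i + j + 2 \<le> m"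
    and f: "\<forall>x y. (x, y) \<in> Omega_bar \<longrightarrow> f (x, y) = D i j x y"
  shows "C2_cell X T f"
proof -
  have ij: "i + j < m" "Suc i + j < m" "i + Suc j < m" using m by auto
  have d: "\<forall>x y. (x, y) \<in> Omega_bar \<longrightarrow> dx Omega_bar f (x, y) = D (Suc i) j x y"
    "\<forall>x y. (x, y) \<in> Omega_bar \<longrightarrow> dy Omega_bar f (x, y) = D i (Suc j) x y"
    using dx_of_partials[OF P f ij(1)] dy_of_partials[OF P f ij(1)] by blast+
  show ?thesis
    unfolding C2_cell_def
    by (intro conjI has_dx_cell_partials[OF M P ij(1) f] has_dy_cell_partials[OF M P ij(1) f]
        has_dx_cell_partials[OF M P ij(2) d(1)] has_dy_cell_partials[OF M P ij(3) d(2)])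
qed

section \<open>Best approximation on edges\<close>

text \<open>Pythagoras: \<open>q\<close> minus the projection lies in \<open>Pk k\<close>, to which
  the projection error is orthogonal. With \<open>q\<close> the trace of a cell polynomial, the jump
  of \<open>Q_proj\<close> is controlled by the error of the cell projection, with no separate
  estimate for the edge projection.\<close>

lemma proj_edge_best:
  assumes M: "mesh N X" "T \<in> cells N" and g: "continuous_on (cell_set X T) g"
    and en: "(e, n) \<in> cell_boundary T" and q: "q \<in> Pk k"
  shows "edge_integral X e (\<lambda>t. (q t - proj_edge k X g e t)\<^sup>2) \<le> edge_integral X e (\<lambda>t. (q t - g (edge_point X e t))\<^sup>2)"
proof -
  obtain a b where e: "edge_range X e = {a..b}" "a < b" by (rule edge_range_cell[OF M en])
  let ?r = "proj_edge k X g e" and ?g = "\<lambda>t. g (edge_point X e t)"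
  define \<psi> where "\<psi> = (\<lambda>t. q t - ?r t)"
  have r: "?r \<in> Pk k" by (rule proj_edge_in_Pk[OF M g en])
  have \<psi>: "\<psi> \<in> Pk k" unfolding \<psi>_def by (rule Pk_minus[OF q r])
  have cg: "continuous_on (edge_range X e) ?g" by (rule edge_continuous[OF M g en])
  note c = cg Pk_continuous[OF q, of "edge_range X e"] Pk_continuous[OF r, of "edge_range X e"] Pk_continuous[OF \<psi>, of "edge_range X e"]
  have cD: "continuous_on (edge_range X e) (\<lambda>t. ?r t * \<psi> t - ?g t * \<psi> t)" by (intro continuous_intros c)
  have "edge_integral X e (\<lambda>t. (q t - ?r t)\<^sup>2) \<le> edge_integral X e (\<lambda>t. (q t - ?g t)\<^sup>2 - 2 * (?r t * \<psi> t - ?g t * \<psi> t))"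
  proof (rule edge_integral_mono)
    show "continuous_on (edge_range X e) (\<lambda>t. (q t - ?r t)\<^sup>2)"
      "continuous_on (edge_range X e) (\<lambda>t. (q t - ?g t)\<^sup>2 - 2 * (?r t * \<psi> t - ?g t * \<psi> t))"
      by (intro continuous_intros c)+
    fix t
    have "0 \<le> (?r t - ?g t)\<^sup>2" by simp
    then show "(q t - ?r t)\<^sup>2 \<le> (q t - ?g t)\<^sup>2 - 2 * (?r t * \<psi> t - ?g t * \<psi> t)"
      unfolding \<psi>_def by (simp add: power2_eq_square algebra_simps)
  qed
  also have "\<dots> = edge_integral X e (\<lambda>t. (q t - ?g t)\<^sup>2) - edge_integral X e (\<lambda>t. 2 * (?r t * \<psi> t - ?g t * \<psi> t))"
    by (intro edge_integral_diff continuous_intros c)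
  also have "edge_integral X e (\<lambda>t. 2 * (?r t * \<psi> t - ?g t * \<psi> t)) = 2 * edge_integral X e (\<lambda>t. ?r t * \<psi> t - ?g t * \<psi> t)"
    by (rule edge_integral_cmult[OF cD])
  also have "edge_integral X e (\<lambda>t. ?r t * \<psi> t - ?g t * \<psi> t) = edge_integral X e (\<lambda>t. ?r t * \<psi> t) - edge_integral X e (\<lambda>t. ?g t * \<psi> t)"
    by (intro edge_integral_diff continuous_intros c)
  also have "edge_integral X e (\<lambda>t. ?r t * \<psi> t) = edge_integral X e (\<lambda>t. ?g t * \<psi> t)"
    by (rule proj_edge_char(2)[OF e edge_continuous[OF M g en, unfolded e(1)] \<psi>])
  finally show ?thesis by simp
qed

lemma boundary_integral_proj_edge_best:
  assumes M: "mesh N X" "T \<in> cells N" and g: "continuous_on (cell_set X T) g" and q: "q \<in> Qk k"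
  shows "boundary_integral X T (\<lambda>e n t. (q (edge_point X e t) - proj_edge k X g e t)\<^sup>2)
    \<le> boundary_integral X T (\<lambda>e n t. (q (edge_point X e t) - g (edge_point X e t))\<^sup>2)"
  unfolding boundary_integral_def
proof (rule sum_mono, clarify)
  fix e and n1 n2 :: real assume en: "(e, n1, n2) \<in> cell_boundary T"
  show "edge_integral X e (\<lambda>t. (q (edge_point X e t) - proj_edge k X g e t)\<^sup>2)
    \<le> edge_integral X e (\<lambda>t. (q (edge_point X e t) - g (edge_point X e t))\<^sup>2)"
    by (rule proj_edge_best[OF M g en Qk_edge[OF q]])
qed

lemma normal_le_1: "(e, n) \<in> cell_boundary T \<Longrightarrow> \<bar>fst n\<bar> \<le> 1 \<and> \<bar>snd n\<bar> \<le> 1"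
  unfolding cell_boundary_def case_prod_unfold by auto

text \<open>With \<open>\<nu> = 1 / N\<close>, \<open>a = \<nu> ^ (k - 2)\<close> and \<open>r = \<rho> ^ (k - 2) * d\<close>, the bases of the squares are \<open>eta 3, eta 1, eta 0, eta 2, eta 1\<close>.\<close>

lemma weighted_error_bound:
  fixes \<epsilon> \<rho> \<nu> A a r wb :: real
  assumes \<epsilon>: "0 < \<epsilon>" "\<epsilon> \<le> 1" and \<rho>: "0 < \<rho>" "\<rho> \<le> A" and \<nu>: "0 < \<nu>" "\<nu> \<le> 1" "\<nu> \<le> \<rho>" and p: "\<epsilon> * \<rho> \<le> \<nu>"
    and wb: "0 < wb" "1 / wb \<le> 2 * (\<nu> * \<rho>\<^sup>2)" "wb \<le> (1 + A\<^sup>2) / (\<nu> * \<rho>\<^sup>2)"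
  shows "\<epsilon> ^ 4 * (a + r / \<epsilon>\<^sup>2)\<^sup>2 / wb + (\<nu>\<^sup>2 * a + \<rho>\<^sup>2 * r)\<^sup>2 / wb + wb * (\<nu> ^ 3 * a + \<epsilon> * \<rho> ^ 3 * r)\<^sup>2
      + \<epsilon> ^ 4 * (\<nu> * a + \<rho> * r / \<epsilon>)\<^sup>2 / (\<epsilon> / \<rho>) + (\<epsilon> / \<rho>) * (\<nu>\<^sup>2 * a + \<rho>\<^sup>2 * r)\<^sup>2
    \<le> (10 + 6 * A\<^sup>2 + 4 * A ^ 4) * (\<nu> ^ 3 * a\<^sup>2 + \<nu> * \<rho>\<^sup>2 * r\<^sup>2)"
proof -
  have sq: "(x + y)\<^sup>2 \<le> 2 * (x\<^sup>2 + y\<^sup>2)" for x y :: real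
    using zero_le_power2[of "x - y"] by (simp add: power2_eq_square algebra_simps)
  define U where "U = \<nu> ^ 3 * a\<^sup>2"
  define V where "V = \<nu> * \<rho>\<^sup>2 * r\<^sup>2"
  have U0: "0 \<le> U" and V0: "0 \<le> V" unfolding U_def V_def using \<nu> by auto
  have A0: "0 < A" using \<rho> by simp
  have p2: "\<epsilon>\<^sup>2 * \<rho>\<^sup>2 \<le> \<nu>\<^sup>2"
    using power_mono[OF p, of 2] \<epsilon> \<rho> by (simp add: power_mult_distrib)
  have \<epsilon>2: "\<epsilon>\<^sup>2 \<le> 1" using \<epsilon> by (simp add: power_le_one)
  have \<rho>A2: "\<rho>\<^sup>2 \<le> A\<^sup>2" using \<rho> by (simp add: power_mono)
  have \<nu>\<rho>2: "\<nu>\<^sup>2 \<le> \<rho>\<^sup>2" using \<nu> by (simp add: power_mono)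
  have cmp: "c * s\<^sup>2 \<le> B * s\<^sup>2" if "c \<le> B" for c B s :: real
    using that by (rule mult_right_mono) simp
  \<comment> \<open>This term fixes the rate: its layer part retains no power of
    \<open>\<epsilon>\<close>. Relative to \<open>V\<close>, the layer parts of the others carry
    extra powers of \<open>\<rho>\<close> or of \<open>\<epsilon> * \<rho> / \<nu>\<close>.\<close>
  have T1: "\<epsilon> ^ 4 * (a + r / \<epsilon>\<^sup>2)\<^sup>2 / wb \<le> 4 * U + 4 * V"
  proof -
    have e: "\<epsilon> ^ 4 * (a + r / \<epsilon>\<^sup>2)\<^sup>2 = (\<epsilon>\<^sup>2 * a + r)\<^sup>2"
      using \<epsilon> by (simp add: field_simps power2_eq_square power4_eq_xxxx)
    have "(\<epsilon>\<^sup>2 * a + r)\<^sup>2 * (1 / wb) \<le> (2 * ((\<epsilon>\<^sup>2 * a)\<^sup>2 + r\<^sup>2)) * (2 * (\<nu> * \<rho>\<^sup>2))"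
      using wb by (intro mult_mono sq) auto
    also have "\<dots> = 4 * ((\<nu> * (\<epsilon>\<^sup>2 * (\<epsilon>\<^sup>2 * \<rho>\<^sup>2))) * a\<^sup>2) + 4 * V"
      unfolding V_def by (simp add: power2_eq_square algebra_simps)
    also have "(\<nu> * (\<epsilon>\<^sup>2 * (\<epsilon>\<^sup>2 * \<rho>\<^sup>2))) * a\<^sup>2 \<le> (\<nu> * (1 * \<nu>\<^sup>2)) * a\<^sup>2"
      using \<nu> p2 \<epsilon>2 by (intro cmp mult_left_mono mult_mono) auto
    also have "\<dots> = U" unfolding U_def by (simp add: power3_eq_cube power2_eq_square)
    finally show ?thesis unfolding e by simp
  qed
  have \<eta>1: "(\<nu>\<^sup>2 * a + \<rho>\<^sup>2 * r)\<^sup>2 \<le> 2 * ((\<nu>\<^sup>2 * a)\<^sup>2 + (\<rho>\<^sup>2 * r)\<^sup>2)" by (rule sq)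
  have T2: "(\<nu>\<^sup>2 * a + \<rho>\<^sup>2 * r)\<^sup>2 / wb \<le> 4 * A\<^sup>2 * U + 4 * A ^ 4 * V"
  proof -
    have "(\<nu>\<^sup>2 * a + \<rho>\<^sup>2 * r)\<^sup>2 * (1 / wb) \<le> (2 * ((\<nu>\<^sup>2 * a)\<^sup>2 + (\<rho>\<^sup>2 * r)\<^sup>2)) * (2 * (\<nu> * \<rho>\<^sup>2))"
      using \<eta>1 wb by (intro mult_mono) auto
    also have "\<dots> = 4 * ((\<rho>\<^sup>2 * \<nu>\<^sup>2) * U) + 4 * ((\<rho>\<^sup>2 * \<rho>\<^sup>2) * V)"
      unfolding U_def V_def by (simp add: power2_eq_square power3_eq_cube algebra_simps)
    also have "(\<rho>\<^sup>2 * \<nu>\<^sup>2) * U \<le> (A\<^sup>2 * 1) * U"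
      using \<rho>A2 \<nu> U0 by (intro mult_right_mono mult_mono) (auto simp: power_le_one)
    also have "(\<rho>\<^sup>2 * \<rho>\<^sup>2) * V \<le> (A\<^sup>2 * A\<^sup>2) * V"
      using \<rho>A2 V0 by (intro mult_right_mono mult_mono) auto
    finally show ?thesis by (simp add: power2_eq_square power4_eq_xxxx)
  qed
  \<comment> \<open>The value jump of the projection is multiplied by \<open>wb\<close>, so the
    upper bound on the weight enters; its factor \<open>1 / \<nu>\<close> is compensated by
    \<open>\<epsilon>\<^sup>2 * \<rho>\<^sup>2 \<le> \<nu>\<^sup>2\<close>.\<close>
  have T3: "wb * (\<nu> ^ 3 * a + \<epsilon> * \<rho> ^ 3 * r)\<^sup>2 \<le> 2 * (1 + A\<^sup>2) * U + 2 * (1 + A\<^sup>2) * V"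
  proof -
    have "wb * (\<nu> ^ 3 * a + \<epsilon> * \<rho> ^ 3 * r)\<^sup>2
        \<le> ((1 + A\<^sup>2) / (\<nu> * \<rho>\<^sup>2)) * (2 * ((\<nu> ^ 3 * a)\<^sup>2 + (\<epsilon> * \<rho> ^ 3 * r)\<^sup>2))"
      using wb sq \<nu> \<rho> by (intro mult_mono) auto
    also have "\<dots> = 2 * (1 + A\<^sup>2) * ((\<nu>\<^sup>2 / \<rho>\<^sup>2) * U) + 2 * (1 + A\<^sup>2) * ((\<epsilon>\<^sup>2 * \<rho>\<^sup>2) * (\<rho>\<^sup>2 * r\<^sup>2) / \<nu>)"
      unfolding U_def using \<nu> \<rho> by (simp add: power2_eq_square power3_eq_cube field_simps)
    finally have 1: "wb * (\<nu> ^ 3 * a + \<epsilon> * \<rho> ^ 3 * r)\<^sup>2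
        \<le> 2 * (1 + A\<^sup>2) * ((\<nu>\<^sup>2 / \<rho>\<^sup>2) * U) + 2 * (1 + A\<^sup>2) * ((\<epsilon>\<^sup>2 * \<rho>\<^sup>2) * (\<rho>\<^sup>2 * r\<^sup>2) / \<nu>)" .
    have "(\<nu>\<^sup>2 / \<rho>\<^sup>2) * U \<le> 1 * U"
      using \<nu>\<rho>2 \<rho> U0 by (intro mult_right_mono) auto
    then have 2: "2 * (1 + A\<^sup>2) * ((\<nu>\<^sup>2 / \<rho>\<^sup>2) * U) \<le> 2 * (1 + A\<^sup>2) * U"
      by (intro mult_left_mono) auto
    have "(\<epsilon>\<^sup>2 * \<rho>\<^sup>2) * (\<rho>\<^sup>2 * r\<^sup>2) / \<nu> \<le> \<nu>\<^sup>2 * (\<rho>\<^sup>2 * r\<^sup>2) / \<nu>"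
      using p2 \<nu> by (intro divide_right_mono mult_right_mono) auto
    also have "\<nu>\<^sup>2 * (\<rho>\<^sup>2 * r\<^sup>2) / \<nu> = V"
      unfolding V_def using \<nu> by (simp add: power2_eq_square)
    finally have "2 * (1 + A\<^sup>2) * ((\<epsilon>\<^sup>2 * \<rho>\<^sup>2) * (\<rho>\<^sup>2 * r\<^sup>2) / \<nu>) \<le> 2 * (1 + A\<^sup>2) * V"
      by (intro mult_left_mono) auto
    with 1 2 show ?thesis by linarith
  qed
  have T4: "\<epsilon> ^ 4 * (\<nu> * a + \<rho> * r / \<epsilon>)\<^sup>2 / (\<epsilon> / \<rho>) \<le> 2 * U + 2 * V"
  proof -
    have "\<epsilon> ^ 4 * (\<nu> * a + \<rho> * r / \<epsilon>)\<^sup>2 / (\<epsilon> / \<rho>) \<le> \<epsilon> ^ 4 * (2 * ((\<nu> * a)\<^sup>2 + (\<rho> * r / \<epsilon>)\<^sup>2)) / (\<epsilon> / \<rho>)"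
      using sq \<epsilon> \<rho> by (intro divide_right_mono mult_left_mono) auto
    also have "\<dots> = 2 * ((\<epsilon>\<^sup>2 * (\<epsilon> * \<rho>) * \<nu>\<^sup>2) * a\<^sup>2) + 2 * ((\<epsilon> * \<rho> * \<rho>\<^sup>2) * r\<^sup>2)"
      using \<epsilon> \<rho> by (simp add: power2_eq_square power4_eq_xxxx field_simps)
    also have "(\<epsilon>\<^sup>2 * (\<epsilon> * \<rho>) * \<nu>\<^sup>2) * a\<^sup>2 \<le> (1 * \<nu> * \<nu>\<^sup>2) * a\<^sup>2"
      using \<epsilon>2 p \<epsilon> \<rho> \<nu> by (intro cmp mult_right_mono mult_mono) auto
    also have "(\<epsilon> * \<rho> * \<rho>\<^sup>2) * r\<^sup>2 \<le> (\<nu> * \<rho>\<^sup>2) * r\<^sup>2"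
      using p by (intro cmp mult_right_mono) auto
    finally show ?thesis unfolding U_def V_def by (simp add: power2_eq_square power3_eq_cube)
  qed
  have T5: "(\<epsilon> / \<rho>) * (\<nu>\<^sup>2 * a + \<rho>\<^sup>2 * r)\<^sup>2 \<le> 2 * U + 2 * V"
  proof -
    have "(\<epsilon> / \<rho>) * (\<nu>\<^sup>2 * a + \<rho>\<^sup>2 * r)\<^sup>2 \<le> (\<epsilon> / \<rho>) * (2 * ((\<nu>\<^sup>2 * a)\<^sup>2 + (\<rho>\<^sup>2 * r)\<^sup>2))"
      using \<eta>1 \<epsilon> \<rho> by (intro mult_left_mono) auto
    also have "\<dots> = 2 * ((\<epsilon> * (\<nu> / \<rho>)) * U) + 2 * ((\<epsilon> * \<rho> * \<rho>\<^sup>2) * r\<^sup>2)"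
      unfolding U_def using \<rho> by (simp add: power2_eq_square power3_eq_cube field_simps)
    also have "(\<epsilon> * (\<nu> / \<rho>)) * U \<le> (1 * 1) * U"
      using \<epsilon> \<nu> \<rho> U0 by (intro mult_right_mono mult_mono) auto
    also have "(\<epsilon> * \<rho> * \<rho>\<^sup>2) * r\<^sup>2 \<le> (\<nu> * \<rho>\<^sup>2) * r\<^sup>2"
      using p by (intro cmp mult_right_mono) auto
    finally show ?thesis unfolding V_def by simp
  qed
  \<comment> \<open>The five bounds sum to the coefficient \<open>10 + 6 * A\<^sup>2\<close> for
    \<open>U\<close> and \<open>10 + 2 * A\<^sup>2 + 4 * A ^ 4\<close> for \<open>V\<close>; the
    stated constant is a common majorant.\<close>
  have "4 * V \<le> (4 + 4 * A\<^sup>2) * V" "4 * A\<^sup>2 * U \<le> (4 * A\<^sup>2 + 4 * A ^ 4) * U"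
    using U0 V0 by (intro mult_right_mono; simp)+
  moreover have "(10 + 6 * A\<^sup>2 + 4 * A ^ 4) * (\<nu> ^ 3 * a\<^sup>2 + \<nu> * \<rho>\<^sup>2 * r\<^sup>2)
      = 4 * U + (4 * A\<^sup>2 + 4 * A ^ 4) * U + 2 * (1 + A\<^sup>2) * U + 4 * U
        + ((4 + 4 * A\<^sup>2) * V + 4 * A ^ 4 * V + 2 * (1 + A\<^sup>2) * V + 4 * V)"
    unfolding U_def[symmetric] V_def[symmetric] by (simp add: algebra_simps)
  ultimately show ?thesis using T1 T2 T3 T4 T5 by linarith
qed

section \<open>The weighted error on the Shishkin mesh\<close>

context shishkin
begin

text \<open>Squared residuals divided by the stabilizer weights. In order, the summands stem from
  \<open>\<nabla>\<Delta>u\<close>, from \<open>\<nabla>u\<close>, from the value jump of the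
  projection, from \<open>\<Delta>u\<close>, and from its gradient jump.\<close>

definition weighted_error :: "cell \<Rightarrow> real"
  where "weighted_error T = \<epsilon> ^ 4 * (eta 3 T)\<^sup>2 / weight_b k \<epsilon> N + (eta 1 T)\<^sup>2 / weight_b k \<epsilon> N
    + weight_b k \<epsilon> N * (eta 0 T)\<^sup>2 + \<epsilon> ^ 4 * (eta 2 T)\<^sup>2 / weight_g k \<epsilon> N + weight_g k \<epsilon> N * (eta 1 T)\<^sup>2"

lemma weight_b_eq: "weight_b k \<epsilon> N = (1 / \<rho>\<^sup>2 + 1) / H"
  unfolding weight_b_def h_eq using eps \<rho>_pos by (simp add: divide_inverse power_mult_distrib algebra_simps)

lemma weight_g_eq: "weight_g k \<epsilon> N = \<epsilon> / \<rho>"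
  unfolding weight_g_def h_eq using eps \<rho>_pos by (simp add: power2_eq_square divide_inverse)

lemma weights_pos: "0 < weight_b k \<epsilon> N" "0 < weight_g k \<epsilon> N"
  unfolding weight_b_eq weight_g_eq using eps \<rho>_pos H_pos by (auto intro!: divide_pos_pos add_pos_pos)

lemma weighted_error_le:
  assumes k3: "3 \<le> k"
  defines "A \<equiv> 4 * real (k + 1)"
  shows "weighted_error T \<le> (10 + 6 * A\<^sup>2 + 4 * A ^ 4) *
    ((1 / real N) ^ (2 * k - 1) + (1 / real N) * \<rho> ^ (2 * k - 2) * (cell_decay T)\<^sup>2)"
proof -
  \<comment> \<open>The exponent in \<open>eta 3\<close>, the smallest of the four in use, so that
    every scale becomes a combination of \<open>a\<close> and \<open>r\<close>.\<close>
  define m where "m = k - 2"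
  have km: "k = m + 2" using k3 by (simp add: m_def)
  define \<nu> where "\<nu> = 1 / real N"
  define a where "a = \<nu> ^ m"
  define r where "r = \<rho> ^ m * cell_decay T"
  have \<nu>: "0 < \<nu>" "\<nu> \<le> 1" "\<nu> \<le> \<rho>" unfolding \<nu>_def using N4 \<rho>_ge by auto
  have p: "\<epsilon> * \<rho> \<le> \<nu>" using h_le unfolding h_eq \<nu>_def .
  have \<rho>A: "\<rho> \<le> A" unfolding A_def by (rule \<rho>_le_const)
  have wb2: "1 / weight_b k \<epsilon> N \<le> 2 * (\<nu> * \<rho>\<^sup>2)"
  proof -
    have "1 / weight_b k \<epsilon> N = H * (\<rho>\<^sup>2 / (1 + \<rho>\<^sup>2))"
      unfolding weight_b_eq using \<rho>_pos by (simp add: field_simps)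
    also have "\<dots> \<le> (2 * \<nu>) * \<rho>\<^sup>2"
    proof (rule mult_mono)
      have "\<rho>\<^sup>2 / (1 + \<rho>\<^sup>2) \<le> \<rho>\<^sup>2 / 1" by (rule divide_left_mono) (auto intro: add_pos_nonneg)
      then show "\<rho>\<^sup>2 / (1 + \<rho>\<^sup>2) \<le> \<rho>\<^sup>2" by simp
    qed (use H_bounds(2) \<nu> in \<open>auto simp: \<nu>_def\<close>)
    finally show ?thesis by simp
  qed
  have wb3: "weight_b k \<epsilon> N \<le> (1 + A\<^sup>2) / (\<nu> * \<rho>\<^sup>2)"
  proof -
    have "weight_b k \<epsilon> N \<le> (1 / \<rho>\<^sup>2 + 1) / \<nu>"
      unfolding weight_b_eq using H_bounds(1) \<nu> \<rho>_pos H_pos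
      by (intro divide_left_mono) (auto simp: \<nu>_def intro!: mult_pos_pos)
    also have "\<dots> = (1 + \<rho>\<^sup>2) / (\<nu> * \<rho>\<^sup>2)" using \<rho>_pos \<nu> by (simp add: field_simps)
    also have "\<dots> \<le> (1 + A\<^sup>2) / (\<nu> * \<rho>\<^sup>2)"
      using \<rho>A \<rho>_pos \<nu> by (intro divide_right_mono add_left_mono power_mono) auto
    finally show ?thesis .
  qed
  have ex: "k + 1 - 3 = m" "k + 1 - 2 = m + 1" "k + 1 - 1 = m + 2" "k + 1 - 0 = m + 3"
    by (simp_all add: km)
  have pw: "\<epsilon> powi (1 - int 3) = 1 / \<epsilon>\<^sup>2" "\<epsilon> powi (1 - int 2) = 1 / \<epsilon>" "\<epsilon> powi (1 - int 1) = 1" "\<epsilon> powi (1 - int 0) = \<epsilon>"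
    by (simp_all add: power_int_def divide_inverse power_inverse)
  have e3: "eta 3 T = a + r / \<epsilon>\<^sup>2"
    unfolding eta_def a_def r_def \<nu>_def[symmetric] ex pw by simp
  have e2: "eta 2 T = \<nu> * a + \<rho> * r / \<epsilon>"
    unfolding eta_def a_def r_def \<nu>_def[symmetric] ex pw by simp
  have e1: "eta 1 T = \<nu>\<^sup>2 * a + \<rho>\<^sup>2 * r"
    unfolding eta_def a_def r_def \<nu>_def[symmetric] ex pw by (simp add: power_add power2_eq_square mult_ac)
  have e0: "eta 0 T = \<nu> ^ 3 * a + \<epsilon> * \<rho> ^ 3 * r"
    unfolding eta_def a_def r_def \<nu>_def[symmetric] ex pw by (simp add: power_add power3_eq_cube mult_ac)
  have "weighted_error T \<le> (10 + 6 * A\<^sup>2 + 4 * A ^ 4) * (\<nu> ^ 3 * a\<^sup>2 + \<nu> * \<rho>\<^sup>2 * r\<^sup>2)"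
    unfolding weighted_error_def e0 e1 e2 e3 weight_g_eq
    using eps \<rho>_pos \<rho>A \<nu> p weights_pos(1) wb2 wb3 by (intro weighted_error_bound) auto
  also have "\<nu> ^ 3 * a\<^sup>2 = \<nu> ^ (2 * k - 1)"
  proof -
    have "2 * k - 1 = 3 + m * 2" by (simp add: km)
    then show ?thesis unfolding a_def by (simp only: power_mult power_add)
  qed
  also have "\<nu> * \<rho>\<^sup>2 * r\<^sup>2 = \<nu> * \<rho> ^ (2 * k - 2) * (cell_decay T)\<^sup>2"
  proof -
    have "2 * k - 2 = 2 + m * 2" by (simp add: km)
    then show ?thesis unfolding r_def by (simp only: power_mult power_add power_mult_distrib mult.assoc)
  qed
  finally show ?thesis unfolding \<nu>_def .
qed

text \<open>The perimeters sum to \<open>4 * N\<close>, which lowers the exponent of the smooth part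
  to \<open>2 * k - 2\<close>; the decay sum contributes \<open>1 / \<rho>\<close>, which lowers
  that of the layers to \<open>2 * k - 3\<close>. Both are then expressed by \<open>1 / N\<close>
  and \<open>ln N\<close>.\<close>

lemma sum_weighted_error:
  assumes k3: "3 \<le> k"
  defines "A \<equiv> 4 * real (k + 1)"
  shows "(\<Sum>T\<in>cells N. perimeter T * weighted_error T)
    \<le> (10 + 6 * A\<^sup>2 + 4 * A ^ 4) * (4 + 24 * decay_const * A ^ (2 * k - 3))
      * ((1 / real N) ^ (2 * k - 2) * ln (real N) ^ (2 * k - 3))"
proof -
  define c where "c = 10 + 6 * A\<^sup>2 + 4 * A ^ 4"
  define \<nu> where "\<nu> = 1 / real N"
  have \<nu>: "0 < \<nu>" "\<nu> * real N = 1" unfolding \<nu>_def using N4 by auto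
  have c0: "0 \<le> c" unfolding c_def by simp
  have dc: "0 \<le> decay_const" unfolding decay_const_def by simp
  have k21: "2 * k - 1 = Suc (2 * k - 2)" and k22: "2 * k - 2 = Suc (2 * k - 3)" using k3 by auto
  have "(\<Sum>T\<in>cells N. perimeter T * weighted_error T)
      \<le> (\<Sum>T\<in>cells N. perimeter T * (c * (\<nu> ^ (2 * k - 1) + \<nu> * \<rho> ^ (2 * k - 2) * (cell_decay T)\<^sup>2)))"
    unfolding c_def \<nu>_def A_def using width_bounds(4) less_imp_le[OF width_bounds(4)]
    by (intro sum_mono mult_left_mono weighted_error_le[OF k3]) (simp add: perimeter_def add_nonneg_nonneg)
  also have "\<dots> = c * (\<nu> ^ (2 * k - 1) * (\<Sum>T\<in>cells N. perimeter T)
      + \<nu> * \<rho> ^ (2 * k - 2) * (\<Sum>T\<in>cells N. perimeter T * (cell_decay T)\<^sup>2))"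
    unfolding sum_distrib_left sum.distrib[symmetric] by (intro sum.cong refl) (simp add: algebra_simps)
  also have "\<dots> \<le> c * (\<nu> ^ (2 * k - 1) * (4 * real N) + \<nu> * \<rho> ^ (2 * k - 2) * (24 * decay_const / \<rho>))"
    unfolding sum_perimeter using sum_perimeter_decay c0 \<nu> \<rho>_pos
    by (intro mult_left_mono add_left_mono) auto
  also have "\<nu> ^ (2 * k - 1) * (4 * real N) = 4 * \<nu> ^ (2 * k - 2)"
    unfolding k21 using \<nu>(2) by (simp add: mult_ac)
  also have "\<nu> * \<rho> ^ (2 * k - 2) * (24 * decay_const / \<rho>) = 24 * decay_const * (\<nu> * \<rho> ^ (2 * k - 3))"
    unfolding k22 using \<rho>_pos by simp
  also have "c * (4 * \<nu> ^ (2 * k - 2) + 24 * decay_const * (\<nu> * \<rho> ^ (2 * k - 3)))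
      \<le> c * (4 * (\<nu> ^ (2 * k - 2) * ln (real N) ^ (2 * k - 3))
        + 24 * decay_const * (A ^ (2 * k - 3) * (\<nu> ^ (2 * k - 2) * ln (real N) ^ (2 * k - 3))))"
  proof (intro mult_left_mono add_mono)
    show "\<nu> ^ (2 * k - 2) \<le> \<nu> ^ (2 * k - 2) * ln (real N) ^ (2 * k - 3)"
      using ln_N \<nu> by (simp add: mult_le_cancel_left1 one_le_power)
    have "\<rho> ^ (2 * k - 3) \<le> (A * ln (real N) * \<nu>) ^ (2 * k - 3)"
      using \<rho>_le \<rho>_pos unfolding A_def \<nu>_def by (intro power_mono) auto
    then have "\<nu> * \<rho> ^ (2 * k - 3) \<le> \<nu> * (A * ln (real N) * \<nu>) ^ (2 * k - 3)"
      using \<nu> by (intro mult_left_mono) auto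
    also have "\<dots> = A ^ (2 * k - 3) * (\<nu> ^ (2 * k - 2) * ln (real N) ^ (2 * k - 3))"
      unfolding k22 by (simp add: power_mult_distrib mult_ac)
    finally show "\<nu> * \<rho> ^ (2 * k - 3) \<le> A ^ (2 * k - 3) * (\<nu> ^ (2 * k - 2) * ln (real N) ^ (2 * k - 3))" .
  qed (use c0 dc in auto)
  also have "\<dots> = c * (4 + 24 * decay_const * A ^ (2 * k - 3)) * (\<nu> ^ (2 * k - 2) * ln (real N) ^ (2 * k - 3))"
    by (simp add: algebra_simps)
  finally show ?thesis unfolding c_def \<nu>_def .
qed

end

section \<open>Residuals of the exact solution\<close>

locale shishkin_approx = shishkin +
  fixes K :: real and U :: "nat \<Rightarrow> nat \<Rightarrow> real \<Rightarrow> real \<Rightarrow> real" and u :: "point \<Rightarrow> real"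
  assumes k3: "3 \<le> k" and U: "approx K U" and u: "\<forall>x y. (x, y) \<in> Omega_bar \<longrightarrow> u (x, y) = U 0 0 x y"
begin

abbreviation "w \<equiv> laplacian Omega_bar u"

text \<open>The array of derivatives of \<open>\<Delta>u\<close>. From the four derivatives of
  \<open>u\<close> that are available for \<open>k = 3\<close> it retains two, enough for
  \<open>C2_cell\<close>.\<close>

definition W :: "nat \<Rightarrow> nat \<Rightarrow> real \<Rightarrow> real \<Rightarrow> real"
  where "W i j x y = U (i + 2) j x y + U i (j + 2) x y"

lemma P4: "partials 4 0 1 0 1 U"
  using partials_le[OF approx_partials[OF U]] k3 by simp

lemma P2W: "partials 2 0 1 0 1 W"
proof -
  have P: "partials (2 + 2) 0 1 0 1 U" using P4 by simp
  have "partials 2 0 1 0 1 (\<lambda>i j x y. U (i + 2) (j + 0) x y + U (i + 0) (j + 2) x y)"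
    by (rule partials_add[OF partials_shift[OF P] partials_shift[OF P]]) auto
  then show ?thesis by (simp add: W_def[abs_def])
qed

lemma
  shows u_x: "\<forall>x y. (x, y) \<in> Omega_bar \<longrightarrow> dx Omega_bar u (x, y) = U 1 0 x y"
    and u_y: "\<forall>x y. (x, y) \<in> Omega_bar \<longrightarrow> dy Omega_bar u (x, y) = U 0 1 x y"
  using dx_of_partials[OF P4 u] dy_of_partials[OF P4 u] by simp_all

lemma w_eq: "\<forall>x y. (x, y) \<in> Omega_bar \<longrightarrow> w (x, y) = W 0 0 x y"
  using dx_of_partials[OF P4 u_x] dy_of_partials[OF P4 u_y]
  by (simp add: laplacian_def W_def numeral_2_eq_2)

lemma
  shows w_x: "\<forall>x y. (x, y) \<in> Omega_bar \<longrightarrow> dx Omega_bar w (x, y) = W 1 0 x y"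
    and w_y: "\<forall>x y. (x, y) \<in> Omega_bar \<longrightarrow> dy Omega_bar w (x, y) = W 0 1 x y"
  using dx_of_partials[OF P2W w_eq] dy_of_partials[OF P2W w_eq] by simp_all

lemma C2_u: "\<forall>T\<in>cells N. C2_cell X T u" and C2_w: "\<forall>T\<in>cells N. C2_cell X T w"
  by (intro ballI C2_cell_partials[OF mesh_X _ P4 _ u]; simp)
    (intro ballI C2_cell_partials[OF mesh_X _ P2W _ w_eq]; simp)

text \<open>The projection acts separately on the two second derivatives in
  \<open>\<Delta>u\<close>; hence the factor \<open>2\<close> in the last three bounds.\<close>

lemma
  assumes T: "T \<in> cells N" and xy: "(x, y) \<in> cell_set X T"
  shows err_u: "\<bar>proj_cell k X u T (x, y) - u (x, y)\<bar> \<le> K * eta 0 T"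
    and err_u_x: "\<bar>dx UNIV (proj_cell k X u T) (x, y) - dx Omega_bar u (x, y)\<bar> \<le> K * eta 1 T"
    and err_u_y: "\<bar>dy UNIV (proj_cell k X u T) (x, y) - dy Omega_bar u (x, y)\<bar> \<le> K * eta 1 T"
    and err_ux: "\<bar>proj_cell k X (dx Omega_bar u) T (x, y) - dx Omega_bar u (x, y)\<bar> \<le> K * eta 1 T"
    and err_uy: "\<bar>proj_cell k X (dy Omega_bar u) T (x, y) - dy Omega_bar u (x, y)\<bar> \<le> K * eta 1 T"
    and err_w: "\<bar>proj_cell k X w T (x, y) - w (x, y)\<bar> \<le> 2 * K * eta 2 T"
    and err_w_x: "\<bar>dx UNIV (proj_cell k X w T) (x, y) - dx Omega_bar w (x, y)\<bar> \<le> 2 * K * eta 3 T"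
    and err_w_y: "\<bar>dy UNIV (proj_cell k X w T) (x, y) - dy Omega_bar w (x, y)\<bar> \<le> 2 * K * eta 3 T"
proof -
  have Om: "(x, y) \<in> Omega_bar" if "x \<in> {X (fst T)..X (Suc (fst T))}" "y \<in> {X (snd T)..X (Suc (snd T))}" for x y
    using that cell_subset_Omega_bar[OF mesh_X T] unfolding cell_set_def by blast
  have O: "(x, y) \<in> Omega_bar" using xy cell_subset_Omega_bar[OF mesh_X T] by blast
  note cu = C2_cell_cont[OF C2_u[rule_format, OF T]] and cw = C2_cell_cont[OF C2_w[rule_format, OF T]]
  note ab = cell_ab[OF T]
  note A0 = approx_0[OF U T xy] and Ax = approx_x[OF U T xy] and Ay = approx_y[OF U T xy]
  have cell: "\<forall>x\<in>{X (fst T)..X (Suc (fst T))}. \<forall>y\<in>{X (snd T)..X (Suc (snd T))}. f (x, y) = g x y"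
    if "\<forall>x y. (x, y) \<in> Omega_bar \<longrightarrow> f (x, y) = g x y" for f :: "point \<Rightarrow> real" and g
    using that Om by blast
  note c1 = proj2_cong[OF cell[OF u]] proj2x_cong[OF cell[OF u]] proj2y_cong[OF cell[OF u]]
    proj2_cong[OF cell[OF u_x]] proj2_cong[OF cell[OF u_y]]
  note c2 = proj2_cong[OF cell[OF w_eq]] proj2x_cong[OF cell[OF w_eq]] proj2y_cong[OF cell[OF w_eq]]
  show "\<bar>proj_cell k X u T (x, y) - u (x, y)\<bar> \<le> K * eta 0 T"
    unfolding proj_cell_eq_proj2(1)[OF mesh_X T cu(1)] c1 u[rule_format, OF O] using A0[of 0 0] by (simp add: abs_minus_commute)
  show "\<bar>dx UNIV (proj_cell k X u T) (x, y) - dx Omega_bar u (x, y)\<bar> \<le> K * eta 1 T"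
    unfolding proj_cell_derivatives[OF mesh_X T cu(1)] c1 u_x[rule_format, OF O] using Ax[of 0 0] by (simp add: abs_minus_commute)
  show "\<bar>dy UNIV (proj_cell k X u T) (x, y) - dy Omega_bar u (x, y)\<bar> \<le> K * eta 1 T"
    unfolding proj_cell_derivatives[OF mesh_X T cu(1)] c1 u_y[rule_format, OF O] using Ay[of 0 0] by (simp add: abs_minus_commute)
  show "\<bar>proj_cell k X (dx Omega_bar u) T (x, y) - dx Omega_bar u (x, y)\<bar> \<le> K * eta 1 T"
    unfolding proj_cell_eq_proj2(1)[OF mesh_X T cu(2)] c1 u_x[rule_format, OF O] using A0[of 1 0] by (simp add: abs_minus_commute)
  show "\<bar>proj_cell k X (dy Omega_bar u) T (x, y) - dy Omega_bar u (x, y)\<bar> \<le> K * eta 1 T"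
    unfolding proj_cell_eq_proj2(1)[OF mesh_X T cu(3)] c1 u_y[rule_format, OF O] using A0[of 0 1] by (simp add: abs_minus_commute)
  have c: "continuous_rect (X (fst T)) (X (Suc (fst T))) (X (snd T)) (X (Suc (snd T))) (U 2 0)"
    "continuous_rect (X (fst T)) (X (Suc (fst T))) (X (snd T)) (X (Suc (snd T))) (U 0 2)"
    using partials_continuous[OF partials_cell[OF T P4]] by simp_all
  have W0: "W 0 0 = (\<lambda>x y. U 2 0 x y + U 0 2 x y)" by (simp add: W_def[abs_def] numeral_2_eq_2)
  have tri: "\<bar>(a' + b') - (a + b)\<bar> \<le> 2 * K * r" if "\<bar>a - a'\<bar> \<le> K * r" "\<bar>b - b'\<bar> \<le> K * r" for a b a' b' r :: real
    using that by linarith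
  show "\<bar>proj_cell k X w T (x, y) - w (x, y)\<bar> \<le> 2 * K * eta 2 T"
    unfolding proj_cell_eq_proj2(1)[OF mesh_X T cw(1)] c2 w_eq[rule_format, OF O] W0 proj2_add[OF ab c]
    using A0[of 2 0] A0[of 0 2] by (intro tri) (auto simp: numeral_2_eq_2)
  show "\<bar>dx UNIV (proj_cell k X w T) (x, y) - dx Omega_bar w (x, y)\<bar> \<le> 2 * K * eta 3 T"
    unfolding proj_cell_derivatives[OF mesh_X T cw(1)] c2 w_x[rule_format, OF O] W0 proj2x_add[OF ab c] W_def
    using Ax[of 2 0] Ax[of 0 2] by (intro tri) (auto simp: numeral_2_eq_2 numeral_3_eq_3)
  show "\<bar>dy UNIV (proj_cell k X w T) (x, y) - dy Omega_bar w (x, y)\<bar> \<le> 2 * K * eta 3 T"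
    unfolding proj_cell_derivatives[OF mesh_X T cw(1)] c2 w_y[rule_format, OF O] W0 proj2y_add[OF ab c] W_def
    using Ay[of 2 0] Ay[of 0 2] by (intro tri) (auto simp: numeral_2_eq_2 numeral_3_eq_3)
qed

text \<open>Best approximation on edges replaces the edge projection by the exact trace. It holds
  for integrals of squares and not pointwise, so the jumps are bounded here in integrated
  form.\<close>

lemma jump_Q_proj:
  assumes T: "T \<in> cells N"
  shows "boundary_integral X T (\<lambda>e n t. (jump_b X (Q_proj k X u) T e t)\<^sup>2) \<le> perimeter T * (K * eta 0 T)\<^sup>2"
    and "boundary_integral X T (\<lambda>e n t. (jump_x X (Q_proj k X u) T e t)\<^sup>2) \<le> perimeter T * (K * eta 1 T)\<^sup>2"
    and "boundary_integral X T (\<lambda>e n t. (jump_y X (Q_proj k X u) T e t)\<^sup>2) \<le> perimeter T * (K * eta 1 T)\<^sup>2"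
proof -
  note M = mesh_X T
  note uT = C2_u[rule_format, OF T]
  note cu = C2_cell_cont[OF uT]
  note q = proj_cell_eq_proj2(2)[OF M cu(1), of k]
  note g = Q_proj_g[OF M uT]
  have bnd: "boundary_integral X T (\<lambda>e n t. (q (edge_point X e t) - f (edge_point X e t))\<^sup>2) \<le> perimeter T * B\<^sup>2"
    if "q \<in> Qk k" "continuous_on (cell_set X T) f" and B: "\<forall>x y. (x, y) \<in> cell_set X T \<longrightarrow> \<bar>q (x, y) - f (x, y)\<bar> \<le> B" for q f B
  proof (rule boundary_integral_le[OF _ T])
    show "bcont X T (\<lambda>e n t. (q (edge_point X e t) - f (edge_point X e t))\<^sup>2)"
      unfolding power2_eq_square
      by (intro bcont_mult bcont_diff bcont_cell[OF M] that Qk_continuous[OF that(1)])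
    fix e n t assume "(e, n) \<in> cell_boundary T" "t \<in> edge_range X e"
    then have "edge_point X e t \<in> cell_set X T" by (rule edge_point_in_cell[OF M])
    then have "\<bar>q (edge_point X e t) - f (edge_point X e t)\<bar> \<le> B"
      using B[rule_format, of "fst (edge_point X e t)" "snd (edge_point X e t)"] by simp
    from power_mono[OF this, of 2] show "(q (edge_point X e t) - f (edge_point X e t))\<^sup>2 \<le> B\<^sup>2" by simp
  qed
  have err: "\<forall>x y. (x, y) \<in> cell_set X T \<longrightarrow> \<bar>proj_cell k X u T (x, y) - u (x, y)\<bar> \<le> K * eta 0 T"
    "\<forall>x y. (x, y) \<in> cell_set X T \<longrightarrow> \<bar>dx UNIV (proj_cell k X u T) (x, y) - dx Omega_bar u (x, y)\<bar> \<le> K * eta 1 T"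
    "\<forall>x y. (x, y) \<in> cell_set X T \<longrightarrow> \<bar>dy UNIV (proj_cell k X u T) (x, y) - dy Omega_bar u (x, y)\<bar> \<le> K * eta 1 T"
    using err_u[OF T] err_u_x[OF T] err_u_y[OF T] by blast+
  show "boundary_integral X T (\<lambda>e n t. (jump_b X (Q_proj k X u) T e t)\<^sup>2) \<le> perimeter T * (K * eta 0 T)\<^sup>2"
    unfolding jump_b_def Q_proj_0 Q_proj_b
    by (rule order.trans[OF boundary_integral_proj_edge_best[OF M cu(1) q] bnd[OF q cu(1) err(1)]])
  have "boundary_integral X T (\<lambda>e n t. (jump_x X (Q_proj k X u) T e t)\<^sup>2)
      = boundary_integral X T (\<lambda>e n t. (dx UNIV (proj_cell k X u T) (edge_point X e t) - proj_edge k X (dx Omega_bar u) e t)\<^sup>2)"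
    by (rule boundary_integral_cong) (simp add: jump_x_def Q_proj_0 g)
  then show "boundary_integral X T (\<lambda>e n t. (jump_x X (Q_proj k X u) T e t)\<^sup>2) \<le> perimeter T * (K * eta 1 T)\<^sup>2"
    using order.trans[OF boundary_integral_proj_edge_best[OF M cu(2) Qk_dx[OF q]] bnd[OF Qk_dx[OF q] cu(2) err(2)]]
    by simp
  have "boundary_integral X T (\<lambda>e n t. (jump_y X (Q_proj k X u) T e t)\<^sup>2)
      = boundary_integral X T (\<lambda>e n t. (dy UNIV (proj_cell k X u T) (edge_point X e t) - proj_edge k X (dy Omega_bar u) e t)\<^sup>2)"
    by (rule boundary_integral_cong) (simp add: jump_y_def Q_proj_0 g)
  then show "boundary_integral X T (\<lambda>e n t. (jump_y X (Q_proj k X u) T e t)\<^sup>2) \<le> perimeter T * (K * eta 1 T)\<^sup>2"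
    using order.trans[OF boundary_integral_proj_edge_best[OF M cu(3) Qk_dy[OF q]] bnd[OF Qk_dy[OF q] cu(3) err(3)]]
    by simp
qed

text \<open>The constant \<open>48\<close> is the largest coefficient: a sum of three squares costs
  \<open>3\<close>, and the bound \<open>4 * K * eta 3 T\<close> for the normal component of the
  error in \<open>\<nabla>\<Delta>u\<close> contributes \<open>16\<close> after squaring.\<close>

lemma residual_cell:
  assumes T: "T \<in> cells N"
  shows "boundary_integral X T (\<lambda>e n t. (res_b k \<epsilon> N u T e n t)\<^sup>2 / weight_b k \<epsilon> N
        + ((res_x k \<epsilon> N u T e n t)\<^sup>2 + (res_y k \<epsilon> N u T e n t)\<^sup>2) / weight_g k \<epsilon> N)
    \<le> 48 * K\<^sup>2 * (perimeter T * weighted_error T)"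
proof -
  let ?wb = "weight_b k \<epsilon> N" and ?wg = "weight_g k \<epsilon> N"
  let ?jb = "jump_b X (Q_proj k X u) T" and ?jx = "jump_x X (Q_proj k X u) T" and ?jy = "jump_y X (Q_proj k X u) T"
  note M = mesh_X T
  note QV = Q_proj_in_V_space[OF mesh_X C2_u, of k]
  note bj = bcont_jumps[OF M QV]
  note br = bcont_res[OF M C2_u C2_w[rule_format, OF T]]
  note bi = bcont_add bcont_diff bcont_mult bcont_const
  \<comment> \<open>\<open>c\<close> gathers the parts with pointwise bounds; the jumps of
    \<open>Q_proj\<close> stay under the integral until \<open>jump_Q_proj\<close> applies.\<close>
  define c where "c = 48 * K\<^sup>2 * (\<epsilon> ^ 4 * (eta 3 T)\<^sup>2 / ?wb) + 12 * K\<^sup>2 * ((eta 1 T)\<^sup>2 / ?wb) + 16 * K\<^sup>2 * (\<epsilon> ^ 4 * (eta 2 T)\<^sup>2 / ?wg)"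
  have "boundary_integral X T (\<lambda>e n t. (res_b k \<epsilon> N u T e n t)\<^sup>2 / ?wb
        + ((res_x k \<epsilon> N u T e n t)\<^sup>2 + (res_y k \<epsilon> N u T e n t)\<^sup>2) / ?wg)
      \<le> boundary_integral X T (\<lambda>e n t. c + 3 * ?wb * (?jb e t)\<^sup>2 + 2 * ?wg * ((?jx e t)\<^sup>2 + (?jy e t)\<^sup>2))"
  proof (rule boundary_integral_mono)
    show "bcont X T (\<lambda>e n t. (res_b k \<epsilon> N u T e n t)\<^sup>2 / ?wb
        + ((res_x k \<epsilon> N u T e n t)\<^sup>2 + (res_y k \<epsilon> N u T e n t)\<^sup>2) / ?wg)"
      "bcont X T (\<lambda>e n t. c + 3 * ?wb * (?jb e t)\<^sup>2 + 2 * ?wg * ((?jx e t)\<^sup>2 + (?jy e t)\<^sup>2))"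
      unfolding power2_eq_square divide_inverse by (intro bi br bj)+
    fix e n t assume en: "(e, n) \<in> cell_boundary T" and t: "t \<in> edge_range X e"
    define p where "p = edge_point X e t"
    have pc: "(fst p, snd p) \<in> cell_set X T" using edge_point_in_cell[OF M en t] by (simp add: p_def)
    have n: "\<bar>fst n\<bar> \<le> 1" "\<bar>snd n\<bar> \<le> 1" using normal_le_1[OF en] by auto
    have lin: "\<bar>x * fst n + y * snd n\<bar> \<le> 2 * B" if "\<bar>x\<bar> \<le> B" "\<bar>y\<bar> \<le> B" for x y B
    proof -
      have "\<bar>x * fst n\<bar> \<le> B * 1" "\<bar>y * snd n\<bar> \<le> B * 1"
        unfolding abs_mult using that n by (intro mult_mono; linarith)+
      then show ?thesis by linarith
    qed
    define G where "G = (dx UNIV (proj_cell k X w T) p - dx Omega_bar w p) * fst n + (dy UNIV (proj_cell k X w T) p - dy Omega_bar w p) * snd n"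
    define Q where "Q = (dx Omega_bar u p - proj_cell k X (dx Omega_bar u) T p) * fst n + (dy Omega_bar u p - proj_cell k X (dy Omega_bar u) T p) * snd n"
    define D where "D = proj_cell k X w T p - w p"
    have G: "\<bar>G\<bar> \<le> 2 * (2 * K * eta 3 T)"
      unfolding G_def using err_w_x[OF T pc] err_w_y[OF T pc] by (intro lin) simp_all
    have Q: "\<bar>Q\<bar> \<le> 2 * (K * eta 1 T)"
      unfolding Q_def using err_ux[OF T pc] err_uy[OF T pc] by (intro lin) (simp_all add: abs_minus_commute)
    have D: "\<bar>D\<bar> \<le> 2 * K * eta 2 T" unfolding D_def using err_w[OF T pc] by simp
    have G2: "G\<^sup>2 \<le> 16 * K\<^sup>2 * (eta 3 T)\<^sup>2" and Q2: "Q\<^sup>2 \<le> 4 * K\<^sup>2 * (eta 1 T)\<^sup>2" and D2: "D\<^sup>2 \<le> 4 * K\<^sup>2 * (eta 2 T)\<^sup>2"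
      using power_mono[OF G, of 2] power_mono[OF Q, of 2] power_mono[OF D, of 2]
      by (simp_all add: power_mult_distrib)
    have rb: "res_b k \<epsilon> N u T e n t = \<epsilon>\<^sup>2 * G + Q + ?wb * ?jb e t"
      unfolding res_b_def Let_def G_def Q_def p_def ..
    have rx: "res_x k \<epsilon> N u T e n t = ?wg * ?jx e t - \<epsilon>\<^sup>2 * D * fst n"
      and ry: "res_y k \<epsilon> N u T e n t = ?wg * ?jy e t - \<epsilon>\<^sup>2 * D * snd n"
      unfolding res_x_def res_y_def Let_def D_def p_def by simp_all
    have sq3: "(x + y + z)\<^sup>2 \<le> 3 * (x\<^sup>2 + y\<^sup>2 + z\<^sup>2)" for x y z :: real
      using sum_squares_ge_zero[of "x - y" "y - z"] zero_le_power2[of "x - z"]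
      by (simp add: power2_eq_square algebra_simps)
    have sq2: "(x - y)\<^sup>2 \<le> 2 * (x\<^sup>2 + y\<^sup>2)" for x y :: real
      using zero_le_power2[of "x + y"] by (simp add: power2_eq_square algebra_simps)
    have e4: "(\<epsilon>\<^sup>2)\<^sup>2 = \<epsilon> ^ 4" by simp
    have "(res_b k \<epsilon> N u T e n t)\<^sup>2 / ?wb \<le> 3 * ((\<epsilon>\<^sup>2 * G)\<^sup>2 + Q\<^sup>2 + (?wb * ?jb e t)\<^sup>2) / ?wb"
      unfolding rb using weights_pos by (intro divide_right_mono sq3) auto
    also have "\<dots> = 3 * (\<epsilon> ^ 4 * G\<^sup>2 / ?wb) + 3 * (Q\<^sup>2 / ?wb) + 3 * ?wb * (?jb e t)\<^sup>2"
      using weights_pos(1) by (simp add: power_mult_distrib add_divide_distrib power2_eq_square[of ?wb] algebra_simps)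
    also have "\<epsilon> ^ 4 * G\<^sup>2 / ?wb \<le> \<epsilon> ^ 4 * (16 * K\<^sup>2 * (eta 3 T)\<^sup>2) / ?wb"
      using G2 weights_pos(1) by (intro divide_right_mono mult_left_mono) auto
    also have "Q\<^sup>2 / ?wb \<le> (4 * K\<^sup>2 * (eta 1 T)\<^sup>2) / ?wb"
      using Q2 weights_pos(1) by (intro divide_right_mono) auto
    finally have B: "(res_b k \<epsilon> N u T e n t)\<^sup>2 / ?wb \<le> 48 * K\<^sup>2 * (\<epsilon> ^ 4 * (eta 3 T)\<^sup>2 / ?wb)
        + 12 * K\<^sup>2 * ((eta 1 T)\<^sup>2 / ?wb) + 3 * ?wb * (?jb e t)\<^sup>2"
      by (simp add: mult_ac)
    have xy: "(?wg * j - \<epsilon>\<^sup>2 * D * s)\<^sup>2 \<le> 2 * (?wg\<^sup>2 * j\<^sup>2 + \<epsilon> ^ 4 * (4 * K\<^sup>2 * (eta 2 T)\<^sup>2))" if "\<bar>s\<bar> \<le> 1" for j s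
    proof -
      have "(\<epsilon>\<^sup>2 * D * s)\<^sup>2 = \<epsilon> ^ 4 * (D\<^sup>2 * s\<^sup>2)" by (simp add: power_mult_distrib mult.assoc)
      also have "\<dots> \<le> \<epsilon> ^ 4 * (4 * K\<^sup>2 * (eta 2 T)\<^sup>2 * 1)"
        using that D2 by (intro mult_left_mono mult_mono) (auto simp: abs_square_le_1)
      finally show ?thesis using sq2[of "?wg * j" "\<epsilon>\<^sup>2 * D * s"] by (simp add: power_mult_distrib)
    qed
    have "((res_x k \<epsilon> N u T e n t)\<^sup>2 + (res_y k \<epsilon> N u T e n t)\<^sup>2) / ?wg
        \<le> (2 * (?wg\<^sup>2 * (?jx e t)\<^sup>2 + \<epsilon> ^ 4 * (4 * K\<^sup>2 * (eta 2 T)\<^sup>2)) + 2 * (?wg\<^sup>2 * (?jy e t)\<^sup>2 + \<epsilon> ^ 4 * (4 * K\<^sup>2 * (eta 2 T)\<^sup>2))) / ?wg"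
      unfolding rx ry using weights_pos(2) by (intro divide_right_mono add_mono xy n) auto
    also have "\<dots> = 16 * K\<^sup>2 * (\<epsilon> ^ 4 * (eta 2 T)\<^sup>2 / ?wg) + 2 * ?wg * ((?jx e t)\<^sup>2 + (?jy e t)\<^sup>2)"
      using weights_pos(2) by (simp add: add_divide_distrib power2_eq_square[of ?wg] algebra_simps)
    finally show "(res_b k \<epsilon> N u T e n t)\<^sup>2 / ?wb + ((res_x k \<epsilon> N u T e n t)\<^sup>2 + (res_y k \<epsilon> N u T e n t)\<^sup>2) / ?wg
        \<le> c + 3 * ?wb * (?jb e t)\<^sup>2 + 2 * ?wg * ((?jx e t)\<^sup>2 + (?jy e t)\<^sup>2)"
      using B unfolding c_def by linarith
  qed
  also have "\<dots> = boundary_integral X T (\<lambda>e n t. c) + 3 * ?wb * boundary_integral X T (\<lambda>e n t. (?jb e t)\<^sup>2)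
      + 2 * ?wg * (boundary_integral X T (\<lambda>e n t. (?jx e t)\<^sup>2) + boundary_integral X T (\<lambda>e n t. (?jy e t)\<^sup>2))"
  proof -
    have b: "bcont X T (\<lambda>e n t. (?jb e t)\<^sup>2)" "bcont X T (\<lambda>e n t. (?jx e t)\<^sup>2)" "bcont X T (\<lambda>e n t. (?jy e t)\<^sup>2)"
      unfolding power2_eq_square by (intro bi bj)+
    have s: "bcont X T (\<lambda>e n t. r * F e n t)" if "bcont X T F" for r F by (intro bi that)
    note bc = bcont_const[of X T "\<lambda>_. c"]
    show ?thesis
      unfolding boundary_integral_add[OF bcont_add[OF bc s[OF b(1)]] s[OF bcont_add[OF b(2,3)]]]
        boundary_integral_add[OF bc s[OF b(1)]] boundary_integral_cmult[OF b(1)]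
        boundary_integral_cmult[OF bcont_add[OF b(2,3)]] boundary_integral_add[OF b(2,3)] ..
  qed
  also have "\<dots> \<le> perimeter T * c + 3 * ?wb * (perimeter T * (K * eta 0 T)\<^sup>2)
      + 2 * ?wg * (perimeter T * (K * eta 1 T)\<^sup>2 + perimeter T * (K * eta 1 T)\<^sup>2)"
    using weights_pos
    by (intro add_mono mult_left_mono jump_Q_proj[OF T] boundary_integral_le[OF bcont_const T]) auto
  also have "\<dots> \<le> 48 * K\<^sup>2 * (perimeter T * weighted_error T)"
  proof -
    define Pm where "Pm = perimeter T"
    have Pm: "0 \<le> Pm" using width_bounds(4)[of "fst T"] width_bounds(4)[of "snd T"] by (simp add: Pm_def perimeter_def)
    define t1 where "t1 = K\<^sup>2 * Pm * (\<epsilon> ^ 4 * (eta 3 T)\<^sup>2 / ?wb)"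
    define t2 where "t2 = K\<^sup>2 * Pm * ((eta 1 T)\<^sup>2 / ?wb)"
    define t3 where "t3 = K\<^sup>2 * Pm * (?wb * (eta 0 T)\<^sup>2)"
    define t4 where "t4 = K\<^sup>2 * Pm * (\<epsilon> ^ 4 * (eta 2 T)\<^sup>2 / ?wg)"
    define t5 where "t5 = K\<^sup>2 * Pm * (?wg * (eta 1 T)\<^sup>2)"
    have nn: "0 \<le> t1" "0 \<le> t2" "0 \<le> t3" "0 \<le> t4" "0 \<le> t5"
      unfolding t1_def t2_def t3_def t4_def t5_def using Pm weights_pos by simp_all
    have lhs: "perimeter T * c + 3 * ?wb * (perimeter T * (K * eta 0 T)\<^sup>2)
      + 2 * ?wg * (perimeter T * (K * eta 1 T)\<^sup>2 + perimeter T * (K * eta 1 T)\<^sup>2)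
      = 48 * t1 + 12 * t2 + 3 * t3 + 16 * t4 + 4 * t5"
      unfolding c_def t1_def t2_def t3_def t4_def t5_def Pm_def by (simp add: power_mult_distrib algebra_simps)
    have rhs: "48 * K\<^sup>2 * (perimeter T * weighted_error T) = 48 * (t1 + t2 + t3 + t4 + t5)"
      unfolding weighted_error_def t1_def t2_def t3_def t4_def t5_def Pm_def by (simp add: algebra_simps)
    show ?thesis unfolding lhs rhs using nn by simp
  qed
  finally show ?thesis .
qed

text \<open>The boundary condition prescribes normal derivatives on open sides only. At a corner the
  derivative in question is tangential to the adjacent side, along which \<open>u\<close> vanishes
  identically.\<close>

lemma normal_derivative_zero:
  assumes s: "solves_problem \<epsilon> f u"
  shows "r \<in> {0, 1} \<Longrightarrow> t \<in> {0..1} \<Longrightarrow> dx Omega_bar u (r, t) = 0"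
    and "r \<in> {0, 1} \<Longrightarrow> t \<in> {0..1} \<Longrightarrow> dy Omega_bar u (t, r) = 0"
proof -
  have u0: "u (a, b) = 0" if "(a, b) \<in> Omega_bar - Omega" for a b
    using s that unfolding solves_problem_def frontier_Omega by blast
  have g: "dy Omega_bar u (t, 0) = 0" "dx Omega_bar u (1, t) = 0" "dy Omega_bar u (t, 1) = 0" "dx Omega_bar u (0, t) = 0"
    if "t \<in> {0<..<1}" for t
    using s that unfolding solves_problem_def by (auto simp: gradient_def inner_prod_def)
  show "dx Omega_bar u (r, t) = 0" if r: "r \<in> {0, 1}" and t: "t \<in> {0..1}"
  proof (cases "t \<in> {0<..<1}")
    case True
    then show ?thesis using g r by auto
  next
    case False
    have "((\<lambda>z. u (z, t)) has_real_derivative 0) (at r within {0..1})"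
    proof (rule real_derivative_transform[OF DERIV_const])
      show "u (z, t) = 0" if "z \<in> {0..1}" for z using that t False by (intro u0) auto
    qed (use r in auto)
    then show ?thesis by (rule dx_Omega_bar_eq[rotated]) (use r t in auto)
  qed
  show "dy Omega_bar u (t, r) = 0" if r: "r \<in> {0, 1}" and t: "t \<in> {0..1}"
  proof (cases "t \<in> {0<..<1}")
    case True
    then show ?thesis using g r by auto
  next
    case False
    have "((\<lambda>z. u (t, z)) has_real_derivative 0) (at r within {0..1})"
    proof (rule real_derivative_transform[OF DERIV_const])
      show "u (t, z) = 0" if "z \<in> {0..1}" for z using that t False by (intro u0) auto
    qed (use r in auto)
    then show ?thesis by (rule dy_Omega_bar_eq[rotated]) (use r t in auto)
  qed
qed

lemma error_bound:
  assumes s: "solves_problem \<epsilon> f u" and uN: "wg_solution k \<epsilon> N f uN"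
  defines "e \<equiv> wf_minus (Q_proj k X u) uN" and "A \<equiv> 4 * real (k + 1)"
  shows "wg_form k \<epsilon> N e e \<le> 48 * K\<^sup>2 * ((10 + 6 * A\<^sup>2 + 4 * A ^ 4) * (4 + 24 * (36 * real (k + 1) + 3) * A ^ (2 * k - 3)))
      * ((1 / real N) ^ (2 * k - 2) * ln (real N) ^ (2 * k - 3))"
proof -
  have f: "AE p in lebesgue. p \<in> Omega \<longrightarrow> \<epsilon>\<^sup>2 * laplacian Omega_bar w p - w p = f p"
    and u0: "\<forall>p\<in>frontier Omega. u p = 0" using s unfolding solves_problem_def by auto
  have QV: "Q_proj k X u \<in> V0_space k N X"
    by (rule Q_proj_in_V0_space[OF mesh_X C2_u u0 normal_derivative_zero[OF s]])
  have "wg_form k \<epsilon> N e e \<le> (\<Sum>T\<in>cells N.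
      boundary_integral X T (\<lambda>e n t. (res_b k \<epsilon> N u T e n t)\<^sup>2 / weight_b k \<epsilon> N
        + ((res_x k \<epsilon> N u T e n t)\<^sup>2 + (res_y k \<epsilon> N u T e n t)\<^sup>2) / weight_g k \<epsilon> N))"
    unfolding e_def by (rule energy_estimate[OF mesh_X C2_u C2_w QV f uN weights_pos])
  also have "\<dots> \<le> (\<Sum>T\<in>cells N. 48 * K\<^sup>2 * (perimeter T * weighted_error T))"
    by (intro sum_mono residual_cell)
  also have "\<dots> = 48 * K\<^sup>2 * (\<Sum>T\<in>cells N. perimeter T * weighted_error T)"
    by (simp add: sum_distrib_left)
  also have "\<dots> \<le> 48 * K\<^sup>2 * ((10 + 6 * A\<^sup>2 + 4 * A ^ 4) * (4 + 24 * decay_const * A ^ (2 * k - 3))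
      * ((1 / real N) ^ (2 * k - 2) * ln (real N) ^ (2 * k - 3)))"
    unfolding A_def by (intro mult_left_mono sum_weighted_error[OF k3]) auto
  finally show ?thesis by (simp only: decay_const_def mult.assoc)
qed

end

section \<open>The final rate\<close>

text \<open>The logarithm carries the odd exponent \<open>2 * k - 3\<close>, so its root is a
  half-integer power and is expressed by \<open>powr\<close>.\<close>

lemma sqrt_rate:
  assumes "3 \<le> k" "4 \<le> N" "0 < ln (real N)"
  shows "sqrt ((1 / real N) ^ (2 * k - 2) * ln (real N) ^ (2 * k - 3))
    = real N powr (- (real k - 1)) * ln (real N) powr (real k - 3 / 2)"
proof -
  have "(1 / real N) ^ (2 * k - 2) = (real N powr (- (real k - 1)))\<^sup>2"
  proof -
    have "2 * k - 2 = (k - 1) * 2" by simp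
    moreover have "real N powr (- (real k - 1)) = (1 / real N) ^ (k - 1)"
    proof -
      have "real k - 1 = real (k - 1)" using assms by simp
      then show ?thesis
        using assms powr_realpow[of "real N" "k - 1"] by (simp only: powr_minus) (simp add: power_one_over divide_inverse power_inverse)
    qed
    ultimately show ?thesis by (simp only: power_mult)
  qed
  moreover have "ln (real N) ^ (2 * k - 3) = (ln (real N) powr (real k - 3 / 2))\<^sup>2"
  proof -
    have "(ln (real N) powr (real k - 3 / 2))\<^sup>2 = ln (real N) powr (real (2 * k - 3))"
      using assms by (simp add: power2_eq_square powr_add[symmetric] of_nat_diff)
    then show ?thesis using assms powr_realpow[of "ln (real N)" "2 * k - 3"] by simp
  qed
  ultimately show ?thesis by (simp add: real_sqrt_mult)
qed

theorem theorem5p1: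
  fixes k :: nat and C0 :: real
  assumes "k \<ge> 3"
  shows "\<exists>C. \<forall>(\<epsilon>::real) (N::nat) (f :: point \<Rightarrow> real) (u :: point \<Rightarrow> real) (uN :: weak_function).
    0 < \<epsilon> \<longrightarrow> \<epsilon> < 1 \<longrightarrow>
    4 \<le> N \<longrightarrow> 4 dvd N \<longrightarrow>
    L2 Omega f \<longrightarrow>
    solves_problem \<epsilon> f u \<longrightarrow>
    layer_decomposition k C0 \<epsilon> u \<longrightarrow>
    u \<in> sobolev_H (k + 1) Omega \<longrightarrow>
    wg_solution k \<epsilon> N f uN \<longrightarrow>
    triple_norm k \<epsilon> N (wf_minus (Q_proj k (shishkin_node k \<epsilon> N) u) uN)
      \<le> C * real N powr (- (real k - 1)) * ln (real N) powr (real k - 3 / 2)"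
proof -
  define A where "A = 4 * real (k + 1)"
  define K where "K = 9 * (proj2_const k * (2 ^ (k + 2) * C0))"
  \<comment> \<open>The constant of \<open>error_bound\<close>. It involves \<open>k\<close> and
    \<open>C0\<close> only, and so its root is independent of \<open>\<epsilon>\<close>,
    \<open>N\<close>, \<open>f\<close> and \<open>u\<close>.\<close>
  define B where "B = 48 * K\<^sup>2 * ((10 + 6 * A\<^sup>2 + 4 * A ^ 4) * (4 + 24 * (36 * real (k + 1) + 3) * A ^ (2 * k - 3)))"
  show ?thesis
  proof (intro exI[of _ "sqrt B"] allI impI)
    fix \<epsilon> :: real and N f u uN
    assume "0 < \<epsilon>" "\<epsilon> < 1" "4 \<le> N" "4 dvd N" and s: "solves_problem \<epsilon> f u"
      and d: "layer_decomposition k C0 \<epsilon> u" and uN: "wg_solution k \<epsilon> N f uN"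
    then interpret shishkin k \<epsilon> N by unfold_locales
    obtain U where U: "approx K U" "\<forall>x y. (x, y) \<in> Omega_bar \<longrightarrow> u (x, y) = U 0 0 x y"
      using layer_decomposition_approx[OF assms d] unfolding K_def by blast
    interpret shishkin_approx k \<epsilon> N K U u by unfold_locales (use assms U in auto)
    let ?e = "wf_minus (Q_proj k X u) uN"
    have "wg_form k \<epsilon> N ?e ?e \<le> B * ((1 / real N) ^ (2 * k - 2) * ln (real N) ^ (2 * k - 3))"
      using error_bound[OF s uN] unfolding B_def A_def .
    then have "triple_norm k \<epsilon> N ?e \<le> sqrt (B * ((1 / real N) ^ (2 * k - 2) * ln (real N) ^ (2 * k - 3)))"
      unfolding triple_norm_def by (rule real_sqrt_le_mono)
    also have "\<dots> = sqrt B * (real N powr (- (real k - 1)) * ln (real N) powr (real k - 3 / 2))"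
      unfolding real_sqrt_mult[of B] using sqrt_rate[OF assms \<open>4 \<le> N\<close>] ln_N by simp
    finally show "triple_norm k \<epsilon> N ?e
        \<le> sqrt B * real N powr (- (real k - 1)) * ln (real N) powr (real k - 3 / 2)"
      by (simp only: mult.assoc)
  qed
qed

end
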